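(* Let $b\in\mathbb{R}^3$ with $b\neq0$, $\alpha>0$, $\varepsilon>0$, $y\in\mathcal{S}(\mathbb{R}^3)$, and let $(Y,\mu)$ be the solution of the coupled Itô stochastic differential equation $$dY_t = -\mu_t\wedge(b\,dt+\varepsilon\,dW_t)-\alpha\,\mu_t\wedge\big(\mu_t\wedge(b\,dt+\varepsilon\,dW_t)\big),\qquad \mu_t=\frac{Y_t}{|Y_t|},\qquad Y_0=y.$$ Let $h(t)=\sqrt{2\varepsilon^2(\alpha^2+1)t+1}$ for $t\ge0$. Then $$\lim_{t\to\infty}\mathbb{E}\big[\,h(t)\,\big||b|-\mu_t\cdot b\big|\,\big]=\frac{\varepsilon^2(1+\alpha^2)}{2\alpha}.$$
   Context: $|\cdot|$ is the Euclidean norm on $\mathbb{R}^3$ (and the absolute value on $\mathbb{R}$), $\cdot$ the scalar product and $\wedge$ the vector (cross) product on $\mathbb{R}^3$; $\mathcal{S}(\mathbb{R}^3)=\{u\in\mathbb{R}^3: |u|=1\}$. $W$ is a standard $\mathbb{R}^3$-valued Brownian motion on a probability space $(\Omega,\mathcal{A},\mathbb{P})$, with natural filtration $\mathbb{F}=(\mathcal{F}_t)_{t\ge0}$ augmented with the $\mathbb{P}$-null sets. For $x\in\mathbb{R}^3$, $L(x)$ is the antisymmetric $3\times3$ matrix with $L(x)v=x\wedge v$ for all $v\in\mathbb{R}^3$; for an adapted process $H$, $\int_0^t H_s\wedge dW_s$ means the Itô integral $\int_0^t L(H_s)\,dW_s$. $(Y,\mu)$ denotes the unique strong solution of the system. 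*)

theory Defs
  imports "HOL-Probability.Probability"
begin

definition cross_matrix :: "real^3 \<Rightarrow> real^3^3"
  where "cross_matrix x = matrix (\<lambda>v. cross3 x v)"

lemma cross_matrix_mult: "cross_matrix x *v v = cross3 x v"
proof -
  have "linear (cross3 x)"
    by (intro linearI) (simp_all add: cross_add_right cross_mult_right)
  then show ?thesis
    by (simp add: cross_matrix_def matrix_works)
qed

lemma transpose_cross_matrix: "transpose (cross_matrix x) = - cross_matrix x"
  by (simp add: cross_matrix_def matrix_def transpose_def axis_def cross3_simps forall_3)

text \<open>
  All processes are functions of time and outcome; only times \<open>t \<ge> 0\<close> matter.
  The product density says that \<open>W\<^sub>t - W\<^sub>s\<close> has law \<open>N(0, (t - s) I)\<close>. Finite families of
  increments are covered because every finite increasing sequence of times extends to a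
  monotone sequence.
\<close>

definition standard_brownian_motion :: "'a measure \<Rightarrow> (real \<Rightarrow> 'a \<Rightarrow> real^'d) \<Rightarrow> bool"
  where "standard_brownian_motion M W \<longleftrightarrow>
    (\<forall>t\<ge>0. W t \<in> borel_measurable M) \<and>
    (AE \<omega> in M. W 0 \<omega> = 0) \<and>
    (AE \<omega> in M. continuous_on {0..} (\<lambda>t. W t \<omega>)) \<and>
    (\<forall>\<tau> :: nat \<Rightarrow> real. \<forall>n. 0 \<le> \<tau> 0 \<and> mono \<tau> \<longrightarrow>
       prob_space.indep_vars M (\<lambda>_. borel) (\<lambda>i \<omega>. W (\<tau> (Suc i)) \<omega> - W (\<tau> i) \<omega>) {..<n}) \<and>
    (\<forall>s t. 0 \<le> s \<and> s < t \<longrightarrow>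
       distributed M lborel (\<lambda>\<omega>. W t \<omega> - W s \<omega>)
         (\<lambda>x. ennreal (\<Prod>i\<in>UNIV. normal_density 0 (sqrt (t - s)) (x $ i))))"

definition augmented_filtration ::
    "'a measure \<Rightarrow> (real \<Rightarrow> 'a \<Rightarrow> real^'d) \<Rightarrow> real \<Rightarrow> 'a measure"
  where "augmented_filtration M W t =
    sigma (space M) ({W s -` B \<inter> space M | s B. s \<in> {0..t} \<and> B \<in> sets borel} \<union> null_sets M)"

definition adapted :: "(real \<Rightarrow> 'a measure) \<Rightarrow> (real \<Rightarrow> 'a \<Rightarrow> 'b::topological_space) \<Rightarrow> bool"
  where "adapted F X \<longleftrightarrow> (\<forall>t\<ge>0. X t \<in> borel_measurable (F t))"

definition progressively_measurable ::
    "(real \<Rightarrow> 'a measure) \<Rightarrow> (real \<Rightarrow> 'a \<Rightarrow> 'b::topological_space) \<Rightarrow> bool"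
  where "progressively_measurable F X \<longleftrightarrow>
    (\<forall>t\<ge>0. (\<lambda>(s, \<omega>). X s \<omega>) \<in> borel_measurable (restrict_space borel {0..t} \<Otimes>\<^sub>M F t))"

text \<open>
  A simple process is given by a number \<open>n\<close> of intervals, grid points \<open>\<tau>\<close> and bounded
  matrix-valued coefficients \<open>\<xi> i\<close>, known at time \<open>\<tau> i\<close>.
\<close>

definition simple_integrand ::
    "'a measure \<Rightarrow> (real \<Rightarrow> 'a measure) \<Rightarrow> nat \<Rightarrow> (nat \<Rightarrow> real) \<Rightarrow> (nat \<Rightarrow> 'a \<Rightarrow> real^'d^'n) \<Rightarrow> bool"
  where "simple_integrand M F n \<tau> \<xi> \<longleftrightarrow>
    0 \<le> \<tau> 0 \<and> mono \<tau> \<and>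
    (\<forall>i<n. \<xi> i \<in> borel_measurable (F (\<tau> i)) \<and> bounded (\<xi> i ` space M))"

definition simple_process ::
    "nat \<Rightarrow> (nat \<Rightarrow> real) \<Rightarrow> (nat \<Rightarrow> 'a \<Rightarrow> real^'d^'n) \<Rightarrow> real \<Rightarrow> 'a \<Rightarrow> real^'d^'n"
  where "simple_process n \<tau> \<xi> t \<omega> = (\<Sum>i<n. indicator {\<tau> i<..\<tau> (Suc i)} t *\<^sub>R \<xi> i \<omega>)"

definition simple_ito_integral ::
    "(real \<Rightarrow> 'a \<Rightarrow> real^'d) \<Rightarrow> nat \<Rightarrow> (nat \<Rightarrow> real) \<Rightarrow> (nat \<Rightarrow> 'a \<Rightarrow> real^'d^'n) \<Rightarrow> real \<Rightarrow> 'a \<Rightarrow> real^'n"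
  where "simple_ito_integral W n \<tau> \<xi> t \<omega> =
    (\<Sum>i<n. \<xi> i \<omega> *v (W (min t (\<tau> (Suc i))) \<omega> - W (min t (\<tau> i)) \<omega>))"

text \<open>
  \<open>has_ito_integral M F W H I\<close>: the process \<open>I\<close> is (a version, unique up to
  indistinguishability, of) \<open>t \<mapsto> \<integral>\<^sub>0\<^sup>t H\<^sub>s dW\<^sub>s\<close>, for a progressive integrand \<open>H\<close> with
  \<open>E \<integral>\<^sub>0\<^sup>T |H\<^sub>s|\<^sup>2 ds < \<infinity>\<close> for all \<open>T\<close>. This is the extension of the integral of simple
  processes by the Ito isometry; the norm on matrices is the Frobenius norm.
\<close>

definition has_ito_integral ::
    "'a measure \<Rightarrow> (real \<Rightarrow> 'a measure) \<Rightarrow> (real \<Rightarrow> 'a \<Rightarrow> real^'d) \<Rightarrow>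
     (real \<Rightarrow> 'a \<Rightarrow> real^'d^'n) \<Rightarrow> (real \<Rightarrow> 'a \<Rightarrow> real^'n) \<Rightarrow> bool"
  where "has_ito_integral M F W H I \<longleftrightarrow>
    progressively_measurable F H \<and>
    (\<forall>T\<ge>0. (\<integral>\<^sup>+\<omega>. (\<integral>\<^sup>+s\<in>{0..T}. ennreal ((norm (H s \<omega>))\<^sup>2) \<partial>lborel) \<partial>M) < \<infinity>) \<and>
    adapted F I \<and>
    (AE \<omega> in M. continuous_on {0..} (\<lambda>t. I t \<omega>)) \<and>
    (\<exists>n \<tau> \<xi>.
       (\<forall>k :: nat. simple_integrand M F (n k) (\<tau> k) (\<xi> k)) \<and>
       (\<forall>T\<ge>0.
         (\<lambda>k. \<integral>\<^sup>+\<omega>. (\<integral>\<^sup>+s\<in>{0..T}.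
             ennreal ((norm (simple_process (n k) (\<tau> k) (\<xi> k) s \<omega> - H s \<omega>))\<^sup>2) \<partial>lborel) \<partial>M)
           \<longlonglongrightarrow> 0) \<and>
       (\<forall>t\<ge>0.
         (\<lambda>k. \<integral>\<^sup>+\<omega>.
             ennreal ((norm (simple_ito_integral W (n k) (\<tau> k) (\<xi> k) t \<omega> - I t \<omega>))\<^sup>2) \<partial>M)
           \<longlonglongrightarrow> 0))"

text \<open>
  \<open>has_ito_differential M F W x a H X\<close>: \<open>dX\<^sub>t = a\<^sub>t dt + H\<^sub>t dW\<^sub>t\<close> with \<open>X\<^sub>0 = x\<close>, for a continuous
  adapted process \<open>X\<close>. When \<open>a\<close> and \<open>H\<close> are functions of \<open>X\<close> and \<open>F\<close> is the augmented natural
  filtration of \<open>W\<close>, it says that \<open>X\<close> is a strong solution of the corresponding equation.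
\<close>

definition has_ito_differential ::
    "'a measure \<Rightarrow> (real \<Rightarrow> 'a measure) \<Rightarrow> (real \<Rightarrow> 'a \<Rightarrow> real^'d) \<Rightarrow> real^'n \<Rightarrow>
     (real \<Rightarrow> 'a \<Rightarrow> real^'n) \<Rightarrow> (real \<Rightarrow> 'a \<Rightarrow> real^'d^'n) \<Rightarrow> (real \<Rightarrow> 'a \<Rightarrow> real^'n) \<Rightarrow> bool"
  where "has_ito_differential M F W x a H X \<longleftrightarrow>
    adapted F X \<and>
    (AE \<omega> in M. continuous_on {0..} (\<lambda>t. X t \<omega>)) \<and>
    (\<exists>I. has_ito_integral M F W H I \<and>
      (AE \<omega> in M. \<forall>t\<ge>0.
         set_integrable lborel {0..t} (\<lambda>s. a s \<omega>) \<and>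
         X t \<omega> = x + set_lebesgue_integral lborel {0..t} (\<lambda>s. a s \<omega>) + I t \<omega>))"

text \<open>
  Strong solutions \<open>(Y, \<mu>)\<close> of
  \<open>dY = - \<mu> \<times> (b dt + \<epsilon> dW) - \<alpha> \<mu> \<times> (\<mu> \<times> (b dt + \<epsilon> dW))\<close>, \<open>\<mu> = Y / |Y|\<close>, \<open>Y\<^sub>0 = y\<close>. The diffusion
  matrix collects the two stochastic integrals of \<open>L(\<mu>)\<close> and \<open>L(\<mu>) L(\<mu>)\<close>, where \<open>L\<close> is
  \<open>cross_matrix\<close>. That \<open>Y\<close> does not vanish is not required; \<open>\<mu>\<close> is \<open>0\<close> wherever \<open>Y\<close> is.
\<close>

definition strong_solution ::
    "'a measure \<Rightarrow> (real \<Rightarrow> 'a \<Rightarrow> real^3) \<Rightarrow> real^3 \<Rightarrow> real \<Rightarrow> real \<Rightarrow> real^3 \<Rightarrow>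
     (real \<Rightarrow> 'a \<Rightarrow> real^3) \<Rightarrow> (real \<Rightarrow> 'a \<Rightarrow> real^3) \<Rightarrow> bool"
  where "strong_solution M W b \<alpha> \<epsilon> y Y \<mu> \<longleftrightarrow>
    (\<forall>t\<ge>0. \<forall>\<omega>\<in>space M. \<mu> t \<omega> = Y t \<omega> /\<^sub>R norm (Y t \<omega>)) \<and>
    has_ito_differential M (augmented_filtration M W) W y
      (\<lambda>t \<omega>. - cross3 (\<mu> t \<omega>) b - \<alpha> *\<^sub>R cross3 (\<mu> t \<omega>) (cross3 (\<mu> t \<omega>) b))
      (\<lambda>t \<omega>. - (\<epsilon> *\<^sub>R cross_matrix (\<mu> t \<omega>))
              - (\<alpha> * \<epsilon>) *\<^sub>R (cross_matrix (\<mu> t \<omega>) ** cross_matrix (\<mu> t \<omega>)))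
      Y"

end

theory Submission
  imports Defs
begin

text \<open>
  In Ito's formula for \<open>|Y|\<^sup>2\<close> the martingale part vanishes, so \<open>|Y t| = h t\<close> is deterministic. With \<open>e = b / |b|\<close>,
  small-step expansions of the moments of \<open>e \<bullet> Y t\<close> give a linear system of differential equations. After the change
  of time \<open>r = h t\<close> it reads, for \<open>y\<^sub>k = E (1 - \<mu> \<bullet> e)\<^sup>k\<close> and \<open>a = \<alpha> |b| / (\<epsilon>\<^sup>2 (1 + \<alpha>\<^sup>2))\<close>,
  \<open>y\<^sub>1' = - a (2 y\<^sub>1 - y\<^sub>2) + (1 - y\<^sub>1) / r\<close>, and similarly for \<open>y\<^sub>2\<close> and \<open>y\<^sub>3\<close>. In the equation for the cube of
  \<open>q = 1 - \<mu> \<bullet> e\<close>, drift and noise share the factor \<open>q\<^sup>2 (2 - q)\<close>, so that \<open>r\<^sup>3\<^sup>/\<^sup>2 y\<^sub>3\<close> stays bounded although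
  \<open>\<mu> = - e\<close> is an equilibrium of the drift. Then \<open>y\<^sub>1\<close> and \<open>r y\<^sub>2\<close> tend to \<open>0\<close>, and the equation
  for \<open>r y\<^sub>1\<close> has the stable equilibrium \<open>1 / (2 a)\<close>.
\<close>


section \<open>Independence of Brownian increments from the past\<close>

text \<open>The formula of Ito is replaced by one-step estimates: if phi(t) - phi(s) - (t - s)
  psi(s) is O((t - s)^(3/2)) uniformly on bounded intervals and psi is continuous, then phi' = psi.
  Such an estimate needs three facts about increments of the stochastic integral: orthogonality to
  the past, the isometry weighted by a variable of the past, and a fourth moment of order (t - s)^2.
  Since \<mu> is 0 wherever Y is, formulas that use |\<mu>| = 1 are out of reach until |Y| is known.
  Hence |Y|^2 is compared with the random bracket of the integral, and only afterwards with h^2. The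
  exponent 3/2 has this origin: the equation for the k-th power of q has right-hand side - k a q^k
  (2 - q) + k q^(k-1) (k - (k + 1) q / 2) / r, and p = k/2 is the only value for which adding (p /
  r) q^k, the effect of the weight r^p, makes the part of order 1/r vanish at q = 2. The cube is the
  first power with k/2 > 1, as needed for r y_3 to tend to 0.\<close>

locale brownian_space = prob_space M for M :: "'a measure" +
  fixes W :: "real \<Rightarrow> 'a \<Rightarrow> real^'d"
  assumes bm: "standard_brownian_motion M W"
begin

abbreviation F :: "real \<Rightarrow> 'a measure"
  where "F \<equiv> augmented_filtration M W"

lemma W_measurable: "0 \<le> t \<Longrightarrow> W t \<in> borel_measurable M"
  using bm unfolding standard_brownian_motion_def by auto

lemma W_zero: "AE \<omega> in M. W 0 \<omega> = 0"
  using bm unfolding standard_brownian_motion_def by auto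

lemma sets_F:
  "sets (F t) = sigma_sets (space M)
     ({W s -` B \<inter> space M | s B. s \<in> {0..t} \<and> B \<in> sets borel} \<union> null_sets M)"
  unfolding augmented_filtration_def by (rule sets_measure_of) (auto dest: sets.sets_into_space)

lemma space_F [simp]: "space (F t) = space M"
  unfolding augmented_filtration_def by (rule space_measure_of) (auto dest: sets.sets_into_space)

lemma subalgebra_F: "subalgebra M (F t)"
  unfolding subalgebra_def sets_F
  using W_measurable by (auto intro!: sets.sigma_sets_subset measurable_sets)

lemma subalgebra_F_mono: "s \<le> t \<Longrightarrow> subalgebra (F t) (F s)"
  unfolding subalgebra_def sets_F
  by (intro conjI sigma_sets_mono' Un_mono) (simp, fastforce+)

lemma measurable_F_M: "X \<in> measurable (F t) N \<Longrightarrow> X \<in> measurable M N"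
  using measurable_from_subalg[OF subalgebra_F] .

lemma measurable_F_mono: "X \<in> measurable (F s) N \<Longrightarrow> s \<le> t \<Longrightarrow> X \<in> measurable (F t) N"
  using measurable_from_subalg[OF subalgebra_F_mono] .

lemma W_measurable_F:
  assumes "0 \<le> s" "s \<le> t" shows "W s \<in> borel_measurable (F t)"
proof (rule measurableI)
  fix B :: "(real^'d) set" assume "B \<in> sets borel"
  then show "W s -` B \<inter> space (F t) \<in> sets (F t)"
    using assms unfolding sets_F by (auto intro!: sigma_sets.Basic)
qed simp

text \<open>The definition of Brownian motion speaks only of increments along one monotone sequence
  of times. The grid 0, the points of \<open>J\<close>, \<open>s\<close>, \<open>t\<close> makes the
  cylinder an event of the first \<open>n\<close> increments, whose partial sums recover
  \<open>W\<close> on \<open>J\<close>, while \<open>Z\<close> is the increment of index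
  \<open>n + 1\<close>.\<close>

lemma cylinder_indep:
  assumes st: "0 \<le> s" "s \<le> t" and J: "finite J" "J \<subseteq> {0..s}"
    and B: "\<And>u. u \<in> J \<Longrightarrow> B u \<in> sets borel" and C: "C \<in> sets borel"
  defines "A \<equiv> {\<omega> \<in> space M. \<forall>u\<in>J. W u \<omega> \<in> B u}"
    and "Z \<equiv> (\<lambda>\<omega>. W t \<omega> - W s \<omega>)"
  shows "prob (A \<inter> (Z -` C \<inter> space M)) = prob A * prob (Z -` C \<inter> space M)"
proof -
  define n where "n = card J"
  define l where "l = sorted_list_of_set J"
  have l: "set l = J" "sorted l" "length l = n"
    using J by (auto simp: l_def n_def)
  \<comment> \<open>The \<open>n\<close> sorted points of \<open>J\<close> sit at the indices 1 to
    \<open>n\<close>, \<open>s\<close> at \<open>n + 1\<close>, and \<open>t\<close> from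
    \<open>n + 2\<close> on, so that the sequence stays monotone.\<close>
  define \<tau> where "\<tau> i = (if i = 0 then 0 else if i \<le> n then l ! (i - 1) else if i = n + 1 then s else t)" for i
  have lJ: "l ! i \<in> {0..s}" if "i < n" for i
    using l J that nth_mem by blast
  have mono: "mono \<tau>"
  proof (rule mono_iff_le_Suc[THEN iffD2], rule allI)
    fix i
    show "\<tau> i \<le> \<tau> (Suc i)"
    proof (cases "i = 0 \<or> i > n")
      case True
      then show ?thesis using lJ[of 0] st by (auto simp: \<tau>_def)
    next
      case False
      then have "i - 1 < n" "i \<noteq> 0" by auto
      then show ?thesis
        using lJ[of "i-1"] sorted_nth_mono[OF l(2), of "i-1" i] l(3)
        by (auto simp: \<tau>_def)
    qed
  qed
  define D where "D i \<omega> = W (\<tau> (Suc i)) \<omega> - W (\<tau> i) \<omega>" for i \<omega>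
  have "0 \<le> \<tau> 0" by (simp add: \<tau>_def)
  then have "indep_vars (\<lambda>_. borel) D {..<n+2}"
    using bm[unfolded standard_brownian_motion_def, THEN conjunct2, THEN conjunct2, THEN conjunct2,
      THEN conjunct1, THEN spec[of _ \<tau>], THEN spec[of _ "n+2"]] mono
    unfolding D_def by blast
  \<comment> \<open>The increment of index \<open>n\<close>, which leads from the last point of
    \<open>J\<close> (or from 0) to \<open>s\<close>, belongs to neither block.\<close>
  from indep_var_restrict[OF this, of "{..<n}" "{n+1}"]
  have ind: "indep_var (PiM {..<n} (\<lambda>_. borel)) (\<lambda>\<omega>. \<lambda>i\<in>{..<n}. D i \<omega>)
      (PiM {n+1} (\<lambda>_. borel)) (\<lambda>\<omega>. \<lambda>i\<in>{n+1}. D i \<omega>)"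
    by auto
  define S where "S = {f \<in> space (PiM {..<n} (\<lambda>_. borel)). \<forall>k\<in>{1..n}. (\<Sum>i<k. f i) \<in> B (\<tau> k)}"
  define S' where "S' = {f \<in> space (PiM {n+1} (\<lambda>_. borel)). f (n+1) \<in> C}"
  have J_eq: "J = \<tau> ` {1..n}"
  proof -
    have "J = (\<lambda>i. l ! i) ` {..<n}" using l by (auto simp: set_conv_nth)
    also have "\<dots> = \<tau> ` {1..n}"
    proof -
      have "{1..n} = Suc ` {..<n}" by (simp add: image_Suc_lessThan)
      then have "\<tau> ` {1..n} = (\<lambda>i. \<tau> (Suc i)) ` {..<n}" by (simp only: image_image)
      also have "\<dots> = (\<lambda>i. l ! i) ` {..<n}" by (rule image_cong) (auto simp: \<tau>_def)
      finally show ?thesis by simp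
    qed
    finally show ?thesis .
  qed
  have sum_meas: "(\<lambda>f. \<Sum>i<k. f i) \<in> measurable (PiM {..<n} (\<lambda>_. borel :: (real^'d) measure)) borel" if "k \<le> n" for k
    by (intro borel_measurable_sum measurable_component_singleton) (use that in auto)
  have S: "S \<in> sets (PiM {..<n} (\<lambda>_. borel))"
    unfolding S_def
  proof (rule sets.sets_Collect_finite_All)
    fix k assume k: "k \<in> {1..n}"
    then have "B (\<tau> k) \<in> sets borel" using B J_eq by auto
    from measurable_sets[OF sum_meas this] k
    show "{f \<in> space (PiM {..<n} (\<lambda>_. borel)). (\<Sum>i<k. f i) \<in> B (\<tau> k)} \<in> sets (PiM {..<n} (\<lambda>_. borel))"
      by (simp add: vimage_def Int_def conj_commute)
  qed auto
  have S': "S' \<in> sets (PiM {n+1} (\<lambda>_. borel))"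
    unfolding S'_def using C by measurable
  have meas: "D i \<in> borel_measurable M" for i
    unfolding D_def using mono W_measurable st lJ
    by (intro borel_measurable_diff W_measurable) (auto simp: \<tau>_def intro: order_trans)
  have SS: "(\<lambda>\<omega>. \<lambda>i\<in>{..<n}. D i \<omega>) -` S \<inter> space M = {\<omega>\<in>space M. \<forall>k\<in>{1..n}. (\<Sum>i<k. D i \<omega>) \<in> B (\<tau> k)}"
    by (auto simp: S_def space_PiM)
  have SS': "(\<lambda>\<omega>. \<lambda>i\<in>{n+1}. D i \<omega>) -` S' \<inter> space M = Z -` C \<inter> space M"
    by (auto simp: S'_def space_PiM D_def Z_def \<tau>_def)
  \<comment> \<open>\<open>W 0\<close> vanishes only almost surely, so the cylinder \<open>A\<close>
    and the event \<open>?A'\<close> on the increments agree only up to a null set.\<close>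
  have tel: "AE \<omega> in M. \<forall>k. (\<Sum>i<k. D i \<omega>) = W (\<tau> k) \<omega>"
    using W_zero
  proof eventually_elim
    case (elim \<omega>)
    then show ?case
      unfolding D_def using sum_lessThan_telescope[of "\<lambda>i. W (\<tau> i) \<omega>"] by (simp add: \<tau>_def)
  qed
  let ?A' = "(\<lambda>\<omega>. \<lambda>i\<in>{..<n}. D i \<omega>) -` S \<inter> space M"
  have A_meas: "A \<in> sets M"
    unfolding A_def
  proof (rule sets.sets_Collect_finite_All)
    fix u assume u: "u \<in> J"
    have "W u \<in> borel_measurable M" using u J W_measurable by auto
    from measurable_sets[OF this B[OF u]]
    show "{\<omega> \<in> space M. W u \<omega> \<in> B u} \<in> sets M"
      by (simp add: vimage_def Int_def conj_commute)
  qed (use J in auto)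
  have A'_meas: "?A' \<in> sets M"
    using S by (intro measurable_sets[OF measurable_restrict]) (auto intro: meas)
  have Z_meas: "Z -` C \<inter> space M \<in> sets M"
    unfolding Z_def using W_measurable st C
    by (intro measurable_sets[of _ M borel] borel_measurable_diff) auto
  have eqA: "AE \<omega> in M. \<omega> \<in> A \<longleftrightarrow> \<omega> \<in> ?A'"
    using tel by eventually_elim (auto simp: A_def SS J_eq)
  have "prob (A \<inter> (Z -` C \<inter> space M)) = prob (?A' \<inter> (Z -` C \<inter> space M))"
    using eqA A_meas A'_meas Z_meas
    by (intro finite_measure_eq_AE) (auto elim: eventually_mono)
  also have "?A' \<inter> (Z -` C \<inter> space M) =
     (\<lambda>\<omega>. (\<lambda>i\<in>{..<n}. D i \<omega>, \<lambda>i\<in>{n+1}. D i \<omega>)) -` (S \<times> S') \<inter> space M"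
    using SS' by auto
  also have "prob \<dots> = prob ?A' * prob ((\<lambda>\<omega>. \<lambda>i\<in>{n+1}. D i \<omega>) -` S' \<inter> space M)"
    by (rule indep_varD[OF ind S S'])
  also have "prob ?A' = prob A"
    using eqA A_meas A'_meas by (intro finite_measure_eq_AE) (auto elim: eventually_mono)
  finally show ?thesis unfolding SS' .
qed

text \<open>Cylinders over finitely many times up to \<open>s\<close>, together with the null sets,
  form an intersection-stable generator of \<open>F s\<close>; null sets are independent of
  everything, and cylinders are covered by \<open>cylinder_indep\<close>. The map \<open>g\<close>
  allows polynomials in the coordinates of the increment.\<close>

lemma indep_increment:
  assumes st: "0 \<le> s" "s \<le> t" and X: "X \<in> measurable (F s) N" and g: "g \<in> measurable borel N'"
  shows "indep_var N X N' (\<lambda>\<omega>. g (W t \<omega> - W s \<omega>))"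
proof -
  let ?Z = "\<lambda>\<omega>. W t \<omega> - W s \<omega>"
  define P where "P = {A. \<exists>J B. finite J \<and> J \<subseteq> {0..s} \<and> (\<forall>u. B u \<in> sets borel) \<and>
      A = {\<omega> \<in> space M. \<forall>u\<in>J. W u \<omega> \<in> B u}} \<union> null_sets M"
  define Q where "Q = {?Z -` C \<inter> space M | C. C \<in> sets borel}"
  have Zm: "?Z \<in> borel_measurable M"
    using W_measurable st by (intro borel_measurable_diff) auto
  have P_sub: "P \<subseteq> sets M"
  proof -
    have "{\<omega> \<in> space M. \<forall>u\<in>J. W u \<omega> \<in> B u} \<in> sets M"
      if "finite J" "J \<subseteq> {0..s}" "\<forall>u. B u \<in> sets borel" for J B
    proof (rule sets.sets_Collect_finite_All)
      fix u assume "u \<in> J"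
      then have "W u \<in> borel_measurable M" using that W_measurable by auto
      then show "{\<omega> \<in> space M. W u \<omega> \<in> B u} \<in> sets M"
        using measurable_sets[of "W u" M borel "B u"] that
        by (simp add: vimage_def Int_def conj_commute)
    qed (use that in auto)
    then show ?thesis unfolding P_def by auto
  qed
  have "indep_set P Q"
  proof (rule indep_setI)
    show "P \<subseteq> sets M" by fact
    show "Q \<subseteq> sets M" unfolding Q_def using Zm by (auto intro: measurable_sets)
    fix a c assume "a \<in> P" "c \<in> Q"
    then obtain C where C: "C \<in> sets borel" "c = ?Z -` C \<inter> space M" unfolding Q_def by auto
    show "prob (a \<inter> c) = prob a * prob c"
    proof (cases "a \<in> null_sets M")
      case True
      moreover have "c \<in> sets M" using C Zm by (auto intro: measurable_sets)
      ultimately have "a \<inter> c \<in> null_sets M" by (rule null_set_Int2)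
      with True show ?thesis by (simp add: null_sets_def measure_def)
    next
      case False
      with \<open>a \<in> P\<close> obtain J B where "finite J" "J \<subseteq> {0..s}" "\<forall>u. B u \<in> sets borel"
        "a = {\<omega> \<in> space M. \<forall>u\<in>J. W u \<omega> \<in> B u}" unfolding P_def by auto
      then show ?thesis using cylinder_indep[OF st, of J B C] C by auto
    qed
  qed
  moreover have "Int_stable P"
  proof (rule Int_stableI)
    fix a b assume ab: "a \<in> P" "b \<in> P"
    show "a \<inter> b \<in> P"
    proof (cases "a \<in> null_sets M \<or> b \<in> null_sets M")
      case True
      then have "a \<inter> b \<in> null_sets M" using ab P_sub by (auto intro: null_set_Int1 null_set_Int2)
      then show ?thesis by (simp add: P_def)
    next
      case False
      with ab obtain J B K C where
        a: "finite J" "J \<subseteq> {0..s}" "\<forall>u. B u \<in> sets borel" "a = {\<omega> \<in> space M. \<forall>u\<in>J. W u \<omega> \<in> B u}"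
        and b: "finite K" "K \<subseteq> {0..s}" "\<forall>u. C u \<in> sets borel" "b = {\<omega> \<in> space M. \<forall>u\<in>K. W u \<omega> \<in> C u}"
        unfolding P_def by blast
      \<comment> \<open>A time that occurs in only one of the two cylinders is unconstrained in the
        other, which \<open>UNIV\<close> encodes.\<close>
      let ?E = "\<lambda>u. (if u \<in> J then B u else UNIV) \<inter> (if u \<in> K then C u else UNIV)"
      have "a \<inter> b = {\<omega> \<in> space M. \<forall>u\<in>J \<union> K. W u \<omega> \<in> ?E u}"
        unfolding a b by auto
      moreover have "\<forall>u. ?E u \<in> sets borel" using a b by auto
      ultimately have "\<exists>J B. finite J \<and> J \<subseteq> {0..s} \<and> (\<forall>u. B u \<in> sets borel) \<and>
          a \<inter> b = {\<omega> \<in> space M. \<forall>u\<in>J. W u \<omega> \<in> B u}"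
        using a b by (intro exI[of _ "J \<union> K"] exI[of _ ?E]) auto
      then show ?thesis unfolding P_def by blast
    qed
  qed
  moreover have "Int_stable Q"
  proof (rule Int_stableI)
    fix a b assume "a \<in> Q" "b \<in> Q"
    then obtain C D where "a = ?Z -` C \<inter> space M" "b = ?Z -` D \<inter> space M" "C \<in> sets borel" "D \<in> sets borel"
      unfolding Q_def by auto
    then have "a \<inter> b = ?Z -` (C \<inter> D) \<inter> space M" "C \<inter> D \<in> sets borel" by auto
    then show "a \<inter> b \<in> Q" unfolding Q_def by blast
  qed
  ultimately have ind: "indep_set (sigma_sets (space M) P) (sigma_sets (space M) Q)"
    by (rule indep_set_sigma_sets)
  have FP: "sets (F s) \<subseteq> sigma_sets (space M) P"
    unfolding sets_F
  proof (rule sigma_sets_mono', rule Un_least)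
    show "null_sets M \<subseteq> P" by (simp add: P_def)
    show "{W u -` B \<inter> space M |u B. u \<in> {0..s} \<and> B \<in> sets borel} \<subseteq> P"
    proof clarify
      fix u and B :: "(real^'d) set" assume "u \<in> {0..s}" "B \<in> sets borel"
      then have "\<exists>J B'. finite J \<and> J \<subseteq> {0..s} \<and> (\<forall>u. B' u \<in> sets borel) \<and>
          W u -` B \<inter> space M = {\<omega> \<in> space M. \<forall>u\<in>J. W u \<omega> \<in> B' u}"
        by (intro exI[of _ "{u}"] exI[of _ "\<lambda>_. B"]) auto
      then show "W u -` B \<inter> space M \<in> P" unfolding P_def by blast
    qed
  qed
  have gZ: "(\<lambda>\<omega>. g (?Z \<omega>)) \<in> measurable M N'"
    using measurable_compose[OF Zm g] .
  show ?thesis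
    unfolding indep_var_eq
  proof (intro conjI gZ measurable_F_M[OF X])
    have 1: "sigma_sets (space M) {X -` A \<inter> space M |A. A \<in> sets N} \<subseteq> sets (F s)"
      using measurable_sets[OF X] sets.sigma_sets_subset[of "{X -` A \<inter> space M |A. A \<in> sets N}" "F s"]
      by auto
    have "{(\<lambda>\<omega>. g (?Z \<omega>)) -` A \<inter> space M |A. A \<in> sets N'} \<subseteq> Q"
    proof clarify
      fix A assume "A \<in> sets N'"
      then have "g -` A \<in> sets borel" using measurable_sets[OF g, of A] by simp
      moreover have "(\<lambda>\<omega>. g (?Z \<omega>)) -` A \<inter> space M = ?Z -` (g -` A) \<inter> space M" by auto
      ultimately show "(\<lambda>\<omega>. g (?Z \<omega>)) -` A \<inter> space M \<in> Q" unfolding Q_def by blast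
    qed
    then have 2: "sigma_sets (space M) {(\<lambda>\<omega>. g (?Z \<omega>)) -` A \<inter> space M |A. A \<in> sets N'} \<subseteq> sigma_sets (space M) Q"
      by (rule sigma_sets_mono')
    show "indep_set (sigma_sets (space M) {X -` A \<inter> space M |A. A \<in> sets N})
       (sigma_sets (space M) {(\<lambda>\<omega>. g (?Z \<omega>)) -` A \<inter> space M |A. A \<in> sets N'})"
      using ind FP 1 2 unfolding indep_sets2_eq by (meson subset_iff)
  qed
qed

end

section \<open>Moments of Gaussian increments\<close>

lemma (in prob_space) integrable_power_le_4:
  fixes f :: "'a \<Rightarrow> real"
  assumes f: "f \<in> borel_measurable M" and int: "integrable M (\<lambda>\<omega>. f \<omega> ^ 4)" and k: "k \<le> 4"
  shows "integrable M (\<lambda>\<omega>. f \<omega> ^ k)"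
proof (rule Bochner_Integration.integrable_bound)
  show "integrable M (\<lambda>\<omega>. 1 + f \<omega> ^ 4)" using int by simp
  show "(\<lambda>\<omega>. f \<omega> ^ k) \<in> borel_measurable M" using f by measurable
  show "AE \<omega> in M. norm (f \<omega> ^ k) \<le> norm (1 + f \<omega> ^ 4)"
  proof (rule AE_I2)
    fix \<omega>
    have "\<bar>f \<omega>\<bar> ^ k \<le> 1 + \<bar>f \<omega>\<bar> ^ 4"
    proof (cases "\<bar>f \<omega>\<bar> \<le> 1")
      case True
      then have "\<bar>f \<omega>\<bar> ^ k \<le> 1" by (simp add: power_le_one)
      then show ?thesis by (smt (verit) zero_le_power abs_ge_zero)
    next
      case False
      then have "\<bar>f \<omega>\<bar> ^ k \<le> \<bar>f \<omega>\<bar> ^ 4" using k by (intro power_increasing) auto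
      then show ?thesis by simp
    qed
    then show "norm (f \<omega> ^ k) \<le> norm (1 + f \<omega> ^ 4)" by (simp add: power_abs)
  qed
qed

lemma borel_measurable_vec_nth [measurable (raw)]:
  fixes f :: "'a \<Rightarrow> real^'d"
  assumes "f \<in> borel_measurable M" shows "(\<lambda>x. f x $ i) \<in> borel_measurable M"
proof (rule measurable_compose[OF assms])
  show "(\<lambda>x::real^'d. x $ i) \<in> borel_measurable borel"
    by (intro borel_measurable_continuous_onI continuous_intros)
qed

lemma prod_Basis_vec:
  fixes f :: "real^'d \<Rightarrow> 'b::comm_monoid_mult"
  shows "(\<Prod>b\<in>Basis. f b) = (\<Prod>i\<in>UNIV. f (axis i 1))"
proof -
  have "Basis = (\<lambda>i::'d. axis i (1::real)) ` UNIV" by (auto simp: Basis_vec_def)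
  moreover have "inj (\<lambda>i::'d. axis i (1::real))" by (simp add: inj_def axis_eq_axis)
  ultimately show ?thesis using prod.reindex[of "\<lambda>i::'d. axis i (1::real)" UNIV f] by (simp add: comp_def)
qed

lemma nn_integral_vec_prod:
  fixes f :: "'d::finite \<Rightarrow> real \<Rightarrow> ennreal"
  assumes [measurable]: "\<And>i. f i \<in> borel_measurable borel"
  shows "(\<integral>\<^sup>+x. (\<Prod>i\<in>UNIV. f i (x $ i)) \<partial>(lborel :: (real^'d) measure)) = (\<Prod>i\<in>UNIV. \<integral>\<^sup>+x. f i x \<partial>lborel)"
proof -
  \<comment> \<open>The product formula for \<open>lborel\<close> labels its factors by basis
    vectors; \<open>ix\<close> turns such a vector back into its coordinate.\<close>
  define ix where "ix b = (THE i. b = axis i (1::real))" for b :: "real^'d"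
  have [simp]: "ix (axis i 1) = i" for i by (simp add: ix_def axis_eq_axis)
  show ?thesis
    using nn_integral_lborel_prod[of "\<lambda>b. f (ix b)"]
    by (simp add: prod_Basis_vec inner_axis)
qed

context brownian_space begin

lemma increment_measurable: "0 \<le> s \<Longrightarrow> s \<le> t \<Longrightarrow> (\<lambda>\<omega>. W t \<omega> - W s \<omega>) \<in> borel_measurable M"
  using W_measurable by (intro borel_measurable_diff) auto

text \<open>The joint density enters the development here. Indicator factors in one or in two
  coordinates then give the marginal laws and the independence of the coordinates.\<close>

lemma nn_integral_increment_prod:
  assumes st: "0 \<le> s" "s < t" and [measurable]: "\<And>i. g i \<in> borel_measurable borel"
  shows "(\<integral>\<^sup>+\<omega>. (\<Prod>i\<in>UNIV. g i ((W t \<omega> - W s \<omega>) $ i)) \<partial>M) =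
    (\<Prod>i\<in>UNIV. \<integral>\<^sup>+x. ennreal (normal_density 0 (sqrt (t - s)) x) * g i x \<partial>lborel)"
proof -
  have "distributed M lborel (\<lambda>\<omega>. W t \<omega> - W s \<omega>)
         (\<lambda>x. ennreal (\<Prod>i\<in>UNIV. normal_density 0 (sqrt (t - s)) (x $ i)))"
    using bm st unfolding standard_brownian_motion_def by blast
  from distributed_nn_integral[OF this, of "\<lambda>x. \<Prod>i\<in>UNIV. g i (x $ i)"]
  have "(\<integral>\<^sup>+\<omega>. (\<Prod>i\<in>UNIV. g i ((W t \<omega> - W s \<omega>) $ i)) \<partial>M) =
     (\<integral>\<^sup>+x. (\<Prod>i\<in>UNIV. ennreal (normal_density 0 (sqrt (t - s)) (x $ i)) * g i (x $ i)) \<partial>lborel)"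
    by (simp add: prod.distrib prod_ennreal[symmetric])
  also have "\<dots> = (\<Prod>i\<in>UNIV. \<integral>\<^sup>+x. ennreal (normal_density 0 (sqrt (t - s)) x) * g i x \<partial>lborel)"
    by (rule nn_integral_vec_prod) measurable
  finally show ?thesis .
qed

lemma distributed_increment_component:
  assumes st: "0 \<le> s" "s < t"
  shows "distributed M lborel (\<lambda>\<omega>. (W t \<omega> - W s \<omega>) $ i) (\<lambda>x. ennreal (normal_density 0 (sqrt (t - s)) x))"
proof -
  have [measurable]: "(\<lambda>\<omega>. (W t \<omega> - W s \<omega>) $ i) \<in> borel_measurable M"
    using increment_measurable st by (intro borel_measurable_vec_nth) auto
  have "distr M lborel (\<lambda>\<omega>. (W t \<omega> - W s \<omega>) $ i) = density lborel (\<lambda>x. ennreal (normal_density 0 (sqrt (t - s)) x))"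
  proof (rule measure_eqI)
    fix A assume "A \<in> sets (distr M lborel (\<lambda>\<omega>. (W t \<omega> - W s \<omega>) $ i))"
    then have A [measurable]: "A \<in> sets borel" by simp
    let ?g = "\<lambda>k x. if k = i then indicator A x else (1::ennreal)"
    have "emeasure (distr M lborel (\<lambda>\<omega>. (W t \<omega> - W s \<omega>) $ i)) A
        = (\<integral>\<^sup>+\<omega>. indicator A ((W t \<omega> - W s \<omega>) $ i) \<partial>M)"
      by (subst nn_integral_distr[of _ M lborel "indicator A", symmetric]) (auto simp del: vector_minus_component)
    also have "\<dots> = (\<integral>\<^sup>+\<omega>. (\<Prod>k\<in>UNIV. ?g k ((W t \<omega> - W s \<omega>) $ k)) \<partial>M)"
      by simp
    also have "\<dots> = (\<Prod>k\<in>UNIV. \<integral>\<^sup>+x. ennreal (normal_density 0 (sqrt (t - s)) x) * ?g k x \<partial>lborel)"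
      by (rule nn_integral_increment_prod[OF st]) measurable
    also have "\<dots> = (\<Prod>k\<in>UNIV. if k = i then (\<integral>\<^sup>+x. ennreal (normal_density 0 (sqrt (t - s)) x) * indicator A x \<partial>lborel) else 1)"
      using st by (intro prod.cong) (auto simp: nn_integral_eq_integral)
    also have "\<dots> = emeasure (density lborel (\<lambda>x. ennreal (normal_density 0 (sqrt (t - s)) x))) A"
      by (simp add: emeasure_density)
    finally show "emeasure (distr M lborel (\<lambda>\<omega>. (W t \<omega> - W s \<omega>) $ i)) A
        = emeasure (density lborel (\<lambda>x. ennreal (normal_density 0 (sqrt (t - s)) x))) A" .
  qed simp
  then show ?thesis unfolding distributed_def by (simp del: vector_minus_component)
qed

text \<open>Indicators in the coordinates \<open>i\<close> and \<open>j\<close> split the product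
  integral, because every other factor is the total mass 1 of a normal density. Preimages of Borel
  sets are intersection-stable, so the product rule on them suffices.\<close>

lemma indep_increment_components:
  assumes st: "0 \<le> s" "s < t" and ij: "i \<noteq> j"
  shows "indep_var borel (\<lambda>\<omega>. (W t \<omega> - W s \<omega>) $ i) borel (\<lambda>\<omega>. (W t \<omega> - W s \<omega>) $ j)"
proof -
  let ?Z = "\<lambda>i \<omega>. (W t \<omega> - W s \<omega>) $ i"
  have m [measurable]: "?Z i \<in> borel_measurable M" for i
    using increment_measurable st by (intro borel_measurable_vec_nth) auto
  have stable: "Int_stable {?Z i -` A \<inter> space M | A. A \<in> sets borel}" for i
  proof (rule Int_stableI)
    fix a b assume "a \<in> {?Z i -` A \<inter> space M | A. A \<in> sets borel}" "b \<in> {?Z i -` A \<inter> space M | A. A \<in> sets borel}"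
    then obtain C D where "a = ?Z i -` C \<inter> space M" "b = ?Z i -` D \<inter> space M" "C \<in> sets borel" "D \<in> sets borel"
      by auto
    then have "a \<inter> b = ?Z i -` (C \<inter> D) \<inter> space M" "C \<inter> D \<in> sets borel" by auto
    then show "a \<inter> b \<in> {?Z i -` A \<inter> space M | A. A \<in> sets borel}" by blast
  qed
  have one: "emeasure M (?Z i -` A \<inter> space M) = (\<integral>\<^sup>+x. ennreal (normal_density 0 (sqrt (t - s)) x) * indicator A x \<partial>lborel)"
    if [measurable]: "A \<in> sets borel" for A i
    using distributed_emeasure[OF distributed_increment_component[OF st], of A i] that by simp
  have "indep_set {?Z i -` A \<inter> space M | A. A \<in> sets borel} {?Z j -` A \<inter> space M | A. A \<in> sets borel}"
  proof (rule indep_setI)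
    fix a b assume "a \<in> {?Z i -` A \<inter> space M | A. A \<in> sets borel}" "b \<in> {?Z j -` A \<inter> space M | A. A \<in> sets borel}"
    then obtain A B where ab: "a = ?Z i -` A \<inter> space M" "b = ?Z j -` B \<inter> space M"
      and [measurable]: "A \<in> sets borel" "B \<in> sets borel" by auto
    let ?g = "\<lambda>k x. (if k = i then indicator A x else (1::ennreal)) * (if k = j then indicator B x else 1)"
    have "emeasure M (a \<inter> b) = (\<integral>\<^sup>+\<omega>. indicator (a \<inter> b) \<omega> \<partial>M)"
      unfolding ab by (subst nn_integral_indicator) (auto simp del: vector_minus_component)
    also have "\<dots> = (\<integral>\<^sup>+\<omega>. (\<Prod>k\<in>UNIV. ?g k (?Z k \<omega>)) \<partial>M)"
      unfolding prod.distrib by (intro nn_integral_cong) (auto simp: ab split: split_indicator)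
    also have "\<dots> = (\<Prod>k\<in>UNIV. \<integral>\<^sup>+x. ennreal (normal_density 0 (sqrt (t - s)) x) * ?g k x \<partial>lborel)"
      by (rule nn_integral_increment_prod[OF st]) measurable
    also have "\<dots> = (\<Prod>k\<in>UNIV. (if k = i then emeasure M a else 1) * (if k = j then emeasure M b else 1))"
      using st ij by (intro prod.cong) (auto simp: nn_integral_eq_integral ab one simp del: vector_minus_component)
    also have "\<dots> = emeasure M a * emeasure M b"
      unfolding prod.distrib by simp
    finally show "prob (a \<inter> b) = prob a * prob b"
      by (simp add: measure_def enn2real_mult)
  qed (use m in \<open>auto intro: measurable_sets\<close>)
  then show ?thesis
    unfolding indep_var_eq using stable m by (intro conjI indep_set_sigma_sets) auto
qed

lemma increment_component_power:
  assumes st: "0 \<le> s" "s \<le> t"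
  shows "integrable M (\<lambda>\<omega>. ((W t \<omega> - W s \<omega>) $ i) ^ k)"
    and "expectation (\<lambda>\<omega>. (W t \<omega> - W s \<omega>) $ i) = 0"
    and "expectation (\<lambda>\<omega>. ((W t \<omega> - W s \<omega>) $ i)\<^sup>2) = t - s"
    and "expectation (\<lambda>\<omega>. ((W t \<omega> - W s \<omega>) $ i) ^ 4) = 3 * (t - s)\<^sup>2"
proof -
  have *: "integrable M (\<lambda>\<omega>. ((W t \<omega> - W s \<omega>) $ i) ^ k) \<and> expectation (\<lambda>\<omega>. (W t \<omega> - W s \<omega>) $ i) = 0
     \<and> expectation (\<lambda>\<omega>. ((W t \<omega> - W s \<omega>) $ i)\<^sup>2) = t - s \<and> expectation (\<lambda>\<omega>. ((W t \<omega> - W s \<omega>) $ i) ^ 4) = 3 * (t - s)\<^sup>2"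
  \<comment> \<open>A density is available only for \<open>s < t\<close>; for \<open>s = t\<close>
    the increment is 0 and all claims are trivial.\<close>
  proof (cases "s = t")
    case True
    then show ?thesis by simp
  next
    case False
    then have st': "0 \<le> s" "s < t" and pos: "0 < sqrt (t - s)" using st by auto
    note d = distributed_increment_component[OF st', of i]
    have int: "integrable M (\<lambda>\<omega>. ((W t \<omega> - W s \<omega>) $ i) ^ k)" for k
      using distributed_integrable[OF d, of "\<lambda>x. x ^ k"] integrable_normal_moment[OF pos, of 0 k] by simp
    have eq: "expectation (\<lambda>\<omega>. ((W t \<omega> - W s \<omega>) $ i) ^ k) = (\<integral>x. normal_density 0 (sqrt (t - s)) x * x ^ k \<partial>lborel)" for k
      using distributed_integral[OF d, of "\<lambda>x. x ^ k"] by simp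
    show ?thesis
      using int eq[of 1] eq[of 2] eq[of 4] integral_normal_moment_odd[OF pos, of 0 0]
        integral_normal_moment_even[OF pos, of 0 1] integral_normal_moment_even[OF pos, of 0 2] st'
      by (simp add: fact_numeral power2_eq_square field_simps)
  qed
  then show "integrable M (\<lambda>\<omega>. ((W t \<omega> - W s \<omega>) $ i) ^ k)"
    and "expectation (\<lambda>\<omega>. (W t \<omega> - W s \<omega>) $ i) = 0"
    and "expectation (\<lambda>\<omega>. ((W t \<omega> - W s \<omega>) $ i)\<^sup>2) = t - s"
    and "expectation (\<lambda>\<omega>. ((W t \<omega> - W s \<omega>) $ i) ^ 4) = 3 * (t - s)\<^sup>2"
    by auto
qed

lemma increment_component_mult:
  assumes st: "0 \<le> s" "s \<le> t"
  shows "integrable M (\<lambda>\<omega>. (W t \<omega> - W s \<omega>) $ i * (W t \<omega> - W s \<omega>) $ j)"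
    and "expectation (\<lambda>\<omega>. (W t \<omega> - W s \<omega>) $ i * (W t \<omega> - W s \<omega>) $ j) = (if i = j then t - s else 0)"
proof -
  have *: "integrable M (\<lambda>\<omega>. (W t \<omega> - W s \<omega>) $ i * (W t \<omega> - W s \<omega>) $ j) \<and>
    expectation (\<lambda>\<omega>. (W t \<omega> - W s \<omega>) $ i * (W t \<omega> - W s \<omega>) $ j) = (if i = j then t - s else 0)"
  proof (cases "s = t \<or> i = j")
    case True
    then show ?thesis
      using increment_component_power(1)[OF st, of i 2] increment_component_power(3)[OF st, of i]
      by (auto simp: power2_eq_square)
  next
    case False
    then have st': "0 \<le> s" "s < t" "i \<noteq> j" using st by auto
    have int: "integrable M (\<lambda>\<omega>. (W t \<omega> - W s \<omega>) $ i)" for i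
      using increment_component_power(1)[OF st, of i 1] by simp
    show ?thesis
      using indep_var_lebesgue_integral[OF indep_increment_components[OF st'] int int]
        indep_var_integrable[OF indep_increment_components[OF st'] int int] False
        increment_component_power(2)[OF st]
      by simp
  qed
  then show "integrable M (\<lambda>\<omega>. (W t \<omega> - W s \<omega>) $ i * (W t \<omega> - W s \<omega>) $ j)"
    and "expectation (\<lambda>\<omega>. (W t \<omega> - W s \<omega>) $ i * (W t \<omega> - W s \<omega>) $ j) = (if i = j then t - s else 0)"
    by auto
qed

lemma past_times_increment:
  fixes X :: "'a \<Rightarrow> real" and g :: "real^'d \<Rightarrow> real"
  assumes st: "0 \<le> s" "s \<le> t" and X: "X \<in> borel_measurable (F s)" "integrable M X"
    and g: "g \<in> borel_measurable borel" "integrable M (\<lambda>\<omega>. g (W t \<omega> - W s \<omega>))"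
  shows "integrable M (\<lambda>\<omega>. X \<omega> * g (W t \<omega> - W s \<omega>))"
    and "expectation (\<lambda>\<omega>. X \<omega> * g (W t \<omega> - W s \<omega>)) = expectation X * expectation (\<lambda>\<omega>. g (W t \<omega> - W s \<omega>))"
proof -
  note i = indep_increment[OF st X(1) g(1)]
  show "integrable M (\<lambda>\<omega>. X \<omega> * g (W t \<omega> - W s \<omega>))"
    by (rule indep_var_integrable[OF i X(2) g(2)])
  show "expectation (\<lambda>\<omega>. X \<omega> * g (W t \<omega> - W s \<omega>)) = expectation X * expectation (\<lambda>\<omega>. g (W t \<omega> - W s \<omega>))"
    by (rule indep_var_lebesgue_integral[OF i X(2) g(2)])
qed

text \<open>In coordinates every term is a variable of the past times a monomial in the increment,
  and the expectation factorises by independence. The covariance matrix of the increment is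
  \<open>t - s\<close> times the identity, so only the diagonal of the double sum survives. The
  weight \<open>X\<close> lets these identities be used under conditioning on
  \<open>F s\<close>.\<close>

lemma past_times_inner_increment:
  fixes X :: "'a \<Rightarrow> real" and x :: "'a \<Rightarrow> real^'d"
  assumes st: "0 \<le> s" "s \<le> t" and X: "X \<in> borel_measurable (F s)" "integrable M X"
    and x: "x \<in> borel_measurable (F s)" "\<And>\<omega>. \<omega> \<in> space M \<Longrightarrow> norm (x \<omega>) \<le> K"
  shows "integrable M (\<lambda>\<omega>. X \<omega> * (x \<omega> \<bullet> (W t \<omega> - W s \<omega>)))"
    and "expectation (\<lambda>\<omega>. X \<omega> * (x \<omega> \<bullet> (W t \<omega> - W s \<omega>))) = 0"
    and "integrable M (\<lambda>\<omega>. X \<omega> * (x \<omega> \<bullet> (W t \<omega> - W s \<omega>))\<^sup>2)"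
    and "integrable M (\<lambda>\<omega>. X \<omega> * (norm (x \<omega>))\<^sup>2)"
    and "expectation (\<lambda>\<omega>. X \<omega> * (x \<omega> \<bullet> (W t \<omega> - W s \<omega>))\<^sup>2) = (t - s) * expectation (\<lambda>\<omega>. X \<omega> * (norm (x \<omega>))\<^sup>2)"
proof -
  let ?D = "\<lambda>\<omega>. W t \<omega> - W s \<omega>"
  have XM: "X \<in> borel_measurable M" using X measurable_F_M by blast
  have bd: "integrable M (\<lambda>\<omega>. X \<omega> * f \<omega>)"
    if "f \<in> borel_measurable M" "\<And>\<omega>. \<omega> \<in> space M \<Longrightarrow> \<bar>f \<omega>\<bar> \<le> C" for f :: "'a \<Rightarrow> real" and C
  proof (rule Bochner_Integration.integrable_bound)
    show "integrable M (\<lambda>\<omega>. C * X \<omega>)" using X by simp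
    show "(\<lambda>\<omega>. X \<omega> * f \<omega>) \<in> borel_measurable M" using XM that by measurable
    show "AE \<omega> in M. norm (X \<omega> * f \<omega>) \<le> norm (C * X \<omega>)"
    proof (rule AE_I2)
      fix \<omega> assume "\<omega> \<in> space M"
      then have "\<bar>X \<omega>\<bar> * \<bar>f \<omega>\<bar> \<le> \<bar>X \<omega>\<bar> * \<bar>C\<bar>"
        using that(2) by (intro mult_left_mono) force+
      then show "norm (X \<omega> * f \<omega>) \<le> norm (C * X \<omega>)" by (simp add: abs_mult mult.commute)
    qed
  qed
  have xi: "\<bar>x \<omega> $ i\<bar> \<le> K" if "\<omega> \<in> space M" for \<omega> i
    using component_le_norm_cart[of "x \<omega>" i] x(2)[OF that] by linarith
  have K: "0 \<le> K" using xi by (metis abs_ge_zero not_empty order_trans all_not_in_conv)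
  have xm: "(\<lambda>\<omega>. x \<omega> $ i) \<in> borel_measurable (F s)" for i using x(1) by measurable
  have xM: "(\<lambda>\<omega>. x \<omega> $ i) \<in> borel_measurable M" for i using measurable_F_M[OF xm] .
  have Xi: "integrable M (\<lambda>\<omega>. X \<omega> * x \<omega> $ i)" for i
    by (rule bd[OF xM xi])
  have Xij: "integrable M (\<lambda>\<omega>. X \<omega> * (x \<omega> $ i * x \<omega> $ j))" for i j
    using xM by (intro bd[of _ "K * K"]) (auto simp: abs_mult intro!: mult_mono xi K)
  have m1: "(\<lambda>\<omega>. X \<omega> * x \<omega> $ i) \<in> borel_measurable (F s)" for i using xm X by measurable
  have m2: "(\<lambda>\<omega>. X \<omega> * (x \<omega> $ i * x \<omega> $ j)) \<in> borel_measurable (F s)" for i j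
    using xm[of i] xm[of j] X by measurable
  have gi: "integrable M (\<lambda>\<omega>. ?D \<omega> $ i)" for i using increment_component_power(1)[OF st, of i 1] by simp
  note p1 = past_times_increment[OF st m1 Xi, of "\<lambda>z. z $ i" for i, OF _ gi]
  note p2 = past_times_increment[OF st m2 Xij, of "\<lambda>z. z $ i * z $ j" for i j, OF _ increment_component_mult(1)[OF st]]
  have e1: "X \<omega> * (x \<omega> \<bullet> ?D \<omega>) = (\<Sum>i\<in>UNIV. (X \<omega> * x \<omega> $ i) * ?D \<omega> $ i)" for \<omega>
    by (simp add: inner_vec_def sum_distrib_left mult.assoc)
  have e2: "X \<omega> * (x \<omega> \<bullet> ?D \<omega>)\<^sup>2 = (\<Sum>i\<in>UNIV. \<Sum>j\<in>UNIV. (X \<omega> * (x \<omega> $ i * x \<omega> $ j)) * (?D \<omega> $ i * ?D \<omega> $ j))" for \<omega>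
    unfolding power2_eq_square inner_vec_def sum_product sum_distrib_left
    by (intro sum.cong refl) (simp add: sum_distrib_left mult_ac del: vector_minus_component)
  have e3: "X \<omega> * (norm (x \<omega>))\<^sup>2 = (\<Sum>i\<in>UNIV. X \<omega> * (x \<omega> $ i * x \<omega> $ i))" for \<omega>
    unfolding power2_norm_eq_inner inner_vec_def sum_distrib_left by simp
  have [simp]: "(\<lambda>z::real^'d. z $ i) \<in> borel_measurable borel" for i by measurable
  have [simp]: "(\<lambda>z::real^'d. z $ i * z $ j) \<in> borel_measurable borel" for i j by measurable
  show "integrable M (\<lambda>\<omega>. X \<omega> * (x \<omega> \<bullet> ?D \<omega>))"
    unfolding e1 using p1(1) by (intro Bochner_Integration.integrable_sum) simp
  show "expectation (\<lambda>\<omega>. X \<omega> * (x \<omega> \<bullet> ?D \<omega>)) = 0"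
    unfolding e1 using p1 increment_component_power(2)[OF st]
    by (subst Bochner_Integration.integral_sum) auto
  show "integrable M (\<lambda>\<omega>. X \<omega> * (x \<omega> \<bullet> ?D \<omega>)\<^sup>2)"
    unfolding e2 using p2(1) by (intro Bochner_Integration.integrable_sum) simp
  show "integrable M (\<lambda>\<omega>. X \<omega> * (norm (x \<omega>))\<^sup>2)"
    unfolding e3 using Xij by (intro Bochner_Integration.integrable_sum) simp
  have "expectation (\<lambda>\<omega>. X \<omega> * (x \<omega> \<bullet> ?D \<omega>)\<^sup>2) =
    (\<Sum>i\<in>UNIV. \<Sum>j\<in>UNIV. expectation (\<lambda>\<omega>. (X \<omega> * (x \<omega> $ i * x \<omega> $ j)) * (?D \<omega> $ i * ?D \<omega> $ j)))"
    unfolding e2 using p2(1)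
    by (simp add: Bochner_Integration.integral_sum Bochner_Integration.integrable_sum)
  also have "\<dots> = (\<Sum>i\<in>UNIV. \<Sum>j\<in>UNIV. expectation (\<lambda>\<omega>. X \<omega> * (x \<omega> $ i * x \<omega> $ j)) * (if i = j then t - s else 0))"
    using p2(2) increment_component_mult(2)[OF st] by simp
  also have "\<dots> = (\<Sum>i\<in>UNIV. (t - s) * expectation (\<lambda>\<omega>. X \<omega> * (x \<omega> $ i * x \<omega> $ i)))"
    by (intro sum.cong refl) (simp add: if_distrib mult.commute cong: if_cong)
  also have "\<dots> = (t - s) * expectation (\<lambda>\<omega>. X \<omega> * (norm (x \<omega>))\<^sup>2)"
    unfolding e3 using Xij by (simp add: Bochner_Integration.integral_sum sum_distrib_left)
  finally show "expectation (\<lambda>\<omega>. X \<omega> * (x \<omega> \<bullet> ?D \<omega>)\<^sup>2) = (t - s) * expectation (\<lambda>\<omega>. X \<omega> * (norm (x \<omega>))\<^sup>2)" .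
qed

text \<open>The bound is pathwise: Cauchy-Schwarz replaces \<open>x\<close> by its bound
  \<open>K\<close>. One factor \<open>CARD('d)\<close> comes from comparing the square of a sum with
  the sum of squares, the other from summing the coordinate moments
  \<open>3 * (t - s)\<^sup>2\<close>.\<close>

lemma inner_increment_fourth_moment:
  fixes x :: "'a \<Rightarrow> real^'d"
  assumes st: "0 \<le> s" "s \<le> t"
    and x: "x \<in> borel_measurable M" "\<And>\<omega>. \<omega> \<in> space M \<Longrightarrow> norm (x \<omega>) \<le> K"
  shows "integrable M (\<lambda>\<omega>. (x \<omega> \<bullet> (W t \<omega> - W s \<omega>)) ^ 4)"
    and "expectation (\<lambda>\<omega>. (x \<omega> \<bullet> (W t \<omega> - W s \<omega>)) ^ 4) \<le> 3 * (real CARD('d))\<^sup>2 * K ^ 4 * (t - s)\<^sup>2"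
proof -
  let ?D = "\<lambda>\<omega>. W t \<omega> - W s \<omega>"
  let ?B = "\<lambda>\<omega>. K ^ 4 * (CARD('d) * (\<Sum>i\<in>UNIV. (?D \<omega> $ i) ^ 4))"
  have int: "integrable M ?B"
    using increment_component_power(1)[OF st] by (intro integrable_mult_right Bochner_Integration.integrable_sum) simp
  have le: "(x \<omega> \<bullet> ?D \<omega>) ^ 4 \<le> ?B \<omega>" if "\<omega> \<in> space M" for \<omega>
  proof -
    have "\<bar>x \<omega> \<bullet> ?D \<omega>\<bar> \<le> K * norm (?D \<omega>)"
      using Cauchy_Schwarz_ineq2[of "x \<omega>" "?D \<omega>"] mult_right_mono[OF x(2)[OF that], of "norm (?D \<omega>)"] by simp
    then have "\<bar>x \<omega> \<bullet> ?D \<omega>\<bar> ^ 4 \<le> (K * norm (?D \<omega>)) ^ 4" by (rule power_mono) simp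
    also have "\<dots> = K ^ 4 * ((norm (?D \<omega>))\<^sup>2)\<^sup>2" by (simp add: power_mult_distrib)
    also have "(norm (?D \<omega>))\<^sup>2 = (\<Sum>i\<in>UNIV. (?D \<omega> $ i)\<^sup>2)"
      unfolding power2_norm_eq_inner inner_vec_def by (simp add: power2_eq_square)
    also have "K ^ 4 * (\<Sum>i\<in>UNIV. (?D \<omega> $ i)\<^sup>2)\<^sup>2 \<le> K ^ 4 * ((\<Sum>i\<in>UNIV. ((?D \<omega> $ i)\<^sup>2)\<^sup>2) * card (UNIV :: 'd set))"
      by (intro mult_left_mono sum_squared_le_sum_of_squares) auto
    finally show ?thesis by (simp add: mult_ac)
  qed
  show 1: "integrable M (\<lambda>\<omega>. (x \<omega> \<bullet> ?D \<omega>) ^ 4)"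
    using x(1) increment_measurable[OF st] le
    by (intro Bochner_Integration.integrable_bound[OF int]) (auto intro!: AE_I2 order_trans[OF _ abs_ge_self])
  have "expectation (\<lambda>\<omega>. (x \<omega> \<bullet> ?D \<omega>) ^ 4) \<le> expectation ?B"
    by (rule integral_mono[OF 1 int le])
  also have "\<dots> = K ^ 4 * (CARD('d) * (\<Sum>i\<in>(UNIV::'d set). 3 * (t - s)\<^sup>2))"
    using increment_component_power(1,4)[OF st] by (simp add: Bochner_Integration.integral_sum)
  finally show "expectation (\<lambda>\<omega>. (x \<omega> \<bullet> ?D \<omega>) ^ 4) \<le> 3 * (real CARD('d))\<^sup>2 * K ^ 4 * (t - s)\<^sup>2"
    by (simp add: power2_eq_square algebra_simps)
qed

end

section \<open>Time integrals and stochastic sums\<close>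

lemma sum_squared_le: "(a + b)\<^sup>2 \<le> 2 * a\<^sup>2 + 2 * b\<^sup>2" for a b :: real
  using sum_squares_ge_zero[of "a - b" 0] by (simp add: power2_eq_square algebra_simps)

lemma sum_fourth_power_le: "(a + b) ^ 4 \<le> 8 * a ^ 4 + 8 * b ^ 4" for a b :: real
proof -
  have "((a + b)\<^sup>2)\<^sup>2 \<le> (2 * a\<^sup>2 + 2 * b\<^sup>2)\<^sup>2" by (intro power_mono sum_squared_le) auto
  also have "\<dots> \<le> 2 * (2 * a\<^sup>2)\<^sup>2 + 2 * (2 * b\<^sup>2)\<^sup>2" by (rule sum_squared_le)
  finally show ?thesis by (simp add: power_mult_distrib)
qed

text \<open>Time is restricted to \<open>{0..t}\<close> as in progressive measurability. With
  \<open>F t\<close> in the role of \<open>N\<close> this yields adapted time integrals, with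
  \<open>M\<close> it yields Fubini.\<close>

abbreviation jointly_measurable :: "real \<Rightarrow> 'a measure \<Rightarrow> (real \<Rightarrow> 'a \<Rightarrow> 'b::topological_space) \<Rightarrow> bool"
  where "jointly_measurable t N f \<equiv>
    (\<lambda>(s, \<omega>). f s \<omega>) \<in> borel_measurable (restrict_space borel {0..t} \<Otimes>\<^sub>M N)"

lemma jointly_measurable_compose:
  assumes "jointly_measurable t N f" "g \<in> borel_measurable borel"
  shows "jointly_measurable t N (\<lambda>s \<omega>. g (f s \<omega>))"
  using measurable_compose[OF assms] by (simp add: split_beta')

lemma jointly_measurable_section:
  assumes "jointly_measurable t N f" "\<omega> \<in> space N"
  shows "(\<lambda>u. f u \<omega>) \<in> borel_measurable (restrict_space borel {0..t})"
  using measurable_compose[OF measurable_Pair2'[OF assms(2)] assms(1)] by simp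

lemma jointly_measurable_indicator_section:
  fixes f :: "real \<Rightarrow> 'a \<Rightarrow> 'b::{banach, second_countable_topology}"
  assumes "jointly_measurable t N f" "\<omega> \<in> space N" "0 \<le> s"
  shows "(\<lambda>u. indicator {s..t} u *\<^sub>R f u \<omega>) \<in> borel_measurable borel"
proof -
  have "(\<lambda>u. indicator {0..t} u *\<^sub>R f u \<omega>) \<in> borel_measurable borel"
    using jointly_measurable_section[OF assms(1,2)] by (subst (asm) borel_measurable_restrict_space_iff) auto
  then have "(\<lambda>u. indicator {s..t} u *\<^sub>R (indicator {0..t} u *\<^sub>R f u \<omega>)) \<in> borel_measurable borel"
    by measurable
  also have "(\<lambda>u. indicator {s..t} u *\<^sub>R (indicator {0..t} u *\<^sub>R f u \<omega>)) = (\<lambda>u. indicator {s..t} u *\<^sub>R f u \<omega>)"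
    using assms by (auto split: split_indicator)
  finally show ?thesis .
qed

lemma finite_measure_restrict_lborel: "finite_measure (restrict_space lborel {s..t::real})"
  by (intro finite_measureI) (auto simp: space_restrict_space emeasure_restrict_space emeasure_lborel_Icc_eq)

lemma integrable_indicator_Icc: "integrable lborel (indicator {s..t::real} :: real \<Rightarrow> real)"
  by (simp add: emeasure_lborel_Icc_eq)

text \<open>On \<open>{0..t}\<close> Lebesgue measure is finite, so measurability of parametrised
  integrals applies to the product with any \<open>N\<close>; the indicator then cuts out
  \<open>{s..t}\<close>.\<close>

lemma time_integral_measurable:
  fixes f :: "real \<Rightarrow> 'a \<Rightarrow> real"
  assumes f: "jointly_measurable t N f" and s: "0 \<le> s"
  shows "(\<lambda>\<omega>. set_lebesgue_integral lborel {s..t} (\<lambda>u. f u \<omega>)) \<in> borel_measurable N"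
proof -
  interpret L: finite_measure "restrict_space lborel {0..t}" by (rule finite_measure_restrict_lborel)
  have "(\<lambda>p. f (snd p) (fst p)) \<in> borel_measurable (N \<Otimes>\<^sub>M restrict_space borel {0..t})"
    using measurable_compose[OF measurable_pair_swap' f] by (simp add: split_beta')
  then have "(\<lambda>p. indicator {s..t} (snd p) * f (snd p) (fst p)) \<in> borel_measurable (N \<Otimes>\<^sub>M restrict_space borel {0..t})"
    by (intro borel_measurable_times borel_measurable_indicator'[of _ _ snd]) 
       (auto intro!: measurable_compose[OF measurable_snd] measurable_restrict_space1)
  then have "(\<lambda>p. indicator {s..t} (snd p) * f (snd p) (fst p)) \<in> borel_measurable (N \<Otimes>\<^sub>M restrict_space lborel {0..t})"
    by (subst measurable_cong_sets[OF sets_pair_measure_cong refl]) (auto simp: sets_restrict_space)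
  then have "(\<lambda>\<omega>. \<integral>u. indicator {s..t} u * f u \<omega> \<partial>restrict_space lborel {0..t}) \<in> borel_measurable N"
    by (intro L.borel_measurable_lebesgue_integral) (simp add: split_beta')
  moreover have "(\<integral>u. indicator {s..t} u * f u \<omega> \<partial>restrict_space lborel {0..t}) =
      set_lebesgue_integral lborel {s..t} (\<lambda>u. f u \<omega>)" for \<omega>
    using s unfolding set_lebesgue_integral_def
    by (subst integral_restrict_space) (auto intro!: Bochner_Integration.integral_cong split: split_indicator)
  ultimately show ?thesis by simp
qed

lemma time_nn_integral_swap:
  fixes f :: "real \<Rightarrow> 'a \<Rightarrow> ennreal"
  assumes M: "sigma_finite_measure M" and f: "jointly_measurable t M f" and s: "0 \<le> s"
  shows "(\<lambda>\<omega>. \<integral>\<^sup>+u\<in>{s..t}. f u \<omega> \<partial>lborel) \<in> borel_measurable M"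
    and "(\<integral>\<^sup>+\<omega>. (\<integral>\<^sup>+u\<in>{s..t}. f u \<omega> \<partial>lborel) \<partial>M) = (\<integral>\<^sup>+u\<in>{s..t}. (\<integral>\<^sup>+\<omega>. f u \<omega> \<partial>M) \<partial>lborel)"
proof -
  interpret L: finite_measure "restrict_space lborel {0..t}" by (rule finite_measure_restrict_lborel)
  interpret M: sigma_finite_measure M by fact
  interpret P: pair_sigma_finite M "restrict_space lborel {0..t}" ..
  have "(\<lambda>p. f (snd p) (fst p)) \<in> borel_measurable (M \<Otimes>\<^sub>M restrict_space borel {0..t})"
    using measurable_compose[OF measurable_pair_swap' f] by (simp add: split_beta')
  then have "(\<lambda>p. f (snd p) (fst p) * indicator {s..t} (snd p)) \<in> borel_measurable (M \<Otimes>\<^sub>M restrict_space borel {0..t})"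
    by (intro borel_measurable_times_ennreal borel_measurable_indicator'[of _ _ snd]) 
       (auto intro!: measurable_compose[OF measurable_snd] measurable_restrict_space1)
  then have m: "(\<lambda>(\<omega>, u). f u \<omega> * indicator {s..t} u) \<in> borel_measurable (M \<Otimes>\<^sub>M restrict_space lborel {0..t})"
    by (subst measurable_cong_sets[OF sets_pair_measure_cong refl]) (auto simp: split_beta' sets_restrict_space)
  have e: "(\<integral>\<^sup>+u. g u * indicator {s..t} u \<partial>restrict_space lborel {0..t}) = (\<integral>\<^sup>+u\<in>{s..t}. g u \<partial>lborel)" for g
    using s by (subst nn_integral_restrict_space) (auto intro!: nn_integral_cong split: split_indicator)
  show "(\<lambda>\<omega>. \<integral>\<^sup>+u\<in>{s..t}. f u \<omega> \<partial>lborel) \<in> borel_measurable M"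
    using L.borel_measurable_nn_integral[OF m] unfolding e .
  have "(\<integral>\<^sup>+u. (\<integral>\<^sup>+\<omega>. f u \<omega> * indicator {s..t} u \<partial>M) \<partial>restrict_space lborel {0..t})
    = (\<integral>\<^sup>+u. (\<integral>\<^sup>+\<omega>. f u \<omega> \<partial>M) * indicator {s..t} u \<partial>restrict_space lborel {0..t})"
    by (intro nn_integral_cong) (auto split: split_indicator)
  then show "(\<integral>\<^sup>+\<omega>. (\<integral>\<^sup>+u\<in>{s..t}. f u \<omega> \<partial>lborel) \<partial>M) = (\<integral>\<^sup>+u\<in>{s..t}. (\<integral>\<^sup>+\<omega>. f u \<omega> \<partial>M) \<partial>lborel)"
    using P.Fubini'[OF m] unfolding e by simp
qed

lemma bounded_path_set_integrable:
  fixes f :: "real \<Rightarrow> 'a \<Rightarrow> 'b::{banach, second_countable_topology}"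
  assumes "jointly_measurable t N f" "\<omega> \<in> space N" "0 \<le> s"
    and bd: "\<And>u. u \<in> {s..t} \<Longrightarrow> norm (f u \<omega>) \<le> C"
  shows "set_integrable lborel {s..t} (\<lambda>u. f u \<omega>)"
  unfolding set_integrable_def
proof (rule Bochner_Integration.integrable_bound)
  show "integrable lborel (\<lambda>u. indicator {s..t} u *\<^sub>R C)"
    by (intro integrable_scaleR_left integrable_indicator_Icc)
  show "(\<lambda>u. indicator {s..t} u *\<^sub>R f u \<omega>) \<in> borel_measurable lborel"
    using jointly_measurable_indicator_section[OF assms(1-3)] by simp
  show "AE u in lborel. norm (indicator {s..t} u *\<^sub>R f u \<omega>) \<le> norm (indicator {s..t} u *\<^sub>R C)"
    using bd by (auto split: split_indicator intro: order_trans[OF _ abs_ge_self])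
qed

lemma ennreal_set_integral:
  fixes g :: "real \<Rightarrow> real"
  assumes "set_integrable lborel {s..t} g" "\<And>u. u \<in> {s..t} \<Longrightarrow> 0 \<le> g u"
  shows "(\<integral>\<^sup>+u\<in>{s..t}. ennreal (g u) \<partial>lborel) = ennreal (set_lebesgue_integral lborel {s..t} g)"
proof -
  have "ennreal (set_lebesgue_integral lborel {s..t} g) = (\<integral>\<^sup>+u. ennreal (indicator {s..t} u *\<^sub>R g u) \<partial>lborel)"
    unfolding set_lebesgue_integral_def using assms unfolding set_integrable_def
    by (intro nn_integral_eq_integral[symmetric]) (auto split: split_indicator)
  also have "\<dots> = (\<integral>\<^sup>+u\<in>{s..t}. ennreal (g u) \<partial>lborel)"
    by (intro nn_integral_cong) (auto split: split_indicator)
  finally show ?thesis by simp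
qed

text \<open>For a path that is not integrable the integral is 0 by convention and the bound is
  trivial. This permits taking expectations first when only moments of the integrand, and not its
  paths, are under control.\<close>

lemma abs_set_integral_le:
  fixes g :: "real \<Rightarrow> real"
  shows "ennreal \<bar>set_lebesgue_integral lborel {s..t} g\<bar> \<le> (\<integral>\<^sup>+u\<in>{s..t}. ennreal \<bar>g u\<bar> \<partial>lborel)"
proof (cases "set_integrable lborel {s..t} g")
  case True
  then have "ennreal \<bar>set_lebesgue_integral lborel {s..t} g\<bar> \<le> (\<integral>\<^sup>+u. ennreal (norm (indicator {s..t} u *\<^sub>R g u)) \<partial>lborel)"
    unfolding set_lebesgue_integral_def set_integrable_def using integral_norm_bound_ennreal by fastforce
  also have "\<dots> = (\<integral>\<^sup>+u\<in>{s..t}. ennreal \<bar>g u\<bar> \<partial>lborel)"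
    by (intro nn_integral_cong) (auto split: split_indicator)
  finally show ?thesis .
next
  case False
  then show ?thesis
    by (simp add: set_lebesgue_integral_def set_integrable_def not_integrable_integral_eq)
qed

context prob_space begin

text \<open>Tonelli for the absolute value. This is how remainders of order (t - s)^(3/2) arise: an
  integrand of mean size sqrt (t - s), integrated over an interval of length t - s.\<close>

lemma expectation_time_integral_bound:
  fixes f :: "real \<Rightarrow> 'a \<Rightarrow> real"
  assumes f: "jointly_measurable t M f" and st: "0 \<le> s" "s \<le> t" and B: "0 \<le> B"
    and int: "\<And>u. u \<in> {s..t} \<Longrightarrow> integrable M (f u)"
    and bd: "\<And>u. u \<in> {s..t} \<Longrightarrow> expectation (\<lambda>\<omega>. \<bar>f u \<omega>\<bar>) \<le> B"
  shows "integrable M (\<lambda>\<omega>. set_lebesgue_integral lborel {s..t} (\<lambda>u. f u \<omega>))" (is "integrable M ?I")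
    and "expectation (\<lambda>\<omega>. \<bar>set_lebesgue_integral lborel {s..t} (\<lambda>u. f u \<omega>)\<bar>) \<le> B * (t - s)"
proof -
  have m: "?I \<in> borel_measurable M" by (rule time_integral_measurable[OF f st(1)])
  have fa: "jointly_measurable t M (\<lambda>u \<omega>. ennreal \<bar>f u \<omega>\<bar>)"
    by (rule jointly_measurable_compose[OF f]) measurable
  have "(\<integral>\<^sup>+\<omega>. ennreal \<bar>?I \<omega>\<bar> \<partial>M) \<le> (\<integral>\<^sup>+\<omega>. (\<integral>\<^sup>+u\<in>{s..t}. ennreal \<bar>f u \<omega>\<bar> \<partial>lborel) \<partial>M)"
    by (intro nn_integral_mono abs_set_integral_le)
  also have "\<dots> = (\<integral>\<^sup>+u\<in>{s..t}. (\<integral>\<^sup>+\<omega>. ennreal \<bar>f u \<omega>\<bar> \<partial>M) \<partial>lborel)"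
    by (rule time_nn_integral_swap(2)[OF _ fa st(1)]) unfold_locales
  also have "\<dots> \<le> (\<integral>\<^sup>+u\<in>{s..t}. ennreal B \<partial>lborel)"
  proof (intro nn_integral_mono)
    fix u
    show "(\<integral>\<^sup>+\<omega>. ennreal \<bar>f u \<omega>\<bar> \<partial>M) * indicator {s..t} u \<le> ennreal B * indicator {s..t} u"
      using int[of u] bd[of u]
      by (auto simp: nn_integral_eq_integral ennreal_leI split: split_indicator)
  qed
  also have "\<dots> = ennreal (B * (t - s))"
    using st B by (simp add: nn_integral_cmult_indicator ennreal_mult)
  finally have le: "(\<integral>\<^sup>+\<omega>. ennreal \<bar>?I \<omega>\<bar> \<partial>M) \<le> ennreal (B * (t - s))" .
  show int: "integrable M ?I"
    using m le by (intro integrableI_bounded) (auto intro: le_less_trans)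
  have "ennreal (expectation (\<lambda>\<omega>. \<bar>?I \<omega>\<bar>)) = (\<integral>\<^sup>+\<omega>. ennreal \<bar>?I \<omega>\<bar> \<partial>M)"
    using int by (intro nn_integral_eq_integral[symmetric]) auto
  then show "expectation (\<lambda>\<omega>. \<bar>?I \<omega>\<bar>) \<le> B * (t - s)"
    using le B st by (metis ennreal_le_iff mult_nonneg_nonneg diff_ge_0_iff_ge)
qed

text \<open>Translates between the \<open>ennreal\<close> double integrals, in which convergence of
  simple integrands is phrased, and expectations of real time integrals, in which the isometry is
  phrased.\<close>

lemma nn_integral_time_bounded:
  fixes f :: "real \<Rightarrow> 'a \<Rightarrow> real"
  assumes f: "jointly_measurable t M f" and st: "0 \<le> s" "s \<le> t"
    and bd: "\<And>u \<omega>. u \<in> {s..t} \<Longrightarrow> \<omega> \<in> space M \<Longrightarrow> 0 \<le> f u \<omega> \<and> f u \<omega> \<le> C"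
  shows "(\<integral>\<^sup>+\<omega>. (\<integral>\<^sup>+u\<in>{s..t}. ennreal (f u \<omega>) \<partial>lborel) \<partial>M) =
     ennreal (expectation (\<lambda>\<omega>. set_lebesgue_integral lborel {s..t} (\<lambda>u. f u \<omega>)))" (is "?l = ennreal (expectation ?I)")
    and "integrable M (\<lambda>\<omega>. set_lebesgue_integral lborel {s..t} (\<lambda>u. f u \<omega>))"
    and "\<And>\<omega>. \<omega> \<in> space M \<Longrightarrow> 0 \<le> set_lebesgue_integral lborel {s..t} (\<lambda>u. f u \<omega>) \<and>
       set_lebesgue_integral lborel {s..t} (\<lambda>u. f u \<omega>) \<le> C * (t - s)"
proof -
  have path: "set_integrable lborel {s..t} (\<lambda>u. f u \<omega>)" if "\<omega> \<in> space M" for \<omega>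
    by (rule bounded_path_set_integrable[OF f that st(1), of C]) (use bd that in auto)
  show b: "0 \<le> ?I \<omega> \<and> ?I \<omega> \<le> C * (t - s)" if "\<omega> \<in> space M" for \<omega>
  proof
    show "0 \<le> ?I \<omega>" unfolding set_lebesgue_integral_def using bd that
      by (intro integral_nonneg_AE) (auto split: split_indicator)
    have "?I \<omega> \<le> set_lebesgue_integral lborel {s..t} (\<lambda>u. C)"
      using bd that by (intro set_integral_mono path) (auto simp: set_integrable_def intro: integrable_indicator_Icc)
    then show "?I \<omega> \<le> C * (t - s)" using st by (simp add: set_lebesgue_integral_def mult.commute)
  qed
  show int: "integrable M ?I"
    by (rule integrable_const_bound[where B="C * (t - s)"])
       (use b time_integral_measurable[OF f st(1)] in \<open>auto intro!: AE_I2\<close>)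
  have "?l = (\<integral>\<^sup>+\<omega>. ennreal (?I \<omega>) \<partial>M)"
    using bd by (intro nn_integral_cong ennreal_set_integral path) auto
  also have "\<dots> = ennreal (expectation ?I)"
    using b int by (intro nn_integral_eq_integral) (auto intro!: AE_I2)
  finally show "?l = ennreal (expectation ?I)" .
qed

end

section \<open>Stochastic sums with bounded coefficients\<close>

context brownian_space begin

text \<open>The scalar counterpart of \<open>simple_ito_integral\<close>:
  \<open>v \<bullet> (A *v w)\<close> equals \<open>(v v* A) \<bullet> w\<close>, so one component
  of a matrix-valued sum has vector coefficients \<open>x i\<close>, namely the rows in direction
  \<open>v\<close>.\<close>

definition stoch_sum :: "(nat \<Rightarrow> real) \<Rightarrow> (nat \<Rightarrow> 'a \<Rightarrow> real^'d) \<Rightarrow> nat \<Rightarrow> 'a \<Rightarrow> real"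
  where "stoch_sum \<sigma> x n \<omega> = (\<Sum>i<n. x i \<omega> \<bullet> (W (\<sigma> (Suc i)) \<omega> - W (\<sigma> i) \<omega>))"

lemma stoch_sum_Suc: "stoch_sum \<sigma> x (Suc n) \<omega> = stoch_sum \<sigma> x n \<omega> + x n \<omega> \<bullet> (W (\<sigma> (Suc n)) \<omega> - W (\<sigma> n) \<omega>)"
  by (simp add: stoch_sum_def)

lemma stoch_sum_measurable:
  assumes \<sigma>: "0 \<le> \<sigma> 0" "mono \<sigma>" and x: "\<And>i. i < n \<Longrightarrow> x i \<in> borel_measurable (F (\<sigma> i))"
  shows "stoch_sum \<sigma> x n \<in> borel_measurable (F (\<sigma> n))"
  unfolding stoch_sum_def[abs_def]
proof (intro borel_measurable_sum borel_measurable_inner borel_measurable_diff)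
  fix i assume "i \<in> {..<n}"
  then have i: "i < n" by simp
  have le: "0 \<le> \<sigma> i" "0 \<le> \<sigma> (Suc i)" "\<sigma> i \<le> \<sigma> n" "\<sigma> (Suc i) \<le> \<sigma> n"
    using \<sigma> i monoD[OF \<sigma>(2), of 0] monoD[OF \<sigma>(2), of _ n] by (auto intro: order_trans)
  show "x i \<in> borel_measurable (F (\<sigma> n))" using measurable_F_mono[OF x[OF i]] le by auto
  show "W (\<sigma> (Suc i)) \<in> borel_measurable (F (\<sigma> n))" "W (\<sigma> i) \<in> borel_measurable (F (\<sigma> n))"
    using W_measurable_F le by auto
qed

text \<open>Induction on the number of terms: the new increment is independent of the sum
  \<open>?J\<close> so far, so the term with \<open>?J \<omega> ^ 3\<close> has mean 0 and the mixed
  quadratic term is controlled by the second moment carried along in the induction. The constant 9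
  is 3, from the inequality \<open>pw\<close>, times 3, from the Gaussian fourth moment; the mixed
  term 8 fits below the 2 * 9 that the square of a sum provides.\<close>

lemma stoch_sum_fourth_moment:
  assumes \<sigma>: "0 \<le> \<sigma> 0" "mono \<sigma>" and x: "\<And>i. i < n \<Longrightarrow> x i \<in> borel_measurable (F (\<sigma> i))"
    and K: "\<And>i \<omega>. i < n \<Longrightarrow> \<omega> \<in> space M \<Longrightarrow> norm (x i \<omega>) \<le> K"
  shows "integrable M (\<lambda>\<omega>. stoch_sum \<sigma> x n \<omega> ^ 4)"
    and "expectation (\<lambda>\<omega>. (stoch_sum \<sigma> x n \<omega>)\<^sup>2) \<le> K\<^sup>2 * (\<sigma> n - \<sigma> 0)"
    and "expectation (\<lambda>\<omega>. stoch_sum \<sigma> x n \<omega> ^ 4) \<le> 9 * (real CARD('d))\<^sup>2 * K ^ 4 * (\<sigma> n - \<sigma> 0)\<^sup>2"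
proof -
  let ?c = "9 * (real CARD('d))\<^sup>2"
  have "integrable M (\<lambda>\<omega>. stoch_sum \<sigma> x m \<omega> ^ 4) \<and>
     expectation (\<lambda>\<omega>. (stoch_sum \<sigma> x m \<omega>)\<^sup>2) \<le> K\<^sup>2 * (\<sigma> m - \<sigma> 0) \<and>
     expectation (\<lambda>\<omega>. stoch_sum \<sigma> x m \<omega> ^ 4) \<le> ?c * K ^ 4 * (\<sigma> m - \<sigma> 0)\<^sup>2" if "m \<le> n" for m
    using that
  proof (induction m)
    case 0
    then show ?case by (simp add: stoch_sum_def)
  next
    case (Suc m)
    then have m: "m < n" by simp
    let ?J = "stoch_sum \<sigma> x m" and ?p = "\<lambda>\<omega>. x m \<omega> \<bullet> (W (\<sigma> (Suc m)) \<omega> - W (\<sigma> m) \<omega>)"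
    let ?t = "\<sigma> m - \<sigma> 0" and ?d = "\<sigma> (Suc m) - \<sigma> m"
    have IH: "integrable M (\<lambda>\<omega>. ?J \<omega> ^ 4)" "expectation (\<lambda>\<omega>. (?J \<omega>)\<^sup>2) \<le> K\<^sup>2 * ?t"
      "expectation (\<lambda>\<omega>. ?J \<omega> ^ 4) \<le> ?c * K ^ 4 * ?t\<^sup>2"
      using Suc by auto
    have le: "0 \<le> \<sigma> m" "\<sigma> m \<le> \<sigma> (Suc m)" "\<sigma> 0 \<le> \<sigma> m"
      using \<sigma> by (auto simp: mono_def intro: order_trans)
    have Jm: "?J \<in> borel_measurable (F (\<sigma> m))"
      using m by (intro stoch_sum_measurable \<sigma> x) auto
    have JM: "?J \<in> borel_measurable M" using measurable_F_M[OF Jm] .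
    have Jk: "integrable M (\<lambda>\<omega>. ?J \<omega> ^ k)" if "k \<le> 4" for k
      by (rule integrable_power_le_4[OF JM IH(1) that])
    have Jkm: "(\<lambda>\<omega>. ?J \<omega> ^ k) \<in> borel_measurable (F (\<sigma> m))" for k
      using Jm by measurable
    note pt = past_times_inner_increment[OF le(1,2) Jkm Jk x[OF m] K[OF m]]
    have xM: "x m \<in> borel_measurable M" using measurable_F_M[OF x[OF m]] .
    note p4 = inner_increment_fourth_moment[OF le(1,2) xM K[OF m]]
    have pM: "?p \<in> borel_measurable M"
      using xM increment_measurable[OF le(1,2)] by measurable
    note pk = integrable_power_le_4[OF pM p4(1)]
    have int4: "integrable M (\<lambda>\<omega>. stoch_sum \<sigma> x (Suc m) \<omega> ^ 4)"
    proof (rule Bochner_Integration.integrable_bound)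
      show "integrable M (\<lambda>\<omega>. 8 * ?J \<omega> ^ 4 + 8 * ?p \<omega> ^ 4)" using IH p4 by simp
      show "(\<lambda>\<omega>. stoch_sum \<sigma> x (Suc m) \<omega> ^ 4) \<in> borel_measurable M"
        unfolding stoch_sum_Suc using JM pM by measurable
      show "AE \<omega> in M. norm (stoch_sum \<sigma> x (Suc m) \<omega> ^ 4) \<le> norm (8 * ?J \<omega> ^ 4 + 8 * ?p \<omega> ^ 4)"
        unfolding stoch_sum_Suc
        by (intro AE_I2) (use sum_fourth_power_le in \<open>auto simp: zero_le_even_power intro: order_trans[OF _ abs_ge_self]\<close>)
    qed
    have x2: "expectation (\<lambda>\<omega>. ?J \<omega> ^ k * (norm (x m \<omega>))\<^sup>2) \<le> K\<^sup>2 * expectation (\<lambda>\<omega>. ?J \<omega> ^ k)" if "k \<le> 4" "even k" for k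
    proof -
      have "expectation (\<lambda>\<omega>. ?J \<omega> ^ k * (norm (x m \<omega>))\<^sup>2) \<le> expectation (\<lambda>\<omega>. ?J \<omega> ^ k * K\<^sup>2)"
        using that pt(4)[of k] Jk[of k] K[OF m]
        by (intro integral_mono mult_left_mono power_mono) (auto simp: zero_le_even_power)
      then show ?thesis by (simp add: mult.commute)
    qed
    have "expectation (\<lambda>\<omega>. (stoch_sum \<sigma> x (Suc m) \<omega>)\<^sup>2)
       = expectation (\<lambda>\<omega>. ?J \<omega> ^ 2 + 2 * (?J \<omega> ^ 1 * ?p \<omega>) + ?J \<omega> ^ 0 * (?p \<omega>)\<^sup>2)"
      unfolding stoch_sum_Suc by (intro Bochner_Integration.integral_cong) (auto simp: power2_eq_square algebra_simps)
    also have "\<dots> = expectation (\<lambda>\<omega>. ?J \<omega> ^ 2) + ?d * expectation (\<lambda>\<omega>. ?J \<omega> ^ 0 * (norm (x m \<omega>))\<^sup>2)"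
      using pt(1,2)[of 1] pt(3,5)[of 0] Jk[of 2] by (simp add: Bochner_Integration.integral_add)
    also have "\<dots> \<le> K\<^sup>2 * ?t + ?d * (K\<^sup>2 * expectation (\<lambda>\<omega>. ?J \<omega> ^ 0))"
      using le by (intro add_mono mult_left_mono x2 IH) auto
    also have "\<dots> = K\<^sup>2 * (\<sigma> (Suc m) - \<sigma> 0)" by (simp add: algebra_simps prob_space)
    finally have sq: "expectation (\<lambda>\<omega>. (stoch_sum \<sigma> x (Suc m) \<omega>)\<^sup>2) \<le> K\<^sup>2 * (\<sigma> (Suc m) - \<sigma> 0)" .
    \<comment> \<open>The exact expansion contains a term \<open>a * b ^ 3\<close>. It is absorbed
      by the nonnegative square \<open>2 * (b * (a - b))\<^sup>2\<close>, so that the increment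
      \<open>b\<close> meets the past only in first and second powers.\<close>
    have pw: "(a + b) ^ 4 \<le> a ^ 4 + 4 * (a ^ 3 * b) + 8 * (a ^ 2 * b\<^sup>2) + 3 * b ^ 4" for a b :: real
    proof -
      have "0 \<le> 2 * (b * (a - b))\<^sup>2" by simp
      also have "\<dots> = a ^ 4 + 4 * (a ^ 3 * b) + 8 * (a ^ 2 * b\<^sup>2) + 3 * b ^ 4 - (a + b) ^ 4"
        by (simp add: power4_eq_xxxx power3_eq_cube power2_eq_square algebra_simps)
      finally show ?thesis by simp
    qed
    have "expectation (\<lambda>\<omega>. stoch_sum \<sigma> x (Suc m) \<omega> ^ 4)
       \<le> expectation (\<lambda>\<omega>. ?J \<omega> ^ 4 + 4 * (?J \<omega> ^ 3 * ?p \<omega>) + 8 * (?J \<omega> ^ 2 * (?p \<omega>)\<^sup>2) + 3 * ?p \<omega> ^ 4)"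
      using int4 IH(1) pt(1)[of 3] pt(3)[of 2] p4(1)
      unfolding stoch_sum_Suc by (intro integral_mono pw) auto
    also have "\<dots> = expectation (\<lambda>\<omega>. ?J \<omega> ^ 4) + 8 * (?d * expectation (\<lambda>\<omega>. ?J \<omega> ^ 2 * (norm (x m \<omega>))\<^sup>2))
         + 3 * expectation (\<lambda>\<omega>. ?p \<omega> ^ 4)"
      using IH(1) pt(1,2)[of 3] pt(3,5)[of 2] p4(1) by (simp add: Bochner_Integration.integral_add)
    also have "\<dots> \<le> ?c * K ^ 4 * ?t\<^sup>2 + 8 * (?d * (K\<^sup>2 * (K\<^sup>2 * ?t))) + 3 * (3 * (real CARD('d))\<^sup>2 * K ^ 4 * ?d\<^sup>2)"
      using le by (intro add_mono mult_left_mono IH p4 order_trans[OF x2] order_refl) auto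
    also have "\<dots> \<le> ?c * K ^ 4 * (\<sigma> (Suc m) - \<sigma> 0)\<^sup>2"
    proof -
      have "1 \<le> (real CARD('d))\<^sup>2" by (intro one_le_power) (simp add: Suc_leI)
      then have "8 \<le> 2 * ?c" by linarith
      then have "8 * (?d * K ^ 4 * ?t) \<le> (2 * ?c) * (?d * K ^ 4 * ?t)"
        using le by (intro mult_right_mono mult_nonneg_nonneg) auto
      moreover have "c * k * (t' + d)\<^sup>2 = c * k * t'\<^sup>2 + 2 * c * (d * k * t') + c * k * d\<^sup>2" for c k t' d :: real
        by (simp add: power2_eq_square algebra_simps)
      from this[of ?c "K ^ 4" ?t ?d]
      have "?c * K ^ 4 * (\<sigma> (Suc m) - \<sigma> 0)\<^sup>2 = ?c * K ^ 4 * ?t\<^sup>2 + 2 * ?c * (?d * K ^ 4 * ?t) + ?c * K ^ 4 * ?d\<^sup>2"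
        by simp
      moreover have "8 * (?d * (K\<^sup>2 * (K\<^sup>2 * ?t))) = 8 * (?d * K ^ 4 * ?t)"
        by (simp add: power2_eq_square power4_eq_xxxx)
      ultimately show ?thesis by linarith
    qed
    finally show ?case using int4 sq by blast
  qed
  then show "integrable M (\<lambda>\<omega>. stoch_sum \<sigma> x n \<omega> ^ 4)"
    and "expectation (\<lambda>\<omega>. (stoch_sum \<sigma> x n \<omega>)\<^sup>2) \<le> K\<^sup>2 * (\<sigma> n - \<sigma> 0)"
    and "expectation (\<lambda>\<omega>. stoch_sum \<sigma> x n \<omega> ^ 4) \<le> 9 * (real CARD('d))\<^sup>2 * K ^ 4 * (\<sigma> n - \<sigma> 0)\<^sup>2"
    by auto
qed

text \<open>The discrete Ito isometry, conditionally on the starting time: the bounded weight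
  \<open>G\<close> is known at \<open>\<sigma> 0\<close>, and mixed terms vanish because
  \<open>G\<close> times the sum so far is known before the next increment.\<close>

lemma stoch_sum_isometry:
  fixes G :: "'a \<Rightarrow> real"
  assumes \<sigma>: "0 \<le> \<sigma> 0" "mono \<sigma>" and x: "\<And>i. i < n \<Longrightarrow> x i \<in> borel_measurable (F (\<sigma> i))"
    and K: "\<And>i \<omega>. i < n \<Longrightarrow> \<omega> \<in> space M \<Longrightarrow> norm (x i \<omega>) \<le> K"
    and G: "G \<in> borel_measurable (F (\<sigma> 0))" "\<And>\<omega>. \<omega> \<in> space M \<Longrightarrow> \<bar>G \<omega>\<bar> \<le> B"
  shows "integrable M (\<lambda>\<omega>. G \<omega> * stoch_sum \<sigma> x n \<omega>)"
    and "expectation (\<lambda>\<omega>. G \<omega> * stoch_sum \<sigma> x n \<omega>) = 0"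
    and "integrable M (\<lambda>\<omega>. G \<omega> * (stoch_sum \<sigma> x n \<omega>)\<^sup>2)"
    and "expectation (\<lambda>\<omega>. G \<omega> * (stoch_sum \<sigma> x n \<omega>)\<^sup>2) =
      expectation (\<lambda>\<omega>. G \<omega> * (\<Sum>i<n. (\<sigma> (Suc i) - \<sigma> i) * (norm (x i \<omega>))\<^sup>2))"
proof -
  have GM: "G \<in> borel_measurable M" using measurable_F_M[OF G(1)] .
  have bd: "integrable M (\<lambda>\<omega>. G \<omega> * f \<omega>)" if "integrable M f" for f :: "'a \<Rightarrow> real"
  proof (rule Bochner_Integration.integrable_bound)
    show "integrable M (\<lambda>\<omega>. B * f \<omega>)" using that by simp
    show "(\<lambda>\<omega>. G \<omega> * f \<omega>) \<in> borel_measurable M" using GM that by measurable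
    show "AE \<omega> in M. norm (G \<omega> * f \<omega>) \<le> norm (B * f \<omega>)"
      using G(2) by (intro AE_I2) (force simp: abs_mult intro!: mult_right_mono)
  qed
  have "expectation (\<lambda>\<omega>. G \<omega> * stoch_sum \<sigma> x m \<omega>) = 0 \<and>
     expectation (\<lambda>\<omega>. G \<omega> * (stoch_sum \<sigma> x m \<omega>)\<^sup>2) =
      expectation (\<lambda>\<omega>. G \<omega> * (\<Sum>i<m. (\<sigma> (Suc i) - \<sigma> i) * (norm (x i \<omega>))\<^sup>2))" if "m \<le> n" for m
    using that
  proof (induction m)
    case 0
    then show ?case by (simp add: stoch_sum_def)
  next
    case (Suc m)
    then have m: "m < n" by simp
    let ?J = "stoch_sum \<sigma> x m" and ?p = "\<lambda>\<omega>. x m \<omega> \<bullet> (W (\<sigma> (Suc m)) \<omega> - W (\<sigma> m) \<omega>)"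
    let ?S = "\<lambda>\<omega>. \<Sum>i<m. (\<sigma> (Suc i) - \<sigma> i) * (norm (x i \<omega>))\<^sup>2"
    have le: "0 \<le> \<sigma> m" "\<sigma> m \<le> \<sigma> (Suc m)" "\<sigma> 0 \<le> \<sigma> m"
      using \<sigma> by (auto simp: mono_def intro: order_trans)
    have Jm: "?J \<in> borel_measurable (F (\<sigma> m))"
      using m by (intro stoch_sum_measurable \<sigma> x) auto
    have J4: "integrable M (\<lambda>\<omega>. ?J \<omega> ^ 4)"
      using m by (intro stoch_sum_fourth_moment(1)[where K=K] \<sigma> x K) auto
    have Jk: "integrable M (\<lambda>\<omega>. ?J \<omega> ^ k)" if "k \<le> 4" for k
      by (rule integrable_power_le_4[OF measurable_F_M[OF Jm] J4 that])
    have Gm: "G \<in> borel_measurable (F (\<sigma> m))" by (rule measurable_F_mono[OF G(1) le(3)])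
    have GJ: "integrable M (\<lambda>\<omega>. G \<omega> * ?J \<omega> ^ k)" if "k \<le> 4" for k by (rule bd[OF Jk[OF that]])
    have GJm: "(\<lambda>\<omega>. G \<omega> * ?J \<omega> ^ k) \<in> borel_measurable (F (\<sigma> m))" for k
      using Gm Jm by measurable
    note pt = past_times_inner_increment[OF le(1,2) GJm GJ x[OF m] K[OF m]]
    have "integrable M (\<lambda>\<omega>. (\<sigma> (Suc i) - \<sigma> i) * (norm (x i \<omega>))\<^sup>2)" if "i < m" for i
      using K[of i] that m measurable_F_M[OF x[of i]]
      by (intro integrable_mult_right integrable_const_bound[where B="K\<^sup>2"]) (auto intro!: AE_I2 power_mono)
    then have S: "integrable M (\<lambda>\<omega>. G \<omega> * ?S \<omega>)"
      by (intro bd Bochner_Integration.integrable_sum) auto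
    have "expectation (\<lambda>\<omega>. G \<omega> * stoch_sum \<sigma> x (Suc m) \<omega>) =
       expectation (\<lambda>\<omega>. G \<omega> * ?J \<omega> ^ 1 + G \<omega> * ?J \<omega> ^ 0 * ?p \<omega>)"
      unfolding stoch_sum_Suc by (simp add: algebra_simps)
    also have "\<dots> = 0"
      using Suc GJ[of 1] pt(1,2)[of 0] by simp
    finally have 1: "expectation (\<lambda>\<omega>. G \<omega> * stoch_sum \<sigma> x (Suc m) \<omega>) = 0" .
    have "expectation (\<lambda>\<omega>. G \<omega> * (stoch_sum \<sigma> x (Suc m) \<omega>)\<^sup>2) =
       expectation (\<lambda>\<omega>. G \<omega> * ?J \<omega> ^ 2 + 2 * (G \<omega> * ?J \<omega> ^ 1 * ?p \<omega>) + G \<omega> * ?J \<omega> ^ 0 * (?p \<omega>)\<^sup>2)"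
      unfolding stoch_sum_Suc by (intro Bochner_Integration.integral_cong) (auto simp: power2_eq_square algebra_simps)
    also have "\<dots> = expectation (\<lambda>\<omega>. G \<omega> * ?S \<omega>) + (\<sigma> (Suc m) - \<sigma> m) * expectation (\<lambda>\<omega>. G \<omega> * (norm (x m \<omega>))\<^sup>2)"
      using Suc GJ[of 2] pt(1,2)[of 1] pt(3,5)[of 0] by simp
    also have "\<dots> = expectation (\<lambda>\<omega>. G \<omega> * ?S \<omega> + (\<sigma> (Suc m) - \<sigma> m) * (G \<omega> * (norm (x m \<omega>))\<^sup>2))"
      using S pt(4)[of 0] by simp
    also have "\<dots> = expectation (\<lambda>\<omega>. G \<omega> * (\<Sum>i<Suc m. (\<sigma> (Suc i) - \<sigma> i) * (norm (x i \<omega>))\<^sup>2))"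
      by (simp add: algebra_simps)
    finally show ?case using 1 by simp
  qed
  then show "expectation (\<lambda>\<omega>. G \<omega> * stoch_sum \<sigma> x n \<omega>) = 0"
    and "expectation (\<lambda>\<omega>. G \<omega> * (stoch_sum \<sigma> x n \<omega>)\<^sup>2) =
      expectation (\<lambda>\<omega>. G \<omega> * (\<Sum>i<n. (\<sigma> (Suc i) - \<sigma> i) * (norm (x i \<omega>))\<^sup>2))"
    by auto
  have "stoch_sum \<sigma> x n \<in> borel_measurable M"
    using stoch_sum_measurable[OF \<sigma> x] measurable_F_M by blast
  note int = integrable_power_le_4[OF this stoch_sum_fourth_moment(1)[OF \<sigma> x K]]
  show "integrable M (\<lambda>\<omega>. G \<omega> * stoch_sum \<sigma> x n \<omega>)"
    using bd[OF int[of 1]] by simp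
  show "integrable M (\<lambda>\<omega>. G \<omega> * (stoch_sum \<sigma> x n \<omega>)\<^sup>2)"
    using bd[OF int[of 2]] by simp
qed

end

section \<open>Approximation of Ito integrals by stochastic sums\<close>

text \<open>Here \<open>e k\<close> is a squared error and the bound comes from Young's inequality
  with a free parameter \<open>\<eta>\<close>, which may therefore be chosen depending on
  \<open>k\<close>.\<close>

lemma tendsto_if_young_bounded:
  fixes a e :: "nat \<Rightarrow> real"
  assumes e: "e \<longlonglongrightarrow> 0" "\<And>k. 0 \<le> e k"
    and bd: "\<forall>\<^sub>F k in sequentially. \<forall>\<eta>>0. \<bar>a k - l\<bar> \<le> C * (\<eta> + e k + e k / \<eta>)"
  shows "a \<longlonglongrightarrow> l"
proof -
  \<comment> \<open>The root balances \<open>\<eta>\<close> against \<open>e k / \<eta>\<close>; the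
    summand \<open>1 / Suc k\<close> keeps the parameter positive where \<open>e k\<close> is
    0.\<close>
  define \<eta> where "\<eta> k = sqrt (e k) + 1 / real (Suc k)" for k
  have pos: "0 < \<eta> k" for k
    unfolding \<eta>_def using e(2)[of k] by (intro add_nonneg_pos) auto
  have div: "e k / \<eta> k \<le> sqrt (e k)" for k
  proof -
    have "e k = sqrt (e k) * sqrt (e k)" using e(2)[of k] by simp
    also have "\<dots> \<le> sqrt (e k) * \<eta> k" unfolding \<eta>_def using e(2)[of k] by (intro mult_left_mono) auto
    finally show ?thesis using pos[of k] by (simp add: field_simps)
  qed
  have s: "(\<lambda>k. sqrt (e k)) \<longlonglongrightarrow> 0" using tendsto_real_sqrt[OF e(1)] by simp
  have "(\<lambda>k. \<bar>C\<bar> * ((sqrt (e k) + 1 / real (Suc k)) + e k + sqrt (e k))) \<longlonglongrightarrow> \<bar>C\<bar> * ((0 + 0) + 0 + 0)"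
    by (intro tendsto_intros s e(1) LIMSEQ_Suc[OF lim_1_over_n])
  then have lim: "(\<lambda>k. \<bar>C\<bar> * (\<eta> k + e k + sqrt (e k))) \<longlonglongrightarrow> 0" by (simp add: \<eta>_def)
  have "(\<lambda>k. a k - l) \<longlonglongrightarrow> 0"
  proof (rule Lim_null_comparison[OF _ lim])
    show "\<forall>\<^sub>F k in sequentially. norm (a k - l) \<le> \<bar>C\<bar> * (\<eta> k + e k + sqrt (e k))"
      using bd
    proof eventually_elim
      case (elim k)
      then have "\<bar>a k - l\<bar> \<le> C * (\<eta> k + e k + e k / \<eta> k)" using pos by blast
      also have "\<dots> \<le> \<bar>C\<bar> * (\<eta> k + e k + sqrt (e k))"
        using div[of k] pos[of k] e(2)[of k] by (intro mult_mono) auto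
      finally show ?case by simp
    qed
  qed
  then show ?thesis by (simp add: LIM_zero_iff)
qed

context prob_space begin

text \<open>Convergence in L2 gives an almost surely convergent subsequence, along which Fatou
  carries the fourth moment bound to the limit. Weighted first and second moments converge along the
  whole sequence, by Young's inequality applied to X - Z and to the difference of squares.\<close>

lemma L2_limit_fourth_moment:
  fixes X :: "nat \<Rightarrow> 'a \<Rightarrow> real" and Z :: "'a \<Rightarrow> real"
  assumes X: "\<And>k. X k \<in> borel_measurable M" "\<And>k. integrable M (\<lambda>\<omega>. X k \<omega> ^ 4)"
      "\<And>k. expectation (\<lambda>\<omega>. X k \<omega> ^ 4) \<le> C"
    and Z: "Z \<in> borel_measurable M"
    and lim: "(\<lambda>k. \<integral>\<^sup>+\<omega>. ennreal ((X k \<omega> - Z \<omega>)\<^sup>2) \<partial>M) \<longlonglongrightarrow> 0"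
  shows "integrable M (\<lambda>\<omega>. Z \<omega> ^ 4)" "expectation (\<lambda>\<omega>. Z \<omega> ^ 4) \<le> C"
    and "\<And>(G :: 'a \<Rightarrow> real) B. G \<in> borel_measurable M \<Longrightarrow> (\<And>\<omega>. \<omega> \<in> space M \<Longrightarrow> \<bar>G \<omega>\<bar> \<le> B) \<Longrightarrow>
      (\<lambda>k. expectation (\<lambda>\<omega>. G \<omega> * X k \<omega>)) \<longlonglongrightarrow> expectation (\<lambda>\<omega>. G \<omega> * Z \<omega>)"
    and "\<And>(G :: 'a \<Rightarrow> real) B. G \<in> borel_measurable M \<Longrightarrow> (\<And>\<omega>. \<omega> \<in> space M \<Longrightarrow> \<bar>G \<omega>\<bar> \<le> B) \<Longrightarrow>
      (\<lambda>k. expectation (\<lambda>\<omega>. G \<omega> * (X k \<omega>)\<^sup>2)) \<longlonglongrightarrow> expectation (\<lambda>\<omega>. G \<omega> * (Z \<omega>)\<^sup>2)"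
proof -
  let ?d = "\<lambda>k \<omega>. (X k \<omega> - Z \<omega>)\<^sup>2"
  define e where "e k = expectation (?d k)" for k
  have dm: "?d k \<in> borel_measurable M" for k using X Z by measurable
  have e_eq: "e k = enn2real (\<integral>\<^sup>+\<omega>. ennreal (?d k \<omega>) \<partial>M)" for k
    unfolding e_def using dm by (intro integral_eq_nn_integral) auto
  have e0: "0 \<le> e k" for k unfolding e_def by (intro integral_nonneg_AE) auto
  have e_lim: "e \<longlonglongrightarrow> 0"
    unfolding e_eq by (rule tendsto_enn2real) (use lim in auto)
  have ev: "\<forall>\<^sub>F k in sequentially. (\<integral>\<^sup>+\<omega>. ennreal (?d k \<omega>) \<partial>M) < 1"
    using lim by (rule order_tendstoD) simp
  have int_ev: "\<forall>\<^sub>F k in sequentially. integrable M (?d k)"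
    using ev
  proof eventually_elim
    case (elim k)
    then show ?case using dm[of k] by (intro integrableI_nonneg) (auto intro: less_trans)
  qed
  \<comment> \<open>Finitely many of the squared differences may have infinite integral; the shift
    by \<open>N\<close> discards them before the subsequence is taken.\<close>
  then obtain N where N: "\<And>k. N \<le> k \<Longrightarrow> integrable M (?d k)"
    unfolding eventually_sequentially by auto
  have "(\<lambda>k. expectation (\<lambda>\<omega>. norm (?d (k + N) \<omega>))) \<longlonglongrightarrow> 0"
    using LIMSEQ_ignore_initial_segment[OF e_lim, of N] by (simp add: e_def)
  from tendsto_L1_AE_subseq[OF N this] obtain r where r: "strict_mono r"
    "AE \<omega> in M. (\<lambda>n. ?d (r n + N) \<omega>) \<longlonglongrightarrow> 0" by auto
  have AEl: "AE \<omega> in M. (\<lambda>n. X (r n + N) \<omega>) \<longlonglongrightarrow> Z \<omega>"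
    using r(2)
  proof eventually_elim
    case (elim \<omega>)
    then have "(\<lambda>n. sqrt (?d (r n + N) \<omega>)) \<longlonglongrightarrow> sqrt 0" by (rule tendsto_real_sqrt)
    then have "(\<lambda>n. X (r n + N) \<omega> - Z \<omega>) \<longlonglongrightarrow> 0" by (simp add: tendsto_rabs_zero_iff)
    then show ?case by (simp add: LIM_zero_iff)
  qed
  have C0: "0 \<le> C" using X(3)[of 0] by (rule order_trans[rotated]) (auto intro!: integral_nonneg_AE simp: zero_le_even_power)
  have Z4: "(\<integral>\<^sup>+\<omega>. ennreal (Z \<omega> ^ 4) \<partial>M) \<le> ennreal C"
  proof -
    have "(\<integral>\<^sup>+\<omega>. ennreal (Z \<omega> ^ 4) \<partial>M) = (\<integral>\<^sup>+\<omega>. liminf (\<lambda>n. ennreal (X (r n + N) \<omega> ^ 4)) \<partial>M)"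
    proof (rule nn_integral_cong_AE)
      show "AE \<omega> in M. ennreal (Z \<omega> ^ 4) = liminf (\<lambda>n. ennreal (X (r n + N) \<omega> ^ 4))"
        using AEl
      proof eventually_elim
        case (elim \<omega>)
        then have "(\<lambda>n. ennreal (X (r n + N) \<omega> ^ 4)) \<longlonglongrightarrow> ennreal (Z \<omega> ^ 4)"
          by (intro tendsto_ennrealI tendsto_power)
        then show ?case by (intro lim_imp_Liminf[symmetric]) auto
      qed
    qed
    also have "\<dots> \<le> liminf (\<lambda>n. \<integral>\<^sup>+\<omega>. ennreal (X (r n + N) \<omega> ^ 4) \<partial>M)"
      using X by (intro nn_integral_liminf) measurable
    also have "\<dots> \<le> ennreal C"
    proof (rule Liminf_le)
      show "\<forall>\<^sub>F n in sequentially. (\<integral>\<^sup>+\<omega>. ennreal (X (r n + N) \<omega> ^ 4) \<partial>M) \<le> ennreal C"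
        using X(2,3) by (intro always_eventually allI) (simp add: nn_integral_eq_integral zero_le_even_power ennreal_leI)
    qed simp
    finally show ?thesis .
  qed
  show Z4i: "integrable M (\<lambda>\<omega>. Z \<omega> ^ 4)"
    using Z Z4 by (intro integrableI_nonneg) (auto simp: zero_le_even_power intro: le_less_trans)
  then have "ennreal (expectation (\<lambda>\<omega>. Z \<omega> ^ 4)) = (\<integral>\<^sup>+\<omega>. ennreal (Z \<omega> ^ 4) \<partial>M)"
    by (intro nn_integral_eq_integral[symmetric]) (auto simp: zero_le_even_power)
  then show "expectation (\<lambda>\<omega>. Z \<omega> ^ 4) \<le> C" using Z4 ennreal_le_iff[OF C0] by metis
  have Zk: "integrable M (\<lambda>\<omega>. Z \<omega> ^ k)" if "k \<le> 4" for k by (rule integrable_power_le_4[OF Z Z4i that])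
  have Xk: "integrable M (\<lambda>\<omega>. X i \<omega> ^ k)" if "k \<le> 4" for i k by (rule integrable_power_le_4[OF X(1,2) that])
  fix G :: "'a \<Rightarrow> real" and B assume G: "G \<in> borel_measurable M" "\<And>\<omega>. \<omega> \<in> space M \<Longrightarrow> \<bar>G \<omega>\<bar> \<le> B"
  have B0: "0 \<le> B" using G(2) not_empty by (meson abs_ge_zero ex_in_conv order_trans)
  have bd: "integrable M (\<lambda>\<omega>. G \<omega> * f \<omega>)" if "integrable M f" for f :: "'a \<Rightarrow> real"
  proof (rule Bochner_Integration.integrable_bound)
    show "integrable M (\<lambda>\<omega>. B * f \<omega>)" using that by simp
    show "(\<lambda>\<omega>. G \<omega> * f \<omega>) \<in> borel_measurable M" using G that by measurable
    show "AE \<omega> in M. norm (G \<omega> * f \<omega>) \<le> norm (B * f \<omega>)"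
      using G(2) by (intro AE_I2) (force simp: abs_mult intro!: mult_right_mono)
  qed
  have diff: "\<bar>expectation (\<lambda>\<omega>. G \<omega> * f \<omega>) - expectation (\<lambda>\<omega>. G \<omega> * g \<omega>)\<bar> \<le> B * expectation h"
    if "integrable M f" "integrable M g" "integrable M h" "\<And>\<omega>. \<bar>f \<omega> - g \<omega>\<bar> \<le> h \<omega>" for f g h :: "'a \<Rightarrow> real"
  proof -
    have "\<bar>expectation (\<lambda>\<omega>. G \<omega> * f \<omega>) - expectation (\<lambda>\<omega>. G \<omega> * g \<omega>)\<bar> = \<bar>expectation (\<lambda>\<omega>. G \<omega> * (f \<omega> - g \<omega>))\<bar>"
      using bd that by (simp add: right_diff_distrib)
    also have "\<dots> \<le> expectation (\<lambda>\<omega>. \<bar>G \<omega> * (f \<omega> - g \<omega>)\<bar>)" by (rule integral_abs_bound)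
    also have "\<dots> \<le> expectation (\<lambda>\<omega>. B * h \<omega>)"
    proof (rule integral_mono)
      show "integrable M (\<lambda>\<omega>. \<bar>G \<omega> * (f \<omega> - g \<omega>)\<bar>)" using bd that by (intro integrable_abs) auto
      show "integrable M (\<lambda>\<omega>. B * h \<omega>)" using that by simp
      fix \<omega> assume "\<omega> \<in> space M"
      then show "\<bar>G \<omega> * (f \<omega> - g \<omega>)\<bar> \<le> B * h \<omega>"
        using G(2) that(4)[of \<omega>] B0 by (auto simp: abs_mult intro!: mult_mono)
    qed
    finally show ?thesis by simp
  qed
  have y1: "\<bar>a\<bar> \<le> \<eta> + a\<^sup>2 / \<eta>" if "0 < \<eta>" for a \<eta> :: real
  proof (cases "\<bar>a\<bar> \<le> \<eta>")
    case False
    then have "\<bar>a\<bar> * \<eta> \<le> \<bar>a\<bar> * \<bar>a\<bar>" by (intro mult_left_mono) auto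
    then have "\<bar>a\<bar> \<le> a\<^sup>2 / \<eta>" using that by (simp add: field_simps power2_eq_square)
    then show ?thesis using that by simp
  qed (use that in \<open>simp add: add_increasing2\<close>)
  have y2: "\<bar>x\<^sup>2 - z\<^sup>2\<bar> \<le> \<eta> * z\<^sup>2 + (x - z)\<^sup>2 + (x - z)\<^sup>2 / \<eta>" if "0 < \<eta>" for x z \<eta> :: real
  proof -
    have "x\<^sup>2 - z\<^sup>2 = (x - z)\<^sup>2 + 2 * z * (x - z)" by (simp add: power2_eq_square algebra_simps)
    moreover have "\<bar>2 * z * (x - z)\<bar> \<le> \<eta> * z\<^sup>2 + (x - z)\<^sup>2 / \<eta>"
    proof -
      have "0 \<le> (\<eta> * \<bar>z\<bar> - \<bar>x - z\<bar>)\<^sup>2 / \<eta>" using that by simp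
      also have "(\<eta> * \<bar>z\<bar> - \<bar>x - z\<bar>)\<^sup>2 = \<eta> * \<eta> * z\<^sup>2 + (x - z)\<^sup>2 - \<eta> * (2 * (\<bar>z\<bar> * \<bar>x - z\<bar>))"
        by (simp add: power2_diff power_mult_distrib) (simp add: power2_eq_square)
      also have "\<dots> / \<eta> = \<eta> * z\<^sup>2 + (x - z)\<^sup>2 / \<eta> - 2 * (\<bar>z\<bar> * \<bar>x - z\<bar>)"
        using that by (simp add: field_simps)
      finally show ?thesis by (simp add: abs_mult)
    qed
    ultimately show ?thesis by (smt (verit) zero_le_power2)
  qed
  show "(\<lambda>k. expectation (\<lambda>\<omega>. G \<omega> * X k \<omega>)) \<longlonglongrightarrow> expectation (\<lambda>\<omega>. G \<omega> * Z \<omega>)"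
  proof (rule tendsto_if_young_bounded[OF e_lim e0, of _ _ B])
    show "\<forall>\<^sub>F k in sequentially. \<forall>\<eta>>0. \<bar>expectation (\<lambda>\<omega>. G \<omega> * X k \<omega>) - expectation (\<lambda>\<omega>. G \<omega> * Z \<omega>)\<bar> \<le> B * (\<eta> + e k + e k / \<eta>)"
      using int_ev
    proof (eventually_elim, intro allI impI)
      fix k and \<eta> :: real assume int: "integrable M (?d k)" and \<eta>: "0 < \<eta>"
      have "\<bar>expectation (\<lambda>\<omega>. G \<omega> * X k \<omega>) - expectation (\<lambda>\<omega>. G \<omega> * Z \<omega>)\<bar> \<le> B * expectation (\<lambda>\<omega>. \<eta> + ?d k \<omega> / \<eta>)"
        using Xk[of 1 k] Zk[of 1] int y1[OF \<eta>] by (intro diff) auto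
      also have "\<dots> = B * (\<eta> + e k / \<eta>)" using int by (simp add: e_def prob_space)
      also have "\<dots> \<le> B * (\<eta> + e k + e k / \<eta>)" using B0 e0[of k] by (intro mult_left_mono) auto
      finally show "\<bar>expectation (\<lambda>\<omega>. G \<omega> * X k \<omega>) - expectation (\<lambda>\<omega>. G \<omega> * Z \<omega>)\<bar> \<le> B * (\<eta> + e k + e k / \<eta>)" .
    qed
  qed
  \<comment> \<open>With \<open>c\<close> at least 1 and at least the second moment of
    \<open>Z\<close>, the single factor \<open>B * c\<close> covers all three terms of the Young
    bound.\<close>
  define c where "c = max 1 (expectation (\<lambda>\<omega>. (Z \<omega>)\<^sup>2))"
  show "(\<lambda>k. expectation (\<lambda>\<omega>. G \<omega> * (X k \<omega>)\<^sup>2)) \<longlonglongrightarrow> expectation (\<lambda>\<omega>. G \<omega> * (Z \<omega>)\<^sup>2)"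
  proof (rule tendsto_if_young_bounded[OF e_lim e0, of _ _ "B * c"])
    show "\<forall>\<^sub>F k in sequentially. \<forall>\<eta>>0. \<bar>expectation (\<lambda>\<omega>. G \<omega> * (X k \<omega>)\<^sup>2) - expectation (\<lambda>\<omega>. G \<omega> * (Z \<omega>)\<^sup>2)\<bar> \<le> B * c * (\<eta> + e k + e k / \<eta>)"
      using int_ev
    proof (eventually_elim, intro allI impI)
      fix k and \<eta> :: real assume int: "integrable M (?d k)" and \<eta>: "0 < \<eta>"
      have "\<bar>expectation (\<lambda>\<omega>. G \<omega> * (X k \<omega>)\<^sup>2) - expectation (\<lambda>\<omega>. G \<omega> * (Z \<omega>)\<^sup>2)\<bar>
          \<le> B * expectation (\<lambda>\<omega>. \<eta> * (Z \<omega>)\<^sup>2 + ?d k \<omega> + ?d k \<omega> / \<eta>)"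
        using Xk[of 2 k] Zk[of 2] int y2[OF \<eta>] by (intro diff) auto
      also have "\<dots> = B * (\<eta> * expectation (\<lambda>\<omega>. (Z \<omega>)\<^sup>2) + e k + e k / \<eta>)" using int Zk[of 2] by (simp add: e_def)
      also have "\<dots> \<le> B * (\<eta> * c + e k * c + e k / \<eta> * c)"
      proof -
        have c: "1 \<le> c" "expectation (\<lambda>\<omega>. (Z \<omega>)\<^sup>2) \<le> c" by (auto simp: c_def)
        have "e k \<le> e k * c" "e k / \<eta> \<le> e k / \<eta> * c"
          using mult_left_mono[OF c(1), of "e k"] mult_left_mono[OF c(1), of "e k / \<eta>"] e0[of k] \<eta> by auto
        then show ?thesis using B0 c \<eta> by (intro mult_left_mono add_mono) auto
      qed
      finally show "\<bar>expectation (\<lambda>\<omega>. G \<omega> * (X k \<omega>)\<^sup>2) - expectation (\<lambda>\<omega>. G \<omega> * (Z \<omega>)\<^sup>2)\<bar> \<le> B * c * (\<eta> + e k + e k / \<eta>)"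
        by (simp add: algebra_simps)
    qed
  qed
qed

end

section \<open>Step processes and uniformly bounded approximation of integrands\<close>

text \<open>The formula of \<open>simple_process\<close> over an arbitrary real vector space, since
  it is needed for matrices, for their rows and for squared norms of rows.\<close>

definition step_process :: "nat \<Rightarrow> (nat \<Rightarrow> real) \<Rightarrow> (nat \<Rightarrow> 'a \<Rightarrow> 'b::real_vector) \<Rightarrow> real \<Rightarrow> 'a \<Rightarrow> 'b"
  where "step_process n \<tau> x t \<omega> = (\<Sum>i<n. indicator {\<tau> i<..\<tau> (Suc i)} t *\<^sub>R x i \<omega>)"

lemma step_process_cases:
  fixes \<tau> :: "nat \<Rightarrow> real"
  assumes "mono \<tau>"
  obtains (on) i where "i < n" "u \<in> {\<tau> i<..\<tau> (Suc i)}" "\<And>j. indicator {\<tau> j<..\<tau> (Suc j)} u = (if j = i then 1 else 0 :: real)"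
  | (off) "\<And>j. j < n \<Longrightarrow> indicator {\<tau> j<..\<tau> (Suc j)} u = (0 :: real)"
proof (cases "\<exists>i<n. u \<in> {\<tau> i<..\<tau> (Suc i)}")
  case True
  then obtain i where i: "i < n" "u \<in> {\<tau> i<..\<tau> (Suc i)}" by auto
  have "u \<notin> {\<tau> j<..\<tau> (Suc j)}" if "j \<noteq> i" for j
  proof (cases "j < i")
    case True
    then have "\<tau> (Suc j) \<le> \<tau> i" by (intro monoD[OF assms]) simp
    then show ?thesis using i by auto
  next
    case False
    then have "\<tau> (Suc i) \<le> \<tau> j" using that by (intro monoD[OF assms]) simp
    then show ?thesis using i by auto
  qed
  then show ?thesis using i by (intro on[of i]) (auto simp: indicator_def)
qed (auto simp: indicator_def intro!: off)

lemma step_process_on: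
  assumes "i < n" "\<And>j. indicator {\<tau> j<..\<tau> (Suc j)} u = (if j = i then 1 else 0 :: real)"
  shows "step_process n \<tau> x u \<omega> = x i \<omega>"
proof -
  have "step_process n \<tau> x u \<omega> = (\<Sum>j<n. if j = i then x j \<omega> else 0)"
    unfolding step_process_def assms(2) by (intro sum.cong) auto
  then show ?thesis using assms(1) by simp
qed

lemma step_process_off:
  assumes "\<And>j. j < n \<Longrightarrow> indicator {\<tau> j<..\<tau> (Suc j)} u = (0 :: real)"
  shows "step_process n \<tau> x u \<omega> = 0"
  unfolding step_process_def using assms by (intro sum.neutral) auto

text \<open>The half-open intervals of a monotone grid are disjoint, so at most one summand is
  active and no mixed terms occur.\<close>

lemma norm_step_process_squared:
  fixes x :: "nat \<Rightarrow> 'a \<Rightarrow> 'b::real_normed_vector"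
  assumes "mono \<tau>"
  shows "(norm (step_process n \<tau> x u \<omega>))\<^sup>2 = (\<Sum>i<n. indicator {\<tau> i<..\<tau> (Suc i)} u * (norm (x i \<omega>))\<^sup>2)"
proof -
  have "(\<Sum>i<n. indicator {\<tau> i<..\<tau> (Suc i)} u * (norm (x i \<omega>))\<^sup>2) = step_process n \<tau> (\<lambda>i \<omega>. (norm (x i \<omega>))\<^sup>2) u \<omega>"
    by (simp add: step_process_def)
  then show ?thesis
    by (cases rule: step_process_cases[OF assms, of n u]) (simp_all add: step_process_on step_process_off)
qed

lemma norm_step_process_le:
  fixes x :: "nat \<Rightarrow> 'a \<Rightarrow> 'b::real_normed_vector"
  assumes "mono \<tau>" "0 \<le> K" "\<And>i. i < n \<Longrightarrow> norm (x i \<omega>) \<le> K"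
  shows "norm (step_process n \<tau> x u \<omega>) \<le> K"
  by (cases rule: step_process_cases[OF assms(1), of n u]) (simp_all add: step_process_on step_process_off assms)

lemma step_process_jointly_measurable:
  fixes x :: "nat \<Rightarrow> 'a \<Rightarrow> 'b::{banach, second_countable_topology}"
  assumes x: "\<And>i. i < n \<Longrightarrow> x i \<in> borel_measurable M"
  shows "jointly_measurable t M (step_process n \<tau> x)"
  unfolding step_process_def split_beta'
proof (intro borel_measurable_sum borel_measurable_scaleR)
  fix i assume "i \<in> {..<n}"
  then show "(\<lambda>p. x i (snd p)) \<in> borel_measurable (restrict_space borel {0..t} \<Otimes>\<^sub>M M)"
    using measurable_compose[OF measurable_snd x] by auto
  have "(indicator {\<tau> i<..\<tau> (Suc i)} :: real \<Rightarrow> real) \<in> borel_measurable (restrict_space borel {0..t})"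
    by (intro measurable_restrict_space1) simp
  from measurable_compose[OF measurable_fst this]
  show "(\<lambda>p. indicator {\<tau> i<..\<tau> (Suc i)} (fst p) :: real) \<in> borel_measurable (restrict_space borel {0..t} \<Otimes>\<^sub>M M)" .
qed

text \<open>The overlap of \<open>{s..t}\<close> with a grid interval is written through clamped
  endpoints, because the grid of \<open>stoch_sum_clamp\<close> is clamped in the same way and the
  two sums can then be matched term by term.\<close>

lemma integral_norm_step_process:
  fixes x :: "nat \<Rightarrow> 'a \<Rightarrow> 'b::real_normed_vector"
  assumes \<tau>: "mono \<tau>" and st: "s \<le> t"
  shows "set_lebesgue_integral lborel {s..t} (\<lambda>u. (norm (step_process n \<tau> x u \<omega>))\<^sup>2) =
    (\<Sum>i<n. (max s (min t (\<tau> (Suc i))) - max s (min t (\<tau> i))) * (norm (x i \<omega>))\<^sup>2)"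
proof -
  have meas: "measure lborel ({s..t} \<inter> {a<..b}) = max s (min t b) - max s (min t a)" if "a \<le> b" for a b
  proof (cases "a < s")
    case True
    then have "{s..t} \<inter> {a<..b} = {s..min t b}" by auto
    then show ?thesis using True st by (cases "s \<le> min t b") (auto simp: min_def max_def)
  next
    case False
    then have "{s..t} \<inter> {a<..b} = {a<..min t b}" by auto
    then show ?thesis using False st that by (cases "a \<le> min t b") (auto simp: min_def max_def)
  qed
  have int: "integrable lborel (\<lambda>u. indicator ({s..t} \<inter> {a<..b}) u * c)" for a b c :: real
    by (intro integrable_mult_left) (auto simp: emeasure_lborel_Icc_eq intro!: integrable_real_indicator intro: le_less_trans[OF emeasure_mono[of _ "{s..t}"]])
  have "set_lebesgue_integral lborel {s..t} (\<lambda>u. (norm (step_process n \<tau> x u \<omega>))\<^sup>2) =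
    (\<integral>u. (\<Sum>i<n. indicator ({s..t} \<inter> {\<tau> i<..\<tau> (Suc i)}) u * (norm (x i \<omega>))\<^sup>2) \<partial>lborel)"
    unfolding set_lebesgue_integral_def norm_step_process_squared[OF \<tau>]
    by (simp only: sum_distrib_left indicator_inter_arith mult.assoc real_scaleR_def)
  also have "\<dots> = (\<Sum>i<n. (\<integral>u. indicator ({s..t} \<inter> {\<tau> i<..\<tau> (Suc i)}) u * (norm (x i \<omega>))\<^sup>2 \<partial>lborel))"
    by (intro Bochner_Integration.integral_sum int)
  also have "\<dots> = (\<Sum>i<n. (max s (min t (\<tau> (Suc i))) - max s (min t (\<tau> i))) * (norm (x i \<omega>))\<^sup>2)"
    using \<tau> by (intro sum.cong refl) (simp add: meas mono_def del: Int_iff)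
  finally show ?thesis .
qed

lemma nn_integral_time_cmult:
  fixes f :: "real \<Rightarrow> 'a \<Rightarrow> ennreal"
  assumes M: "sigma_finite_measure M" and f: "jointly_measurable t M f"
  shows "(\<integral>\<^sup>+\<omega>. (\<integral>\<^sup>+u\<in>{0..t}. c * f u \<omega> \<partial>lborel) \<partial>M) = c * (\<integral>\<^sup>+\<omega>. (\<integral>\<^sup>+u\<in>{0..t}. f u \<omega> \<partial>lborel) \<partial>M)"
proof -
  have "(\<integral>\<^sup>+u\<in>{0..t}. c * f u \<omega> \<partial>lborel) = c * (\<integral>\<^sup>+u\<in>{0..t}. f u \<omega> \<partial>lborel)" if "\<omega> \<in> space M" for \<omega>
  proof -
    have "(\<lambda>u. f u \<omega>) \<in> borel_measurable (restrict_space lborel {0..t})"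
      using jointly_measurable_section[OF f that]
      by (subst measurable_cong_sets[OF sets_restrict_space_cong[OF sets_lborel] refl])
    from nn_integral_cmult[OF this, of c] show ?thesis
      by (simp add: nn_integral_restrict_space)
  qed
  then have "(\<integral>\<^sup>+\<omega>. (\<integral>\<^sup>+u\<in>{0..t}. c * f u \<omega> \<partial>lborel) \<partial>M) = (\<integral>\<^sup>+\<omega>. c * (\<integral>\<^sup>+u\<in>{0..t}. f u \<omega> \<partial>lborel) \<partial>M)"
    by (rule nn_integral_cong)
  also have "\<dots> = c * (\<integral>\<^sup>+\<omega>. (\<integral>\<^sup>+u\<in>{0..t}. f u \<omega> \<partial>lborel) \<partial>M)"
    by (intro nn_integral_cmult time_nn_integral_swap(1)[OF M f]) simp
  finally show ?thesis .
qed

context brownian_space begin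

text \<open>An increment of a simple integral over \<open>{s..t}\<close> is again a stochastic sum,
  along the grid clamped to \<open>{s..t}\<close>. Coefficients with \<open>\<tau> i > t\<close>
  meet an interval of length 0; they are set to 0 because they need not be known at the clamped time
  \<open>t\<close>.\<close>

lemma stoch_sum_clamp:
  fixes \<tau> :: "nat \<Rightarrow> real"
  assumes st: "0 \<le> s" "s \<le> t" and \<tau>: "0 \<le> \<tau> 0" "mono \<tau>"
  shows "stoch_sum (\<lambda>i. min t (\<tau> i)) x n \<omega> - stoch_sum (\<lambda>i. min s (\<tau> i)) x n \<omega> =
    stoch_sum (\<lambda>i. max s (min t (\<tau> i))) (\<lambda>i \<omega>. if \<tau> i \<le> t then x i \<omega> else 0) n \<omega>"
proof -
  have w: "W (min t a) \<omega> - W (min s a) \<omega> = W (max s (min t a)) \<omega> - W s \<omega>" for a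
    using st by (auto simp: min_def max_def)
  have "x i \<omega> \<bullet> (W (min t (\<tau> (Suc i))) \<omega> - W (min t (\<tau> i)) \<omega>) - x i \<omega> \<bullet> (W (min s (\<tau> (Suc i))) \<omega> - W (min s (\<tau> i)) \<omega>) =
    (if \<tau> i \<le> t then x i \<omega> else 0) \<bullet> (W (max s (min t (\<tau> (Suc i)))) \<omega> - W (max s (min t (\<tau> i))) \<omega>)" for i
  proof (cases "\<tau> i \<le> t")
    case True
    have "x i \<omega> \<bullet> (W (min t (\<tau> (Suc i))) \<omega> - W (min t (\<tau> i)) \<omega>) - x i \<omega> \<bullet> (W (min s (\<tau> (Suc i))) \<omega> - W (min s (\<tau> i)) \<omega>)
      = x i \<omega> \<bullet> ((W (min t (\<tau> (Suc i))) \<omega> - W (min s (\<tau> (Suc i))) \<omega>) - (W (min t (\<tau> i)) \<omega> - W (min s (\<tau> i)) \<omega>))"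
      by (simp add: algebra_simps)
    then show ?thesis using True unfolding w by simp
  next
    case False
    moreover have "\<tau> i \<le> \<tau> (Suc i)" using \<tau> by (simp add: mono_def)
    ultimately show ?thesis using st by (simp add: min_def)
  qed
  then show ?thesis unfolding stoch_sum_def by (simp add: sum_subtractf[symmetric])
qed

text \<open>Restates the discrete isometry with a time integral of the step process in place of a
  sum over the grid. In this form grids that vary with the approximation can be compared and the
  limit taken.\<close>

lemma stoch_sum_increment:
  fixes \<tau> :: "nat \<Rightarrow> real"
  assumes st: "0 \<le> s" "s \<le> t" and \<tau>: "0 \<le> \<tau> 0" "mono \<tau>"
    and x: "\<And>i. i < n \<Longrightarrow> x i \<in> borel_measurable (F (\<tau> i))"
    and K: "\<And>i \<omega>. i < n \<Longrightarrow> \<omega> \<in> space M \<Longrightarrow> norm (x i \<omega>) \<le> K" "0 \<le> K"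
  defines "D \<equiv> \<lambda>\<omega>. stoch_sum (\<lambda>i. min t (\<tau> i)) x n \<omega> - stoch_sum (\<lambda>i. min s (\<tau> i)) x n \<omega>"
  shows "D \<in> borel_measurable M" "integrable M (\<lambda>\<omega>. D \<omega> ^ 4)"
    and "expectation (\<lambda>\<omega>. D \<omega> ^ 4) \<le> 9 * (real CARD('d))\<^sup>2 * K ^ 4 * (t - s)\<^sup>2"
    and "\<And>(G :: 'a \<Rightarrow> real) B. G \<in> borel_measurable (F s) \<Longrightarrow> (\<And>\<omega>. \<omega> \<in> space M \<Longrightarrow> \<bar>G \<omega>\<bar> \<le> B) \<Longrightarrow>
      expectation (\<lambda>\<omega>. G \<omega> * D \<omega>) = 0 \<and>
      expectation (\<lambda>\<omega>. G \<omega> * (D \<omega>)\<^sup>2) =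
        expectation (\<lambda>\<omega>. G \<omega> * set_lebesgue_integral lborel {s..t} (\<lambda>u. (norm (step_process n \<tau> x u \<omega>))\<^sup>2))"
proof -
  let ?s = "\<lambda>i. max s (min t (\<tau> i))"
  let ?x = "\<lambda>i \<omega>. if \<tau> i \<le> t then x i \<omega> else 0"
  have D: "D = stoch_sum ?s ?x n"
    unfolding D_def using stoch_sum_clamp[OF st \<tau>] by auto
  have s: "0 \<le> ?s 0" "mono ?s"
    using st \<tau>(2) by (auto simp: mono_def min_def max_def intro: order_trans)
  have xm: "?x i \<in> borel_measurable (F (?s i))" if "i < n" for i
    using measurable_F_mono[OF x[OF that], of "?s i"] by (cases "\<tau> i \<le> t") auto
  have xK: "norm (?x i \<omega>) \<le> K" if "i < n" "\<omega> \<in> space M" for i \<omega>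
    using K that by auto
  note m4 = stoch_sum_fourth_moment[OF s xm xK]
  show "D \<in> borel_measurable M"
    unfolding D using stoch_sum_measurable[OF s xm] measurable_F_M by blast
  show "integrable M (\<lambda>\<omega>. D \<omega> ^ 4)" unfolding D by (rule m4(1))
  have "expectation (\<lambda>\<omega>. D \<omega> ^ 4) \<le> 9 * (real CARD('d))\<^sup>2 * K ^ 4 * (?s n - ?s 0)\<^sup>2"
    unfolding D by (rule m4(3))
  also have "\<dots> \<le> 9 * (real CARD('d))\<^sup>2 * K ^ 4 * (t - s)\<^sup>2"
  proof -
    have "?s 0 \<le> ?s n" using s(2) by (simp add: mono_def)
    moreover have "?s n \<le> t" "s \<le> ?s 0" using st by auto
    ultimately have "(?s n - ?s 0)\<^sup>2 \<le> (t - s)\<^sup>2" by (intro power_mono) auto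
    then show ?thesis using K(2) by (intro mult_left_mono) auto
  qed
  finally show "expectation (\<lambda>\<omega>. D \<omega> ^ 4) \<le> 9 * (real CARD('d))\<^sup>2 * K ^ 4 * (t - s)\<^sup>2" .
  fix G :: "'a \<Rightarrow> real" and B assume G: "G \<in> borel_measurable (F s)" "\<And>\<omega>. \<omega> \<in> space M \<Longrightarrow> \<bar>G \<omega>\<bar> \<le> B"
  have Gm: "G \<in> borel_measurable (F (?s 0))" by (rule measurable_F_mono[OF G(1)]) simp
  have "(?s (Suc i) - ?s i) * (norm (?x i \<omega>))\<^sup>2 = (?s (Suc i) - ?s i) * (norm (x i \<omega>))\<^sup>2" for i \<omega>
  proof (cases "\<tau> i \<le> t")
    case False
    moreover have "\<tau> i \<le> \<tau> (Suc i)" using \<tau> by (simp add: mono_def)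
    ultimately show ?thesis by (simp add: min_def)
  qed simp
  then have e: "set_lebesgue_integral lborel {s..t} (\<lambda>u. (norm (step_process n \<tau> x u \<omega>))\<^sup>2) =
     (\<Sum>i<n. (?s (Suc i) - ?s i) * (norm (?x i \<omega>))\<^sup>2)" for \<omega>
    unfolding integral_norm_step_process[OF \<tau>(2) st(2)] by (simp only:)
  show "expectation (\<lambda>\<omega>. G \<omega> * D \<omega>) = 0 \<and>
      expectation (\<lambda>\<omega>. G \<omega> * (D \<omega>)\<^sup>2) =
        expectation (\<lambda>\<omega>. G \<omega> * set_lebesgue_integral lborel {s..t} (\<lambda>u. (norm (step_process n \<tau> x u \<omega>))\<^sup>2))"
    unfolding D e using stoch_sum_isometry(2,4)[OF s xm xK Gm G(2)] by blast
qed

end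

lemma linear_vector_matrix_mult_right: "linear (\<lambda>A. v v* A)" for v :: "real^'n"
  by (rule linearI) (simp_all add: vector_matrix_mult_def vec_eq_iff sum.distrib sum_distrib_left algebra_simps)

context brownian_space begin

lemma progressively_measurable_jointly:
  assumes "progressively_measurable F H" "0 \<le> t"
  shows "jointly_measurable t M H"
proof -
  have "(\<lambda>p. p) \<in> restrict_space borel {0..t} \<Otimes>\<^sub>M M \<rightarrow>\<^sub>M restrict_space borel {0..t} \<Otimes>\<^sub>M F t"
    using measurable_from_subalg[OF subalgebra_F measurable_ident, of t]
    by (intro measurable_pair) (auto simp: comp_def id_def intro: measurable_compose[OF measurable_snd])
  then show ?thesis
    using assms unfolding progressively_measurable_def by (auto intro: measurable_compose)
qed

text \<open>The simple integrands in the definition of the integral are bounded one by one but not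
  uniformly, while the fourth moment estimate needs one bound for all of them. Projecting each row
  to the ball of radius \<open>K\<close>, which contains the rows of \<open>H\<close>, makes the
  bound uniform and does not increase the distance to \<open>H\<close>; the isometry shows that the
  integrals change by an amount that tends to 0.\<close>

lemma scalar_approximation:
  fixes H :: "real \<Rightarrow> 'a \<Rightarrow> real^'d^'n" and v :: "real^'n"
  assumes ito: "has_ito_integral M F W H I"
    and K: "\<And>t \<omega>. 0 \<le> t \<Longrightarrow> \<omega> \<in> space M \<Longrightarrow> norm (v v* H t \<omega>) \<le> K" "0 \<le> K"
  obtains n \<tau> x where
    "\<And>k. 0 \<le> \<tau> k 0" "\<And>k. mono (\<tau> k)"
    "\<And>k i. i < n k \<Longrightarrow> x k i \<in> borel_measurable (F (\<tau> k i))"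
    "\<And>k i \<omega>. norm (x k i \<omega>) \<le> K"
    "\<And>T. 0 \<le> T \<Longrightarrow> (\<lambda>k. \<integral>\<^sup>+\<omega>. (\<integral>\<^sup>+s\<in>{0..T}.
        ennreal ((norm (step_process (n k) (\<tau> k) (x k) s \<omega> - v v* H s \<omega>))\<^sup>2) \<partial>lborel) \<partial>M) \<longlonglongrightarrow> 0"
    "\<And>t. 0 \<le> t \<Longrightarrow> (\<lambda>k. \<integral>\<^sup>+\<omega>. ennreal ((stoch_sum (\<lambda>i. min t (\<tau> k i)) (x k) (n k) \<omega> - v \<bullet> I t \<omega>)\<^sup>2) \<partial>M) \<longlonglongrightarrow> 0"
proof -
  from ito obtain n \<tau> \<xi> where
    simple: "\<And>k :: nat. simple_integrand M F (n k) (\<tau> k) (\<xi> k)"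
    and limH: "\<And>T. 0 \<le> T \<Longrightarrow> (\<lambda>k. \<integral>\<^sup>+\<omega>. (\<integral>\<^sup>+s\<in>{0..T}.
             ennreal ((norm (simple_process (n k) (\<tau> k) (\<xi> k) s \<omega> - H s \<omega>))\<^sup>2) \<partial>lborel) \<partial>M) \<longlonglongrightarrow> 0"
    and limI: "\<And>t. 0 \<le> t \<Longrightarrow> (\<lambda>k. \<integral>\<^sup>+\<omega>.
             ennreal ((norm (simple_ito_integral W (n k) (\<tau> k) (\<xi> k) t \<omega> - I t \<omega>))\<^sup>2) \<partial>M) \<longlonglongrightarrow> 0"
    unfolding has_ito_integral_def by (elim conjE exE) blast
  have H: "jointly_measurable t M H" if "0 \<le> t" for t
    using ito that progressively_measurable_jointly unfolding has_ito_integral_def by blast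
  have IM: "I t \<in> borel_measurable M" if "0 \<le> t" for t
    using ito that measurable_F_M unfolding has_ito_integral_def adapted_def by blast
  let ?L = "\<lambda>A :: real^'d^'n. v v* A"
  have linL: "linear ?L" by (rule linear_vector_matrix_mult_right)
  obtain C where C: "0 < C" "\<And>A. norm (?L A) \<le> C * norm A"
    using linear_bounded_pos[OF linL] by auto
  have Lm: "?L \<in> borel_measurable borel"
    by (intro borel_measurable_continuous_onI linear_continuous_on linear_conv_bounded_linear[THEN iffD1] linL)
  \<comment> \<open>The metric projection onto the ball is 1-Lipschitz and fixes every row of
    \<open>H\<close>.\<close>
  define P where "P = closest_point (cball (0 :: real^'d) K)"
  have P: "norm (P a) \<le> K" "norm (P a - P b) \<le> norm (a - b)" for a b
    using closest_point_in_set[of "cball 0 K" a] closest_point_lipschitz[of "cball 0 K" a b] K(2)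
    by (auto simp: P_def dist_norm)
  have P_id: "P a = a" if "norm a \<le> K" for a
    using that by (simp add: P_def closest_point_self)
  have Pm: "P \<in> borel_measurable borel"
    unfolding P_def using K(2) by (intro borel_measurable_continuous_onI continuous_on_closest_point) auto
  define x where "x k i \<omega> = P (?L (\<xi> k i \<omega>))" for k i \<omega>
  \<comment> \<open>What the projection removes. Its stochastic sum is the change in the integral,
    and its L2 size is at most \<open>2 * C\<close> times the original error.\<close>
  define y where "y k i \<omega> = x k i \<omega> - ?L (\<xi> k i \<omega>)" for k i \<omega>
  have \<tau>: "0 \<le> \<tau> k 0" "mono (\<tau> k)" for k using simple unfolding simple_integrand_def by auto
  have \<xi>m: "\<xi> k i \<in> borel_measurable (F (\<tau> k i))" if "i < n k" for k i
    using simple that unfolding simple_integrand_def by auto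
  have xm: "x k i \<in> borel_measurable (F (\<tau> k i))" if "i < n k" for k i
    unfolding x_def using measurable_compose[OF measurable_compose[OF \<xi>m[OF that] Lm] Pm] .
  have ym: "y k i \<in> borel_measurable (F (\<tau> k i))" if "i < n k" for k i
    unfolding y_def using xm[OF that] measurable_compose[OF \<xi>m[OF that] Lm] by measurable
  have xK: "norm (x k i \<omega>) \<le> K" for k i \<omega> unfolding x_def by (rule P)
  have "\<exists>B. \<forall>i<n k. \<forall>\<omega>\<in>space M. norm (y k i \<omega>) \<le> B" for k
  proof -
    have "\<exists>B. \<forall>\<omega>\<in>space M. norm (\<xi> k i \<omega>) \<le> B" if "i < n k" for i
      using simple[of k] that unfolding simple_integrand_def bounded_iff by auto
    then obtain B where B: "\<And>i \<omega>. i < n k \<Longrightarrow> \<omega> \<in> space M \<Longrightarrow> norm (\<xi> k i \<omega>) \<le> B i" by metis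
    have "norm (y k i \<omega>) \<le> K + C * (\<Sum>i<n k. \<bar>B i\<bar>)" if i: "i < n k" "\<omega> \<in> space M" for i \<omega>
    proof -
      have "norm (y k i \<omega>) \<le> norm (x k i \<omega>) + norm (?L (\<xi> k i \<omega>))" unfolding y_def by (rule norm_triangle_ineq4)
      also have "\<dots> \<le> K + C * norm (\<xi> k i \<omega>)" using xK C by (intro add_mono) auto
      also have "norm (\<xi> k i \<omega>) \<le> (\<Sum>i<n k. \<bar>B i\<bar>)"
        using B[OF i] member_le_sum[of i "{..<n k}" "\<lambda>i. \<bar>B i\<bar>"] i by auto
      finally show ?thesis using C by simp
    qed
    then show ?thesis by blast
  qed
  then obtain B0 where B0: "\<And>k i \<omega>. i < n k \<Longrightarrow> \<omega> \<in> space M \<Longrightarrow> norm (y k i \<omega>) \<le> B0 k" by metis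
  define B where "B k = \<bar>B0 k\<bar>" for k
  have B: "norm (y k i \<omega>) \<le> B k" "0 \<le> B k" if "i < n k" "\<omega> \<in> space M" for k i \<omega>
    using B0[OF that] by (auto simp: B_def)
  have B_nonneg: "0 \<le> B k" for k by (simp add: B_def)
  let ?S = "\<lambda>k s \<omega>. simple_process (n k) (\<tau> k) (\<xi> k) s \<omega>"
  have S_eq: "?S k s \<omega> = step_process (n k) (\<tau> k) (\<xi> k) s \<omega>" for k s \<omega>
    by (simp add: simple_process_def step_process_def)
  have close: "norm (step_process (n k) (\<tau> k) (x k) s \<omega> - ?L (H s \<omega>)) \<le> C * norm (?S k s \<omega> - H s \<omega>)"
     "norm (step_process (n k) (\<tau> k) (y k) s \<omega>) \<le> 2 * C * norm (?S k s \<omega> - H s \<omega>)"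
    if "0 \<le> s" "\<omega> \<in> space M" for k s \<omega>
  proof -
    \<comment> \<open>At each time at most one coefficient is active, and off the grid intervals
      both sides are 0 because the projection fixes 0. Hence projecting coefficients is the same as
      projecting the process.\<close>
    have e: "step_process (n k) (\<tau> k) (x k) s \<omega> = P (?L (?S k s \<omega>)) \<and>
      step_process (n k) (\<tau> k) (y k) s \<omega> = P (?L (?S k s \<omega>)) - ?L (?S k s \<omega>)"
      unfolding S_eq
      by (cases rule: step_process_cases[OF \<tau>(2), of "n k" s k])
         (simp_all add: step_process_on step_process_off linear_0[OF linL] P_id K(2) x_def y_def)
    have hK: "P (?L (H s \<omega>)) = ?L (H s \<omega>)" by (rule P_id[OF K(1)[OF that]])
    have d: "norm (?L (?S k s \<omega>) - ?L (H s \<omega>)) \<le> C * norm (?S k s \<omega> - H s \<omega>)"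
      using C(2)[of "?S k s \<omega> - H s \<omega>"] by (simp add: linear_diff[OF linL])
    have p: "norm (P (?L (?S k s \<omega>)) - ?L (H s \<omega>)) \<le> C * norm (?S k s \<omega> - H s \<omega>)"
      using P(2)[of "?L (?S k s \<omega>)" "?L (H s \<omega>)"] d unfolding hK by linarith
    show "norm (step_process (n k) (\<tau> k) (x k) s \<omega> - ?L (H s \<omega>)) \<le> C * norm (?S k s \<omega> - H s \<omega>)"
      using p e by simp
    have "norm (P (?L (?S k s \<omega>)) - ?L (?S k s \<omega>)) \<le> norm (P (?L (?S k s \<omega>)) - ?L (H s \<omega>)) + norm (?L (?S k s \<omega>) - ?L (H s \<omega>))"
      using norm_triangle_ineq4[of "P (?L (?S k s \<omega>)) - ?L (H s \<omega>)" "?L (?S k s \<omega>) - ?L (H s \<omega>)"] by simp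
    then show "norm (step_process (n k) (\<tau> k) (y k) s \<omega>) \<le> 2 * C * norm (?S k s \<omega> - H s \<omega>)"
      using p d e by simp
  qed
  have Sjm: "jointly_measurable t M (\<lambda>s \<omega>. ennreal ((norm (?S k s \<omega> - H s \<omega>))\<^sup>2))" if "0 \<le> t" for t k
  proof -
    have 1: "jointly_measurable t M (\<lambda>s \<omega>. ?S k s \<omega>)"
      unfolding S_eq using measurable_F_M[OF \<xi>m] by (intro step_process_jointly_measurable) auto
    have "(\<lambda>p. (?S k (fst p) (snd p)) - H (fst p) (snd p)) \<in> borel_measurable (restrict_space borel {0..t} \<Otimes>\<^sub>M M)"
      using 1 H[OF that] unfolding split_beta' by (rule borel_measurable_diff)
    then have "jointly_measurable t M (\<lambda>s \<omega>. ?S k s \<omega> - H s \<omega>)" by (simp add: split_beta')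
    then show ?thesis by (rule jointly_measurable_compose) measurable
  qed
  let ?E = "\<lambda>T k. \<integral>\<^sup>+\<omega>. (\<integral>\<^sup>+s\<in>{0..T}. ennreal ((norm (?S k s \<omega> - H s \<omega>))\<^sup>2) \<partial>lborel) \<partial>M"
  have cE: "(\<integral>\<^sup>+\<omega>. (\<integral>\<^sup>+s\<in>{0..T}. ennreal ((g s \<omega>)\<^sup>2) \<partial>lborel) \<partial>M) \<le> ennreal (c\<^sup>2) * ?E T k"
    if "0 \<le> T" "0 \<le> c" "\<And>s \<omega>. 0 \<le> s \<Longrightarrow> \<omega> \<in> space M \<Longrightarrow> 0 \<le> g s \<omega> \<and> g s \<omega> \<le> c * norm (?S k s \<omega> - H s \<omega>)" for T k c g
  proof -
    have "(\<integral>\<^sup>+\<omega>. (\<integral>\<^sup>+s\<in>{0..T}. ennreal ((g s \<omega>)\<^sup>2) \<partial>lborel) \<partial>M) \<le>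
       (\<integral>\<^sup>+\<omega>. (\<integral>\<^sup>+s\<in>{0..T}. ennreal (c\<^sup>2) * ennreal ((norm (?S k s \<omega> - H s \<omega>))\<^sup>2) \<partial>lborel) \<partial>M)"
    proof (intro nn_integral_mono)
      fix \<omega> s assume w: "\<omega> \<in> space M"
      show "ennreal ((g s \<omega>)\<^sup>2) * indicator {0..T} s \<le> ennreal (c\<^sup>2) * ennreal ((norm (?S k s \<omega> - H s \<omega>))\<^sup>2) * indicator {0..T} s"
      proof (cases "s \<in> {0..T}")
        case True
        then have "(g s \<omega>)\<^sup>2 \<le> (c * norm (?S k s \<omega> - H s \<omega>))\<^sup>2"
          using that(3)[of s \<omega>] w by (intro power_mono) auto
        then show ?thesis using True by (simp add: ennreal_mult[symmetric] power_mult_distrib ennreal_leI)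
      qed simp
    qed
    also have "\<dots> = ennreal (c\<^sup>2) * ?E T k"
      by (rule nn_integral_time_cmult[OF _ Sjm[OF that(1)]]) unfold_locales
    finally show ?thesis .
  qed
  have limE: "(\<lambda>k. ennreal c * ?E T k) \<longlonglongrightarrow> 0" if "0 \<le> T" for c T
    using ennreal_tendsto_cmult[OF _ limH[OF that], of "ennreal c"] by simp
  have lim1: "(\<lambda>k. \<integral>\<^sup>+\<omega>. (\<integral>\<^sup>+s\<in>{0..T}.
        ennreal ((norm (step_process (n k) (\<tau> k) (x k) s \<omega> - v v* H s \<omega>))\<^sup>2) \<partial>lborel) \<partial>M) \<longlonglongrightarrow> 0" if T: "0 \<le> T" for T
    by (rule tendsto_sandwich[OF _ _ tendsto_const limE[OF T, of "C\<^sup>2"]])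
       (use close(1) C cE[OF T, of C] in \<open>auto intro!: always_eventually\<close>)
  have lim2: "(\<lambda>k. \<integral>\<^sup>+\<omega>. ennreal ((stoch_sum (\<lambda>i. min t (\<tau> k i)) (x k) (n k) \<omega> - v \<bullet> I t \<omega>)\<^sup>2) \<partial>M) \<longlonglongrightarrow> 0" if t: "0 \<le> t" for t
  proof -
    let ?J = "\<lambda>k \<omega>. simple_ito_integral W (n k) (\<tau> k) (\<xi> k) t \<omega>"
    let ?D = "\<lambda>k. stoch_sum (\<lambda>i. min t (\<tau> k i)) (y k) (n k)"
    have split: "stoch_sum (\<lambda>i. min t (\<tau> k i)) (x k) (n k) \<omega> = ?D k \<omega> + v \<bullet> ?J k \<omega>" for k \<omega>
      unfolding stoch_sum_def simple_ito_integral_def y_def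
      by (simp add: inner_sum_right sum.distrib[symmetric] dot_lmul_matrix inner_diff_left)
    \<comment> \<open>All grid times are nonnegative, so the sum stopped at 0 vanishes and the facts
      about increments from 0 to \<open>t\<close> become facts about the sum itself.\<close>
    have zero: "stoch_sum (\<lambda>i. min 0 (\<tau> k i)) (y k) (n k) \<omega> = 0" for k \<omega>
    proof -
      have "min 0 (\<tau> k i) = 0" for i using \<tau>[of k] monoD[OF \<tau>(2), of 0 i k] by (simp add: min_def)
      then show ?thesis by (simp add: stoch_sum_def)
    qed
    have "ennreal (expectation (\<lambda>\<omega>. (?D k \<omega>)\<^sup>2)) \<le> ennreal ((2 * C)\<^sup>2) * ?E t k \<and>
       ?D k \<in> borel_measurable M \<and> (\<integral>\<^sup>+\<omega>. ennreal ((?D k \<omega>)\<^sup>2) \<partial>M) = ennreal (expectation (\<lambda>\<omega>. (?D k \<omega>)\<^sup>2))" for k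
    proof -
      note inc = stoch_sum_increment[where x="y k" and \<tau>="\<tau> k" and n="n k" and K="B k", OF order_refl t \<tau> ym B(1) B_nonneg, unfolded zero diff_zero]
      have iso: "expectation (\<lambda>\<omega>. (?D k \<omega>)\<^sup>2) =
        expectation (\<lambda>\<omega>. set_lebesgue_integral lborel {0..t} (\<lambda>u. (norm (step_process (n k) (\<tau> k) (y k) u \<omega>))\<^sup>2))"
        using inc(4)[of "\<lambda>_. 1" 1] by simp
      have jm: "jointly_measurable t M (\<lambda>u \<omega>. (norm (step_process (n k) (\<tau> k) (y k) u \<omega>))\<^sup>2)"
        using measurable_F_M[OF ym] by (intro jointly_measurable_compose[OF step_process_jointly_measurable]) auto
      have "ennreal (expectation (\<lambda>\<omega>. (?D k \<omega>)\<^sup>2)) =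
        (\<integral>\<^sup>+\<omega>. (\<integral>\<^sup>+u\<in>{0..t}. ennreal ((norm (step_process (n k) (\<tau> k) (y k) u \<omega>))\<^sup>2) \<partial>lborel) \<partial>M)"
        unfolding iso using B B_nonneg
        by (intro nn_integral_time_bounded(1)[OF jm order_refl t, of "(B k)\<^sup>2", symmetric])
           (auto intro!: power_mono norm_step_process_le \<tau>)
      also have "\<dots> \<le> ennreal ((2 * C)\<^sup>2) * ?E t k"
        using close(2) C by (intro cE[OF t]) auto
      finally have 1: "ennreal (expectation (\<lambda>\<omega>. (?D k \<omega>)\<^sup>2)) \<le> ennreal ((2 * C)\<^sup>2) * ?E t k" .
      have "integrable M (\<lambda>\<omega>. (?D k \<omega>)\<^sup>2)" by (rule integrable_power_le_4[OF inc(1,2)]) simp_all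
      then show ?thesis using 1 inc(1) by (auto intro!: nn_integral_eq_integral)
    qed
    note Dk = this
    have Jm: "(\<lambda>\<omega>. v \<bullet> ?J k \<omega>) \<in> borel_measurable M" for k
    proof -
      have Wm: "W (min t (\<tau> k i)) \<in> borel_measurable M" for i
        using monoD[OF \<tau>(2), of 0 i k] \<tau>(1)[of k] t by (intro W_measurable) (auto simp: min_def)
      have "(\<lambda>\<omega>. \<Sum>i<n k. ?L (\<xi> k i \<omega>) \<bullet> (W (min t (\<tau> k (Suc i))) \<omega> - W (min t (\<tau> k i)) \<omega>)) \<in> borel_measurable M"
        using Wm measurable_F_M[OF \<xi>m] by (intro borel_measurable_sum borel_measurable_inner borel_measurable_diff measurable_compose[OF _ Lm]) auto
      then show ?thesis unfolding simple_ito_integral_def by (simp add: inner_sum_right dot_lmul_matrix)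
    qed
    let ?V = "ennreal (2 * (norm v)\<^sup>2)"
    let ?N = "\<lambda>k. \<integral>\<^sup>+\<omega>. ennreal ((norm (?J k \<omega> - I t \<omega>))\<^sup>2) \<partial>M"
    have bound: "(\<integral>\<^sup>+\<omega>. ennreal ((stoch_sum (\<lambda>i. min t (\<tau> k i)) (x k) (n k) \<omega> - v \<bullet> I t \<omega>)\<^sup>2) \<partial>M)
       \<le> ennreal (2 * (2 * C)\<^sup>2) * ?E t k + ?V * ?N k" for k
    proof -
      have Jn: "(\<lambda>\<omega>. norm (?J k \<omega> - I t \<omega>)) \<in> borel_measurable M"
      proof -
        have Wm: "W (min t (\<tau> k i)) \<in> borel_measurable M" for i
          using monoD[OF \<tau>(2), of 0 i k] \<tau>(1)[of k] t by (intro W_measurable) (auto simp: min_def)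
        have "(\<lambda>\<omega>. \<xi> k i \<omega> *v (W (min t (\<tau> k (Suc i))) \<omega> - W (min t (\<tau> k i)) \<omega>)) \<in> borel_measurable M" if "i < n k" for i
        proof (subst borel_measurable_euclidean_space, intro ballI)
          fix b :: "real^'n"
          have "(\<lambda>\<omega>. (b v* \<xi> k i \<omega>) \<bullet> (W (min t (\<tau> k (Suc i))) \<omega> - W (min t (\<tau> k i)) \<omega>)) \<in> borel_measurable M"
            using Wm measurable_F_M[OF \<xi>m[OF that]]
            by (intro borel_measurable_inner borel_measurable_diff measurable_compose[OF _ borel_measurable_continuous_onI[OF linear_continuous_on[OF linear_conv_bounded_linear[THEN iffD1, OF linear_vector_matrix_mult_right]]]]) auto
          then show "(\<lambda>\<omega>. (\<xi> k i \<omega> *v (W (min t (\<tau> k (Suc i))) \<omega> - W (min t (\<tau> k i)) \<omega>)) \<bullet> b) \<in> borel_measurable M"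
            by (simp add: dot_lmul_matrix inner_commute)
        qed
        then have "?J k \<in> borel_measurable M" unfolding simple_ito_integral_def by (intro borel_measurable_sum) auto
        then show ?thesis using IM[OF t] by measurable
      qed
      have "(\<integral>\<^sup>+\<omega>. ennreal ((stoch_sum (\<lambda>i. min t (\<tau> k i)) (x k) (n k) \<omega> - v \<bullet> I t \<omega>)\<^sup>2) \<partial>M)
        \<le> (\<integral>\<^sup>+\<omega>. 2 * ennreal ((?D k \<omega>)\<^sup>2) + ?V * ennreal ((norm (?J k \<omega> - I t \<omega>))\<^sup>2) \<partial>M)"
      proof (intro nn_integral_mono)
        fix \<omega>
        have "(?D k \<omega> + v \<bullet> ?J k \<omega> - v \<bullet> I t \<omega>)\<^sup>2 \<le> 2 * (?D k \<omega>)\<^sup>2 + 2 * (v \<bullet> (?J k \<omega> - I t \<omega>))\<^sup>2"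
        proof -
          have "(a + b)\<^sup>2 \<le> 2 * a\<^sup>2 + 2 * b\<^sup>2" for a b :: real
            using sum_squares_ge_zero[of "a - b" 0] by (simp add: power2_eq_square algebra_simps)
          from this[of "?D k \<omega>" "v \<bullet> (?J k \<omega> - I t \<omega>)"] show ?thesis by (simp add: inner_diff_right algebra_simps)
        qed
        also have "(v \<bullet> (?J k \<omega> - I t \<omega>))\<^sup>2 \<le> (norm v * norm (?J k \<omega> - I t \<omega>))\<^sup>2"
          using Cauchy_Schwarz_ineq2[of v "?J k \<omega> - I t \<omega>"] by (metis abs_ge_zero power2_abs power_mono)
        finally have "(?D k \<omega> + v \<bullet> ?J k \<omega> - v \<bullet> I t \<omega>)\<^sup>2 \<le> 2 * (?D k \<omega>)\<^sup>2 + 2 * (norm v)\<^sup>2 * (norm (?J k \<omega> - I t \<omega>))\<^sup>2"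
          by (simp add: power_mult_distrib)
        then have "ennreal ((?D k \<omega> + v \<bullet> ?J k \<omega> - v \<bullet> I t \<omega>)\<^sup>2) \<le> ennreal (2 * (?D k \<omega>)\<^sup>2 + 2 * (norm v)\<^sup>2 * (norm (?J k \<omega> - I t \<omega>))\<^sup>2)"
          by (rule ennreal_leI)
        also have "\<dots> = 2 * ennreal ((?D k \<omega>)\<^sup>2) + ?V * ennreal ((norm (?J k \<omega> - I t \<omega>))\<^sup>2)"
          by (simp add: ennreal_mult ennreal_plus)
        finally show "ennreal ((stoch_sum (\<lambda>i. min t (\<tau> k i)) (x k) (n k) \<omega> - v \<bullet> I t \<omega>)\<^sup>2)
           \<le> 2 * ennreal ((?D k \<omega>)\<^sup>2) + ?V * ennreal ((norm (?J k \<omega> - I t \<omega>))\<^sup>2)"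
          unfolding split .
      qed
      also have "\<dots> = 2 * ennreal (expectation (\<lambda>\<omega>. (?D k \<omega>)\<^sup>2)) + ?V * ?N k"
        using Dk[of k] Jn by (subst nn_integral_add) (auto simp: nn_integral_cmult)
      also have "\<dots> \<le> 2 * (ennreal ((2 * C)\<^sup>2) * ?E t k) + ?V * ?N k"
        using Dk[of k] by (intro add_mono mult_left_mono) auto
      also have "2 * (ennreal ((2 * C)\<^sup>2) * ?E t k) = ennreal (2 * (2 * C)\<^sup>2) * ?E t k"
        by (simp add: ennreal_mult mult.assoc)
      finally show ?thesis .
    qed
    have "(\<lambda>k. ?V * ?N k) \<longlonglongrightarrow> 0"
      using ennreal_tendsto_cmult[OF _ limI[OF t], of ?V] by simp
    then have "(\<lambda>k. ennreal (2 * (2 * C)\<^sup>2) * ?E t k + ?V * ?N k) \<longlonglongrightarrow> 0 + 0"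
      by (intro tendsto_add limE[OF t])
    then have lim0: "(\<lambda>k. ennreal (2 * (2 * C)\<^sup>2) * ?E t k + ?V * ?N k) \<longlonglongrightarrow> 0" by simp
    show ?thesis
      by (rule tendsto_sandwich[OF _ _ tendsto_const lim0]) (use bound in \<open>auto intro!: always_eventually\<close>)
  qed
  show ?thesis
    by (rule that[of \<tau> n x, OF \<tau> xm xK lim1 lim2])
qed

end

section \<open>Ito integrals of bounded integrands\<close>

lemma abs_le_young:
  fixes a \<eta> :: real
  assumes "0 < \<eta>" shows "\<bar>a\<bar> \<le> \<eta> + a\<^sup>2 / \<eta>"
proof (cases "\<bar>a\<bar> \<le> \<eta>")
  case False
  then have "\<bar>a\<bar> * \<eta> \<le> \<bar>a\<bar> * \<bar>a\<bar>" by (intro mult_left_mono) auto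
  then have "\<bar>a\<bar> \<le> a\<^sup>2 / \<eta>" using assms by (simp add: field_simps power2_eq_square)
  then show ?thesis using assms by simp
qed (use assms in \<open>simp add: add_increasing2\<close>)

text \<open>The bound is put on the rows \<open>v v* H\<close> and thus on the operator norm,
  because each component \<open>v \<bullet> I\<close> is treated as a scalar integral with that row
  as integrand.\<close>

locale bounded_ito_integral = brownian_space M W
  for M :: "'a measure" and W :: "real \<Rightarrow> 'a \<Rightarrow> real^'d" +
  fixes H :: "real \<Rightarrow> 'a \<Rightarrow> real^'d^'n" and I :: "real \<Rightarrow> 'a \<Rightarrow> real^'n" and K :: real
  assumes ito: "has_ito_integral M F W H I"
    and K_nonneg: "0 \<le> K"
    and H_bound: "\<And>v t \<omega>. 0 \<le> t \<Longrightarrow> \<omega> \<in> space M \<Longrightarrow> norm (v v* H t \<omega>) \<le> K * norm v"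
begin

lemma I_measurable_F: "0 \<le> t \<Longrightarrow> I t \<in> borel_measurable (F t)"
  using ito unfolding has_ito_integral_def adapted_def by blast

lemma I_measurable: "0 \<le> t \<Longrightarrow> I t \<in> borel_measurable M"
  using I_measurable_F measurable_F_M by blast

lemma row_progressive:
  assumes "0 \<le> t"
  shows "jointly_measurable t (F t) (\<lambda>u \<omega>. v v* H u \<omega>)" "jointly_measurable t M (\<lambda>u \<omega>. v v* H u \<omega>)"
proof -
  have L: "(\<lambda>A :: real^'d^'n. v v* A) \<in> borel_measurable borel"
    by (intro borel_measurable_continuous_onI linear_continuous_on linear_conv_bounded_linear[THEN iffD1]
        linear_vector_matrix_mult_right)
  have H: "progressively_measurable F H" using ito unfolding has_ito_integral_def by blast
  then show "jointly_measurable t (F t) (\<lambda>u \<omega>. v v* H u \<omega>)"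
    using assms unfolding progressively_measurable_def by (intro jointly_measurable_compose[OF _ L]) auto
  show "jointly_measurable t M (\<lambda>u \<omega>. v v* H u \<omega>)"
    by (rule jointly_measurable_compose[OF progressively_measurable_jointly[OF H assms] L])
qed

lemma row_product_jointly:
  assumes "0 \<le> t"
  shows "jointly_measurable t M (\<lambda>u \<omega>. (v v* H u \<omega>) \<bullet> (w v* H u \<omega>))"
    and "jointly_measurable t (F t) (\<lambda>u \<omega>. (v v* H u \<omega>) \<bullet> (w v* H u \<omega>))"
  using row_progressive[OF assms, of v] row_progressive[OF assms, of w]
  unfolding split_beta' by (intro borel_measurable_inner; simp)+

lemma row_product_bound:
  assumes "0 \<le> u" "\<omega> \<in> space M"
  shows "\<bar>(v v* H u \<omega>) \<bullet> (w v* H u \<omega>)\<bar> \<le> K\<^sup>2 * norm v * norm w"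
proof -
  have "\<bar>(v v* H u \<omega>) \<bullet> (w v* H u \<omega>)\<bar> \<le> norm (v v* H u \<omega>) * norm (w v* H u \<omega>)"
    by (rule Cauchy_Schwarz_ineq2)
  also have "\<dots> \<le> (K * norm v) * (K * norm w)"
    using assms H_bound K_nonneg by (intro mult_mono) auto
  finally show ?thesis by (simp add: power2_eq_square mult_ac)
qed

text \<open>The bracket of \<open>v \<bullet> I\<close> and \<open>w \<bullet> I\<close> over
  \<open>{s..t}\<close>, defined through its density rather than as a limit of products of
  increments.\<close>

definition covariation :: "real^'n \<Rightarrow> real^'n \<Rightarrow> real \<Rightarrow> real \<Rightarrow> 'a \<Rightarrow> real"
  where "covariation v w s t \<omega> = set_lebesgue_integral lborel {s..t} (\<lambda>u. (v v* H u \<omega>) \<bullet> (w v* H u \<omega>))"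

lemma covariation_measurable:
  assumes "0 \<le> s" "s \<le> t" shows "covariation v w s t \<in> borel_measurable M"
  unfolding covariation_def using assms by (intro time_integral_measurable row_product_jointly) auto

lemma row_product_integrable:
  assumes "0 \<le> s" "s \<le> t" "\<omega> \<in> space M"
  shows "set_integrable lborel {s..t} (\<lambda>u. (v v* H u \<omega>) \<bullet> (w v* H u \<omega>))"
  using assms row_product_bound[of _ \<omega> v w]
  by (intro bounded_path_set_integrable[OF row_product_jointly(1)[of t v w], of \<omega> s "K\<^sup>2 * norm v * norm w"]) auto

lemma set_integral_abs_bound:
  fixes f :: "real \<Rightarrow> real"
  assumes "set_integrable lborel {s..t} f" "\<And>u. u \<in> {s..t} \<Longrightarrow> \<bar>f u\<bar> \<le> C" "s \<le> t"
  shows "\<bar>set_lebesgue_integral lborel {s..t} f\<bar> \<le> C * (t - s)"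
proof -
  have "set_lebesgue_integral lborel {s..t} f \<le> set_lebesgue_integral lborel {s..t} (\<lambda>u. C)"
    "set_lebesgue_integral lborel {s..t} (\<lambda>u. - C) \<le> set_lebesgue_integral lborel {s..t} f"
    using assms by (intro set_integral_mono; force simp: set_integrable_def intro: integrable_indicator_Icc)+
  moreover have "set_lebesgue_integral lborel {s..t} (\<lambda>u. c) = c * (t - s)" for c :: real
    using assms by (simp add: set_lebesgue_integral_def mult.commute)
  ultimately show ?thesis by (simp add: abs_le_iff)
qed

lemma covariation_bound:
  assumes "0 \<le> s" "s \<le> t" "\<omega> \<in> space M"
  shows "\<bar>covariation v w s t \<omega>\<bar> \<le> K\<^sup>2 * norm v * norm w * (t - s)"
  unfolding covariation_def using assms
  by (intro set_integral_abs_bound row_product_integrable row_product_bound) auto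

text \<open>Transfers orthogonality, isometry and fourth moment from stochastic sums to the
  integral. The weighted second moments of the sums have two limits, one through L2 convergence of
  the sums and one through L2 convergence of the integrands; uniqueness of limits gives the
  isometry.\<close>

lemma increment_bounded_test:
  fixes v :: "real^'n"
  assumes st: "0 \<le> s" "s \<le> t"
  defines "D \<equiv> \<lambda>\<omega>. v \<bullet> (I t \<omega> - I s \<omega>)"
  shows "integrable M (\<lambda>\<omega>. D \<omega> ^ 4)"
    and "expectation (\<lambda>\<omega>. D \<omega> ^ 4) \<le> 9 * (real CARD('d))\<^sup>2 * (K * norm v) ^ 4 * (t - s)\<^sup>2"
    and "\<And>(G :: 'a \<Rightarrow> real) B. G \<in> borel_measurable (F s) \<Longrightarrow> (\<And>\<omega>. \<omega> \<in> space M \<Longrightarrow> \<bar>G \<omega>\<bar> \<le> B) \<Longrightarrow>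
      expectation (\<lambda>\<omega>. G \<omega> * D \<omega>) = 0 \<and>
      expectation (\<lambda>\<omega>. G \<omega> * (D \<omega>)\<^sup>2) = expectation (\<lambda>\<omega>. G \<omega> * covariation v v s t \<omega>)"
proof -
  let ?K = "K * norm v"
  have K0: "0 \<le> ?K" using K_nonneg by simp
  have t0: "0 \<le> t" using st by simp
  let ?h = "\<lambda>u \<omega>. v v* H u \<omega>"
  obtain \<tau> n x where
    \<tau>: "\<And>k. 0 \<le> \<tau> k 0" "\<And>k. mono (\<tau> k)"
    and xm: "\<And>k i. i < n k \<Longrightarrow> x k i \<in> borel_measurable (F (\<tau> k i))"
    and xK: "\<And>k i \<omega>. norm (x k i \<omega>) \<le> ?K"
    and limH: "\<And>T. 0 \<le> T \<Longrightarrow> (\<lambda>k. \<integral>\<^sup>+\<omega>. (\<integral>\<^sup>+s\<in>{0..T}.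
        ennreal ((norm (step_process (n k) (\<tau> k) (x k) s \<omega> - v v* H s \<omega>))\<^sup>2) \<partial>lborel) \<partial>M) \<longlonglongrightarrow> 0"
    and limI: "\<And>t. 0 \<le> t \<Longrightarrow> (\<lambda>k. \<integral>\<^sup>+\<omega>. ennreal ((stoch_sum (\<lambda>i. min t (\<tau> k i)) (x k) (n k) \<omega> - v \<bullet> I t \<omega>)\<^sup>2) \<partial>M) \<longlonglongrightarrow> 0"
  proof (rule scalar_approximation[OF ito H_bound[of _ _ v] K0], goal_cases)
    case prems: (3 n \<tau> x)
    show ?case by (rule prems(1)[OF prems(2-)])
  qed
  define X where "X k \<omega> = stoch_sum (\<lambda>i. min t (\<tau> k i)) (x k) (n k) \<omega> - stoch_sum (\<lambda>i. min s (\<tau> k i)) (x k) (n k) \<omega>" for k \<omega>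
  let ?st = "\<lambda>k. step_process (n k) (\<tau> k) (x k)"
  note si = stoch_sum_increment[where x="x k" and \<tau>="\<tau> k" and n="n k" and K="?K" for k, OF st \<tau> xm xK K0]
  have inc: "X k \<in> borel_measurable M" "integrable M (\<lambda>\<omega>. X k \<omega> ^ 4)"
     "expectation (\<lambda>\<omega>. X k \<omega> ^ 4) \<le> 9 * (real CARD('d))\<^sup>2 * ?K ^ 4 * (t - s)\<^sup>2" for k
    unfolding X_def using si(1-3)[of k] by simp_all
  have inc4: "expectation (\<lambda>\<omega>. G \<omega> * X k \<omega>) = 0 \<and>
      expectation (\<lambda>\<omega>. G \<omega> * (X k \<omega>)\<^sup>2) =
        expectation (\<lambda>\<omega>. G \<omega> * set_lebesgue_integral lborel {s..t} (\<lambda>u. (norm (?st k u \<omega>))\<^sup>2))"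
    if "G \<in> borel_measurable (F s)" "\<And>\<omega>. \<omega> \<in> space M \<Longrightarrow> \<bar>G \<omega>\<bar> \<le> B" for k B and G :: "'a \<Rightarrow> real"
    unfolding X_def by (rule si(4)[OF _ that])
  have Sm: "stoch_sum (\<lambda>i. min r (\<tau> k i)) (x k) (n k) \<in> borel_measurable M" if "0 \<le> r" for r k
  proof -
    have "x k i \<in> borel_measurable M" if "i < n k" for i using xm[OF that] measurable_F_M by blast
    moreover have "W (min r (\<tau> k i)) \<in> borel_measurable M" for i
      using monoD[OF \<tau>(2), of 0 i k] \<tau>(1)[of k] \<open>0 \<le> r\<close> by (intro W_measurable) (auto simp: min_def)
    ultimately show ?thesis
      unfolding stoch_sum_def[abs_def] by (intro borel_measurable_sum borel_measurable_inner borel_measurable_diff) auto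
  qed
  have Dm: "D \<in> borel_measurable M"
    unfolding D_def using I_measurable[OF st(1)] I_measurable[OF t0] by measurable
  let ?a = "\<lambda>r k. \<integral>\<^sup>+\<omega>. ennreal ((stoch_sum (\<lambda>i. min r (\<tau> k i)) (x k) (n k) \<omega> - v \<bullet> I r \<omega>)\<^sup>2) \<partial>M"
  have lim: "(\<lambda>k. \<integral>\<^sup>+\<omega>. ennreal ((X k \<omega> - D \<omega>)\<^sup>2) \<partial>M) \<longlonglongrightarrow> 0"
  proof -
    have le: "(\<integral>\<^sup>+\<omega>. ennreal ((X k \<omega> - D \<omega>)\<^sup>2) \<partial>M) \<le> 2 * ?a t k + 2 * ?a s k" for k
    proof -
      have "(\<integral>\<^sup>+\<omega>. ennreal ((X k \<omega> - D \<omega>)\<^sup>2) \<partial>M) \<le>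
        (\<integral>\<^sup>+\<omega>. 2 * ennreal ((stoch_sum (\<lambda>i. min t (\<tau> k i)) (x k) (n k) \<omega> - v \<bullet> I t \<omega>)\<^sup>2) +
           2 * ennreal ((stoch_sum (\<lambda>i. min s (\<tau> k i)) (x k) (n k) \<omega> - v \<bullet> I s \<omega>)\<^sup>2) \<partial>M)"
      proof (intro nn_integral_mono)
        fix \<omega>
        let ?p = "stoch_sum (\<lambda>i. min t (\<tau> k i)) (x k) (n k) \<omega> - v \<bullet> I t \<omega>"
        let ?q = "stoch_sum (\<lambda>i. min s (\<tau> k i)) (x k) (n k) \<omega> - v \<bullet> I s \<omega>"
        have "(X k \<omega> - D \<omega>)\<^sup>2 \<le> 2 * ?p\<^sup>2 + 2 * ?q\<^sup>2"
        proof -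
          have "X k \<omega> - D \<omega> = ?p + - ?q" by (simp add: X_def D_def inner_diff_right)
          then show ?thesis using sum_squared_le[of ?p "- ?q"] by (simp only: power2_minus)
        qed
        then have "ennreal ((X k \<omega> - D \<omega>)\<^sup>2) \<le> ennreal (2 * ?p\<^sup>2 + 2 * ?q\<^sup>2)" by (rule ennreal_leI)
        also have "\<dots> = 2 * ennreal (?p\<^sup>2) + 2 * ennreal (?q\<^sup>2)" by (simp add: ennreal_mult ennreal_plus)
        finally show "ennreal ((X k \<omega> - D \<omega>)\<^sup>2) \<le> 2 * ennreal (?p\<^sup>2) + 2 * ennreal (?q\<^sup>2)" .
      qed
      also have "\<dots> = 2 * ?a t k + 2 * ?a s k"
        using Sm[OF t0] Sm[OF st(1)] I_measurable[OF st(1)] I_measurable[OF t0]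
        by (subst nn_integral_add) (auto simp: nn_integral_cmult)
      finally show ?thesis .
    qed
    have "(\<lambda>k. 2 * ?a t k + 2 * ?a s k) \<longlonglongrightarrow> 2 * 0 + 2 * 0"
      by (intro tendsto_add ennreal_tendsto_cmult limI st t0) auto
    then have lim0: "(\<lambda>k. 2 * ?a t k + 2 * ?a s k) \<longlonglongrightarrow> 0" by simp
    show ?thesis
      by (rule tendsto_sandwich[OF _ _ tendsto_const lim0]) (use le in \<open>auto intro!: always_eventually\<close>)
  qed
  note L2 = L2_limit_fourth_moment[OF inc Dm lim]
  show "integrable M (\<lambda>\<omega>. D \<omega> ^ 4)" by (rule L2(1))
  show "expectation (\<lambda>\<omega>. D \<omega> ^ 4) \<le> 9 * (real CARD('d))\<^sup>2 * ?K ^ 4 * (t - s)\<^sup>2" by (rule L2(2))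
  fix G :: "'a \<Rightarrow> real" and B assume G: "G \<in> borel_measurable (F s)" "\<And>\<omega>. \<omega> \<in> space M \<Longrightarrow> \<bar>G \<omega>\<bar> \<le> B"
  have GM: "G \<in> borel_measurable M" using measurable_F_M[OF G(1)] .
  have B0: "0 \<le> B" using G(2) not_empty by (meson abs_ge_zero ex_in_conv order_trans)
  have xM: "x k i \<in> borel_measurable M" if "i < n k" for k i using measurable_F_M[OF xm[OF that]] .
  have stj: "jointly_measurable t M (?st k)" for k
    by (rule step_process_jointly_measurable) (rule xM)
  have hj: "jointly_measurable t M ?h" by (rule row_progressive(2)[OF t0])
  have dj: "jointly_measurable t M (\<lambda>u \<omega>. (norm (?st k u \<omega> - ?h u \<omega>))\<^sup>2)" for k
  proof -
    have "jointly_measurable t M (\<lambda>u \<omega>. ?st k u \<omega> - ?h u \<omega>)"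
      using stj[of k] hj unfolding split_beta' by (rule borel_measurable_diff)
    then show ?thesis by (rule jointly_measurable_compose) measurable
  qed
  have stK: "norm (?st k u \<omega>) \<le> ?K" for k u \<omega> by (intro norm_step_process_le \<tau> K0 xK)
  have dK: "norm (?st k u \<omega> - ?h u \<omega>) \<le> 2 * ?K" if "0 \<le> u" "\<omega> \<in> space M" for k u \<omega>
    using norm_triangle_ineq4[of "?st k u \<omega>" "?h u \<omega>"] stK[of k u \<omega>] H_bound[OF that, of v] by linarith
  define e where "e k = expectation (\<lambda>\<omega>. set_lebesgue_integral lborel {s..t} (\<lambda>u. (norm (?st k u \<omega> - ?h u \<omega>))\<^sup>2))" for k
  have d2K: "0 \<le> (norm (?st k u \<omega> - ?h u \<omega>))\<^sup>2 \<and> (norm (?st k u \<omega> - ?h u \<omega>))\<^sup>2 \<le> (2 * ?K)\<^sup>2" if "u \<in> {s..t}" "\<omega> \<in> space M" for k u \<omega>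
    using dK[of u \<omega> k] that st by (intro conjI zero_le_power2 power_mono) auto
  let ?q = "\<lambda>k \<omega>. set_lebesgue_integral lborel {s..t} (\<lambda>u. (norm (?st k u \<omega> - ?h u \<omega>))\<^sup>2)"
  have en1: "(\<integral>\<^sup>+\<omega>. (\<integral>\<^sup>+u\<in>{s..t}. ennreal ((norm (?st k u \<omega> - ?h u \<omega>))\<^sup>2) \<partial>lborel) \<partial>M) = ennreal (e k)" for k
    unfolding e_def by (rule nn_integral_time_bounded(1)[OF dj st d2K])
  have en2: "integrable M (?q k)" for k
    by (rule nn_integral_time_bounded(2)[OF dj st d2K])
  have en3: "0 \<le> ?q k \<omega>" if "\<omega> \<in> space M" for k \<omega>
    by (rule nn_integral_time_bounded(3)[OF dj st d2K that, THEN conjunct1])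
  have e0: "0 \<le> e k" for k unfolding e_def using en3 by (intro integral_nonneg_AE AE_I2) auto
  have e_lim: "e \<longlonglongrightarrow> 0"
  proof -
    have "ennreal (e k) \<le> (\<integral>\<^sup>+\<omega>. (\<integral>\<^sup>+u\<in>{0..t}. ennreal ((norm (?st k u \<omega> - ?h u \<omega>))\<^sup>2) \<partial>lborel) \<partial>M)" for k
      unfolding en1[symmetric] using st by (intro nn_integral_mono) (auto split: split_indicator)
    then have "(\<lambda>k. ennreal (e k)) \<longlonglongrightarrow> 0"
      by (intro tendsto_sandwich[OF _ _ tendsto_const limH[OF t0]]) auto
    then show ?thesis using e0 by (simp add: ennreal_tendsto_0_iff)
  qed
  have path: "set_integrable lborel {s..t} (\<lambda>u. (norm (?st k u \<omega>))\<^sup>2)"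
    "set_integrable lborel {s..t} (\<lambda>u. (norm (?h u \<omega>))\<^sup>2)"
    "set_integrable lborel {s..t} (\<lambda>u. (norm (?st k u \<omega> - ?h u \<omega>))\<^sup>2)" if w: "\<omega> \<in> space M" for k \<omega>
  proof -
    have j1: "jointly_measurable t M (\<lambda>u \<omega>. (norm (?st k u \<omega>))\<^sup>2)"
      by (rule jointly_measurable_compose[OF stj]) measurable
    show "set_integrable lborel {s..t} (\<lambda>u. (norm (?st k u \<omega>))\<^sup>2)"
      using stK by (intro bounded_path_set_integrable[where C="?K\<^sup>2", OF j1 w st(1)]) (auto intro!: power_mono)
    show "set_integrable lborel {s..t} (\<lambda>u. (norm (?h u \<omega>))\<^sup>2)"
      using row_product_integrable[OF st w, of v v] by (simp add: power2_norm_eq_inner)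
    show "set_integrable lborel {s..t} (\<lambda>u. (norm (?st k u \<omega> - ?h u \<omega>))\<^sup>2)"
      using d2K w by (intro bounded_path_set_integrable[where C="(2 * ?K)\<^sup>2", OF dj w st(1)]) auto
  qed
  have cov: "covariation v v s t \<omega> = set_lebesgue_integral lborel {s..t} (\<lambda>u. (norm (?h u \<omega>))\<^sup>2)" for \<omega>
    unfolding covariation_def by (simp add: power2_norm_eq_inner)
  \<comment> \<open>The difference of two squared norms is at most \<open>2 * ?K\<close> times the
    norm of the difference, since both processes are bounded by \<open>?K\<close>; Young's
    inequality then makes the bound quadratic in that norm.\<close>
  have close: "\<bar>set_lebesgue_integral lborel {s..t} (\<lambda>u. (norm (?st k u \<omega>))\<^sup>2) - covariation v v s t \<omega>\<bar>
     \<le> 2 * ?K * (\<eta> * (t - s) + set_lebesgue_integral lborel {s..t} (\<lambda>u. (norm (?st k u \<omega> - ?h u \<omega>))\<^sup>2) / \<eta>)"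
    if w: "\<omega> \<in> space M" and \<eta>: "0 < \<eta>" for k \<omega> \<eta>
  proof -
    let ?f = "\<lambda>u. (norm (?st k u \<omega>))\<^sup>2 - (norm (?h u \<omega>))\<^sup>2"
    let ?g = "\<lambda>u. 2 * ?K * (\<eta> + (norm (?st k u \<omega> - ?h u \<omega>))\<^sup>2 / \<eta>)"
    have fi: "set_integrable lborel {s..t} ?f" using path[OF w] by (intro set_integral_diff)
    have ci: "set_integrable lborel {s..t} (\<lambda>u. \<eta>)"
      by (auto simp: set_integrable_def intro: integrable_indicator_Icc)
    have gi: "set_integrable lborel {s..t} ?g"
      using path(3)[OF w, of k] ci by (intro set_integrable_mult_right set_integral_add set_integrable_divide)
    have le: "\<bar>?f u\<bar> \<le> ?g u" if "u \<in> {s..t}" for u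
    proof -
      have u: "0 \<le> u" using that st by simp
      have "\<bar>?f u\<bar> = \<bar>norm (?st k u \<omega>) - norm (?h u \<omega>)\<bar> * \<bar>norm (?st k u \<omega>) + norm (?h u \<omega>)\<bar>"
        by (simp add: power2_eq_square square_diff_square_factored abs_mult mult.commute)
      also have "\<dots> \<le> norm (?st k u \<omega> - ?h u \<omega>) * (2 * ?K)"
        using stK[of k u \<omega>] H_bound[OF u w, of v] by (intro mult_mono norm_triangle_ineq3) auto
      also have "\<dots> \<le> (\<eta> + (norm (?st k u \<omega> - ?h u \<omega>))\<^sup>2 / \<eta>) * (2 * ?K)"
        using abs_le_young[OF \<eta>, of "norm (?st k u \<omega> - ?h u \<omega>)"] K0 by (intro mult_right_mono) auto
      finally show ?thesis by (simp add: mult.commute)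
    qed
    have "set_lebesgue_integral lborel {s..t} ?f \<le> set_lebesgue_integral lborel {s..t} ?g"
      by (intro set_integral_mono fi gi) (use le in force)
    moreover have "set_lebesgue_integral lborel {s..t} (\<lambda>u. - ?f u) \<le> set_lebesgue_integral lborel {s..t} ?g"
    proof (intro set_integral_mono gi)
      show "set_integrable lborel {s..t} (\<lambda>u. - ?f u)" using set_integral_diff(1)[OF path(2)[OF w] path(1)[OF w, of k]] by simp
      show "- ?f u \<le> ?g u" if "u \<in> {s..t}" for u using le[OF that] by linarith
    qed
    ultimately have "\<bar>set_lebesgue_integral lborel {s..t} ?f\<bar> \<le> set_lebesgue_integral lborel {s..t} ?g"
      using set_integral_uminus[OF fi] by simp
    also have "\<dots> = 2 * ?K * (\<eta> * (t - s) + set_lebesgue_integral lborel {s..t} (\<lambda>u. (norm (?st k u \<omega> - ?h u \<omega>))\<^sup>2) / \<eta>)"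
    proof -
      have "set_lebesgue_integral lborel {s..t} (\<lambda>u. \<eta>) = \<eta> * (t - s)"
        using st by (simp add: set_lebesgue_integral_def mult.commute)
      moreover have "set_integrable lborel {s..t} (\<lambda>u. (norm (?st k u \<omega> - ?h u \<omega>))\<^sup>2 / \<eta>)"
        by (intro set_integrable_divide path(3)[OF w])
      ultimately show ?thesis
        using set_integral_add(2)[OF ci] by simp
    qed
    finally show ?thesis unfolding cov using set_integral_diff(2)[OF path(1)[OF w, of k] path(2)[OF w]] by simp
  qed
  have stm: "(\<lambda>\<omega>. set_lebesgue_integral lborel {s..t} (\<lambda>u. (norm (?st k u \<omega>))\<^sup>2)) \<in> borel_measurable M" for k
    by (rule time_integral_measurable[OF jointly_measurable_compose[OF stj] st(1)]) measurable
  have stb: "\<bar>set_lebesgue_integral lborel {s..t} (\<lambda>u. (norm (?st k u \<omega>))\<^sup>2)\<bar> \<le> ?K\<^sup>2 * (t - s)" if "\<omega> \<in> space M" for k \<omega>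
    using stK st by (intro set_integral_abs_bound path that) (auto intro!: power_mono)
  have Gst: "integrable M (\<lambda>\<omega>. G \<omega> * set_lebesgue_integral lborel {s..t} (\<lambda>u. (norm (?st k u \<omega>))\<^sup>2))" for k
    using stb stm GM G(2) B0
    by (intro integrable_const_bound[where B="B * (?K\<^sup>2 * (t - s))"]) (auto simp: abs_mult intro!: AE_I2 mult_mono)
  have Gcov: "integrable M (\<lambda>\<omega>. G \<omega> * covariation v v s t \<omega>)"
    using covariation_bound[OF st] covariation_measurable[OF st] GM G(2) B0
    by (intro integrable_const_bound[where B="B * (K\<^sup>2 * norm v * norm v * (t - s))"]) (auto simp: abs_mult intro!: AE_I2 mult_mono)
  have "(\<lambda>k. expectation (\<lambda>\<omega>. G \<omega> * set_lebesgue_integral lborel {s..t} (\<lambda>u. (norm (?st k u \<omega>))\<^sup>2)))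
      \<longlonglongrightarrow> expectation (\<lambda>\<omega>. G \<omega> * covariation v v s t \<omega>)"
  proof (rule tendsto_if_young_bounded[OF e_lim e0, of _ _ "B * (2 * ?K) * (1 + (t - s))"], intro always_eventually allI impI)
    fix k and \<eta> :: real assume \<eta>: "0 < \<eta>"
    let ?r = "\<lambda>\<omega>. set_lebesgue_integral lborel {s..t} (\<lambda>u. (norm (?st k u \<omega>))\<^sup>2)"
    have "\<bar>expectation (\<lambda>\<omega>. G \<omega> * ?r \<omega>) - expectation (\<lambda>\<omega>. G \<omega> * covariation v v s t \<omega>)\<bar>
       = \<bar>expectation (\<lambda>\<omega>. G \<omega> * ?r \<omega> - G \<omega> * covariation v v s t \<omega>)\<bar>"
      using Gst Gcov by simp
    also have "\<dots> \<le> expectation (\<lambda>\<omega>. \<bar>G \<omega> * ?r \<omega> - G \<omega> * covariation v v s t \<omega>\<bar>)" by (rule integral_abs_bound)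
    also have "\<dots> \<le> expectation (\<lambda>\<omega>. B * (2 * ?K * (\<eta> * (t - s) + ?q k \<omega> / \<eta>)))"
    proof (rule integral_mono)
      show "integrable M (\<lambda>\<omega>. \<bar>G \<omega> * ?r \<omega> - G \<omega> * covariation v v s t \<omega>\<bar>)" using Gst Gcov by simp
      show "integrable M (\<lambda>\<omega>. B * (2 * ?K * (\<eta> * (t - s) + ?q k \<omega> / \<eta>)))" using en2[of k] by simp
      fix \<omega> assume w: "\<omega> \<in> space M"
      have "\<bar>G \<omega> * ?r \<omega> - G \<omega> * covariation v v s t \<omega>\<bar> = \<bar>G \<omega>\<bar> * \<bar>?r \<omega> - covariation v v s t \<omega>\<bar>"
        by (simp add: right_diff_distrib[symmetric] abs_mult)
      also have "\<dots> \<le> B * (2 * ?K * (\<eta> * (t - s) + ?q k \<omega> / \<eta>))"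
        using close[OF w \<eta>, of k] G(2)[OF w] B0 by (intro mult_mono) auto
      finally show "\<bar>G \<omega> * ?r \<omega> - G \<omega> * covariation v v s t \<omega>\<bar> \<le> B * (2 * ?K * (\<eta> * (t - s) + ?q k \<omega> / \<eta>))" .
    qed
    also have "\<dots> = B * (2 * ?K) * (\<eta> * (t - s) + e k / \<eta>)"
      using en2[of k] by (simp add: e_def prob_space)
    also have "\<dots> \<le> B * (2 * ?K) * ((1 + (t - s)) * (\<eta> + e k + e k / \<eta>))"
    proof -
      have "\<eta> * (t - s) \<le> \<eta> * (1 + (t - s))" "e k / \<eta> \<le> (e k + e k / \<eta>) * (1 + (t - s))"
        using \<eta> st e0[of k] mult_left_mono[of 1 "1 + (t - s)" "e k + e k / \<eta>"] mult_left_mono[of "t - s" "1 + (t - s)" \<eta>]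
        by auto
      then show ?thesis using B0 K0 by (intro mult_left_mono) (auto simp: algebra_simps)
    qed
    finally show "\<bar>expectation (\<lambda>\<omega>. G \<omega> * ?r \<omega>) - expectation (\<lambda>\<omega>. G \<omega> * covariation v v s t \<omega>)\<bar>
      \<le> B * (2 * ?K) * (1 + (t - s)) * (\<eta> + e k + e k / \<eta>)" by (simp add: mult.assoc)
  qed
  \<comment> \<open>By the isometry of the sums, \<open>inc4\<close>, this is the same sequence as
    the one whose limit was just found.\<close>
  then have "(\<lambda>k. expectation (\<lambda>\<omega>. G \<omega> * (X k \<omega>)\<^sup>2)) \<longlonglongrightarrow> expectation (\<lambda>\<omega>. G \<omega> * covariation v v s t \<omega>)"
    using inc4[OF G] by simp
  moreover have "(\<lambda>k. expectation (\<lambda>\<omega>. G \<omega> * (X k \<omega>)\<^sup>2)) \<longlonglongrightarrow> expectation (\<lambda>\<omega>. G \<omega> * (D \<omega>)\<^sup>2)"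
    by (rule L2(4)[OF GM G(2)])
  ultimately have "expectation (\<lambda>\<omega>. G \<omega> * (D \<omega>)\<^sup>2) = expectation (\<lambda>\<omega>. G \<omega> * covariation v v s t \<omega>)"
    using LIMSEQ_unique by blast
  moreover have "expectation (\<lambda>\<omega>. G \<omega> * D \<omega>) = 0"
    using L2(3)[OF GM G(2)] inc4[OF G] by (simp add: LIMSEQ_const_iff)
  ultimately show "expectation (\<lambda>\<omega>. G \<omega> * D \<omega>) = 0 \<and>
      expectation (\<lambda>\<omega>. G \<omega> * (D \<omega>)\<^sup>2) = expectation (\<lambda>\<omega>. G \<omega> * covariation v v s t \<omega>)" by simp
qed

end

section \<open>Unbounded test variables\<close>

definition clamp_abs :: "nat \<Rightarrow> real \<Rightarrow> real"
  where "clamp_abs m x = max (- real m) (min (real m) x)"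

lemma clamp_abs_le: "\<bar>clamp_abs m x\<bar> \<le> real m" "\<bar>clamp_abs m x\<bar> \<le> \<bar>x\<bar>"
  by (auto simp: clamp_abs_def min_def max_def)

lemma clamp_abs_tendsto: "(\<lambda>m. clamp_abs m x) \<longlonglongrightarrow> x"
proof (rule tendsto_eventually)
  obtain N :: nat where "\<bar>x\<bar> \<le> N" using real_arch_simple by blast
  then have "clamp_abs m x = x" if "N \<le> m" for m using that by (auto simp: clamp_abs_def)
  then show "\<forall>\<^sub>F m in sequentially. clamp_abs m x = x" by (auto simp: eventually_sequentially)
qed

lemma clamp_abs_measurable: "clamp_abs m \<in> borel_measurable borel"
  unfolding clamp_abs_def by measurable

lemma (in prob_space) expectation_clamp_tendsto:
  fixes G X :: "'a \<Rightarrow> real"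
  assumes "G \<in> borel_measurable M" "X \<in> borel_measurable M" "integrable M (\<lambda>\<omega>. G \<omega> * X \<omega>)"
  shows "(\<lambda>m. expectation (\<lambda>\<omega>. clamp_abs m (G \<omega>) * X \<omega>)) \<longlonglongrightarrow> expectation (\<lambda>\<omega>. G \<omega> * X \<omega>)"
proof (rule integral_dominated_convergence[where w="\<lambda>\<omega>. \<bar>G \<omega> * X \<omega>\<bar>"])
  show "AE \<omega> in M. (\<lambda>m. clamp_abs m (G \<omega>) * X \<omega>) \<longlonglongrightarrow> G \<omega> * X \<omega>"
    by (intro AE_I2 tendsto_mult clamp_abs_tendsto tendsto_const)
  show "AE \<omega> in M. norm (clamp_abs m (G \<omega>) * X \<omega>) \<le> \<bar>G \<omega> * X \<omega>\<bar>" for m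
    using clamp_abs_le(2) by (intro AE_I2) (auto simp: abs_mult intro!: mult_right_mono)
  show "(\<lambda>\<omega>. clamp_abs m (G \<omega>) * X \<omega>) \<in> borel_measurable M" for m
    using assms measurable_compose[OF assms(1) clamp_abs_measurable] by measurable
qed (use assms in auto)

context bounded_ito_integral begin

definition incr :: "real^'n \<Rightarrow> real \<Rightarrow> real \<Rightarrow> 'a \<Rightarrow> real"
  where "incr v s t \<omega> = v \<bullet> (I t \<omega> - I s \<omega>)"

lemma incr_measurable: "0 \<le> s \<Longrightarrow> s \<le> t \<Longrightarrow> incr v s t \<in> borel_measurable M"
  unfolding incr_def[abs_def] using I_measurable[of s] I_measurable[of t] by simp

lemma incr_fourth_moment:
  assumes "0 \<le> s" "s \<le> t"
  shows "integrable M (\<lambda>\<omega>. incr v s t \<omega> ^ 4)"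
    and "expectation (\<lambda>\<omega>. incr v s t \<omega> ^ 4) \<le> 9 * (real CARD('d))\<^sup>2 * (K * norm v) ^ 4 * (t - s)\<^sup>2"
  unfolding incr_def by (rule increment_bounded_test[OF assms])+

text \<open>Truncating \<open>G\<close> keeps it measurable with respect to the past, and the
  truncated products are dominated by the product itself.\<close>

lemma incr_orthogonal:
  fixes G :: "'a \<Rightarrow> real"
  assumes st: "0 \<le> s" "s \<le> t" and G: "G \<in> borel_measurable (F s)" "integrable M (\<lambda>\<omega>. G \<omega> * incr v s t \<omega>)"
  shows "expectation (\<lambda>\<omega>. G \<omega> * incr v s t \<omega>) = 0"
proof -
  have "expectation (\<lambda>\<omega>. clamp_abs m (G \<omega>) * incr v s t \<omega>) = 0" for m
    unfolding incr_def
    by (rule increment_bounded_test(3)[OF st measurable_compose[OF G(1) clamp_abs_measurable] clamp_abs_le(1), THEN conjunct1])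
  then have "(\<lambda>m. 0) \<longlonglongrightarrow> expectation (\<lambda>\<omega>. G \<omega> * incr v s t \<omega>)"
    using expectation_clamp_tendsto[OF measurable_F_M[OF G(1)] incr_measurable[OF st, of v] G(2)] by simp
  then show ?thesis by (simp add: LIMSEQ_const_iff)
qed

lemma integrable_mult_covariation:
  assumes st: "0 \<le> s" "s \<le> t" and G: "integrable M G"
  shows "integrable M (\<lambda>\<omega>. G \<omega> * covariation v w s t \<omega>)"
proof (rule Bochner_Integration.integrable_bound)
  show "integrable M (\<lambda>\<omega>. K\<^sup>2 * norm v * norm w * (t - s) * G \<omega>)" using G by simp
  show "(\<lambda>\<omega>. G \<omega> * covariation v w s t \<omega>) \<in> borel_measurable M"
    using G covariation_measurable[OF st] by measurable
  show "AE \<omega> in M. norm (G \<omega> * covariation v w s t \<omega>) \<le> norm (K\<^sup>2 * norm v * norm w * (t - s) * G \<omega>)"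
  proof (rule AE_I2)
    fix \<omega> assume "\<omega> \<in> space M"
    from covariation_bound[OF st this, of v w]
    have "\<bar>G \<omega>\<bar> * \<bar>covariation v w s t \<omega>\<bar> \<le> \<bar>G \<omega>\<bar> * \<bar>K\<^sup>2 * norm v * norm w * (t - s)\<bar>"
      by (intro mult_left_mono) auto
    then show "norm (G \<omega> * covariation v w s t \<omega>) \<le> norm (K\<^sup>2 * norm v * norm w * (t - s) * G \<omega>)"
      by (simp add: abs_mult mult_ac)
  qed
qed

lemma integrable_mult_incr_squared:
  assumes st: "0 \<le> s" "s \<le> t" and G: "G \<in> borel_measurable M" "integrable M (\<lambda>\<omega>. (G \<omega>)\<^sup>2)"
  shows "integrable M (\<lambda>\<omega>. G \<omega> * (incr v s t \<omega>)\<^sup>2)"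
proof (rule Bochner_Integration.integrable_bound)
  show "integrable M (\<lambda>\<omega>. (G \<omega>)\<^sup>2 + incr v s t \<omega> ^ 4)" using G incr_fourth_moment[OF st] by simp
  show "(\<lambda>\<omega>. G \<omega> * (incr v s t \<omega>)\<^sup>2) \<in> borel_measurable M" using G incr_measurable[OF st] by measurable
  have "\<bar>a * b\<^sup>2\<bar> \<le> a\<^sup>2 + b ^ 4" for a b :: real
  proof -
    have "0 \<le> (\<bar>a\<bar> - b\<^sup>2)\<^sup>2" by simp
    also have "\<dots> = a\<^sup>2 + b ^ 4 - 2 * \<bar>a * b\<^sup>2\<bar>"
      by (simp add: power2_diff abs_mult)
    finally show ?thesis using abs_ge_zero[of "a * b\<^sup>2"] by linarith
  qed
  then show "AE \<omega> in M. norm (G \<omega> * (incr v s t \<omega>)\<^sup>2) \<le> norm ((G \<omega>)\<^sup>2 + incr v s t \<omega> ^ 4)"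
    by (intro AE_I2) (auto intro: order_trans[OF _ abs_ge_self])
qed

text \<open>Truncation again. Square integrability of \<open>G\<close> is paired with the fourth
  moment of the increment, which makes both sides dominated.\<close>

lemma incr_isometry_diag:
  fixes G :: "'a \<Rightarrow> real"
  assumes st: "0 \<le> s" "s \<le> t" and G: "G \<in> borel_measurable (F s)" "integrable M (\<lambda>\<omega>. (G \<omega>)\<^sup>2)"
  shows "expectation (\<lambda>\<omega>. G \<omega> * (incr v s t \<omega>)\<^sup>2) = expectation (\<lambda>\<omega>. G \<omega> * covariation v v s t \<omega>)"
proof -
  have GM: "G \<in> borel_measurable M" by (rule measurable_F_M[OF G(1)])
  have "expectation (\<lambda>\<omega>. clamp_abs m (G \<omega>) * (incr v s t \<omega>)\<^sup>2) = expectation (\<lambda>\<omega>. clamp_abs m (G \<omega>) * covariation v v s t \<omega>)" for m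
    unfolding incr_def
    by (rule increment_bounded_test(3)[OF st measurable_compose[OF G(1) clamp_abs_measurable] clamp_abs_le(1), THEN conjunct2])
  note eq = this
  have 1: "(\<lambda>m. expectation (\<lambda>\<omega>. clamp_abs m (G \<omega>) * (incr v s t \<omega>)\<^sup>2)) \<longlonglongrightarrow> expectation (\<lambda>\<omega>. G \<omega> * (incr v s t \<omega>)\<^sup>2)"
    using incr_measurable[OF st, of v] by (intro expectation_clamp_tendsto GM integrable_mult_incr_squared[OF st GM G(2)]) measurable
  have 2: "(\<lambda>m. expectation (\<lambda>\<omega>. clamp_abs m (G \<omega>) * covariation v v s t \<omega>)) \<longlonglongrightarrow> expectation (\<lambda>\<omega>. G \<omega> * covariation v v s t \<omega>)"
    by (intro expectation_clamp_tendsto GM covariation_measurable[OF st] integrable_mult_covariation[OF st square_integrable_imp_integrable[OF GM G(2)]])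
  show ?thesis by (rule LIMSEQ_unique[OF 1 2[folded eq]])
qed

text \<open>Polarisation of the diagonal case in the directions \<open>v\<close>, \<open>w\<close>
  and \<open>v + w\<close>; both the product of increments and the covariation are bilinear.\<close>

lemma incr_isometry:
  fixes G :: "'a \<Rightarrow> real"
  assumes st: "0 \<le> s" "s \<le> t" and G: "G \<in> borel_measurable (F s)" "integrable M (\<lambda>\<omega>. (G \<omega>)\<^sup>2)"
  shows "integrable M (\<lambda>\<omega>. G \<omega> * (incr v s t \<omega> * incr w s t \<omega>))"
    and "expectation (\<lambda>\<omega>. G \<omega> * (incr v s t \<omega> * incr w s t \<omega>)) = expectation (\<lambda>\<omega>. G \<omega> * covariation v w s t \<omega>)"
proof -
  have GM: "G \<in> borel_measurable M" by (rule measurable_F_M[OF G(1)])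
  have G1: "integrable M G" by (rule square_integrable_imp_integrable[OF GM G(2)])
  note sq = integrable_mult_incr_squared[OF st GM G(2)]
  note cv = integrable_mult_covariation[OF st G1]
  have e: "G \<omega> * (incr v s t \<omega> * incr w s t \<omega>) =
     (G \<omega> * (incr (v + w) s t \<omega>)\<^sup>2 - G \<omega> * (incr v s t \<omega>)\<^sup>2 - G \<omega> * (incr w s t \<omega>)\<^sup>2) / 2" for \<omega>
  proof -
    have "incr (v + w) s t \<omega> = incr v s t \<omega> + incr w s t \<omega>" by (simp add: incr_def inner_add_left)
    then have "(incr (v + w) s t \<omega>)\<^sup>2 = (incr v s t \<omega>)\<^sup>2 + (incr w s t \<omega>)\<^sup>2 + 2 * (incr v s t \<omega> * incr w s t \<omega>)"
      by (simp add: power2_sum)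
    then show ?thesis by (simp add: distrib_left)
  qed
  show "integrable M (\<lambda>\<omega>. G \<omega> * (incr v s t \<omega> * incr w s t \<omega>))"
    unfolding e using sq by simp
  have c: "G \<omega> * covariation v w s t \<omega> =
     (G \<omega> * covariation (v + w) (v + w) s t \<omega> - G \<omega> * covariation v v s t \<omega> - G \<omega> * covariation w w s t \<omega>) / 2"
    if w: "\<omega> \<in> space M" for \<omega>
  proof -
    note i = row_product_integrable[OF st w]
    have "covariation (v + w) (v + w) s t \<omega> = set_lebesgue_integral lborel {s..t}
        (\<lambda>u. ((v v* H u \<omega>) \<bullet> (v v* H u \<omega>) + (w v* H u \<omega>) \<bullet> (w v* H u \<omega>)) + ((v v* H u \<omega>) \<bullet> (w v* H u \<omega>) + (v v* H u \<omega>) \<bullet> (w v* H u \<omega>)))"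
      unfolding covariation_def vector_matrix_left_distrib
      by (intro arg_cong[where f="set_lebesgue_integral lborel {s..t}"] ext) (simp add: inner_add_left inner_add_right inner_commute)
    also have "\<dots> = (covariation v v s t \<omega> + covariation w w s t \<omega>) + (covariation v w s t \<omega> + covariation v w s t \<omega>)"
      unfolding covariation_def using i by (simp add: set_integral_add)
    finally show ?thesis by (simp add: algebra_simps)
  qed
  have "expectation (\<lambda>\<omega>. G \<omega> * (incr v s t \<omega> * incr w s t \<omega>)) =
     (expectation (\<lambda>\<omega>. G \<omega> * (incr (v + w) s t \<omega>)\<^sup>2) - expectation (\<lambda>\<omega>. G \<omega> * (incr v s t \<omega>)\<^sup>2) - expectation (\<lambda>\<omega>. G \<omega> * (incr w s t \<omega>)\<^sup>2)) / 2"
    unfolding e using sq by simp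
  also have "\<dots> = (expectation (\<lambda>\<omega>. G \<omega> * covariation (v + w) (v + w) s t \<omega>) - expectation (\<lambda>\<omega>. G \<omega> * covariation v v s t \<omega>)
       - expectation (\<lambda>\<omega>. G \<omega> * covariation w w s t \<omega>)) / 2"
    unfolding incr_isometry_diag[OF st G] ..
  also have "\<dots> = expectation (\<lambda>\<omega>. (G \<omega> * covariation (v + w) (v + w) s t \<omega> - G \<omega> * covariation v v s t \<omega> - G \<omega> * covariation w w s t \<omega>) / 2)"
    using cv by simp
  also have "\<dots> = expectation (\<lambda>\<omega>. G \<omega> * covariation v w s t \<omega>)"
    by (rule Bochner_Integration.integral_cong[OF refl]) (rule c[symmetric])
  finally show "expectation (\<lambda>\<omega>. G \<omega> * (incr v s t \<omega> * incr w s t \<omega>)) = expectation (\<lambda>\<omega>. G \<omega> * covariation v w s t \<omega>)" .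
qed

end

section \<open>Square integrability\<close>

text \<open>The discriminant argument behind Cauchy-Schwarz, by inserting the minimiser
  \<open>c = p / z\<close>.\<close>

lemma square_le_if_quadratic_nonneg:
  fixes x z p :: real
  assumes "0 \<le> x" "0 \<le> z" "0 \<le> p" and q: "\<And>c. 2 * c * p \<le> x + c\<^sup>2 * z"
  shows "p\<^sup>2 \<le> x * z"
proof (cases "z = 0")
  case True
  have "p \<le> 0"
  proof (rule ccontr)
    assume "\<not> p \<le> 0"
    \<comment> \<open>For \<open>z = 0\<close> the assumption bounds a multiple of \<open>c\<close>
      by \<open>x\<close> for every \<open>c\<close>, which this choice of \<open>c\<close>
      violates.\<close>
    then have "2 * ((x + 1) / p) * p = 2 * (x + 1)" by simp
    then show False using q[of "(x + 1) / p"] True assms by simp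
  qed
  then show ?thesis using True assms by simp
next
  case False
  then have "0 < z" using assms by simp
  with q[of "p / z"] show ?thesis by (simp add: field_simps power2_eq_square)
qed

context prob_space begin

definition square_integrable :: "('a \<Rightarrow> real) \<Rightarrow> bool"
  where "square_integrable X \<longleftrightarrow> X \<in> borel_measurable M \<and> integrable M (\<lambda>\<omega>. (X \<omega>)\<^sup>2)"

definition L2_norm :: "('a \<Rightarrow> real) \<Rightarrow> real"
  where "L2_norm X = sqrt (expectation (\<lambda>\<omega>. (X \<omega>)\<^sup>2))"

lemma L2_norm_nonneg [simp]: "0 \<le> L2_norm X"
  by (simp add: L2_norm_def)

lemma L2_norm_squared: "(L2_norm X)\<^sup>2 = expectation (\<lambda>\<omega>. (X \<omega>)\<^sup>2)"
  by (simp add: L2_norm_def)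

lemma L2_norm_le: "0 \<le> C \<Longrightarrow> expectation (\<lambda>\<omega>. (X \<omega>)\<^sup>2) \<le> C\<^sup>2 \<Longrightarrow> L2_norm X \<le> C"
  unfolding L2_norm_def by (rule real_le_lsqrt) auto

lemma square_integrableD:
  assumes "square_integrable X"
  shows "X \<in> borel_measurable M" "integrable M (\<lambda>\<omega>. (X \<omega>)\<^sup>2)" "integrable M X" "integrable M (\<lambda>\<omega>. \<bar>X \<omega>\<bar>)"
proof -
  show *: "X \<in> borel_measurable M" "integrable M (\<lambda>\<omega>. (X \<omega>)\<^sup>2)"
    using assms unfolding square_integrable_def by auto
  show "integrable M X" by (rule square_integrable_imp_integrable[OF *])
  then show "integrable M (\<lambda>\<omega>. \<bar>X \<omega>\<bar>)" by simp
qed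

lemma square_integrable_bounded_by:
  assumes "X \<in> borel_measurable M" "integrable M g" "AE \<omega> in M. (X \<omega>)\<^sup>2 \<le> g \<omega>"
  shows "square_integrable X"
  unfolding square_integrable_def
proof
  show "integrable M (\<lambda>\<omega>. (X \<omega>)\<^sup>2)"
    using assms(1,3) by (intro Bochner_Integration.integrable_bound[OF assms(2)]) (auto elim!: eventually_mono)
qed fact

lemma square_integrable_mult:
  assumes "square_integrable X" "square_integrable Z"
  shows "integrable M (\<lambda>\<omega>. X \<omega> * Z \<omega>)"
proof (rule Bochner_Integration.integrable_bound)
  show "integrable M (\<lambda>\<omega>. (X \<omega>)\<^sup>2 + (Z \<omega>)\<^sup>2)" using assms square_integrableD by auto
  show "(\<lambda>\<omega>. X \<omega> * Z \<omega>) \<in> borel_measurable M" using assms square_integrableD(1) by (intro borel_measurable_times)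
  have "\<bar>a * b\<bar> \<le> a\<^sup>2 + b\<^sup>2" for a b :: real
  proof -
    have "0 \<le> (\<bar>a\<bar> - \<bar>b\<bar>)\<^sup>2" by simp
    then have "2 * \<bar>a * b\<bar> \<le> a\<^sup>2 + b\<^sup>2" by (simp add: power2_diff abs_mult)
    then show ?thesis using abs_ge_zero[of "a * b"] by linarith
  qed
  then show "AE \<omega> in M. norm (X \<omega> * Z \<omega>) \<le> norm ((X \<omega>)\<^sup>2 + (Z \<omega>)\<^sup>2)"
    by (intro AE_I2) (auto intro: order_trans[OF _ abs_ge_self])
qed

lemma Cauchy_Schwarz_expectation:
  assumes X: "square_integrable X" and Z: "square_integrable Z"
  shows "expectation (\<lambda>\<omega>. \<bar>X \<omega> * Z \<omega>\<bar>) \<le> L2_norm X * L2_norm Z"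
proof -
  let ?x = "expectation (\<lambda>\<omega>. (X \<omega>)\<^sup>2)" and ?z = "expectation (\<lambda>\<omega>. (Z \<omega>)\<^sup>2)" and ?p = "expectation (\<lambda>\<omega>. \<bar>X \<omega> * Z \<omega>\<bar>)"
  have int: "integrable M (\<lambda>\<omega>. \<bar>X \<omega> * Z \<omega>\<bar>)" using square_integrable_mult[OF X Z] by simp
  have q: "2 * c * ?p \<le> ?x + c\<^sup>2 * ?z" for c
  proof -
    have "0 \<le> expectation (\<lambda>\<omega>. (\<bar>X \<omega>\<bar> - c * \<bar>Z \<omega>\<bar>)\<^sup>2)" by (intro integral_nonneg_AE) auto
    also have "\<dots> = expectation (\<lambda>\<omega>. (X \<omega>)\<^sup>2 + c\<^sup>2 * (Z \<omega>)\<^sup>2 - 2 * c * \<bar>X \<omega> * Z \<omega>\<bar>)"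
      by (intro Bochner_Integration.integral_cong refl) (simp add: power2_diff power_mult_distrib abs_mult)
    also have "\<dots> = ?x + c\<^sup>2 * ?z - 2 * c * ?p"
      using int square_integrableD[OF X] square_integrableD[OF Z] by simp
    finally show ?thesis by simp
  qed
  have x0: "0 \<le> ?x" and z0: "0 \<le> ?z" and p0: "0 \<le> ?p" by (auto intro!: integral_nonneg_AE)
  have "?p\<^sup>2 \<le> ?x * ?z" by (rule square_le_if_quadratic_nonneg[OF x0 z0 p0 q])
  then have "sqrt (?p\<^sup>2) \<le> sqrt (?x * ?z)" by (rule real_sqrt_le_mono)
  then show ?thesis using p0 by (simp add: L2_norm_def real_sqrt_mult)
qed

lemma expectation_abs_le_L2_norm:
  assumes "square_integrable X" shows "expectation (\<lambda>\<omega>. \<bar>X \<omega>\<bar>) \<le> L2_norm X"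
  using Cauchy_Schwarz_expectation[OF assms, of "\<lambda>_. 1"] by (simp add: square_integrable_def L2_norm_def prob_space)

lemma square_integrable_add:
  assumes X: "square_integrable X" and Z: "square_integrable Z"
  shows "square_integrable (\<lambda>\<omega>. X \<omega> + Z \<omega>)" "L2_norm (\<lambda>\<omega>. X \<omega> + Z \<omega>) \<le> L2_norm X + L2_norm Z"
proof -
  have e: "(X \<omega> + Z \<omega>)\<^sup>2 = (X \<omega>)\<^sup>2 + (Z \<omega>)\<^sup>2 + 2 * (X \<omega> * Z \<omega>)" for \<omega> by (simp add: power2_sum)
  note i = square_integrableD[OF X] square_integrableD[OF Z] square_integrable_mult[OF X Z]
  show "square_integrable (\<lambda>\<omega>. X \<omega> + Z \<omega>)"
    unfolding square_integrable_def e using i by simp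
  have "expectation (\<lambda>\<omega>. (X \<omega> + Z \<omega>)\<^sup>2) = (L2_norm X)\<^sup>2 + (L2_norm Z)\<^sup>2 + 2 * expectation (\<lambda>\<omega>. X \<omega> * Z \<omega>)"
    unfolding e L2_norm_squared using i by simp
  also have "\<dots> \<le> (L2_norm X)\<^sup>2 + (L2_norm Z)\<^sup>2 + 2 * (L2_norm X * L2_norm Z)"
    using Cauchy_Schwarz_expectation[OF X Z] integral_abs_bound[of M "\<lambda>\<omega>. X \<omega> * Z \<omega>"] by linarith
  also have "\<dots> = (L2_norm X + L2_norm Z)\<^sup>2" by (simp add: power2_sum)
  finally show "L2_norm (\<lambda>\<omega>. X \<omega> + Z \<omega>) \<le> L2_norm X + L2_norm Z" by (intro L2_norm_le) auto
qed

lemma square_integrable_cmult: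
  assumes X: "square_integrable X"
  shows "square_integrable (\<lambda>\<omega>. c * X \<omega>)" "L2_norm (\<lambda>\<omega>. c * X \<omega>) = \<bar>c\<bar> * L2_norm X"
proof -
  show "square_integrable (\<lambda>\<omega>. c * X \<omega>)" using square_integrableD[OF X]
    unfolding square_integrable_def power_mult_distrib by simp
  show "L2_norm (\<lambda>\<omega>. c * X \<omega>) = \<bar>c\<bar> * L2_norm X"
    unfolding L2_norm_def power_mult_distrib by (simp add: real_sqrt_mult)
qed

lemma square_integrable_diff:
  assumes X: "square_integrable X" and Z: "square_integrable Z"
  shows "square_integrable (\<lambda>\<omega>. X \<omega> - Z \<omega>)" "L2_norm (\<lambda>\<omega>. X \<omega> - Z \<omega>) \<le> L2_norm X + L2_norm Z"
  using square_integrable_add[OF X square_integrable_cmult(1)[OF Z, of "-1"]] square_integrable_cmult(2)[OF Z, of "-1"]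
  by auto

lemma square_integrable_sum:
  assumes "finite A" "\<And>i. i \<in> A \<Longrightarrow> square_integrable (X i)"
  shows "square_integrable (\<lambda>\<omega>. \<Sum>i\<in>A. X i \<omega>)" "L2_norm (\<lambda>\<omega>. \<Sum>i\<in>A. X i \<omega>) \<le> (\<Sum>i\<in>A. L2_norm (X i))"
  using assms
proof (induction A rule: finite_induct)
  case empty
  { case 1 then show ?case by (simp add: square_integrable_def) }
  { case 2 then show ?case by (simp add: L2_norm_def) }
next
  case (insert i A)
  { case 1
    have "square_integrable (\<lambda>\<omega>. X i \<omega> + (\<Sum>i\<in>A. X i \<omega>))"
      using insert 1 by (intro square_integrable_add) auto
    then show ?case using insert by simp }
  { case 2
    then have "L2_norm (\<lambda>\<omega>. X i \<omega> + (\<Sum>i\<in>A. X i \<omega>)) \<le> L2_norm (X i) + L2_norm (\<lambda>\<omega>. \<Sum>i\<in>A. X i \<omega>)"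
      using insert by (intro square_integrable_add(2)) auto
    also have "\<dots> \<le> L2_norm (X i) + (\<Sum>i\<in>A. L2_norm (X i))"
      using insert 2 by (intro add_left_mono) auto
    finally show ?case using insert by simp }
qed

lemma square_integrable_dominated:
  assumes X: "X \<in> borel_measurable M" and Z: "square_integrable Z" and le: "AE \<omega> in M. \<bar>X \<omega>\<bar> \<le> \<bar>Z \<omega>\<bar>"
  shows "square_integrable X" "L2_norm X \<le> L2_norm Z"
proof -
  have le2: "AE \<omega> in M. (X \<omega>)\<^sup>2 \<le> (Z \<omega>)\<^sup>2"
    using le by eventually_elim (metis abs_le_square_iff)
  show si: "square_integrable X"
    by (rule square_integrable_bounded_by[OF X square_integrableD(2)[OF Z] le2])
  show "L2_norm X \<le> L2_norm Z"
    unfolding L2_norm_def using square_integrableD(2)[OF si] square_integrableD(2)[OF Z] le2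
    by (intro real_sqrt_le_mono integral_mono_AE) auto
qed

lemma square_integrable_const: "square_integrable (\<lambda>_. c)" "L2_norm (\<lambda>_. c) = \<bar>c\<bar>"
  by (auto simp: square_integrable_def L2_norm_def prob_space)

text \<open>\<open>fourth_integrable X\<close> is membership in \<open>L\<^sup>4\<close>; products of such variables are handled through their squares.\<close>

definition fourth_integrable :: "('a \<Rightarrow> real) \<Rightarrow> bool"
  where "fourth_integrable X \<longleftrightarrow> X \<in> borel_measurable M \<and> square_integrable (\<lambda>\<omega>. (X \<omega>)\<^sup>2)"

lemma fourth_integrable_iff: "fourth_integrable X \<longleftrightarrow> X \<in> borel_measurable M \<and> integrable M (\<lambda>\<omega>. X \<omega> ^ 4)"
  unfolding fourth_integrable_def square_integrable_def by auto

lemma fourth_integrableD: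
  assumes "fourth_integrable X"
  shows "X \<in> borel_measurable M" "square_integrable X" "square_integrable (\<lambda>\<omega>. (X \<omega>)\<^sup>2)" "integrable M (\<lambda>\<omega>. X \<omega> ^ 4)"
proof -
  show *: "X \<in> borel_measurable M" "square_integrable (\<lambda>\<omega>. (X \<omega>)\<^sup>2)" "integrable M (\<lambda>\<omega>. X \<omega> ^ 4)"
    using assms unfolding fourth_integrable_iff[of X] by (auto simp: square_integrable_def)
  show "square_integrable X"
    using integrable_power_le_4[OF *(1,3), of 2] *(1) by (simp add: square_integrable_def)
qed

text \<open>Hoelder for two factors in L4, kept in terms of L2 norms of squares so that no fourth
  roots appear.\<close>

lemma fourth_integrable_mult:
  assumes X: "fourth_integrable X" and Z: "fourth_integrable Z"
  shows "square_integrable (\<lambda>\<omega>. X \<omega> * Z \<omega>)"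
    "(L2_norm (\<lambda>\<omega>. X \<omega> * Z \<omega>))\<^sup>2 \<le> L2_norm (\<lambda>\<omega>. (X \<omega>)\<^sup>2) * L2_norm (\<lambda>\<omega>. (Z \<omega>)\<^sup>2)"
proof -
  note x = fourth_integrableD[OF X] and z = fourth_integrableD[OF Z]
  show "square_integrable (\<lambda>\<omega>. X \<omega> * Z \<omega>)"
    using square_integrable_mult[OF x(3) z(3)] x(1) z(1) unfolding square_integrable_def power_mult_distrib by simp
  have "expectation (\<lambda>\<omega>. (X \<omega> * Z \<omega>)\<^sup>2) = expectation (\<lambda>\<omega>. \<bar>(X \<omega>)\<^sup>2 * (Z \<omega>)\<^sup>2\<bar>)"
    by (simp add: power_mult_distrib)
  also have "\<dots> \<le> L2_norm (\<lambda>\<omega>. (X \<omega>)\<^sup>2) * L2_norm (\<lambda>\<omega>. (Z \<omega>)\<^sup>2)"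
    by (rule Cauchy_Schwarz_expectation[OF x(3) z(3)])
  finally show "(L2_norm (\<lambda>\<omega>. X \<omega> * Z \<omega>))\<^sup>2 \<le> L2_norm (\<lambda>\<omega>. (X \<omega>)\<^sup>2) * L2_norm (\<lambda>\<omega>. (Z \<omega>)\<^sup>2)"
    unfolding L2_norm_squared .
qed

lemma fourth_integrable_add:
  assumes X: "fourth_integrable X" and Z: "fourth_integrable Z"
  shows "fourth_integrable (\<lambda>\<omega>. X \<omega> + Z \<omega>)"
    "expectation (\<lambda>\<omega>. (X \<omega> + Z \<omega>) ^ 4) \<le> 8 * expectation (\<lambda>\<omega>. X \<omega> ^ 4) + 8 * expectation (\<lambda>\<omega>. Z \<omega> ^ 4)"
proof -
  have i: "integrable M (\<lambda>\<omega>. 8 * X \<omega> ^ 4 + 8 * Z \<omega> ^ 4)" using fourth_integrableD(4)[OF X] fourth_integrableD(4)[OF Z] by simp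
  have p: "(a + b) ^ 4 \<le> 8 * a ^ 4 + 8 * b ^ 4" for a b :: real
  proof -
    have "((a + b)\<^sup>2)\<^sup>2 \<le> (2 * a\<^sup>2 + 2 * b\<^sup>2)\<^sup>2" by (intro power_mono sum_squared_le) auto
    also have "\<dots> \<le> 2 * (2 * a\<^sup>2)\<^sup>2 + 2 * (2 * b\<^sup>2)\<^sup>2" by (rule sum_squared_le)
    finally show ?thesis by (simp add: power_mult_distrib)
  qed
  show *: "fourth_integrable (\<lambda>\<omega>. X \<omega> + Z \<omega>)"
    unfolding fourth_integrable_iff
  proof
    show "(\<lambda>\<omega>. X \<omega> + Z \<omega>) \<in> borel_measurable M" using fourth_integrableD(1)[OF X] fourth_integrableD(1)[OF Z] by simp
    then show "integrable M (\<lambda>\<omega>. (X \<omega> + Z \<omega>) ^ 4)"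
      using p by (intro Bochner_Integration.integrable_bound[OF i]) (auto intro!: AE_I2 simp: zero_le_even_power intro: order_trans[OF _ abs_ge_self])
  qed
  have "expectation (\<lambda>\<omega>. (X \<omega> + Z \<omega>) ^ 4) \<le> expectation (\<lambda>\<omega>. 8 * X \<omega> ^ 4 + 8 * Z \<omega> ^ 4)"
    by (intro integral_mono i p fourth_integrableD(4)[OF *])
  then show "expectation (\<lambda>\<omega>. (X \<omega> + Z \<omega>) ^ 4) \<le> 8 * expectation (\<lambda>\<omega>. X \<omega> ^ 4) + 8 * expectation (\<lambda>\<omega>. Z \<omega> ^ 4)"
    using fourth_integrableD(4)[OF X] fourth_integrableD(4)[OF Z] by simp
qed

lemma L2_norm_le_fourth:
  assumes X: "fourth_integrable X" and C: "0 \<le> C" "expectation (\<lambda>\<omega>. X \<omega> ^ 4) \<le> C ^ 4"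
  shows "L2_norm (\<lambda>\<omega>. (X \<omega>)\<^sup>2) \<le> C\<^sup>2" "L2_norm X \<le> C"
proof -
  show 1: "L2_norm (\<lambda>\<omega>. (X \<omega>)\<^sup>2) \<le> C\<^sup>2"
    using C by (intro L2_norm_le) auto
  have "expectation (\<lambda>\<omega>. (X \<omega>)\<^sup>2) = expectation (\<lambda>\<omega>. \<bar>(X \<omega>)\<^sup>2\<bar>)" by simp
  also have "\<dots> \<le> C\<^sup>2" using expectation_abs_le_L2_norm[OF fourth_integrableD(3)[OF X]] 1 by simp
  finally show "L2_norm X \<le> C" using C by (intro L2_norm_le)
qed

end

section \<open>The equation for \<open>Y\<close>\<close>

lemma vector_matrix_cross_matrix: "v v* cross_matrix m = cross3 v m"
proof -
  have "v v* cross_matrix m = transpose (cross_matrix m) *v v" by simp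
  also have "\<dots> = - (cross_matrix m *v v)"
    unfolding transpose_cross_matrix
    by (simp add: matrix_vector_mult_def vec_eq_iff sum_negf)
  also have "\<dots> = cross3 v m" unfolding cross_matrix_mult by (rule cross_skew[symmetric])
  finally show ?thesis .
qed

text \<open>Written exactly as the integrand in \<open>strong_solution\<close>, so that the latter
  can be folded.\<close>

definition llg_diffusion :: "real \<Rightarrow> real \<Rightarrow> real^3 \<Rightarrow> real^3^3"
  where "llg_diffusion \<alpha> \<epsilon> m = - (\<epsilon> *\<^sub>R cross_matrix m) - (\<alpha> * \<epsilon>) *\<^sub>R (cross_matrix m ** cross_matrix m)"

definition llg_drift :: "real \<Rightarrow> real^3 \<Rightarrow> real^3 \<Rightarrow> real^3"
  where "llg_drift \<alpha> b m = - cross3 m b - \<alpha> *\<^sub>R cross3 m (cross3 m b)"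

lemma row_llg_diffusion:
  "v v* llg_diffusion \<alpha> \<epsilon> m = - (\<epsilon> *\<^sub>R cross3 v m) - (\<alpha> * \<epsilon>) *\<^sub>R cross3 (cross3 v m) m"
proof -
  have "v v* (- (\<epsilon> *\<^sub>R cross_matrix m)) = v v* ((- \<epsilon>) *\<^sub>R cross_matrix m)" by simp
  also have "\<dots> = (- \<epsilon>) *\<^sub>R (v v* cross_matrix m)" by (rule vector_scaleR_matrix_ac)
  finally show ?thesis
    unfolding llg_diffusion_def vector_matrix_mult_diff_rdistrib vector_scaleR_matrix_ac
      vector_matrix_mul_assoc[symmetric] vector_matrix_cross_matrix by simp
qed

text \<open>In matrix form H H^T = \<epsilon>^2 (1 + \<alpha>^2) (|m|^2 1 - m m^T), a multiple of
  the projection orthogonal to \<open>m\<close>: the vectors \<open>?P\<close> and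
  \<open>cross3 ?P m\<close> are orthogonal, so the precession and damping terms do not interact and
  their squares add. The case \<open>m = 0\<close> is included because \<mu> takes that value where
  Y vanishes.\<close>

lemma row_llg_diffusion_inner:
  assumes "m = 0 \<or> norm m = 1"
  shows "(v v* llg_diffusion \<alpha> \<epsilon> m) \<bullet> (w v* llg_diffusion \<alpha> \<epsilon> m) =
    \<epsilon>\<^sup>2 * (1 + \<alpha>\<^sup>2) * ((v \<bullet> w) * (m \<bullet> m) - (v \<bullet> m) * (w \<bullet> m))"
proof -
  let ?P = "cross3 v m" and ?Q = "cross3 w m"
  have a: "?P \<bullet> cross3 ?Q m + cross3 ?P m \<bullet> ?Q = 0"
  proof -
    have "cross3 ?P m \<bullet> ?Q = cross3 m ?Q \<bullet> ?P" by (rule cross_triple)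
    also have "\<dots> = - (?P \<bullet> cross3 ?Q m)"
      by (subst cross_skew) (simp only: inner_minus_left inner_minus_right inner_commute)
    finally show ?thesis by simp
  qed
  have b: "cross3 ?P m \<bullet> cross3 ?Q m = (?P \<bullet> ?Q) * (m \<bullet> m)"
    by (simp add: dot_cross dot_cross_self)
  have c: "?P \<bullet> ?Q = (v \<bullet> w) * (m \<bullet> m) - (v \<bullet> m) * (w \<bullet> m)"
    by (simp add: dot_cross inner_commute)
  have "(v v* llg_diffusion \<alpha> \<epsilon> m) \<bullet> (w v* llg_diffusion \<alpha> \<epsilon> m) =
      \<epsilon>\<^sup>2 * (?P \<bullet> ?Q) + \<alpha> * \<epsilon>\<^sup>2 * (?P \<bullet> cross3 ?Q m + cross3 ?P m \<bullet> ?Q) + \<alpha>\<^sup>2 * \<epsilon>\<^sup>2 * (cross3 ?P m \<bullet> cross3 ?Q m)"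
    unfolding row_llg_diffusion
    by (simp add: inner_diff_left inner_diff_right power2_eq_square algebra_simps)
  also have "\<dots> = \<epsilon>\<^sup>2 * (?P \<bullet> ?Q) * (1 + \<alpha>\<^sup>2 * (m \<bullet> m))"
    unfolding a b by (simp add: algebra_simps)
  also have "\<dots> = \<epsilon>\<^sup>2 * (?P \<bullet> ?Q) * (1 + \<alpha>\<^sup>2)"
    using assms by (auto simp: power2_norm_eq_inner[symmetric])
  finally show ?thesis unfolding c by simp
qed

lemma inner_llg_drift_self: "m \<bullet> llg_drift \<alpha> b m = 0"
  by (simp add: llg_drift_def inner_diff_right dot_cross_self)

lemma inner_llg_drift_field: "b \<bullet> llg_drift \<alpha> b m = \<alpha> * ((b \<bullet> b) * (m \<bullet> m) - (b \<bullet> m)\<^sup>2)"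
proof -
  have *: "b \<bullet> cross3 m (cross3 m b) = (b \<bullet> m)\<^sup>2 - (b \<bullet> b) * (m \<bullet> m)"
    by (simp add: Lagrange inner_diff_right power2_eq_square inner_commute)
  have "b \<bullet> llg_drift \<alpha> b m = - (\<alpha> * (b \<bullet> cross3 m (cross3 m b)))"
    by (simp add: llg_drift_def inner_diff_right dot_cross_self)
  also have "\<dots> = \<alpha> * ((b \<bullet> b) * (m \<bullet> m) - (b \<bullet> m)\<^sup>2)"
    unfolding * by (simp add: algebra_simps)
  finally show ?thesis .
qed

lemma norm_cross3_le: "norm (cross3 x z) \<le> norm x * norm z"
proof (rule power2_le_imp_le)
  show "(norm (cross3 x z))\<^sup>2 \<le> (norm x * norm z)\<^sup>2"
    using norm_cross_dot[of x z] zero_le_power2[of "x \<bullet> z"] by linarith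
qed simp

lemma norm_llg_drift_le:
  assumes "norm m \<le> 1" "0 \<le> \<alpha>"
  shows "norm (llg_drift \<alpha> b m) \<le> (1 + \<alpha>) * norm b"
proof -
  have 1: "norm (cross3 m c) \<le> norm c" for c
    using norm_cross3_le[of m c] mult_right_mono[OF assms(1), of "norm c"] by simp
  have "norm (llg_drift \<alpha> b m) \<le> norm (cross3 m b) + norm (\<alpha> *\<^sub>R cross3 m (cross3 m b))"
    unfolding llg_drift_def by (metis norm_minus_cancel norm_triangle_ineq4)
  also have "\<dots> \<le> norm b + \<alpha> * norm b"
    using assms(2) 1[of b] 1[of "cross3 m b"] by (intro add_mono) (auto intro!: mult_left_mono)
  finally show ?thesis by (simp add: algebra_simps)
qed

text \<open>Reads \<open>m\<close> off the antisymmetric part of the diffusion matrix, to which the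
  symmetric square of \<open>cross_matrix m\<close> contributes nothing. It serves to deduce joint
  measurability of \<mu> in time and outcome from that of the integrand, which is part of
  \<open>has_ito_integral\<close>, whereas Y is only known to be adapted.\<close>

definition llg_recover :: "real \<Rightarrow> real^3^3 \<Rightarrow> real^3"
  where "llg_recover \<epsilon> A = (1 / (2 * \<epsilon>)) *\<^sub>R
    ((A$2$3 - A$3$2) *\<^sub>R axis 1 1 + (A$3$1 - A$1$3) *\<^sub>R axis 2 1 + (A$1$2 - A$2$1) *\<^sub>R axis 3 1)"

lemma llg_recover_diffusion:
  assumes "\<epsilon> \<noteq> 0" shows "llg_recover \<epsilon> (llg_diffusion \<alpha> \<epsilon> m) = m"
proof -
  have e: "A $ i $ j = (axis i 1 v* A) $ j" for A :: "real^3^3" and i j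
  proof -
    have "(axis i 1 v* A) $ j = (\<Sum>k\<in>UNIV. if k = i then A $ k $ j else 0)"
      unfolding vector_matrix_mult_def vec_lambda_beta by (rule sum.cong) (auto simp: axis_def)
    then show ?thesis by simp
  qed
  show ?thesis
    using assms unfolding llg_recover_def e[of "llg_diffusion \<alpha> \<epsilon> m"] row_llg_diffusion
    by (simp add: vec_eq_iff forall_3 cross_components axis_def field_simps)
qed

lemma llg_recover_measurable: "llg_recover \<epsilon> \<in> borel_measurable borel"
  unfolding llg_recover_def by (intro borel_measurable_continuous_onI continuous_intros)

lemma set_integral_split_at:
  fixes f :: "real \<Rightarrow> 'b::{banach, second_countable_topology}"
  assumes "0 \<le> s" "s \<le> t" "set_integrable lborel {0..t} f"
  shows "set_lebesgue_integral lborel {0..t} f = set_lebesgue_integral lborel {0..s} f + set_lebesgue_integral lborel {s..t} f"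
proof -
  have "{0..t} = {0..s} \<union> {s..t}" using assms by auto
  moreover have "AE x in lborel. \<not> (x \<in> {0..s} \<and> x \<in> {s..t})"
    using AE_lborel_singleton[of s] by eventually_elim auto
  moreover have "set_integrable lborel {0..s} f" "set_integrable lborel {s..t} f"
    using assms by (auto intro: set_integrable_subset)
  ultimately show ?thesis by (simp add: set_integral_Un_AE)
qed

lemma set_integral_inner_right:
  fixes f :: "real \<Rightarrow> 'b::euclidean_space"
  assumes "set_integrable lborel A f"
  shows "v \<bullet> set_lebesgue_integral lborel A f = set_lebesgue_integral lborel A (\<lambda>u. v \<bullet> f u)"
  using assms integral_inner_right[of v lborel "\<lambda>u. indicator A u *\<^sub>R f u"]
  unfolding set_lebesgue_integral_def set_integrable_def by simp

text \<open>All approximating integrals vanish at time 0, since their grids lie in the nonnegative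
  half-line, and \<open>I 0\<close> is their limit in L2.\<close>

lemma (in brownian_space) ito_integral_zero:
  fixes H :: "real \<Rightarrow> 'a \<Rightarrow> real^'d^'n"
  assumes ito: "has_ito_integral M F W H I"
  shows "AE \<omega> in M. I 0 \<omega> = 0"
proof -
  from ito obtain n \<tau> \<xi> where
    simple: "\<forall>k :: nat. simple_integrand M F (n k) (\<tau> k) (\<xi> k)"
    and lim: "\<forall>t\<ge>0. (\<lambda>k. \<integral>\<^sup>+\<omega>.
             ennreal ((norm (simple_ito_integral W (n k) (\<tau> k) (\<xi> k) t \<omega> - I t \<omega>))\<^sup>2) \<partial>M) \<longlonglongrightarrow> 0"
    unfolding has_ito_integral_def by (elim conjE exE) blast
  have "simple_ito_integral W (n k) (\<tau> k) (\<xi> k) 0 \<omega> = 0" for k \<omega>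
  proof -
    have "0 \<le> \<tau> k i" for i
      using simple monoD[of "\<tau> k" 0 i] unfolding simple_integrand_def by (auto intro: order_trans)
    then show ?thesis by (simp add: simple_ito_integral_def min_def)
  qed
  then have "(\<lambda>k::nat. \<integral>\<^sup>+\<omega>. ennreal ((norm (I 0 \<omega>))\<^sup>2) \<partial>M) \<longlonglongrightarrow> 0"
    using lim[rule_format, OF order_refl] by simp
  then have "(\<integral>\<^sup>+\<omega>. ennreal ((norm (I 0 \<omega>))\<^sup>2) \<partial>M) = 0"
    by (simp add: LIMSEQ_const_iff)
  moreover have "I 0 \<in> borel_measurable M"
    using ito measurable_F_M unfolding has_ito_integral_def adapted_def by blast
  ultimately have "AE \<omega> in M. ennreal ((norm (I 0 \<omega>))\<^sup>2) = 0"
    by (subst (asm) nn_integral_0_iff_AE) auto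
  then show ?thesis by eventually_elim simp
qed

section \<open>The solution process and its increments\<close>

text \<open>The unpacked form of \<open>strong_solution\<close>, with the stochastic integral named
  \<open>I\<close>, because the expansions treat the increments of \<open>I\<close> and of the drift
  separately.\<close>

locale llg_solution = brownian_space M W
  for M :: "'a measure" and W :: "real \<Rightarrow> 'a \<Rightarrow> real^3" +
  fixes b y :: "real^3" and \<alpha> \<epsilon> :: real and Y \<mu> I :: "real \<Rightarrow> 'a \<Rightarrow> real^3"
  assumes b: "b \<noteq> 0" and \<alpha>: "0 < \<alpha>" and \<epsilon>: "0 < \<epsilon>" and y: "norm y = 1"
    and \<mu>: "\<And>t \<omega>. 0 \<le> t \<Longrightarrow> \<omega> \<in> space M \<Longrightarrow> \<mu> t \<omega> = Y t \<omega> /\<^sub>R norm (Y t \<omega>)"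
    and Y_adapted: "\<And>t. 0 \<le> t \<Longrightarrow> Y t \<in> borel_measurable (F t)"
    and ito_I: "has_ito_integral M F W (\<lambda>t \<omega>. llg_diffusion \<alpha> \<epsilon> (\<mu> t \<omega>)) I"
    and Y_eq: "AE \<omega> in M. \<forall>t\<ge>0. set_integrable lborel {0..t} (\<lambda>s. llg_drift \<alpha> b (\<mu> s \<omega>)) \<and>
       Y t \<omega> = y + set_lebesgue_integral lborel {0..t} (\<lambda>s. llg_drift \<alpha> b (\<mu> s \<omega>)) + I t \<omega>"
begin

text \<open>The noise intensity: the covariance rate of \<open>I\<close> is \<kappa> times the
  projection orthogonal to \<mu>, wherever \<mu> is a unit vector.\<close>

definition \<kappa> :: real where "\<kappa> = \<epsilon>\<^sup>2 * (1 + \<alpha>\<^sup>2)"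

lemma \<kappa>_pos: "0 < \<kappa>"
  unfolding \<kappa>_def using \<epsilon> by (intro mult_pos_pos) (auto simp: add_pos_nonneg)

lemma \<mu>_unit_or_zero: "0 \<le> t \<Longrightarrow> \<omega> \<in> space M \<Longrightarrow> \<mu> t \<omega> = 0 \<or> norm (\<mu> t \<omega>) = 1"
  using \<mu>[of t \<omega>] by (cases "Y t \<omega> = 0") auto

lemma norm_\<mu>_le: "0 \<le> t \<Longrightarrow> \<omega> \<in> space M \<Longrightarrow> norm (\<mu> t \<omega>) \<le> 1"
  using \<mu>_unit_or_zero[of t \<omega>] by auto

lemma Y_eq_norm_\<mu>: "0 \<le> t \<Longrightarrow> \<omega> \<in> space M \<Longrightarrow> Y t \<omega> = norm (Y t \<omega>) *\<^sub>R \<mu> t \<omega>"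
  using \<mu>[of t \<omega>] by (cases "Y t \<omega> = 0") auto

abbreviation H :: "real \<Rightarrow> 'a \<Rightarrow> real^3^3"
  where "H t \<omega> \<equiv> llg_diffusion \<alpha> \<epsilon> (\<mu> t \<omega>)"

lemma row_H_inner: "0 \<le> t \<Longrightarrow> \<omega> \<in> space M \<Longrightarrow>
    (v v* H t \<omega>) \<bullet> (w v* H t \<omega>) = \<kappa> * ((v \<bullet> w) * (\<mu> t \<omega> \<bullet> \<mu> t \<omega>) - (v \<bullet> \<mu> t \<omega>) * (w \<bullet> \<mu> t \<omega>))"
  unfolding \<kappa>_def by (intro row_llg_diffusion_inner \<mu>_unit_or_zero)

lemma inner_\<mu>_self_le: "0 \<le> t \<Longrightarrow> \<omega> \<in> space M \<Longrightarrow> \<mu> t \<omega> \<bullet> \<mu> t \<omega> \<le> 1"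
  using norm_\<mu>_le[of t \<omega>] by (simp add: power2_norm_eq_inner[symmetric] power_le_one)

lemma row_H_bound:
  assumes "0 \<le> t" "\<omega> \<in> space M"
  shows "norm (v v* H t \<omega>) \<le> sqrt \<kappa> * norm v"
proof (rule power2_le_imp_le)
  have "(norm (v v* H t \<omega>))\<^sup>2 = \<kappa> * ((v \<bullet> v) * (\<mu> t \<omega> \<bullet> \<mu> t \<omega>) - (v \<bullet> \<mu> t \<omega>)\<^sup>2)"
    unfolding power2_norm_eq_inner row_H_inner[OF assms] by (simp add: power2_eq_square)
  also have "\<dots> \<le> \<kappa> * ((v \<bullet> v) * 1 - 0)"
    using \<kappa>_pos inner_\<mu>_self_le[OF assms] by (intro mult_left_mono diff_mono) auto
  also have "\<dots> = (sqrt \<kappa> * norm v)\<^sup>2"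
    using \<kappa>_pos by (simp add: power_mult_distrib power2_norm_eq_inner)
  finally show "(norm (v v* H t \<omega>))\<^sup>2 \<le> (sqrt \<kappa> * norm v)\<^sup>2" .
qed (use \<kappa>_pos in simp)

sublocale bounded_ito_integral M W H I "sqrt \<kappa>"
  by unfold_locales (use ito_I row_H_bound \<kappa>_pos in auto)

lemma \<mu>_jointly_measurable:
  assumes "0 \<le> t" shows "jointly_measurable t M \<mu>" "jointly_measurable t (F t) \<mu>"
proof -
  have p: "progressively_measurable F H" using ito_I unfolding has_ito_integral_def by blast
  have e: "llg_recover \<epsilon> (H s \<omega>) = \<mu> s \<omega>" for s \<omega> using \<epsilon> by (simp add: llg_recover_diffusion)
  show "jointly_measurable t M \<mu>"
    using jointly_measurable_compose[OF progressively_measurable_jointly[OF p assms] llg_recover_measurable, of \<epsilon>]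
    unfolding e .
  have "jointly_measurable t (F t) H" using p assms unfolding progressively_measurable_def by blast
  from jointly_measurable_compose[OF this llg_recover_measurable, of \<epsilon>]
  show "jointly_measurable t (F t) \<mu>" unfolding e .
qed

lemma Y_measurable: "0 \<le> t \<Longrightarrow> Y t \<in> borel_measurable M"
  using Y_adapted measurable_F_M by blast

lemma \<mu>_measurable_F:
  assumes "0 \<le> t" shows "\<mu> t \<in> borel_measurable (F t)"
proof -
  have "(\<lambda>\<omega>. Y t \<omega> /\<^sub>R norm (Y t \<omega>)) \<in> borel_measurable (F t)"
    using Y_adapted[OF assms] by measurable
  moreover have "\<mu> t \<omega> = Y t \<omega> /\<^sub>R norm (Y t \<omega>)" if "\<omega> \<in> space (F t)" for \<omega>
    using \<mu> assms that by simp
  ultimately show ?thesis by (subst measurable_cong) auto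
qed

lemma \<mu>_measurable: "0 \<le> t \<Longrightarrow> \<mu> t \<in> borel_measurable M"
  using \<mu>_measurable_F measurable_F_M by blast

definition drift_incr :: "real^3 \<Rightarrow> real \<Rightarrow> real \<Rightarrow> 'a \<Rightarrow> real"
  where "drift_incr v s t \<omega> = set_lebesgue_integral lborel {s..t} (\<lambda>u. v \<bullet> llg_drift \<alpha> b (\<mu> u \<omega>))"

lemma llg_drift_measurable: "(\<lambda>m. v \<bullet> llg_drift \<alpha> b m) \<in> borel_measurable borel"
  unfolding llg_drift_def
  by (intro borel_measurable_continuous_onI continuous_intros continuous_on_cross)

lemma inner_drift_jointly_measurable: "0 \<le> t \<Longrightarrow> jointly_measurable t M (\<lambda>u \<omega>. v \<bullet> llg_drift \<alpha> b (\<mu> u \<omega>))"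
  by (rule jointly_measurable_compose[OF \<mu>_jointly_measurable(1) llg_drift_measurable])

lemma drift_incr_measurable: "0 \<le> s \<Longrightarrow> s \<le> t \<Longrightarrow> drift_incr v s t \<in> borel_measurable M"
  unfolding drift_incr_def by (intro time_integral_measurable inner_drift_jointly_measurable) auto

lemma inner_drift_bound: "0 \<le> u \<Longrightarrow> \<omega> \<in> space M \<Longrightarrow> \<bar>v \<bullet> llg_drift \<alpha> b (\<mu> u \<omega>)\<bar> \<le> norm v * ((1 + \<alpha>) * norm b)"
  using \<alpha> by (intro order_trans[OF Cauchy_Schwarz_ineq2] mult_left_mono norm_llg_drift_le norm_\<mu>_le) auto

lemma inner_drift_integrable:
  assumes "0 \<le> s" "s \<le> t" "\<omega> \<in> space M"
  shows "set_integrable lborel {s..t} (\<lambda>u. v \<bullet> llg_drift \<alpha> b (\<mu> u \<omega>))"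
  by (rule bounded_path_set_integrable[where C="norm v * ((1 + \<alpha>) * norm b)", OF inner_drift_jointly_measurable])
     (use assms inner_drift_bound in auto)

lemma drift_incr_bound:
  assumes "0 \<le> s" "s \<le> t" "\<omega> \<in> space M"
  shows "\<bar>drift_incr v s t \<omega>\<bar> \<le> norm v * ((1 + \<alpha>) * norm b) * (t - s)"
  unfolding drift_incr_def using assms
  by (intro set_integral_abs_bound inner_drift_integrable inner_drift_bound) auto

lemma Y_zero: "AE \<omega> in M. Y 0 \<omega> = y"
  using Y_eq ito_integral_zero[OF ito_I]
proof eventually_elim
  case (elim \<omega>)
  have "AE x in lborel. indicator {0..0::real} x *\<^sub>R llg_drift \<alpha> b (\<mu> x \<omega>) = 0"
    using AE_lborel_singleton[of 0] by eventually_elim auto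
  then have "set_lebesgue_integral lborel {0..0} (\<lambda>s. llg_drift \<alpha> b (\<mu> s \<omega>)) = 0"
    unfolding set_lebesgue_integral_def by (rule integral_eq_zero_AE)
  then show ?case using elim by auto
qed

lemma Y_increment: "AE \<omega> in M. \<forall>s t v. 0 \<le> s \<longrightarrow> s \<le> t \<longrightarrow> v \<bullet> (Y t \<omega> - Y s \<omega>) = drift_incr v s t \<omega> + incr v s t \<omega>"
  using Y_eq
proof eventually_elim
  case (elim \<omega>)
  show ?case
  proof (intro allI impI)
    fix s t :: real and v :: "real^3" assume st: "0 \<le> s" "s \<le> t"
    let ?f = "\<lambda>s. llg_drift \<alpha> b (\<mu> s \<omega>)"
    have i: "set_integrable lborel {0..t} ?f" using elim st by auto
    have i2: "set_integrable lborel {s..t} ?f" using i st by (auto intro: set_integrable_subset)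
    have "Y t \<omega> - Y s \<omega> = set_lebesgue_integral lborel {s..t} ?f + (I t \<omega> - I s \<omega>)"
      using elim st set_integral_split_at[OF st i] by simp
    then show "v \<bullet> (Y t \<omega> - Y s \<omega>) = drift_incr v s t \<omega> + incr v s t \<omega>"
      by (simp add: drift_incr_def incr_def inner_add_right set_integral_inner_right[OF i2])
  qed
qed

text \<open>Increments are of order sqrt (t - s) in L4, uniformly on \<open>{0..T}\<close>. The
  martingale part has that order by its fourth moment bound; the drift part is of order t - s, and
  the horizon \<open>T\<close> pays for the difference.\<close>

lemma Y_increment_fourth_moment:
  assumes T: "0 \<le> T"
  obtains c where "0 \<le> c"
    "\<And>s t v. 0 \<le> s \<Longrightarrow> s \<le> t \<Longrightarrow> t \<le> T \<Longrightarrow> norm v \<le> 1 \<Longrightarrow> fourth_integrable (\<lambda>\<omega>. v \<bullet> (Y t \<omega> - Y s \<omega>))"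
    "\<And>s t v. 0 \<le> s \<Longrightarrow> s \<le> t \<Longrightarrow> t \<le> T \<Longrightarrow> norm v \<le> 1 \<Longrightarrow>
      expectation (\<lambda>\<omega>. (v \<bullet> (Y t \<omega> - Y s \<omega>)) ^ 4) \<le> (c * sqrt (t - s)) ^ 4"
    "\<And>s t v. 0 \<le> s \<Longrightarrow> s \<le> t \<Longrightarrow> t \<le> T \<Longrightarrow> norm v \<le> 1 \<Longrightarrow> fourth_integrable (incr v s t)"
    "\<And>s t v. 0 \<le> s \<Longrightarrow> s \<le> t \<Longrightarrow> t \<le> T \<Longrightarrow> norm v \<le> 1 \<Longrightarrow>
      expectation (\<lambda>\<omega>. incr v s t \<omega> ^ 4) \<le> (c * sqrt (t - s)) ^ 4"
proof -
  let ?k = "(1 + \<alpha>) * norm b"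
  have k0: "0 \<le> ?k" using \<alpha> by simp
  \<comment> \<open>The 8 stems from the fourth power of a sum, and 648 is 8 * 9 * 3^2 from the
    fourth moment bound in dimension 3. Adding 1 ensures that \<open>c\<close> lies below
    \<open>c ^ 4\<close>, which spares a fourth root.\<close>
  define c where "c = 1 + (8 * ?k ^ 4 * T\<^sup>2 + 648 * \<kappa>\<^sup>2)"
  have c1: "1 \<le> c" by (simp add: c_def)
  have c4: "8 * ?k ^ 4 * T\<^sup>2 + 648 * \<kappa>\<^sup>2 \<le> c ^ 4"
    using power_increasing[of 1 4 c] c1 by (simp add: c_def)
  have sq4: "(c * sqrt (t - s)) ^ 4 = c ^ 4 * (t - s)\<^sup>2" if "s \<le> t" for s t
  proof -
    have "sqrt (t - s) ^ 4 = ((sqrt (t - s))\<^sup>2)\<^sup>2" by simp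
    also have "\<dots> = (t - s)\<^sup>2" using that by simp
    finally show ?thesis by (simp only: power_mult_distrib)
  qed
  { fix s t :: real and v :: "real^3" assume st: "0 \<le> s" "s \<le> t" "t \<le> T" and v: "norm v \<le> 1"
    have J: "fourth_integrable (incr v s t)"
      using incr_measurable[OF st(1,2)] incr_fourth_moment(1)[OF st(1,2)] by (simp add: fourth_integrable_iff)
    have J4: "expectation (\<lambda>\<omega>. incr v s t \<omega> ^ 4) \<le> 81 * \<kappa>\<^sup>2 * (t - s)\<^sup>2"
    proof -
      have k4: "sqrt \<kappa> ^ 4 = \<kappa>\<^sup>2"
      proof -
        have "sqrt \<kappa> ^ 4 = ((sqrt \<kappa>)\<^sup>2)\<^sup>2" by simp
        then show ?thesis using \<kappa>_pos by simp
      qed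
      have "(sqrt \<kappa> * norm v) ^ 4 \<le> (sqrt \<kappa> * 1) ^ 4"
        using v \<kappa>_pos by (intro power_mono mult_left_mono) auto
      then have "9 * (real CARD(3))\<^sup>2 * (sqrt \<kappa> * norm v) ^ 4 * (t - s)\<^sup>2 \<le> 9 * (real CARD(3))\<^sup>2 * \<kappa>\<^sup>2 * (t - s)\<^sup>2"
        using k4 by (intro mult_right_mono mult_left_mono) auto
      then show ?thesis using incr_fourth_moment(2)[OF st(1,2), of v] by simp
    qed
    have D: "fourth_integrable (drift_incr v s t)" and D4: "expectation (\<lambda>\<omega>. drift_incr v s t \<omega> ^ 4) \<le> ?k ^ 4 * T\<^sup>2 * (t - s)\<^sup>2"
    proof -
      have "norm v * ?k * (t - s) \<le> 1 * ?k * (t - s)" using v k0 st by (intro mult_right_mono) auto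
      then have bd: "\<bar>drift_incr v s t \<omega>\<bar> \<le> ?k * (t - s)" if "\<omega> \<in> space M" for \<omega>
        using drift_incr_bound[OF st(1,2) that, of v] by linarith
      have bd4: "drift_incr v s t \<omega> ^ 4 \<le> (?k * (t - s)) ^ 4" if "\<omega> \<in> space M" for \<omega>
        using power_mono[OF bd[OF that], of 4] by simp
      have int: "integrable M (\<lambda>\<omega>. drift_incr v s t \<omega> ^ 4)"
        using drift_incr_measurable[OF st(1,2), of v] bd4
        by (intro integrable_const_bound[where B="(?k * (t - s)) ^ 4"]) (auto intro!: AE_I2)
      show "fourth_integrable (drift_incr v s t)"
        using int drift_incr_measurable[OF st(1,2), of v] by (simp add: fourth_integrable_iff)
      have "expectation (\<lambda>\<omega>. drift_incr v s t \<omega> ^ 4) \<le> expectation (\<lambda>\<omega>. (?k * (t - s)) ^ 4)"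
        by (intro integral_mono int bd4) auto
      also have "\<dots> = ?k ^ 4 * (t - s)\<^sup>2 * (t - s)\<^sup>2"
        by (simp add: prob_space power_mult_distrib power2_eq_square power4_eq_xxxx)
      also have "\<dots> \<le> ?k ^ 4 * T\<^sup>2 * (t - s)\<^sup>2"
        using st T by (intro mult_right_mono mult_left_mono power_mono) auto
      finally show "expectation (\<lambda>\<omega>. drift_incr v s t \<omega> ^ 4) \<le> ?k ^ 4 * T\<^sup>2 * (t - s)\<^sup>2" .
    qed
    have ae: "AE \<omega> in M. v \<bullet> (Y t \<omega> - Y s \<omega>) = drift_incr v s t \<omega> + incr v s t \<omega>"
      using Y_increment st by (auto elim!: eventually_mono)
    note s = fourth_integrable_add[OF D J]
    have Ym: "(\<lambda>\<omega>. v \<bullet> (Y t \<omega> - Y s \<omega>)) \<in> borel_measurable M"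
      using Y_measurable[of t] Y_measurable[of s] st by simp
    have eq: "integrable M (\<lambda>\<omega>. (v \<bullet> (Y t \<omega> - Y s \<omega>)) ^ 4) \<longleftrightarrow> integrable M (\<lambda>\<omega>. (drift_incr v s t \<omega> + incr v s t \<omega>) ^ 4)"
      "expectation (\<lambda>\<omega>. (v \<bullet> (Y t \<omega> - Y s \<omega>)) ^ 4) = expectation (\<lambda>\<omega>. (drift_incr v s t \<omega> + incr v s t \<omega>) ^ 4)"
      using ae Ym drift_incr_measurable[OF st(1,2), of v] incr_measurable[OF st(1,2), of v]
      by (intro integrable_cong_AE integral_cong_AE; auto elim!: eventually_mono)+
    have "fourth_integrable (\<lambda>\<omega>. v \<bullet> (Y t \<omega> - Y s \<omega>))"
      using Ym eq(1) fourth_integrableD(4)[OF s(1)] by (simp add: fourth_integrable_iff)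
    moreover have "expectation (\<lambda>\<omega>. (v \<bullet> (Y t \<omega> - Y s \<omega>)) ^ 4) \<le> (c * sqrt (t - s)) ^ 4"
    proof -
      have "expectation (\<lambda>\<omega>. (v \<bullet> (Y t \<omega> - Y s \<omega>)) ^ 4) \<le> 8 * (?k ^ 4 * T\<^sup>2 * (t - s)\<^sup>2) + 8 * (81 * \<kappa>\<^sup>2 * (t - s)\<^sup>2)"
        unfolding eq(2) using s(2) D4 J4 by linarith
      also have "\<dots> = (8 * ?k ^ 4 * T\<^sup>2 + 648 * \<kappa>\<^sup>2) * (t - s)\<^sup>2" by (simp add: algebra_simps)
      also have "\<dots> \<le> c ^ 4 * (t - s)\<^sup>2" by (intro mult_right_mono c4) simp
      finally show ?thesis unfolding sq4[OF st(2)] .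
    qed
    moreover have "expectation (\<lambda>\<omega>. incr v s t \<omega> ^ 4) \<le> (c * sqrt (t - s)) ^ 4"
    proof -
      have "81 * \<kappa>\<^sup>2 \<le> 8 * ?k ^ 4 * T\<^sup>2 + 648 * \<kappa>\<^sup>2" using zero_le_power2[of \<kappa>] k0 by (smt (verit) mult_nonneg_nonneg zero_le_power zero_le_power2)
      from order_trans[OF this c4]
      have "81 * \<kappa>\<^sup>2 * (t - s)\<^sup>2 \<le> c ^ 4 * (t - s)\<^sup>2" by (rule mult_right_mono) simp
      then show ?thesis using J4 unfolding sq4[OF st(2)] by linarith
    qed
    ultimately have "fourth_integrable (\<lambda>\<omega>. v \<bullet> (Y t \<omega> - Y s \<omega>)) \<and>
       expectation (\<lambda>\<omega>. (v \<bullet> (Y t \<omega> - Y s \<omega>)) ^ 4) \<le> (c * sqrt (t - s)) ^ 4 \<and>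
       fourth_integrable (incr v s t) \<and> expectation (\<lambda>\<omega>. incr v s t \<omega> ^ 4) \<le> (c * sqrt (t - s)) ^ 4"
      using J by blast }
  note * = this
  show ?thesis
    by (rule that[of c]) (use c1 * in auto)
qed

lemma Y_fourth_integrable:
  assumes "0 \<le> t" "norm v \<le> 1" shows "fourth_integrable (\<lambda>\<omega>. v \<bullet> Y t \<omega>)"
proof -
  from Y_increment_fourth_moment[OF assms(1)] obtain c where
    "\<And>s t' v. 0 \<le> s \<Longrightarrow> s \<le> t' \<Longrightarrow> t' \<le> t \<Longrightarrow> norm v \<le> 1 \<Longrightarrow> fourth_integrable (\<lambda>\<omega>. v \<bullet> (Y t' \<omega> - Y s \<omega>))"
    by metis
  then have 1: "fourth_integrable (\<lambda>\<omega>. v \<bullet> (Y t \<omega> - Y 0 \<omega>))" using assms by auto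
  have 2: "fourth_integrable (\<lambda>\<omega>. v \<bullet> y)" by (simp add: fourth_integrable_iff)
  note 3 = fourth_integrable_add(1)[OF 1 2]
  have m: "(\<lambda>\<omega>. v \<bullet> Y t \<omega>) \<in> borel_measurable M" using Y_measurable[OF assms(1)] by simp
  have "integrable M (\<lambda>\<omega>. (v \<bullet> Y t \<omega>) ^ 4) \<longleftrightarrow> integrable M (\<lambda>\<omega>. (v \<bullet> (Y t \<omega> - Y 0 \<omega>) + v \<bullet> y) ^ 4)"
  proof (rule integrable_cong_AE)
    show "AE \<omega> in M. (v \<bullet> Y t \<omega>) ^ 4 = (v \<bullet> (Y t \<omega> - Y 0 \<omega>) + v \<bullet> y) ^ 4"
      using Y_zero by eventually_elim (simp add: inner_diff_right)
  qed (use m 3 in \<open>auto simp: fourth_integrable_iff\<close>)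
  then show ?thesis using m 3 by (simp add: fourth_integrable_iff)
qed

end

section \<open>The norm of \<open>Y\<close>\<close>

text \<open>The substitute for Ito's formula under the expectation: an error of order (t - s)^(3/2)
  is negligible in the difference quotient.\<close>

lemma has_derivative_if_one_step:
  fixes \<phi> \<psi> :: "real \<Rightarrow> real"
  assumes step: "\<And>s t. 0 \<le> s \<Longrightarrow> s \<le> t \<Longrightarrow> t \<le> T \<Longrightarrow> \<bar>\<phi> t - \<phi> s - (t - s) * \<psi> s\<bar> \<le> C * ((t - s) * sqrt (t - s))"
    and cont: "continuous_on {0..T} \<psi>" and x: "x \<in> {0..T}"
  shows "(\<phi> has_field_derivative \<psi> x) (at x within {0..T})"
proof -
  have quot: "\<bar>(\<phi> z - \<phi> x) / (z - x) - \<psi> x\<bar> \<le> \<bar>C\<bar> * sqrt \<bar>z - x\<bar> + \<bar>\<psi> z - \<psi> x\<bar>" if z: "z \<in> {0..T}" "z \<noteq> x" for z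
  proof -
    have one: "\<bar>(\<phi> t - \<phi> s) / (t - s) - \<psi> s\<bar> \<le> \<bar>C\<bar> * sqrt (t - s)" if "0 \<le> s" "s < t" "t \<le> T" for s t
    proof -
      have "(\<phi> t - \<phi> s) / (t - s) - \<psi> s = (\<phi> t - \<phi> s - (t - s) * \<psi> s) / (t - s)"
        using that by (simp add: field_simps)
      then have "\<bar>(\<phi> t - \<phi> s) / (t - s) - \<psi> s\<bar> = \<bar>\<phi> t - \<phi> s - (t - s) * \<psi> s\<bar> / (t - s)"
        using that by simp
      also have "\<dots> \<le> C * ((t - s) * sqrt (t - s)) / (t - s)"
        using that by (intro divide_right_mono step) auto
      also have "\<dots> = C * sqrt (t - s)" using that by simp
      also have "\<dots> \<le> \<bar>C\<bar> * sqrt (t - s)" using that by (intro mult_right_mono) auto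
      finally show ?thesis .
    qed
    show ?thesis
    proof (cases "x < z")
      case True
      then show ?thesis using one[of x z] x z by auto
    next
      case False
      \<comment> \<open>To the left of \<open>x\<close> the step starts at \<open>z\<close> and
        yields \<open>\<psi> z\<close>; continuity of \<open>\<psi>\<close> makes up for the
        difference to \<open>\<psi> x\<close>.\<close>
      then have "\<bar>(\<phi> x - \<phi> z) / (x - z) - \<psi> z\<bar> \<le> \<bar>C\<bar> * sqrt (x - z)" using one[of z x] x z by auto
      moreover have "(\<phi> x - \<phi> z) / (x - z) = (\<phi> z - \<phi> x) / (z - x)"
        by (metis minus_diff_eq minus_divide_divide)
      ultimately show ?thesis using False by (simp add: abs_minus_commute)
    qed
  qed
  have "((\<lambda>z. \<bar>C\<bar> * sqrt \<bar>z - x\<bar> + \<bar>\<psi> z - \<psi> x\<bar>) \<longlongrightarrow> \<bar>C\<bar> * sqrt \<bar>x - x\<bar> + \<bar>\<psi> x - \<psi> x\<bar>) (at x within {0..T})"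
    using cont x by (intro tendsto_intros) (auto simp: continuous_on_def)
  then have lim: "((\<lambda>z. \<bar>C\<bar> * sqrt \<bar>z - x\<bar> + \<bar>\<psi> z - \<psi> x\<bar>) \<longlongrightarrow> 0) (at x within {0..T})" by simp
  have "((\<lambda>z. (\<phi> z - \<phi> x) / (z - x) - \<psi> x) \<longlongrightarrow> 0) (at x within {0..T})"
  proof (rule Lim_null_comparison[OF _ lim])
    show "\<forall>\<^sub>F z in at x within {0..T}. norm ((\<phi> z - \<phi> x) / (z - x) - \<psi> x) \<le> \<bar>C\<bar> * sqrt \<bar>z - x\<bar> + \<bar>\<psi> z - \<psi> x\<bar>"
      using quot by (auto simp: eventually_at_filter)
  qed
  then show ?thesis by (simp add: has_field_derivative_iff LIM_zero_iff)
qed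

lemma set_integral_linear_combination:
  fixes g :: "'i \<Rightarrow> real \<Rightarrow> real"
  assumes "finite A" "\<And>i. i \<in> A \<Longrightarrow> set_integrable lborel B (g i)"
  shows "set_lebesgue_integral lborel B (\<lambda>u. \<Sum>i\<in>A. c i * g i u) = (\<Sum>i\<in>A. c i * set_lebesgue_integral lborel B (g i))"
proof -
  have "set_lebesgue_integral lborel B (\<lambda>u. \<Sum>i\<in>A. c i * g i u) = (\<integral>u. (\<Sum>i\<in>A. c i * (indicator B u *\<^sub>R g i u)) \<partial>lborel)"
    unfolding set_lebesgue_integral_def
    by (intro Bochner_Integration.integral_cong refl) (simp add: sum_distrib_left mult_ac)
  also have "\<dots> = (\<Sum>i\<in>A. \<integral>u. c i * (indicator B u *\<^sub>R g i u) \<partial>lborel)"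
    using assms(2) unfolding set_integrable_def
    by (intro Bochner_Integration.integral_sum integrable_mult_right)
  finally show ?thesis by (simp add: set_lebesgue_integral_def)
qed

lemma inner_vec_nth: "(x :: real^'n) \<bullet> z = (\<Sum>i\<in>UNIV. x $ i * z $ i)"
  by (simp add: inner_vec_def)

context llg_solution begin

lemma covariation_split:
  assumes "0 \<le> s" "s \<le> t" "\<omega> \<in> space M"
  shows "covariation v w 0 t \<omega> = covariation v w 0 s \<omega> + covariation v w s t \<omega>"
  unfolding covariation_def using assms by (intro set_integral_split_at row_product_integrable) auto

lemma covariation_measurable_F: "0 \<le> t \<Longrightarrow> covariation v w 0 t \<in> borel_measurable (F t)"
  unfolding covariation_def by (intro time_integral_measurable row_product_jointly) auto

text \<open>The integral of the squared Frobenius norm of \<open>H\<close>. It is kept as a random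
  variable, since its value 2 \<kappa> t depends on \<mu> being a unit vector, which is not yet
  known.\<close>

definition trace_variation :: "real \<Rightarrow> 'a \<Rightarrow> real"
  where "trace_variation t \<omega> = (\<Sum>i\<in>UNIV. covariation (axis i 1) (axis i 1) 0 t \<omega>)"

text \<open>The compensated process \<open>|Y|\<^sup>2 - 1 - \<integral> |H|\<^sup>2\<close>, which turns out to vanish.\<close>

definition compensated :: "real \<Rightarrow> 'a \<Rightarrow> real"
  where "compensated t \<omega> = (\<Sum>i\<in>UNIV. (Y t \<omega> $ i)\<^sup>2) - 1 - trace_variation t \<omega>"

lemma trace_variation_measurable_F: "0 \<le> t \<Longrightarrow> trace_variation t \<in> borel_measurable (F t)"
  unfolding trace_variation_def[abs_def] using covariation_measurable_F by (intro borel_measurable_sum) auto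

lemma compensated_measurable_F: "0 \<le> t \<Longrightarrow> compensated t \<in> borel_measurable (F t)"
  unfolding compensated_def[abs_def] using trace_variation_measurable_F[of t] Y_adapted[of t] by measurable

lemma trace_variation_bound:
  assumes "0 \<le> t" "\<omega> \<in> space M" shows "\<bar>trace_variation t \<omega>\<bar> \<le> 3 * \<kappa> * t"
proof -
  have "\<bar>trace_variation t \<omega>\<bar> \<le> (\<Sum>i\<in>(UNIV::3 set). \<bar>covariation (axis i 1) (axis i 1) 0 t \<omega>\<bar>)"
    unfolding trace_variation_def by (rule sum_abs)
  also have "\<dots> \<le> (\<Sum>i\<in>(UNIV::3 set). \<kappa> * t)"
    using covariation_bound[OF order_refl assms, of "axis i 1" "axis i 1" for i] \<kappa>_pos by (intro sum_mono) (simp add: norm_axis_1)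
  finally show ?thesis by simp
qed

lemma Y_component: "axis i 1 \<bullet> Y t \<omega> = Y t \<omega> $ i"
  by (simp add: inner_axis')

lemma component_fourth_integrable: "0 \<le> t \<Longrightarrow> fourth_integrable (\<lambda>\<omega>. Y t \<omega> $ i)"
  using Y_fourth_integrable[of t "axis i 1"] by (simp add: Y_component norm_axis_1)

lemma trace_variation_square_integrable: "0 \<le> t \<Longrightarrow> square_integrable (trace_variation t)"
  "0 \<le> t \<Longrightarrow> L2_norm (trace_variation t) \<le> 3 * \<kappa> * t"
proof -
  assume t: "0 \<le> t"
  have "AE \<omega> in M. \<bar>trace_variation t \<omega>\<bar> \<le> \<bar>3 * \<kappa> * t\<bar>"
    using trace_variation_bound[OF t] by (intro AE_I2) (auto intro: order_trans[OF _ abs_ge_self])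
  note * = square_integrable_dominated[OF measurable_F_M[OF trace_variation_measurable_F[OF t]] square_integrable_const(1) this]
  show "square_integrable (trace_variation t)" by (rule *(1))
  show "L2_norm (trace_variation t) \<le> 3 * \<kappa> * t" using *(2) t \<kappa>_pos by (simp add: square_integrable_const)
qed

lemma compensated_square_integrable:
  assumes t: "0 \<le> t" shows "square_integrable (compensated t)"
proof -
  have "square_integrable (\<lambda>\<omega>. \<Sum>i\<in>UNIV. (Y t \<omega> $ i)\<^sup>2)"
    by (rule square_integrable_sum(1)) (simp_all only: finite fourth_integrableD(3)[OF component_fourth_integrable[OF t]])
  from square_integrable_diff(1)[OF square_integrable_diff(1)[OF this square_integrable_const(1)] trace_variation_square_integrable(1)[OF t]]
  show ?thesis unfolding compensated_def[abs_def] .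
qed

lemma Y_fourth_moment_bound:
  assumes T: "0 \<le> T"
  obtains d where "0 \<le> d" "\<And>t i. 0 \<le> t \<Longrightarrow> t \<le> T \<Longrightarrow> expectation (\<lambda>\<omega>. (Y t \<omega> $ i) ^ 4) \<le> d ^ 4"
proof -
  obtain c where c: "0 \<le> c"
    and f: "\<And>s t v. 0 \<le> s \<Longrightarrow> s \<le> t \<Longrightarrow> t \<le> T \<Longrightarrow> norm v \<le> 1 \<Longrightarrow> fourth_integrable (\<lambda>\<omega>. v \<bullet> (Y t \<omega> - Y s \<omega>))"
      "\<And>s t v. 0 \<le> s \<Longrightarrow> s \<le> t \<Longrightarrow> t \<le> T \<Longrightarrow> norm v \<le> 1 \<Longrightarrow>
      expectation (\<lambda>\<omega>. (v \<bullet> (Y t \<omega> - Y s \<omega>)) ^ 4) \<le> (c * sqrt (t - s)) ^ 4"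
  proof (rule Y_increment_fourth_moment[OF T], goal_cases)
    case prems: (1 c)
    show ?case by (rule prems(1)[OF prems(2-4)])
  qed
  define d where "d = 1 + (8 * (c * sqrt T) ^ 4 + 8)"
  have d: "1 \<le> d" "8 * (c * sqrt T) ^ 4 + 8 \<le> d" "d \<le> d ^ 4"
    using power_increasing[of 1 4 d] c by (auto simp: d_def)
  have "expectation (\<lambda>\<omega>. (Y t \<omega> $ i) ^ 4) \<le> d ^ 4" if t: "0 \<le> t" "t \<le> T" for t i
  proof -
    have n: "norm (axis i 1 :: real^3) \<le> 1" by (simp add: norm_axis_1)
    have 2: "fourth_integrable (\<lambda>\<omega>. y $ i)" by (simp add: fourth_integrable_iff)
    note 3 = fourth_integrable_add[OF f(1)[OF order_refl t n] 2]
    have yi: "(y $ i) ^ 4 \<le> 1"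
      using component_le_norm_cart[of y i] y power_mono[of "\<bar>y $ i\<bar>" 1 4] by simp
    have "expectation (\<lambda>\<omega>. (Y t \<omega> $ i) ^ 4) = expectation (\<lambda>\<omega>. (axis i 1 \<bullet> (Y t \<omega> - Y 0 \<omega>) + y $ i) ^ 4)"
    proof (rule integral_cong_AE)
      show "AE \<omega> in M. (Y t \<omega> $ i) ^ 4 = (axis i 1 \<bullet> (Y t \<omega> - Y 0 \<omega>) + y $ i) ^ 4"
        using Y_zero by eventually_elim (simp add: inner_axis')
    qed (use fourth_integrableD(1)[OF component_fourth_integrable[OF t(1), of i]] fourth_integrableD(1)[OF 3(1)] in auto)
    also have "\<dots> \<le> 8 * (c * sqrt (t - 0)) ^ 4 + 8 * 1"
      using 3(2) f(2)[OF order_refl t n] yi by (simp add: prob_space)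
    also have "\<dots> \<le> 8 * (c * sqrt T) ^ 4 + 8"
      using t c by (intro add_mono mult_left_mono power_mono) (auto intro!: mult_left_mono)
    finally show ?thesis using d by linarith
  qed
  then show ?thesis using d by (intro that[of d]) auto
qed

text \<open>The left side is the variance of \<open>Y s\<close> paired with the noise increment. The
  covariance rate annihilates the direction of \<mu> at time \<open>u\<close>, hence that of
  \<open>Y u\<close>, so \<open>Y s\<close> contributes only through \<open>Y u - Y s\<close>. This
  cancellation gains one order in t - s once \<open>c\<close> itself is of order t - s.\<close>

lemma expectation_cross_variation_bound:
  assumes st: "0 \<le> s" "s \<le> t" and c: "0 \<le> c"
    and fi: "\<And>u i. u \<in> {s..t} \<Longrightarrow> square_integrable (\<lambda>\<omega>. Y u \<omega> $ i - Y s \<omega> $ i)"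
    and fb: "\<And>u i. u \<in> {s..t} \<Longrightarrow> expectation (\<lambda>\<omega>. (Y u \<omega> $ i - Y s \<omega> $ i)\<^sup>2) \<le> c"
  shows "expectation (\<lambda>\<omega>. \<Sum>i\<in>UNIV. \<Sum>j\<in>UNIV. Y s \<omega> $ i * Y s \<omega> $ j * covariation (axis i 1) (axis j 1) s t \<omega>) \<le> 3 * \<kappa> * c * (t - s)"
proof -
  define f where "f u \<omega> = \<kappa> * ((Y s \<omega> \<bullet> Y s \<omega>) * (\<mu> u \<omega> \<bullet> \<mu> u \<omega>) - (Y s \<omega> \<bullet> \<mu> u \<omega>)\<^sup>2)" for u \<omega>
  have f0: "\<bar>f u \<omega>\<bar> \<le> \<kappa> * (\<Sum>i\<in>UNIV. (Y u \<omega> $ i - Y s \<omega> $ i)\<^sup>2)" if u: "0 \<le> u" "\<omega> \<in> space M" for u \<omega>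
  proof -
    have "f u \<omega> = \<kappa> * (norm (cross3 (Y s \<omega>) (\<mu> u \<omega>)))\<^sup>2"
      using norm_cross_dot[of "Y s \<omega>" "\<mu> u \<omega>"] by (simp add: f_def power_mult_distrib power2_norm_eq_inner)
    also have "cross3 (Y s \<omega>) (\<mu> u \<omega>) = - cross3 (Y u \<omega> - Y s \<omega>) (\<mu> u \<omega>)"
    proof -
      have "cross3 (Y u \<omega>) (\<mu> u \<omega>) = 0"
        using Y_eq_norm_\<mu>[OF u] by (metis cross_mult_left cross_refl scaleR_zero_right)
      then show ?thesis by (simp add: Cross3.left_diff_distrib)
    qed
    finally have fe: "f u \<omega> = \<kappa> * (norm (cross3 (Y u \<omega> - Y s \<omega>) (\<mu> u \<omega>)))\<^sup>2" by simp
    have "norm (cross3 (Y u \<omega> - Y s \<omega>) (\<mu> u \<omega>)) \<le> norm (Y u \<omega> - Y s \<omega>) * 1"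
      using norm_\<mu>_le[OF u] by (intro order_trans[OF norm_cross3_le] mult_left_mono) auto
    then have "(norm (cross3 (Y u \<omega> - Y s \<omega>) (\<mu> u \<omega>)))\<^sup>2 \<le> (norm (Y u \<omega> - Y s \<omega>))\<^sup>2"
      by (intro power_mono) auto
    also have "\<dots> = (\<Sum>i\<in>UNIV. (Y u \<omega> $ i - Y s \<omega> $ i)\<^sup>2)"
      unfolding power2_norm_eq_inner inner_vec_nth by (simp add: power2_eq_square)
    finally show ?thesis unfolding fe using \<kappa>_pos by (simp add: abs_mult)
  qed
  have t0: "0 \<le> t" using st by simp
  have Ys: "Y s \<in> borel_measurable M" by (rule Y_measurable[OF st(1)])
  have fj: "jointly_measurable t M f"
    unfolding f_def split_beta'
    using \<mu>_jointly_measurable(1)[OF t0, unfolded split_beta'] measurable_compose[OF measurable_snd Ys, of "restrict_space borel {0..t}"]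
    by measurable
  have fm: "f u \<in> borel_measurable M" if "0 \<le> u" for u
    unfolding f_def[abs_def] using Ys \<mu>_measurable[OF that] by measurable
  have int: "integrable M (\<lambda>\<omega>. \<kappa> * (\<Sum>i\<in>UNIV. (Y u \<omega> $ i - Y s \<omega> $ i)\<^sup>2))" if "u \<in> {s..t}" for u
    using square_integrableD(2)[OF fi[OF that]] by simp
  have fint: "integrable M (f u)" if u: "u \<in> {s..t}" for u
    using fm[of u] f0[of u] u st
    by (intro Bochner_Integration.integrable_bound[OF int[OF u]]) (auto intro!: AE_I2 order_trans[OF _ abs_ge_self])
  have fE: "expectation (\<lambda>\<omega>. \<bar>f u \<omega>\<bar>) \<le> 3 * \<kappa> * c" if u: "u \<in> {s..t}" for u
  proof -
    have "expectation (\<lambda>\<omega>. \<bar>f u \<omega>\<bar>) \<le> expectation (\<lambda>\<omega>. \<kappa> * (\<Sum>i\<in>UNIV. (Y u \<omega> $ i - Y s \<omega> $ i)\<^sup>2))"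
      using f0[of u] u st fint[OF u] by (intro integral_mono int) auto
    also have "\<dots> = \<kappa> * (\<Sum>i\<in>UNIV. expectation (\<lambda>\<omega>. (Y u \<omega> $ i - Y s \<omega> $ i)\<^sup>2))"
      using square_integrableD(2)[OF fi[OF u]] by simp
    also have "\<dots> \<le> \<kappa> * (\<Sum>i\<in>(UNIV::3 set). c)"
      using \<kappa>_pos fb[OF u] by (intro mult_left_mono sum_mono) auto
    finally show ?thesis by simp
  qed
  have "0 \<le> 3 * \<kappa> * c" using \<kappa>_pos c by simp
  note tb = expectation_time_integral_bound[OF fj st this fint fE]
  have e: "(\<Sum>i\<in>UNIV. \<Sum>j\<in>UNIV. Y s \<omega> $ i * Y s \<omega> $ j * covariation (axis i 1) (axis j 1) s t \<omega>) =
     set_lebesgue_integral lborel {s..t} (\<lambda>u. f u \<omega>)" if w: "\<omega> \<in> space M" for \<omega>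
  proof -
    let ?c = "\<lambda>p. Y s \<omega> $ fst p * Y s \<omega> $ snd p"
    let ?g = "\<lambda>p u. (axis (fst p) 1 v* H u \<omega>) \<bullet> (axis (snd p) 1 v* H u \<omega>)"
    have "(\<Sum>i\<in>UNIV. \<Sum>j\<in>UNIV. Y s \<omega> $ i * Y s \<omega> $ j * covariation (axis i 1) (axis j 1) s t \<omega>) =
      (\<Sum>p\<in>UNIV \<times> UNIV. ?c p * set_lebesgue_integral lborel {s..t} (?g p))"
      unfolding sum.cartesian_product covariation_def by (simp add: split_beta')
    also have "\<dots> = set_lebesgue_integral lborel {s..t} (\<lambda>u. \<Sum>p\<in>UNIV \<times> UNIV. ?c p * ?g p u)"
      by (intro set_integral_linear_combination[symmetric] row_product_integrable st w) auto
    also have "\<dots> = set_lebesgue_integral lborel {s..t} (\<lambda>u. f u \<omega>)"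
    proof (rule set_lebesgue_integral_cong)
      show "\<forall>u. u \<in> {s..t} \<longrightarrow> (\<Sum>p\<in>UNIV \<times> UNIV. ?c p * ?g p u) = f u \<omega>"
      proof (intro allI impI)
        fix u assume "u \<in> {s..t}"
        then have u: "0 \<le> u" using st by simp
        have "(\<Sum>p\<in>UNIV \<times> UNIV. ?c p * ?g p u) =
          (\<Sum>i\<in>UNIV. \<Sum>j\<in>UNIV. (Y s \<omega> $ i * Y s \<omega> $ j) * (\<kappa> * ((if i = j then 1 else 0) * (\<mu> u \<omega> \<bullet> \<mu> u \<omega>) - \<mu> u \<omega> $ i * \<mu> u \<omega> $ j)))"
          unfolding sum.cartesian_product row_H_inner[OF u w]
          by (simp add: split_beta' inner_axis') (simp add: axis_def)
        also have "\<dots> = f u \<omega>"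
          unfolding f_def inner_vec_nth[of "Y s \<omega>"] by (simp add: sum_3 power2_eq_square algebra_simps)
        finally show "(\<Sum>p\<in>UNIV \<times> UNIV. ?c p * ?g p u) = f u \<omega>" .
      qed
    qed simp
    finally show ?thesis .
  qed
  have "expectation (\<lambda>\<omega>. \<Sum>i\<in>UNIV. \<Sum>j\<in>UNIV. Y s \<omega> $ i * Y s \<omega> $ j * covariation (axis i 1) (axis j 1) s t \<omega>)
     = expectation (\<lambda>\<omega>. set_lebesgue_integral lborel {s..t} (\<lambda>u. f u \<omega>))"
    by (rule Bochner_Integration.integral_cong[OF refl e])
  also have "\<dots> \<le> expectation (\<lambda>\<omega>. \<bar>set_lebesgue_integral lborel {s..t} (\<lambda>u. f u \<omega>)\<bar>)"
    using tb(1) by (intro integral_mono) auto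
  also have "\<dots> \<le> 3 * \<kappa> * c * (t - s)" by (rule tb(2))
  finally show ?thesis .
qed

text \<open>The drift at time \<open>u\<close> is orthogonal to \<mu>, hence to \<open>Y u\<close>,
  so that pairing it with \<open>Y s\<close> leaves only \<open>Y u - Y s\<close>. With
  \<open>c\<close> of order sqrt (t - s) the result is of order (t - s)^(3/2), although the drift
  increment alone is of order t - s.\<close>

lemma expectation_mult_drift_bound:
  assumes st: "0 \<le> s" "s \<le> t" and c: "0 \<le> c" and G: "square_integrable G"
    and fi: "\<And>u i. u \<in> {s..t} \<Longrightarrow> square_integrable (\<lambda>\<omega>. Y u \<omega> $ i - Y s \<omega> $ i)"
    and fb: "\<And>u i. u \<in> {s..t} \<Longrightarrow> L2_norm (\<lambda>\<omega>. Y u \<omega> $ i - Y s \<omega> $ i) \<le> c"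
  shows "integrable M (\<lambda>\<omega>. G \<omega> * (\<Sum>i\<in>UNIV. Y s \<omega> $ i * drift_incr (axis i 1) s t \<omega>))" (is ?int)
    and "expectation (\<lambda>\<omega>. \<bar>G \<omega> * (\<Sum>i\<in>UNIV. Y s \<omega> $ i * drift_incr (axis i 1) s t \<omega>)\<bar>)
      \<le> 3 * ((1 + \<alpha>) * norm b) * L2_norm G * c * (t - s)" (is ?E)
proof -
  let ?k = "(1 + \<alpha>) * norm b"
  have k: "0 \<le> ?k" using \<alpha> by simp
  define f where "f u \<omega> = G \<omega> * (Y s \<omega> \<bullet> llg_drift \<alpha> b (\<mu> u \<omega>))" for u \<omega>
  have t0: "0 \<le> t" using st by simp
  have Ys: "Y s \<in> borel_measurable M" by (rule Y_measurable[OF st(1)])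
  have Gm: "G \<in> borel_measurable M" by (rule square_integrableD(1)[OF G])
  have dm: "llg_drift \<alpha> b \<in> borel_measurable borel"
    unfolding llg_drift_def[abs_def] by (intro borel_measurable_continuous_onI continuous_intros continuous_on_cross)
  have fj: "jointly_measurable t M f"
  proof -
    have "jointly_measurable t M (\<lambda>u \<omega>. llg_drift \<alpha> b (\<mu> u \<omega>))"
      by (rule jointly_measurable_compose[OF \<mu>_jointly_measurable(1)[OF t0] dm])
    then show ?thesis
      unfolding f_def split_beta'
      by (intro borel_measurable_times borel_measurable_inner measurable_compose[OF measurable_snd Ys] measurable_compose[OF measurable_snd Gm])
  qed
  have fm: "f u \<in> borel_measurable M" if "0 \<le> u" for u
    unfolding f_def[abs_def] using Ys Gm measurable_compose[OF \<mu>_measurable[OF that] dm] by measurable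
  have fle: "\<bar>f u \<omega>\<bar> \<le> ?k * (\<Sum>i\<in>UNIV. \<bar>G \<omega> * (Y u \<omega> $ i - Y s \<omega> $ i)\<bar>)" if u: "0 \<le> u" "\<omega> \<in> space M" for u \<omega>
  proof -
    have "Y u \<omega> \<bullet> llg_drift \<alpha> b (\<mu> u \<omega>) = 0"
      using Y_eq_norm_\<mu>[OF u] by (metis inner_llg_drift_self inner_scaleR_left mult_zero_right)
    then have "Y s \<omega> \<bullet> llg_drift \<alpha> b (\<mu> u \<omega>) = - ((Y u \<omega> - Y s \<omega>) \<bullet> llg_drift \<alpha> b (\<mu> u \<omega>))"
      by (simp add: inner_diff_left)
    then have "\<bar>f u \<omega>\<bar> = \<bar>G \<omega>\<bar> * \<bar>(Y u \<omega> - Y s \<omega>) \<bullet> llg_drift \<alpha> b (\<mu> u \<omega>)\<bar>"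
      by (simp add: f_def abs_mult)
    also have "\<dots> \<le> \<bar>G \<omega>\<bar> * ((\<Sum>i\<in>UNIV. \<bar>Y u \<omega> $ i - Y s \<omega> $ i\<bar>) * ?k)"
    proof (rule mult_left_mono)
      have "\<bar>(Y u \<omega> - Y s \<omega>) \<bullet> llg_drift \<alpha> b (\<mu> u \<omega>)\<bar> \<le> norm (Y u \<omega> - Y s \<omega>) * norm (llg_drift \<alpha> b (\<mu> u \<omega>))"
        by (rule Cauchy_Schwarz_ineq2)
      also have "\<dots> \<le> (\<Sum>i\<in>UNIV. \<bar>Y u \<omega> $ i - Y s \<omega> $ i\<bar>) * ?k"
        using norm_le_l1_cart[of "Y u \<omega> - Y s \<omega>"] norm_llg_drift_le[OF norm_\<mu>_le[OF u], of \<alpha> b] \<alpha>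
        by (intro mult_mono) (auto intro: sum_nonneg)
      finally show "\<bar>(Y u \<omega> - Y s \<omega>) \<bullet> llg_drift \<alpha> b (\<mu> u \<omega>)\<bar> \<le> (\<Sum>i\<in>UNIV. \<bar>Y u \<omega> $ i - Y s \<omega> $ i\<bar>) * ?k" .
    qed simp
    finally show ?thesis by (simp add: abs_mult sum_distrib_left sum_distrib_right mult_ac)
  qed
  have gi: "integrable M (\<lambda>\<omega>. \<bar>G \<omega> * (Y u \<omega> $ i - Y s \<omega> $ i)\<bar>)" if "u \<in> {s..t}" for u i
    using square_integrable_mult[OF G fi[OF that]] by simp
  have int: "integrable M (\<lambda>\<omega>. ?k * (\<Sum>i\<in>UNIV. \<bar>G \<omega> * (Y u \<omega> $ i - Y s \<omega> $ i)\<bar>))" if "u \<in> {s..t}" for u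
    using gi[OF that] by (intro integrable_mult_right Bochner_Integration.integrable_sum)
  have fint: "integrable M (f u)" if u: "u \<in> {s..t}" for u
    using fm[of u] fle[of u] u st
    by (intro Bochner_Integration.integrable_bound[OF int[OF u]]) (auto intro!: AE_I2 order_trans[OF _ abs_ge_self])
  have fE: "expectation (\<lambda>\<omega>. \<bar>f u \<omega>\<bar>) \<le> 3 * ?k * L2_norm G * c" if u: "u \<in> {s..t}" for u
  proof -
    have "expectation (\<lambda>\<omega>. \<bar>f u \<omega>\<bar>) \<le> expectation (\<lambda>\<omega>. ?k * (\<Sum>i\<in>UNIV. \<bar>G \<omega> * (Y u \<omega> $ i - Y s \<omega> $ i)\<bar>))"
      using fle[of u] u st fint[OF u] by (intro integral_mono int) auto
    also have "\<dots> = ?k * (\<Sum>i\<in>UNIV. expectation (\<lambda>\<omega>. \<bar>G \<omega> * (Y u \<omega> $ i - Y s \<omega> $ i)\<bar>))"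
      using gi[OF u] by (simp add: Bochner_Integration.integral_sum)
    also have "\<dots> \<le> ?k * (\<Sum>i\<in>(UNIV::3 set). L2_norm G * c)"
      using k fb[OF u] by (intro mult_left_mono sum_mono order_trans[OF Cauchy_Schwarz_expectation[OF G fi[OF u]]]) auto
    also have "(\<Sum>i\<in>(UNIV::3 set). L2_norm G * c) = 3 * (L2_norm G * c)" by simp
    finally show ?thesis by (simp only: mult_ac)
  qed
  have "0 \<le> 3 * ?k * L2_norm G * c" using k c by simp
  note tb = expectation_time_integral_bound[OF fj st this fint fE]
  have e: "G \<omega> * (\<Sum>i\<in>UNIV. Y s \<omega> $ i * drift_incr (axis i 1) s t \<omega>) = set_lebesgue_integral lborel {s..t} (\<lambda>u. f u \<omega>)"
    if w: "\<omega> \<in> space M" for \<omega>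
  proof -
    have "(\<Sum>i\<in>UNIV. Y s \<omega> $ i * drift_incr (axis i 1) s t \<omega>) =
      set_lebesgue_integral lborel {s..t} (\<lambda>u. \<Sum>i\<in>UNIV. Y s \<omega> $ i * (axis i 1 \<bullet> llg_drift \<alpha> b (\<mu> u \<omega>)))"
      unfolding drift_incr_def by (intro set_integral_linear_combination[symmetric] inner_drift_integrable st w) auto
    also have "\<dots> = set_lebesgue_integral lborel {s..t} (\<lambda>u. Y s \<omega> \<bullet> llg_drift \<alpha> b (\<mu> u \<omega>))"
      by (simp add: inner_vec_nth[of "Y s \<omega>"] inner_axis')
    finally show ?thesis by (simp add: f_def)
  qed
  have i: "integrable M (\<lambda>\<omega>. G \<omega> * (\<Sum>i\<in>UNIV. Y s \<omega> $ i * drift_incr (axis i 1) s t \<omega>)) \<longleftrightarrow>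
    integrable M (\<lambda>\<omega>. set_lebesgue_integral lborel {s..t} (\<lambda>u. f u \<omega>))"
    by (rule Bochner_Integration.integrable_cong[OF refl e])
  show ?int unfolding i by (rule tb(1))
  have "expectation (\<lambda>\<omega>. \<bar>G \<omega> * (\<Sum>i\<in>UNIV. Y s \<omega> $ i * drift_incr (axis i 1) s t \<omega>)\<bar>) =
     expectation (\<lambda>\<omega>. \<bar>set_lebesgue_integral lborel {s..t} (\<lambda>u. f u \<omega>)\<bar>)"
    by (rule Bochner_Integration.integral_cong[OF refl]) (simp add: e)
  then show ?E using tb(2) by simp
qed

end

context llg_solution begin

lemma Y_component_increment: "axis i 1 \<bullet> (Y t \<omega> - Y s \<omega>) = Y t \<omega> $ i - Y s \<omega> $ i"
  by (simp add: inner_axis')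

lemma component_measurable_F: "0 \<le> s \<Longrightarrow> (\<lambda>\<omega>. Y s \<omega> $ i) \<in> borel_measurable (F s)"
  using Y_adapted[of s] by measurable

text \<open>The increment D of the compensated process N splits into \<open>R1\<close>
  (\<open>Y s\<close> against drift), \<open>R2\<close> (\<open>Y s\<close> against noise),
  \<open>R3\<close> (compensated squares of the noise) and \<open>R4\<close> (products with a drift
  increment). N at time \<open>s\<close> is orthogonal to \<open>R2\<close> and \<open>R3\<close>,
  and its pairing with \<open>R1\<close> and \<open>R4\<close> is O((t - s)^(3/2)). Since D is O(t -
  s) in L2, the change of E N^2 is of that order too.\<close>

lemma compensated_step:
  assumes T: "0 \<le> T"
  shows "\<exists>C. \<forall>s t. 0 \<le> s \<longrightarrow> s \<le> t \<longrightarrow> t \<le> T \<longrightarrow>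
    \<bar>expectation (\<lambda>\<omega>. (compensated t \<omega>)\<^sup>2) - expectation (\<lambda>\<omega>. (compensated s \<omega>)\<^sup>2)\<bar> \<le> C * ((t - s) * sqrt (t - s))"
proof -
  obtain c where c: "0 \<le> c"
    and Yi: "\<And>s t v. 0 \<le> s \<Longrightarrow> s \<le> t \<Longrightarrow> t \<le> T \<Longrightarrow> norm v \<le> 1 \<Longrightarrow> fourth_integrable (\<lambda>\<omega>. v \<bullet> (Y t \<omega> - Y s \<omega>))"
      "\<And>s t v. 0 \<le> s \<Longrightarrow> s \<le> t \<Longrightarrow> t \<le> T \<Longrightarrow> norm v \<le> 1 \<Longrightarrow>
      expectation (\<lambda>\<omega>. (v \<bullet> (Y t \<omega> - Y s \<omega>)) ^ 4) \<le> (c * sqrt (t - s)) ^ 4"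
    and Ji: "\<And>s t v. 0 \<le> s \<Longrightarrow> s \<le> t \<Longrightarrow> t \<le> T \<Longrightarrow> norm v \<le> 1 \<Longrightarrow> fourth_integrable (incr v s t)"
      "\<And>s t v. 0 \<le> s \<Longrightarrow> s \<le> t \<Longrightarrow> t \<le> T \<Longrightarrow> norm v \<le> 1 \<Longrightarrow>
      expectation (\<lambda>\<omega>. incr v s t \<omega> ^ 4) \<le> (c * sqrt (t - s)) ^ 4"
  proof (rule Y_increment_fourth_moment[OF T], goal_cases)
    case prems: (1 c)
    show ?case by (rule prems(1)[OF prems(2-6)])
  qed
  obtain d where d: "0 \<le> d" and Yd: "\<And>t i. 0 \<le> t \<Longrightarrow> t \<le> T \<Longrightarrow> expectation (\<lambda>\<omega>. (Y t \<omega> $ i) ^ 4) \<le> d ^ 4"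
  proof (rule Y_fourth_moment_bound[OF T], goal_cases)
    case prems: (1 d)
    show ?case by (rule prems(1)[OF prems(2-3)])
  qed
  define k where "k = (1 + \<alpha>) * norm b"
  define R where "R = sqrt T"
  define n where "n = 3 * d\<^sup>2 + 1 + 3 * \<kappa> * T"
  \<comment> \<open>The four summands are the L2 rates of \<open>R1\<close>, \<open>R2\<close>,
    \<open>R3\<close> and \<open>R4\<close>; \<open>n\<close> bounds the L2 norm of the compensated
    process on the whole interval.\<close>
  define Q where "Q = 6 * k * d + 4 * sqrt \<kappa> * c + 3 * (c\<^sup>2 + \<kappa>) + 3 * k * R * (2 * c + k * R)"
  have k: "0 \<le> k" and R: "0 \<le> R" and n: "0 \<le> n" using \<alpha> T \<kappa>_pos by (auto simp: k_def R_def n_def)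
  let ?N = compensated
  have n1: "norm (axis i 1 :: real^3) \<le> 1" for i by (simp add: norm_axis_1)
  have N_norm: "L2_norm (?N s) \<le> n" if s: "0 \<le> s" "s \<le> T" for s
  proof -
    have sq: "square_integrable (\<lambda>\<omega>. (Y s \<omega> $ i)\<^sup>2)" for i by (rule fourth_integrableD(3)[OF component_fourth_integrable[OF s(1)]])
    have sm: "square_integrable (\<lambda>\<omega>. \<Sum>i\<in>UNIV. (Y s \<omega> $ i)\<^sup>2)"
      by (rule square_integrable_sum(1)) (simp_all only: finite sq)
    have "L2_norm (\<lambda>\<omega>. (\<Sum>i\<in>UNIV. (Y s \<omega> $ i)\<^sup>2) - 1 - trace_variation s \<omega>)
       \<le> L2_norm (\<lambda>\<omega>. (\<Sum>i\<in>UNIV. (Y s \<omega> $ i)\<^sup>2) - 1) + L2_norm (trace_variation s)"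
      by (rule square_integrable_diff(2)[OF square_integrable_diff(1)[OF sm square_integrable_const(1)] trace_variation_square_integrable(1)[OF s(1)]])
    also have "L2_norm (\<lambda>\<omega>. (\<Sum>i\<in>UNIV. (Y s \<omega> $ i)\<^sup>2) - 1) \<le> L2_norm (\<lambda>\<omega>. \<Sum>i\<in>UNIV. (Y s \<omega> $ i)\<^sup>2) + L2_norm (\<lambda>\<omega>. 1)"
      by (rule square_integrable_diff(2)[OF sm square_integrable_const(1)])
    also have "L2_norm (\<lambda>\<omega>. \<Sum>i\<in>UNIV. (Y s \<omega> $ i)\<^sup>2) \<le> (\<Sum>i\<in>(UNIV::3 set). L2_norm (\<lambda>\<omega>. (Y s \<omega> $ i)\<^sup>2))"
      by (rule square_integrable_sum(2)) (simp_all only: finite sq)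
    also have "\<dots> \<le> (\<Sum>i\<in>(UNIV::3 set). d\<^sup>2)"
      by (intro sum_mono L2_norm_le_fourth(1)[OF component_fourth_integrable[OF s(1)] d Yd[OF s]])
    finally have "L2_norm (?N s) \<le> 3 * d\<^sup>2 + 1 + L2_norm (trace_variation s)"
      unfolding compensated_def[abs_def] by (simp add: square_integrable_const(2))
    also have "L2_norm (trace_variation s) \<le> 3 * \<kappa> * s" by (rule trace_variation_square_integrable(2)[OF s(1)])
    also have "3 * \<kappa> * s \<le> 3 * \<kappa> * T" using s \<kappa>_pos by simp
    finally show ?thesis by (simp add: n_def)
  qed
  define C where "C = 12 * k * n * c + 6 * n * k * (2 * c + k * R) + R * Q\<^sup>2"
  have "\<bar>expectation (\<lambda>\<omega>. (?N t \<omega>)\<^sup>2) - expectation (\<lambda>\<omega>. (?N s \<omega>)\<^sup>2)\<bar> \<le> C * ((t - s) * sqrt (t - s))"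
    if st: "0 \<le> s" "s \<le> t" "t \<le> T" for s t
  proof -
    \<comment> \<open>Errors are measured as \<open>\<delta> * r\<close> with \<open>r\<close> the
      root of \<open>\<delta>\<close>; \<open>R\<close> bounds \<open>r\<close>, which turns any
      surplus power of \<open>r\<close> into a constant.\<close>
    define r where "r = sqrt (t - s)"
    have r: "0 \<le> r" "r * r = t - s" "r \<le> R" using st by (auto simp: r_def R_def)
    define \<delta> where "\<delta> = t - s"
    have \<delta>: "0 \<le> \<delta>" "\<delta> = r * r" "\<delta> \<le> r * R" using st r mult_left_mono[OF r(3,1)] by (auto simp: \<delta>_def)
    have sT: "s \<le> T" using st by simp
    let ?a = "\<lambda>i::3. drift_incr (axis i 1) s t" and ?J = "\<lambda>i::3. incr (axis i 1) s t" and ?y = "\<lambda>(i::3) \<omega>. Y s \<omega> $ i"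
    let ?cov = "\<lambda>i j :: 3. covariation (axis i 1) (axis j 1) s t"
    define R1 where "R1 \<omega> = 2 * (\<Sum>i\<in>UNIV. ?y i \<omega> * ?a i \<omega>)" for \<omega>
    define R2 where "R2 \<omega> = 2 * (\<Sum>i\<in>UNIV. ?y i \<omega> * ?J i \<omega>)" for \<omega>
    define R3 where "R3 \<omega> = (\<Sum>i\<in>UNIV. (?J i \<omega>)\<^sup>2 - ?cov i i \<omega>)" for \<omega>
    define R4 where "R4 \<omega> = (\<Sum>i\<in>UNIV. ?a i \<omega> * (2 * ?J i \<omega> + ?a i \<omega>))" for \<omega>
    have y4: "fourth_integrable (?y i)" for i by (rule component_fourth_integrable[OF st(1)])
    have J4: "fourth_integrable (?J i)" for i by (rule Ji(1)[OF st n1])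
    note y2 = fourth_integrableD(2)[OF y4] and J2 = fourth_integrableD(2)[OF J4]
    have yn: "L2_norm (?y i) \<le> d" for i by (rule L2_norm_le_fourth(2)[OF y4 d Yd[OF st(1) sT]])
    have cr: "0 \<le> c * r" using c r by simp
    have Jn: "L2_norm (?J i) \<le> c * r" "L2_norm (\<lambda>\<omega>. (?J i \<omega>)\<^sup>2) \<le> (c * r)\<^sup>2" for i
      using L2_norm_le_fourth[OF J4 cr] Ji(2)[OF st n1] by (simp_all add: r_def)
    have am: "?a i \<in> borel_measurable M" for i by (rule drift_incr_measurable[OF st(1,2)])
    have ab: "\<bar>?a i \<omega>\<bar> \<le> k * \<delta>" if "\<omega> \<in> space M" for i \<omega>
      using drift_incr_bound[OF st(1,2) that, of "axis i 1"] by (simp add: k_def \<delta>_def norm_axis_1)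
    have k\<delta>: "0 \<le> k * \<delta>" using k \<delta> by simp
    have a_mult: "square_integrable (\<lambda>\<omega>. ?a i \<omega> * X \<omega>)" "L2_norm (\<lambda>\<omega>. ?a i \<omega> * X \<omega>) \<le> k * \<delta> * L2_norm X"
      if X: "square_integrable X" for i X
    proof -
      have "AE \<omega> in M. \<bar>?a i \<omega> * X \<omega>\<bar> \<le> \<bar>k * \<delta> * X \<omega>\<bar>"
        using ab[of _ i] k \<delta>(1) by (intro AE_I2) (auto simp: abs_mult intro!: mult_right_mono)
      from square_integrable_dominated[OF _ square_integrable_cmult(1)[OF X] this]
      show "square_integrable (\<lambda>\<omega>. ?a i \<omega> * X \<omega>)" "L2_norm (\<lambda>\<omega>. ?a i \<omega> * X \<omega>) \<le> k * \<delta> * L2_norm X"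
        using am[of i] square_integrableD(1)[OF X] square_integrable_cmult(2)[OF X, of "k * \<delta>"] k\<delta> by auto
    qed
    have a2: "square_integrable (?a i)" "L2_norm (?a i) \<le> k * \<delta>" for i
      using a_mult[OF square_integrable_const(1)[of 1], of i] by (simp_all add: square_integrable_const)
    have S1: "square_integrable R1" "L2_norm R1 \<le> 6 * k * d * \<delta>"
    proof -
      have i: "square_integrable (\<lambda>\<omega>. ?y i \<omega> * ?a i \<omega>)" "L2_norm (\<lambda>\<omega>. ?y i \<omega> * ?a i \<omega>) \<le> k * \<delta> * d" for i
        using a_mult[OF y2, of i i] mult_left_mono[OF yn[of i] k\<delta>] by (simp_all add: mult.commute)
      have s: "square_integrable (\<lambda>\<omega>. \<Sum>i\<in>UNIV. ?y i \<omega> * ?a i \<omega>)" "L2_norm (\<lambda>\<omega>. \<Sum>i\<in>UNIV. ?y i \<omega> * ?a i \<omega>) \<le> (\<Sum>i\<in>UNIV. L2_norm (\<lambda>\<omega>. ?y i \<omega> * ?a i \<omega>))"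
        by (rule square_integrable_sum; simp only: finite i)+
      show "square_integrable R1" unfolding R1_def[abs_def] by (rule square_integrable_cmult(1)[OF s(1)])
      have "L2_norm (\<lambda>\<omega>. \<Sum>i\<in>UNIV. ?y i \<omega> * ?a i \<omega>) \<le> (\<Sum>i\<in>(UNIV::3 set). k * \<delta> * d)"
        by (rule order_trans[OF s(2) sum_mono[OF i(2)]])
      then have "L2_norm R1 \<le> 2 * (\<Sum>i\<in>(UNIV::3 set). k * \<delta> * d)"
        unfolding R1_def[abs_def] square_integrable_cmult(2)[OF s(1)] abs_numeral by (rule mult_left_mono) simp
      also have "2 * (\<Sum>i\<in>(UNIV::3 set). k * \<delta> * d) = 6 * k * d * \<delta>" by simp
      finally show "L2_norm R1 \<le> 6 * k * d * \<delta>" .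
    qed
    have S4: "square_integrable R4" "L2_norm R4 \<le> 3 * (k * \<delta> * (2 * (c * r) + k * \<delta>))"
    proof -
      have j: "square_integrable (\<lambda>\<omega>. 2 * ?J i \<omega> + ?a i \<omega>)" for i
        by (rule square_integrable_add(1)[OF square_integrable_cmult(1)[OF J2] a2(1)])
      have "L2_norm (\<lambda>\<omega>. 2 * ?J i \<omega> + ?a i \<omega>) \<le> 2 * (c * r) + k * \<delta>" for i
        using square_integrable_add(2)[OF square_integrable_cmult(1)[OF J2, where c=2] a2(1), of i i] square_integrable_cmult(2)[OF J2, of 2 i] Jn(1)[of i] a2(2)[of i]
        by linarith
      then have i: "square_integrable (\<lambda>\<omega>. ?a i \<omega> * (2 * ?J i \<omega> + ?a i \<omega>))"
          "L2_norm (\<lambda>\<omega>. ?a i \<omega> * (2 * ?J i \<omega> + ?a i \<omega>)) \<le> k * \<delta> * (2 * (c * r) + k * \<delta>)" for i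
        using a_mult[OF j, of i i] mult_left_mono[OF _ k\<delta>] by (blast intro: order_trans)+
      have s: "square_integrable (\<lambda>\<omega>. \<Sum>i\<in>UNIV. ?a i \<omega> * (2 * ?J i \<omega> + ?a i \<omega>))"
        "L2_norm (\<lambda>\<omega>. \<Sum>i\<in>UNIV. ?a i \<omega> * (2 * ?J i \<omega> + ?a i \<omega>)) \<le> (\<Sum>i\<in>UNIV. L2_norm (\<lambda>\<omega>. ?a i \<omega> * (2 * ?J i \<omega> + ?a i \<omega>)))"
        by (rule square_integrable_sum; simp only: finite i)+
      show "square_integrable R4" unfolding R4_def[abs_def] by (rule s(1))
      have "L2_norm R4 \<le> (\<Sum>i\<in>(UNIV::3 set). k * \<delta> * (2 * (c * r) + k * \<delta>))"
        unfolding R4_def[abs_def] by (rule order_trans[OF s(2) sum_mono[OF i(2)]])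
      then show "L2_norm R4 \<le> 3 * (k * \<delta> * (2 * (c * r) + k * \<delta>))" by simp
    qed
    have S3: "square_integrable R3" "L2_norm R3 \<le> 3 * ((c * r)\<^sup>2 + \<kappa> * \<delta>)"
    proof -
      have cb: "AE \<omega> in M. \<bar>?cov i i \<omega>\<bar> \<le> \<bar>\<kappa> * \<delta>\<bar>" for i
        using covariation_bound[OF st(1,2), of _ "axis i 1" "axis i 1"] \<kappa>_pos \<delta>
        by (intro AE_I2) (auto simp: norm_axis_1 \<delta>_def)
      note cv = square_integrable_dominated[OF covariation_measurable[OF st(1,2)] square_integrable_const(1) cb]
      have i: "square_integrable (\<lambda>\<omega>. (?J i \<omega>)\<^sup>2 - ?cov i i \<omega>)" "L2_norm (\<lambda>\<omega>. (?J i \<omega>)\<^sup>2 - ?cov i i \<omega>) \<le> (c * r)\<^sup>2 + \<kappa> * \<delta>" for i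
      proof -
        show "square_integrable (\<lambda>\<omega>. (?J i \<omega>)\<^sup>2 - ?cov i i \<omega>)"
          by (rule square_integrable_diff(1)[OF fourth_integrableD(3)[OF J4] cv(1)])
        have "L2_norm (?cov i i) \<le> \<kappa> * \<delta>" using cv(2)[of i] \<kappa>_pos \<delta> by (simp add: square_integrable_const)
        then show "L2_norm (\<lambda>\<omega>. (?J i \<omega>)\<^sup>2 - ?cov i i \<omega>) \<le> (c * r)\<^sup>2 + \<kappa> * \<delta>"
          using square_integrable_diff(2)[OF fourth_integrableD(3)[OF J4] cv(1), of i i] Jn(2)[of i] by linarith
      qed
      have s: "square_integrable (\<lambda>\<omega>. \<Sum>i\<in>UNIV. (?J i \<omega>)\<^sup>2 - ?cov i i \<omega>)"
        "L2_norm (\<lambda>\<omega>. \<Sum>i\<in>UNIV. (?J i \<omega>)\<^sup>2 - ?cov i i \<omega>) \<le> (\<Sum>i\<in>UNIV. L2_norm (\<lambda>\<omega>. (?J i \<omega>)\<^sup>2 - ?cov i i \<omega>))"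
        by (rule square_integrable_sum; simp only: finite i)+
      show "square_integrable R3" unfolding R3_def[abs_def] by (rule s(1))
      have "L2_norm R3 \<le> (\<Sum>i\<in>(UNIV::3 set). (c * r)\<^sup>2 + \<kappa> * \<delta>)"
        unfolding R3_def[abs_def] by (rule order_trans[OF s(2) sum_mono[OF i(2)]])
      then show "L2_norm R3 \<le> 3 * ((c * r)\<^sup>2 + \<kappa> * \<delta>)" by simp
    qed
    have incr_sq: "square_integrable (\<lambda>\<omega>. Y u \<omega> $ i - Y s \<omega> $ i)" "L2_norm (\<lambda>\<omega>. Y u \<omega> $ i - Y s \<omega> $ i) \<le> c * r"
      "expectation (\<lambda>\<omega>. (Y u \<omega> $ i - Y s \<omega> $ i)\<^sup>2) \<le> (c * r)\<^sup>2" if u: "u \<in> {s..t}" for u i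
    proof -
      have us: "s \<le> u" "u \<le> T" using u st by auto
      have cu: "0 \<le> c * sqrt (u - s)" using c us by simp
      note f = Yi(1)[OF st(1) us n1[of i], unfolded Y_component_increment] and e = Yi(2)[OF st(1) us n1[of i], unfolded Y_component_increment]
      show "square_integrable (\<lambda>\<omega>. Y u \<omega> $ i - Y s \<omega> $ i)" by (rule fourth_integrableD(2)[OF f])
      have "L2_norm (\<lambda>\<omega>. Y u \<omega> $ i - Y s \<omega> $ i) \<le> c * sqrt (u - s)" by (rule L2_norm_le_fourth(2)[OF f cu e])
      also have "\<dots> \<le> c * r" using u c by (intro mult_left_mono) (auto simp: r_def)
      finally show l: "L2_norm (\<lambda>\<omega>. Y u \<omega> $ i - Y s \<omega> $ i) \<le> c * r" .
      show "expectation (\<lambda>\<omega>. (Y u \<omega> $ i - Y s \<omega> $ i)\<^sup>2) \<le> (c * r)\<^sup>2"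
        unfolding L2_norm_squared[symmetric] using l by (intro power_mono) auto
    qed
    \<comment> \<open>A martingale increment is normally of order sqrt (t - s). That
      \<open>R2\<close> is of order t - s, so that its square contributes nothing to the derivative,
      rests on the cancellation in \<open>expectation_cross_variation_bound\<close>.\<close>
    have S2: "square_integrable R2" "L2_norm R2 \<le> 4 * sqrt \<kappa> * c * \<delta>"
    proof -
      have yy1: "(\<lambda>\<omega>. ?y i \<omega> * ?y j \<omega>) \<in> borel_measurable (F s)" for i j
        by (intro borel_measurable_times component_measurable_F[OF st(1)])
      have yy2: "integrable M (\<lambda>\<omega>. (?y i \<omega> * ?y j \<omega>)\<^sup>2)" for i j
        by (rule square_integrableD(2)[OF fourth_integrable_mult(1)[OF y4 y4]])
      note iso = incr_isometry[OF st(1,2) yy1 yy2]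
      have e: "(R2 \<omega>)\<^sup>2 = 4 * (\<Sum>i\<in>UNIV. \<Sum>j\<in>UNIV. ?y i \<omega> * ?y j \<omega> * (?J i \<omega> * ?J j \<omega>))" for \<omega>
        unfolding R2_def power2_eq_square by (simp add: sum_product mult_ac)
      have si: "integrable M (\<lambda>\<omega>. (R2 \<omega>)\<^sup>2)"
        unfolding e using iso(1) by (intro integrable_mult_right Bochner_Integration.integrable_sum) auto
      have R2m: "R2 \<in> borel_measurable M"
        unfolding R2_def[abs_def] using fourth_integrableD(1)[OF y4] fourth_integrableD(1)[OF J4] by simp
      show "square_integrable R2" using R2m si by (simp add: square_integrable_def)
      have ci: "integrable M (\<lambda>\<omega>. ?y i \<omega> * ?y j \<omega> * ?cov i j \<omega>)" for i j
        by (intro integrable_mult_covariation st square_integrable_mult y2)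
      have "expectation (\<lambda>\<omega>. (R2 \<omega>)\<^sup>2) = 4 * (\<Sum>i\<in>UNIV. \<Sum>j\<in>UNIV. expectation (\<lambda>\<omega>. ?y i \<omega> * ?y j \<omega> * (?J i \<omega> * ?J j \<omega>)))"
        unfolding e using iso(1) by (simp add: Bochner_Integration.integral_sum Bochner_Integration.integrable_sum)
      also have "\<dots> = 4 * expectation (\<lambda>\<omega>. \<Sum>i\<in>UNIV. \<Sum>j\<in>UNIV. ?y i \<omega> * ?y j \<omega> * ?cov i j \<omega>)"
        unfolding iso(2) using ci by (simp add: Bochner_Integration.integral_sum Bochner_Integration.integrable_sum)
      also have "\<dots> \<le> 4 * (3 * \<kappa> * (c * r)\<^sup>2 * (t - s))"
        by (rule mult_left_mono[OF expectation_cross_variation_bound[OF st(1,2) zero_le_power2 incr_sq(1,3)]]) simp_all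
      \<comment> \<open>The factor 12 is rounded up to 16 in order to be a perfect square.\<close>
      also have "\<dots> \<le> 16 * \<kappa> * (c * r)\<^sup>2 * (t - s)"
      proof -
        have "0 \<le> \<kappa> * (c * r)\<^sup>2 * (t - s)" using \<kappa>_pos st by simp
        moreover have "4 * (3 * x) \<le> 16 * x" if "0 \<le> x" for x :: real using that by simp
        ultimately show ?thesis by (simp only: mult.assoc)
      qed
      also have "\<dots> = (4 * sqrt \<kappa> * c * \<delta>)\<^sup>2"
        using \<kappa>_pos r(2) unfolding power_mult_distrib by (simp add: \<delta>_def power2_eq_square)
      finally show "L2_norm R2 \<le> 4 * sqrt \<kappa> * c * \<delta>"
        using \<kappa>_pos c \<delta> by (intro L2_norm_le) auto
    qed
    have Ns: "square_integrable (?N s)" by (rule compensated_square_integrable[OF st(1)])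
    have Nsm: "?N s \<in> borel_measurable (F s)" by (rule compensated_measurable_F[OF st(1)])
    have o2: "integrable M (\<lambda>\<omega>. ?N s \<omega> * R2 \<omega>)" "expectation (\<lambda>\<omega>. ?N s \<omega> * R2 \<omega>) = 0"
    proof -
      have i: "integrable M (\<lambda>\<omega>. ?N s \<omega> * ?y i \<omega> * ?J i \<omega>)" for i
        using square_integrable_mult[OF Ns fourth_integrable_mult(1)[OF y4 J4], of i i] by (simp add: mult.assoc)
      have "expectation (\<lambda>\<omega>. ?N s \<omega> * ?y i \<omega> * ?J i \<omega>) = 0" for i
        using Nsm component_measurable_F[OF st(1)] by (intro incr_orthogonal[OF st(1,2) _ i] borel_measurable_times) auto
      moreover have "?N s \<omega> * R2 \<omega> = 2 * (\<Sum>i\<in>UNIV. ?N s \<omega> * ?y i \<omega> * ?J i \<omega>)" for \<omega>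
        by (simp add: R2_def sum_distrib_left mult_ac)
      ultimately show "expectation (\<lambda>\<omega>. ?N s \<omega> * R2 \<omega>) = 0" using i by (simp add: Bochner_Integration.integral_sum)
      show "integrable M (\<lambda>\<omega>. ?N s \<omega> * R2 \<omega>)" by (rule square_integrable_mult[OF Ns S2(1)])
    qed
    have o3: "expectation (\<lambda>\<omega>. ?N s \<omega> * R3 \<omega>) = 0"
    proof -
      note iso = incr_isometry[OF st(1,2) Nsm square_integrableD(2)[OF Ns]]
      note ci = integrable_mult_covariation[OF st(1,2) square_integrableD(3)[OF Ns]]
      have "?N s \<omega> * R3 \<omega> = (\<Sum>i\<in>UNIV. ?N s \<omega> * (?J i \<omega> * ?J i \<omega>) - ?N s \<omega> * ?cov i i \<omega>)" for \<omega>
        by (simp add: R3_def sum_distrib_left power2_eq_square algebra_simps)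
      then show ?thesis using iso ci by (simp add: Bochner_Integration.integral_sum)
    qed
    have o1: "\<bar>expectation (\<lambda>\<omega>. ?N s \<omega> * R1 \<omega>)\<bar> \<le> 6 * k * n * c * (\<delta> * r)"
    proof -
      let ?X = "\<lambda>\<omega>. ?N s \<omega> * (\<Sum>i\<in>UNIV. Y s \<omega> $ i * drift_incr (axis i 1) s t \<omega>)"
      note db = expectation_mult_drift_bound[OF st(1,2) cr Ns incr_sq(1,2)]
      have A: "\<bar>expectation ?X\<bar> \<le> 3 * k * L2_norm (?N s) * (c * r) * \<delta>"
        using order_trans[OF integral_abs_bound db(2)] by (simp add: k_def \<delta>_def)
      have B: "3 * k * L2_norm (?N s) * (c * r) * \<delta> \<le> 3 * k * n * (c * r) * \<delta>"
        using k cr \<delta> N_norm[OF st(1) sT] by (intro mult_right_mono mult_left_mono) auto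
      have "expectation (\<lambda>\<omega>. ?N s \<omega> * R1 \<omega>) = 2 * expectation ?X"
        using db(1) by (simp add: R1_def mult.left_commute)
      then have "\<bar>expectation (\<lambda>\<omega>. ?N s \<omega> * R1 \<omega>)\<bar> = 2 * \<bar>expectation ?X\<bar>" by (simp add: abs_mult)
      also have "\<dots> \<le> 2 * (3 * k * n * (c * r) * \<delta>)" by (rule mult_left_mono[OF order_trans[OF A B]]) simp
      also have "\<dots> = 6 * k * n * c * (\<delta> * r)" by simp
      finally show ?thesis .
    qed
    have R4b: "L2_norm R4 \<le> 3 * k * (2 * c + k * R) * (\<delta> * r)"
    proof -
      have "2 * (c * r) + k * \<delta> \<le> (2 * c + k * R) * r"
        using mult_left_mono[OF \<delta>(3) k] by (simp add: algebra_simps)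
      then have "k * \<delta> * (2 * (c * r) + k * \<delta>) \<le> k * \<delta> * ((2 * c + k * R) * r)" using k\<delta> by (rule mult_left_mono)
      then have "3 * (k * \<delta> * (2 * (c * r) + k * \<delta>)) \<le> 3 * (k * \<delta> * ((2 * c + k * R) * r))" by (rule mult_left_mono) simp
      also have "\<dots> = 3 * k * (2 * c + k * R) * (\<delta> * r)" by (simp only: mult_ac)
      finally show ?thesis using S4(2) by (rule order_trans[rotated])
    qed
    have o4: "\<bar>expectation (\<lambda>\<omega>. ?N s \<omega> * R4 \<omega>)\<bar> \<le> n * (3 * k * (2 * c + k * R) * (\<delta> * r))"
    proof -
      have "\<bar>expectation (\<lambda>\<omega>. ?N s \<omega> * R4 \<omega>)\<bar> \<le> L2_norm (?N s) * L2_norm R4"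
        by (rule order_trans[OF integral_abs_bound Cauchy_Schwarz_expectation[OF Ns S4(1)]])
      also have "\<dots> \<le> n * (3 * k * (2 * c + k * R) * (\<delta> * r))"
        by (intro mult_mono N_norm st sT R4b n L2_norm_nonneg)
      finally show ?thesis .
    qed
    define D where "D \<omega> = (R1 \<omega> + R2 \<omega>) + (R3 \<omega> + R4 \<omega>)" for \<omega>
    have D2: "square_integrable D" unfolding D_def[abs_def]
      by (rule square_integrable_add(1)[OF square_integrable_add(1)[OF S1(1) S2(1)] square_integrable_add(1)[OF S3(1) S4(1)]])
    have Dn: "L2_norm D \<le> Q * \<delta>"
    proof -
      have "L2_norm D \<le> (L2_norm R1 + L2_norm R2) + (L2_norm R3 + L2_norm R4)"
        unfolding D_def[abs_def]
        using square_integrable_add(2)[OF square_integrable_add(1)[OF S1(1) S2(1)] square_integrable_add(1)[OF S3(1) S4(1)]]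
          square_integrable_add(2)[OF S1(1) S2(1)] square_integrable_add(2)[OF S3(1) S4(1)] by linarith
      moreover have "L2_norm R4 \<le> 3 * k * R * (2 * c + k * R) * \<delta>"
      proof -
        have "3 * k * (2 * c + k * R) * (\<delta> * r) \<le> 3 * k * (2 * c + k * R) * (\<delta> * R)"
          using k c R \<delta> r by (intro mult_left_mono) auto
        also have "\<dots> = 3 * k * R * (2 * c + k * R) * \<delta>" by (simp only: mult_ac)
        finally show ?thesis using R4b by (rule order_trans[rotated])
      qed
      moreover have "L2_norm R3 \<le> 3 * (c\<^sup>2 + \<kappa>) * \<delta>"
      proof -
        have "3 * ((c * r)\<^sup>2 + \<kappa> * \<delta>) = 3 * (c\<^sup>2 + \<kappa>) * \<delta>"
          unfolding \<delta>(2) by (simp add: power_mult_distrib power2_eq_square distrib_left distrib_right)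
        then show ?thesis using S3(2) by simp
      qed
      ultimately have "L2_norm D \<le> 6 * k * d * \<delta> + 4 * sqrt \<kappa> * c * \<delta> + 3 * (c\<^sup>2 + \<kappa>) * \<delta> + 3 * k * R * (2 * c + k * R) * \<delta>"
        using S1(2) S2(2) by linarith
      also have "\<dots> = Q * \<delta>" unfolding Q_def by (simp only: distrib_right)
      finally show ?thesis .
    qed
    have ED: "expectation (\<lambda>\<omega>. (D \<omega>)\<^sup>2) \<le> R * Q\<^sup>2 * (\<delta> * r)"
    proof -
      have "expectation (\<lambda>\<omega>. (D \<omega>)\<^sup>2) \<le> (Q * \<delta>)\<^sup>2"
        unfolding L2_norm_squared[symmetric] using Dn by (intro power_mono) auto
      also have "\<dots> = Q\<^sup>2 * \<delta> * \<delta>" by (simp add: power2_eq_square mult_ac)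
      also have "\<dots> \<le> Q\<^sup>2 * \<delta> * (r * R)" using \<delta> by (intro mult_left_mono) auto
      also have "\<dots> = R * Q\<^sup>2 * (\<delta> * r)" by (simp only: mult_ac)
      finally show ?thesis .
    qed
    have step: "AE \<omega> in M. ?N t \<omega> = ?N s \<omega> + D \<omega>"
      using Y_increment AE_space
    proof eventually_elim
      case (elim \<omega>)
      have yt: "Y t \<omega> $ i = ?y i \<omega> + (?a i \<omega> + ?J i \<omega>)" for i
        using elim(1)[rule_format, OF st(1,2), of "axis i 1"] unfolding Y_component_increment by simp
      have tv: "trace_variation t \<omega> = trace_variation s \<omega> + (\<Sum>i\<in>UNIV. ?cov i i \<omega>)"
        unfolding trace_variation_def sum.distrib[symmetric]
        using covariation_split[OF st(1,2) elim(2)] by simp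
      have "(\<Sum>i\<in>UNIV. (Y t \<omega> $ i)\<^sup>2) - (\<Sum>i\<in>UNIV. ?cov i i \<omega>) = (\<Sum>i\<in>UNIV. (?y i \<omega>)\<^sup>2) + D \<omega>"
        unfolding D_def R1_def R2_def R3_def R4_def yt sum_distrib_left sum.distrib[symmetric] sum_subtractf[symmetric]
        by (intro sum.cong refl) (simp add: power2_eq_square algebra_simps)
      then show ?case unfolding compensated_def tv by simp
    qed
    have Nt: "square_integrable (?N t)" using st by (intro compensated_square_integrable) auto
    have "expectation (\<lambda>\<omega>. (?N t \<omega>)\<^sup>2) = expectation (\<lambda>\<omega>. (?N s \<omega>)\<^sup>2 + 2 * (?N s \<omega> * D \<omega>) + (D \<omega>)\<^sup>2)"
    proof (rule integral_cong_AE)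
      show "AE \<omega> in M. (?N t \<omega>)\<^sup>2 = (?N s \<omega>)\<^sup>2 + 2 * (?N s \<omega> * D \<omega>) + (D \<omega>)\<^sup>2"
        using step by eventually_elim (simp add: power2_sum algebra_simps)
    qed (use square_integrableD(1)[OF Nt] square_integrableD(1)[OF Ns] square_integrableD(1)[OF D2] in auto)
    also have "\<dots> = expectation (\<lambda>\<omega>. (?N s \<omega>)\<^sup>2) + 2 * expectation (\<lambda>\<omega>. ?N s \<omega> * D \<omega>) + expectation (\<lambda>\<omega>. (D \<omega>)\<^sup>2)"
      using square_integrableD(2)[OF Ns] square_integrableD(2)[OF D2] square_integrable_mult[OF Ns D2] by simp
    also have "expectation (\<lambda>\<omega>. ?N s \<omega> * D \<omega>) = expectation (\<lambda>\<omega>. (?N s \<omega> * R1 \<omega> + ?N s \<omega> * R2 \<omega>) + (?N s \<omega> * R3 \<omega> + ?N s \<omega> * R4 \<omega>))"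
      by (simp add: D_def distrib_left)
    also have "\<dots> = expectation (\<lambda>\<omega>. ?N s \<omega> * R1 \<omega>) + expectation (\<lambda>\<omega>. ?N s \<omega> * R4 \<omega>)"
      using square_integrable_mult[OF Ns S1(1)] square_integrable_mult[OF Ns S2(1)] square_integrable_mult[OF Ns S3(1)]
        square_integrable_mult[OF Ns S4(1)] o2(2) o3 by simp
    finally have eq: "expectation (\<lambda>\<omega>. (?N t \<omega>)\<^sup>2) = expectation (\<lambda>\<omega>. (?N s \<omega>)\<^sup>2)
      + 2 * (expectation (\<lambda>\<omega>. ?N s \<omega> * R1 \<omega>) + expectation (\<lambda>\<omega>. ?N s \<omega> * R4 \<omega>)) + expectation (\<lambda>\<omega>. (D \<omega>)\<^sup>2)" .
    have ED0: "0 \<le> expectation (\<lambda>\<omega>. (D \<omega>)\<^sup>2)" by (intro integral_nonneg_AE) auto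
    have "\<bar>expectation (\<lambda>\<omega>. (?N t \<omega>)\<^sup>2) - expectation (\<lambda>\<omega>. (?N s \<omega>)\<^sup>2)\<bar> \<le>
        2 * (6 * k * n * c * (\<delta> * r) + n * (3 * k * (2 * c + k * R) * (\<delta> * r))) + R * Q\<^sup>2 * (\<delta> * r)"
    proof -
      have "\<bar>u - v\<bar> \<le> 2 * (p + q) + z" if "\<bar>a\<bar> \<le> p" "\<bar>a'\<bar> \<le> q" "0 \<le> e" "e \<le> z" "u = v + 2 * (a + a') + e"
        for u v p q z a a' e :: real
        using that by (auto simp: abs_le_iff)
      from this[OF o1 o4 ED0 ED eq] show ?thesis .
    qed
    also have "\<dots> = C * (\<delta> * r)" by (simp add: C_def algebra_simps)
    finally show ?thesis by (simp add: \<delta>_def r_def)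
  qed
  then show ?thesis by blast
qed

end

lemma difference_of_quotients:
  fixes x z p q :: real
  assumes "x \<noteq> 0" "z \<noteq> 0"
  shows "(1 - p\<^sup>2 / z) - (1 - q\<^sup>2 / x) = (q - p) * (q + p) / x + p\<^sup>2 * (z - x) / (x * z)"
  using assms by (simp add: field_simps power2_eq_square)

context llg_solution begin

lemma covariation_nonneg: "0 \<le> covariation v v s t \<omega>"
  unfolding covariation_def set_lebesgue_integral_def
  by (intro integral_nonneg_AE) (auto split: split_indicator)

text \<open>The one-step estimate with derivative 0 makes the second moment constant in time, and it
  starts at 0 because \<open>y\<close> is a unit vector.\<close>

lemma compensated_zero:
  assumes T: "0 \<le> T" shows "AE \<omega> in M. compensated T \<omega> = 0"
proof -
  let ?\<phi> = "\<lambda>t. expectation (\<lambda>\<omega>. (compensated t \<omega>)\<^sup>2)"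
  obtain C where C: "\<And>s t. 0 \<le> s \<Longrightarrow> s \<le> t \<Longrightarrow> t \<le> T \<Longrightarrow> \<bar>?\<phi> t - ?\<phi> s\<bar> \<le> C * ((t - s) * sqrt (t - s))"
    using compensated_step[OF T] by blast
  have "(?\<phi> has_field_derivative 0) (at x within {0..T})" if "x \<in> {0..T}" for x
    by (rule has_derivative_if_one_step[where \<psi>="\<lambda>_. 0" and C=C, OF _ _ that]) (use C in \<open>simp_all add: continuous_on_const\<close>)
  then have "\<exists>c. \<forall>x\<in>{0..T}. ?\<phi> x = c"
    by (intro has_field_derivative_zero_constant) auto
  then have eq: "?\<phi> T = ?\<phi> 0" using T by auto
  have "AE \<omega> in M. compensated 0 \<omega> = 0"
    using Y_zero AE_space
  proof eventually_elim
    case (elim \<omega>)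
    have "trace_variation 0 \<omega> = 0" using trace_variation_bound[of 0 \<omega>] elim by simp
    moreover have "(\<Sum>i\<in>UNIV. (y $ i)\<^sup>2) = 1"
      using y power2_norm_eq_inner[of y] by (simp add: inner_vec_nth power2_eq_square)
    ultimately show ?case using elim by (simp add: compensated_def)
  qed
  then have "?\<phi> 0 = 0" by (intro integral_eq_zero_AE) (auto elim: eventually_mono)
  then have "?\<phi> T = 0" using eq by simp
  then have "AE \<omega> in M. (compensated T \<omega>)\<^sup>2 = 0"
    using square_integrableD(2)[OF compensated_square_integrable[OF T]]
    by (subst (asm) integral_nonneg_eq_0_iff_AE) auto
  then show ?thesis by eventually_elim simp
qed

lemma norm_Y_squared_trace:
  assumes "0 \<le> t" shows "AE \<omega> in M. (norm (Y t \<omega>))\<^sup>2 = 1 + trace_variation t \<omega>"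
  using compensated_zero[OF assms]
proof eventually_elim
  case (elim \<omega>)
  have "(norm (Y t \<omega>))\<^sup>2 = (\<Sum>i\<in>UNIV. (Y t \<omega> $ i)\<^sup>2)"
    unfolding power2_norm_eq_inner inner_vec_nth by (simp add: power2_eq_square)
  then show ?case using elim by (simp add: compensated_def)
qed

text \<open>The bracket is nonnegative, so |Y|^2 is at least 1 and Y does not vanish at time
  \<open>t\<close>, outside a null set that may depend on \<open>t\<close>.\<close>

lemma \<mu>_unit:
  assumes t: "0 \<le> t" shows "AE \<omega> in M. \<mu> t \<omega> \<bullet> \<mu> t \<omega> = 1"
  using norm_Y_squared_trace[OF t] AE_space
proof eventually_elim
  case (elim \<omega>)
  have "0 \<le> trace_variation t \<omega>" unfolding trace_variation_def by (intro sum_nonneg covariation_nonneg)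
  then have "Y t \<omega> \<noteq> 0" using elim by auto
  then have "norm (\<mu> t \<omega>) = 1" using \<mu>[OF t elim(2)] by simp
  then show ?case by (simp add: power2_norm_eq_inner[symmetric])
qed

text \<open>The exceptional null set of the assumption may depend on the time \<open>u\<close>, so
  it cannot be used path by path; exchanging the integrals shows that the time integral has mean
  absolute value 0.\<close>

lemma time_integral_zero:
  fixes f :: "real \<Rightarrow> 'a \<Rightarrow> real"
  assumes f: "jointly_measurable t M f" and st: "0 \<le> s" "s \<le> t"
    and z: "\<And>u. u \<in> {s..t} \<Longrightarrow> AE \<omega> in M. f u \<omega> = 0" and m: "\<And>u. u \<in> {s..t} \<Longrightarrow> f u \<in> borel_measurable M"
  shows "AE \<omega> in M. set_lebesgue_integral lborel {s..t} (\<lambda>u. f u \<omega>) = 0"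
proof -
  have int: "integrable M (f u)" if "u \<in> {s..t}" for u
    using integrable_cong_AE[OF m[OF that], of "\<lambda>_. 0"] z[OF that] by simp
  have E: "expectation (\<lambda>\<omega>. \<bar>f u \<omega>\<bar>) \<le> 0" if "u \<in> {s..t}" for u
  proof -
    have "expectation (\<lambda>\<omega>. \<bar>f u \<omega>\<bar>) = 0"
      using z[OF that] by (intro integral_eq_zero_AE) (auto elim: eventually_mono)
    then show ?thesis by simp
  qed
  note b = expectation_time_integral_bound[OF f st order_refl int E]
  have "0 \<le> expectation (\<lambda>\<omega>. \<bar>set_lebesgue_integral lborel {s..t} (\<lambda>u. f u \<omega>)\<bar>)" by (intro integral_nonneg_AE) auto
  moreover have "expectation (\<lambda>\<omega>. \<bar>set_lebesgue_integral lborel {s..t} (\<lambda>u. f u \<omega>)\<bar>) \<le> 0"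
    using b(2) by (simp only: mult_zero_left)
  ultimately have "expectation (\<lambda>\<omega>. \<bar>set_lebesgue_integral lborel {s..t} (\<lambda>u. f u \<omega>)\<bar>) = 0"
    by (intro antisym)
  then have "AE \<omega> in M. \<bar>set_lebesgue_integral lborel {s..t} (\<lambda>u. f u \<omega>)\<bar> = 0"
    using b(1) by (subst (asm) integral_nonneg_eq_0_iff_AE) auto
  then show ?thesis by eventually_elim simp
qed

text \<open>The function \<open>h\<close> of the theorem, in terms of \<kappa>.\<close>

definition radius :: "real \<Rightarrow> real" where "radius t = sqrt (1 + 2 * \<kappa> * t)"

lemma radius: "0 \<le> t \<Longrightarrow> (radius t)\<^sup>2 = 1 + 2 * \<kappa> * t" "0 \<le> t \<Longrightarrow> 1 \<le> radius t" "0 \<le> s \<Longrightarrow> s \<le> t \<Longrightarrow> radius s \<le> radius t"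
  using \<kappa>_pos by (auto simp: radius_def)

text \<open>The trace of the covariance rate is \<kappa> (3 - 1) |\<mu>|^2, which is 2 \<kappa> for
  a unit vector; \<open>f\<close> is the deviation from that value. It vanishes almost surely at
  each fixed time, and hence so does its time integral.\<close>

lemma norm_Y:
  assumes t: "0 \<le> t" shows "AE \<omega> in M. norm (Y t \<omega>) = radius t"
proof -
  define f where "f u \<omega> = 2 * \<kappa> * (\<mu> u \<omega> \<bullet> \<mu> u \<omega>) - 2 * \<kappa>" for u \<omega>
  have fj: "jointly_measurable t M f"
    unfolding f_def split_beta' using \<mu>_jointly_measurable(1)[OF t, unfolded split_beta'] by measurable
  have fz: "AE \<omega> in M. f u \<omega> = 0" if "u \<in> {0..t}" for u
    using \<mu>_unit[of u] that by (auto simp: f_def elim: eventually_mono)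
  have fm: "f u \<in> borel_measurable M" if "u \<in> {0..t}" for u
  proof -
    have [measurable]: "\<mu> u \<in> borel_measurable M" using \<mu>_measurable that by simp
    show ?thesis unfolding f_def[abs_def] by measurable
  qed
  have tz: "AE \<omega> in M. set_lebesgue_integral lborel {0..t} (\<lambda>u. f u \<omega>) = 0"
    by (rule time_integral_zero[OF fj order_refl t fz fm])
  have "AE \<omega> in M. trace_variation t \<omega> = 2 * \<kappa> * t"
    using tz AE_space
  proof eventually_elim
    case (elim \<omega>)
    note ri = row_product_integrable[OF order_refl t elim(2)]
    have "trace_variation t \<omega> = (\<Sum>i\<in>(UNIV::3 set). 1 * set_lebesgue_integral lborel {0..t} (\<lambda>u. (axis i 1 v* H u \<omega>) \<bullet> (axis i 1 v* H u \<omega>)))"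
      by (simp add: trace_variation_def covariation_def)
    also have "\<dots> = set_lebesgue_integral lborel {0..t} (\<lambda>u. \<Sum>i\<in>(UNIV::3 set). 1 * ((axis i 1 v* H u \<omega>) \<bullet> (axis i 1 v* H u \<omega>)))"
      by (intro set_integral_linear_combination[symmetric] ri) auto
    also have "\<dots> = set_lebesgue_integral lborel {0..t} (\<lambda>u. f u \<omega> + 2 * \<kappa>)"
    proof (rule set_lebesgue_integral_cong)
      show "\<forall>u. u \<in> {0..t} \<longrightarrow> (\<Sum>i\<in>(UNIV::3 set). 1 * ((axis i 1 v* H u \<omega>) \<bullet> (axis i 1 v* H u \<omega>))) = f u \<omega> + 2 * \<kappa>"
      proof (intro allI impI)
        fix u assume "u \<in> {0..t}"
        then have u: "0 \<le> u" by simp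
        have "(\<Sum>i\<in>(UNIV::3 set). 1 * ((axis i 1 v* H u \<omega>) \<bullet> (axis i 1 v* H u \<omega>))) =
          (\<Sum>i\<in>(UNIV::3 set). \<kappa> * ((\<mu> u \<omega> \<bullet> \<mu> u \<omega>) - \<mu> u \<omega> $ i * \<mu> u \<omega> $ i))"
          unfolding row_H_inner[OF u elim(2)] by (simp add: inner_axis' norm_axis_1 inner_axis_axis)
        also have "\<dots> = \<kappa> * (3 * (\<mu> u \<omega> \<bullet> \<mu> u \<omega>) - (\<Sum>i\<in>UNIV. \<mu> u \<omega> $ i * \<mu> u \<omega> $ i))"
          by (simp add: sum_distrib_left[symmetric] sum_subtractf)
        also have "\<dots> = f u \<omega> + 2 * \<kappa>"
          unfolding inner_vec_nth[symmetric] f_def by (simp add: algebra_simps)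
        finally show "(\<Sum>i\<in>(UNIV::3 set). 1 * ((axis i 1 v* H u \<omega>) \<bullet> (axis i 1 v* H u \<omega>))) = f u \<omega> + 2 * \<kappa>" .
      qed
    qed simp
    also have "\<dots> = set_lebesgue_integral lborel {0..t} (\<lambda>u. f u \<omega>) + set_lebesgue_integral lborel {0..t} (\<lambda>u. 2 * \<kappa>)"
    proof (rule set_integral_add(2))
      have "\<bar>f u \<omega>\<bar> \<le> 2 * \<kappa>" if "u \<in> {0..t}" for u
      proof -
        have "0 \<le> \<mu> u \<omega> \<bullet> \<mu> u \<omega>" "\<mu> u \<omega> \<bullet> \<mu> u \<omega> \<le> 1" using inner_\<mu>_self_le[of u \<omega>] that elim by auto
        then have "\<kappa> * (\<mu> u \<omega> \<bullet> \<mu> u \<omega>) \<le> \<kappa> * 1" "0 \<le> \<kappa> * (\<mu> u \<omega> \<bullet> \<mu> u \<omega>)"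
          using \<kappa>_pos by (auto intro: mult_left_mono)
        then show ?thesis unfolding f_def by (simp add: abs_le_iff)
      qed
      then show "set_integrable lborel {0..t} (\<lambda>u. f u \<omega>)"
        by (intro bounded_path_set_integrable[where C="2 * \<kappa>", OF fj elim(2) order_refl]) auto
      show "set_integrable lborel {0..t} (\<lambda>u. 2 * \<kappa>)" by (auto simp: set_integrable_def intro: integrable_indicator_Icc)
    qed
    also have "\<dots> = 2 * \<kappa> * t" using elim(1) t by (simp add: set_lebesgue_integral_def)
    finally show ?case .
  qed
  then show ?thesis
    using norm_Y_squared_trace[OF t]
  proof eventually_elim
    case (elim \<omega>)
    then have "(norm (Y t \<omega>))\<^sup>2 = (radius t)\<^sup>2" using radius(1)[OF t] by simp
    moreover have "0 \<le> radius t" using radius(2)[OF t] by simp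
    ultimately show ?case using power2_eq_imp_eq norm_ge_zero by blast
  qed
qed

section \<open>The component of \<open>Y\<close> along the field\<close>

definition \<beta> :: real where "\<beta> = norm b"
definition e :: "real^3" where "e = b /\<^sub>R norm b"

lemma \<beta>_pos: "0 < \<beta>" using b by (simp add: \<beta>_def)
lemma norm_e: "norm e = 1" using b by (simp add: e_def)
lemma b_eq: "b = \<beta> *\<^sub>R e" using b by (simp add: e_def \<beta>_def)

text \<open>The component of Y rather than of \<mu>: it satisfies the equation directly, while
  division by |Y| is postponed to the deterministic level.\<close>

definition S :: "real \<Rightarrow> 'a \<Rightarrow> real" where "S t \<omega> = e \<bullet> Y t \<omega>"

text \<open>The factor \<open>1 - (\<mu> \<bullet> e)\<^sup>2\<close>, to which both the drift and the variance of \<open>S\<close> are proportional.\<close>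

definition transverse :: "real \<Rightarrow> 'a \<Rightarrow> real" where "transverse u \<omega> = \<mu> u \<omega> \<bullet> \<mu> u \<omega> - (e \<bullet> \<mu> u \<omega>)\<^sup>2"

lemma transverse_bounds:
  assumes "0 \<le> u" "\<omega> \<in> space M" shows "0 \<le> transverse u \<omega>" "transverse u \<omega> \<le> 1"
proof -
  have "(e \<bullet> \<mu> u \<omega>)\<^sup>2 \<le> (norm e * norm (\<mu> u \<omega>))\<^sup>2"
    using Cauchy_Schwarz_ineq2[of e "\<mu> u \<omega>"] by (metis abs_ge_zero power2_abs power_mono)
  then show "0 \<le> transverse u \<omega>" by (simp add: transverse_def norm_e power2_norm_eq_inner)
  show "transverse u \<omega> \<le> 1"
    using inner_\<mu>_self_le[OF assms] zero_le_power2[of "e \<bullet> \<mu> u \<omega>"] unfolding transverse_def by linarith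
qed

lemma transverse_jointly:
  assumes "0 \<le> t" shows "jointly_measurable t M transverse"
  unfolding transverse_def split_beta' using \<mu>_jointly_measurable(1)[OF assms, unfolded split_beta'] by measurable

lemma transverse_measurable:
  assumes "0 \<le> t" shows "transverse t \<in> borel_measurable M"
  unfolding transverse_def[abs_def] using \<mu>_measurable[OF assms] by measurable

lemma S_measurable_F:
  assumes "0 \<le> t" shows "S t \<in> borel_measurable (F t)"
  unfolding S_def[abs_def] using Y_adapted[OF assms] by measurable

lemma S_measurable: "0 \<le> t \<Longrightarrow> S t \<in> borel_measurable M"
  using S_measurable_F measurable_F_M by blast

lemma S_bound:
  assumes "0 \<le> t" shows "AE \<omega> in M. \<bar>S t \<omega>\<bar> \<le> radius t"
  using norm_Y[OF assms]
proof eventually_elim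
  case (elim \<omega>)
  then show ?case unfolding S_def using Cauchy_Schwarz_ineq2[of e "Y t \<omega>"] norm_e by simp
qed

text \<open>This closes the moment equations: drift and variance of \<open>S\<close> become
  polynomials in \<open>S\<close> with deterministic coefficients. It depends on |Y| being
  deterministic.\<close>

lemma transverse_eq:
  assumes t: "0 \<le> t" shows "AE \<omega> in M. transverse t \<omega> = 1 - (S t \<omega>)\<^sup>2 / (radius t)\<^sup>2"
  using norm_Y[OF t] \<mu>_unit[OF t] AE_space
proof eventually_elim
  case (elim \<omega>)
  have "e \<bullet> \<mu> t \<omega> = S t \<omega> / radius t"
    using elim \<mu>[OF t elim(3)] by (simp add: S_def field_simps)
  then show ?case using elim by (simp add: transverse_def power_divide)
qed

definition transverse_time :: "real \<Rightarrow> real \<Rightarrow> 'a \<Rightarrow> real"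
  where "transverse_time s t \<omega> = set_lebesgue_integral lborel {s..t} (\<lambda>u. transverse u \<omega>)"

lemma transverse_integrable:
  assumes "0 \<le> s" "s \<le> t" "\<omega> \<in> space M" shows "set_integrable lborel {s..t} (\<lambda>u. transverse u \<omega>)"
  by (rule bounded_path_set_integrable[where C=1, OF transverse_jointly])
     (use assms transverse_bounds[of _ \<omega>] in \<open>auto simp: abs_le_iff intro: order_trans[of _ 0]\<close>)

lemma transverse_time_measurable: "0 \<le> s \<Longrightarrow> s \<le> t \<Longrightarrow> transverse_time s t \<in> borel_measurable M"
  unfolding transverse_time_def by (intro time_integral_measurable transverse_jointly) auto

lemma transverse_time_bound:
  assumes "0 \<le> s" "s \<le> t" "\<omega> \<in> space M" shows "\<bar>transverse_time s t \<omega>\<bar> \<le> t - s"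
proof -
  have "\<bar>transverse_time s t \<omega>\<bar> \<le> 1 * (t - s)"
    unfolding transverse_time_def
    by (intro set_integral_abs_bound transverse_integrable assms)
       (use assms transverse_bounds[of _ \<omega>] in \<open>auto simp: abs_le_iff intro: order_trans[of _ 0]\<close>)
  then show ?thesis by simp
qed

lemma drift_incr_e:
  assumes "0 \<le> s" "s \<le> t" "\<omega> \<in> space M"
  shows "drift_incr e s t \<omega> = \<alpha> * \<beta> * transverse_time s t \<omega>"
proof -
  have "e \<bullet> llg_drift \<alpha> b m = \<alpha> * \<beta> * (m \<bullet> m - (e \<bullet> m)\<^sup>2)" for m
  proof -
    have "\<beta> * (e \<bullet> llg_drift \<alpha> b m) = b \<bullet> llg_drift \<alpha> b m" using b_eq by (metis inner_scaleR_left)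
    also have "\<dots> = \<alpha> * ((b \<bullet> b) * (m \<bullet> m) - (b \<bullet> m)\<^sup>2)" by (rule inner_llg_drift_field)
    also have "b \<bullet> b = \<beta>\<^sup>2" by (simp add: \<beta>_def power2_norm_eq_inner)
    also have "b \<bullet> m = \<beta> * (e \<bullet> m)" using b_eq by (metis inner_scaleR_left)
    finally have "\<beta> * (e \<bullet> llg_drift \<alpha> b m) = \<beta> * (\<alpha> * \<beta> * (m \<bullet> m - (e \<bullet> m)\<^sup>2))"
      by (simp add: power2_eq_square algebra_simps)
    then show ?thesis using \<beta>_pos by simp
  qed
  then show ?thesis unfolding drift_incr_def transverse_time_def transverse_def by simp
qed

lemma covariation_e:
  assumes "0 \<le> s" "s \<le> t" "\<omega> \<in> space M"
  shows "covariation e e s t \<omega> = \<kappa> * transverse_time s t \<omega>"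
proof -
  have "set_lebesgue_integral lborel {s..t} (\<lambda>u. (e v* H u \<omega>) \<bullet> (e v* H u \<omega>)) = set_lebesgue_integral lborel {s..t} (\<lambda>u. \<kappa> * transverse u \<omega>)"
  proof (rule set_lebesgue_integral_cong)
    show "\<forall>u. u \<in> {s..t} \<longrightarrow> (e v* H u \<omega>) \<bullet> (e v* H u \<omega>) = \<kappa> * transverse u \<omega>"
    proof (intro allI impI)
      fix u assume "u \<in> {s..t}"
      then have u: "0 \<le> u" using assms by simp
      have "e \<bullet> e = 1" using norm_e by (simp add: power2_norm_eq_inner[symmetric])
      then show "(e v* H u \<omega>) \<bullet> (e v* H u \<omega>) = \<kappa> * transverse u \<omega>"
        unfolding row_H_inner[OF u assms(3)] by (simp add: transverse_def power2_eq_square)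
    qed
  qed simp
  then show ?thesis by (simp add: covariation_def transverse_time_def)
qed

lemma AE_bounded_square_integrable:
  assumes "X \<in> borel_measurable M" "AE \<omega> in M. \<bar>X \<omega>\<bar> \<le> B"
  shows "square_integrable X" "L2_norm X \<le> \<bar>B\<bar>"
proof -
  have "AE \<omega> in M. \<bar>X \<omega>\<bar> \<le> \<bar>B\<bar>" using assms(2) by eventually_elim simp
  from square_integrable_dominated[OF assms(1) square_integrable_const(1) this]
  show "square_integrable X" "L2_norm X \<le> \<bar>B\<bar>" by (simp_all add: square_integrable_const)
qed

lemma AE_bounded_mult:
  fixes X Z :: "'a \<Rightarrow> real"
  assumes X: "X \<in> borel_measurable M" "AE \<omega> in M. \<bar>X \<omega>\<bar> \<le> B" and Z: "integrable M Z" and B: "0 \<le> B"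
  shows "integrable M (\<lambda>\<omega>. X \<omega> * Z \<omega>)" "\<bar>expectation (\<lambda>\<omega>. X \<omega> * Z \<omega>)\<bar> \<le> B * expectation (\<lambda>\<omega>. \<bar>Z \<omega>\<bar>)"
proof -
  have le: "AE \<omega> in M. norm (X \<omega> * Z \<omega>) \<le> norm (B * Z \<omega>)"
    using X(2)
  proof eventually_elim
    case (elim \<omega>)
    then have "\<bar>X \<omega>\<bar> * \<bar>Z \<omega>\<bar> \<le> B * \<bar>Z \<omega>\<bar>" by (rule mult_right_mono) simp
    then show ?case using B by (simp add: abs_mult)
  qed
  show i: "integrable M (\<lambda>\<omega>. X \<omega> * Z \<omega>)"
    using X(1) Z by (intro Bochner_Integration.integrable_bound[OF _ _ le]) auto
  have "\<bar>expectation (\<lambda>\<omega>. X \<omega> * Z \<omega>)\<bar> \<le> expectation (\<lambda>\<omega>. \<bar>X \<omega> * Z \<omega>\<bar>)" by (rule integral_abs_bound)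
  also have "\<dots> \<le> expectation (\<lambda>\<omega>. B * \<bar>Z \<omega>\<bar>)"
    using integrable_abs[OF i] Z le B by (intro integral_mono_AE) (auto simp: abs_mult)
  finally show "\<bar>expectation (\<lambda>\<omega>. X \<omega> * Z \<omega>)\<bar> \<le> B * expectation (\<lambda>\<omega>. \<bar>Z \<omega>\<bar>)" using Z by simp
qed

text \<open>Expansions of the first three moments of an increment of \<open>S\<close>, with a weight
  \<open>G\<close> from the past and one constant for all steps up to \<open>T\<close>. Drift and
  bracket are both multiples of the time integral of \<open>transverse\<close>, which is replaced by
  its initial value at a cost of order (t - s)^(3/2); the third moment is already of that
  order.\<close>

lemma S_one_step:
  assumes T: "0 \<le> T" and B: "0 \<le> B"
  obtains C where "0 \<le> C"
    "\<And>s t. 0 \<le> s \<Longrightarrow> s \<le> t \<Longrightarrow> t \<le> T \<Longrightarrow> square_integrable (\<lambda>\<omega>. S t \<omega> - S s \<omega>)"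
    "\<And>s t. 0 \<le> s \<Longrightarrow> s \<le> t \<Longrightarrow> t \<le> T \<Longrightarrow> expectation (\<lambda>\<omega>. \<bar>S t \<omega> - S s \<omega>\<bar>) \<le> C * sqrt (t - s)"
    "\<And>s t. 0 \<le> s \<Longrightarrow> s \<le> t \<Longrightarrow> t \<le> T \<Longrightarrow> \<bar>expectation (\<lambda>\<omega>. (S t \<omega> - S s \<omega>) ^ 3)\<bar> \<le> C * ((t - s) * sqrt (t - s))"
    "\<And>s t G. 0 \<le> s \<Longrightarrow> s \<le> t \<Longrightarrow> t \<le> T \<Longrightarrow> G \<in> borel_measurable (F s) \<Longrightarrow> AE \<omega> in M. \<bar>G \<omega>\<bar> \<le> B \<Longrightarrow>
      \<bar>expectation (\<lambda>\<omega>. G \<omega> * (S t \<omega> - S s \<omega>)) - (t - s) * (\<alpha> * \<beta> * expectation (\<lambda>\<omega>. G \<omega> * transverse s \<omega>))\<bar> \<le> C * ((t - s) * sqrt (t - s))"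
    "\<And>s t G. 0 \<le> s \<Longrightarrow> s \<le> t \<Longrightarrow> t \<le> T \<Longrightarrow> G \<in> borel_measurable (F s) \<Longrightarrow> AE \<omega> in M. \<bar>G \<omega>\<bar> \<le> B \<Longrightarrow>
      \<bar>expectation (\<lambda>\<omega>. G \<omega> * (S t \<omega> - S s \<omega>)\<^sup>2) - (t - s) * (\<kappa> * expectation (\<lambda>\<omega>. G \<omega> * transverse s \<omega>))\<bar> \<le> C * ((t - s) * sqrt (t - s))"
proof -
  obtain c where c: "0 \<le> c"
    and Yi: "\<And>s t v. 0 \<le> s \<Longrightarrow> s \<le> t \<Longrightarrow> t \<le> T \<Longrightarrow> norm v \<le> 1 \<Longrightarrow> fourth_integrable (\<lambda>\<omega>. v \<bullet> (Y t \<omega> - Y s \<omega>))"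
      "\<And>s t v. 0 \<le> s \<Longrightarrow> s \<le> t \<Longrightarrow> t \<le> T \<Longrightarrow> norm v \<le> 1 \<Longrightarrow>
      expectation (\<lambda>\<omega>. (v \<bullet> (Y t \<omega> - Y s \<omega>)) ^ 4) \<le> (c * sqrt (t - s)) ^ 4"
    and Ji: "\<And>s t v. 0 \<le> s \<Longrightarrow> s \<le> t \<Longrightarrow> t \<le> T \<Longrightarrow> norm v \<le> 1 \<Longrightarrow> fourth_integrable (incr v s t)"
      "\<And>s t v. 0 \<le> s \<Longrightarrow> s \<le> t \<Longrightarrow> t \<le> T \<Longrightarrow> norm v \<le> 1 \<Longrightarrow>
      expectation (\<lambda>\<omega>. incr v s t \<omega> ^ 4) \<le> (c * sqrt (t - s)) ^ 4"
  proof (rule Y_increment_fourth_moment[OF T], goal_cases)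
    case prems: (1 c)
    show ?case by (rule prems(1)[OF prems(2-6)])
  qed
  have e1: "norm e \<le> 1" using norm_e by simp
  define R where "R = radius T"
  define U where "U = sqrt T"
  define A where "A = \<alpha> * \<beta>"
  have R1: "1 \<le> R" and U: "0 \<le> U" and A: "0 \<le> A" using radius(2)[OF T] T \<alpha> \<beta>_pos by (auto simp: R_def U_def A_def)
  \<comment> \<open>\<open>L * sqrt (t - s)\<close> bounds the mean change of
    \<open>transverse\<close>: the part \<open>2 * R * c\<close> comes from the change of
    \<open>S\<close>, the part \<open>2 * \<kappa> * U\<close> from the growth of the squared
    radius.\<close>
  define L where "L = 2 * R * c + 2 * \<kappa> * U"
  have L: "0 \<le> L" using R1 c \<kappa>_pos U by (simp add: L_def)
  \<comment> \<open>The sum of the constants of the separate estimates; all of them are nonnegative,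
    so each lies below \<open>C\<close>.\<close>
  define C where "C = c + c ^ 3 + A * (B * L) + (\<kappa> * (B * L) + 2 * A * (B * c) + A\<^sup>2 * (B * U))"
  have Cn: "0 \<le> c" "0 \<le> c ^ 3" "0 \<le> A * (B * L)" "0 \<le> \<kappa> * (B * L) + 2 * A * (B * c) + A\<^sup>2 * (B * U)"
    using c A B L \<kappa>_pos U by (auto intro!: add_nonneg_nonneg)
  have main: "square_integrable (\<lambda>\<omega>. S t \<omega> - S s \<omega>) \<and> expectation (\<lambda>\<omega>. \<bar>S t \<omega> - S s \<omega>\<bar>) \<le> c * sqrt (t - s) \<and>
      \<bar>expectation (\<lambda>\<omega>. (S t \<omega> - S s \<omega>) ^ 3)\<bar> \<le> c ^ 3 * ((t - s) * sqrt (t - s)) \<and>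
      (\<forall>G. G \<in> borel_measurable (F s) \<longrightarrow> (AE \<omega> in M. \<bar>G \<omega>\<bar> \<le> B) \<longrightarrow>
      \<bar>expectation (\<lambda>\<omega>. G \<omega> * (S t \<omega> - S s \<omega>)) - (t - s) * (\<alpha> * \<beta> * expectation (\<lambda>\<omega>. G \<omega> * transverse s \<omega>))\<bar> \<le> A * (B * L) * ((t - s) * sqrt (t - s)) \<and>
      \<bar>expectation (\<lambda>\<omega>. G \<omega> * (S t \<omega> - S s \<omega>)\<^sup>2) - (t - s) * (\<kappa> * expectation (\<lambda>\<omega>. G \<omega> * transverse s \<omega>))\<bar>
        \<le> (\<kappa> * (B * L) + 2 * A * (B * c) + A\<^sup>2 * (B * U)) * ((t - s) * sqrt (t - s)))"
    if st: "0 \<le> s" "s \<le> t" "t \<le> T" for s t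
  proof -
    define r where "r = sqrt (t - s)"
    define \<delta> where "\<delta> = t - s"
    have r: "0 \<le> r" "\<delta> = r * r" "r \<le> U" "0 \<le> \<delta>" using st by (auto simp: r_def U_def \<delta>_def)
    have rr: "r * r * r = \<delta> * r" using r(2) by simp
    have t0: "0 \<le> t" using st by simp
    have S_diff: "S u \<omega> - S s \<omega> = e \<bullet> (Y u \<omega> - Y s \<omega>)" for u \<omega> by (simp add: S_def inner_diff_right)
    have D4: "fourth_integrable (\<lambda>\<omega>. S u \<omega> - S s \<omega>)" "L2_norm (\<lambda>\<omega>. (S u \<omega> - S s \<omega>)\<^sup>2) \<le> (c * r)\<^sup>2" "L2_norm (\<lambda>\<omega>. S u \<omega> - S s \<omega>) \<le> c * r"
      if u: "u \<in> {s..t}" for u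
    proof -
      have us: "s \<le> u" "u \<le> T" using u st by auto
      have cu: "0 \<le> c * sqrt (u - s)" "c * sqrt (u - s) \<le> c * r" using c us u by (auto simp: r_def intro!: mult_left_mono)
      note f = Yi(1)[OF st(1) us e1, folded S_diff] and n = Yi(2)[OF st(1) us e1, folded S_diff]
      show "fourth_integrable (\<lambda>\<omega>. S u \<omega> - S s \<omega>)" by (rule f)
      note l = L2_norm_le_fourth[OF f cu(1) n]
      show "L2_norm (\<lambda>\<omega>. S u \<omega> - S s \<omega>) \<le> c * r" using l(2) cu(2) by simp
      have "(c * sqrt (u - s))\<^sup>2 \<le> (c * r)\<^sup>2" using cu by (intro power_mono)
      then show "L2_norm (\<lambda>\<omega>. (S u \<omega> - S s \<omega>)\<^sup>2) \<le> (c * r)\<^sup>2" using l(1) by simp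
    qed
    have tt: "t \<in> {s..t}" using st by simp
    note D2 = fourth_integrableD(2)[OF D4(1)]
    have Dabs: "expectation (\<lambda>\<omega>. \<bar>S u \<omega> - S s \<omega>\<bar>) \<le> c * r" if "u \<in> {s..t}" for u
      using expectation_abs_le_L2_norm[OF D2[OF that]] D4(3)[OF that] by simp
    have cube: "\<bar>expectation (\<lambda>\<omega>. (S t \<omega> - S s \<omega>) ^ 3)\<bar> \<le> c ^ 3 * (\<delta> * r)"
    proof -
      have "\<bar>expectation (\<lambda>\<omega>. (S t \<omega> - S s \<omega>) ^ 3)\<bar> \<le> expectation (\<lambda>\<omega>. \<bar>(S t \<omega> - S s \<omega>) ^ 3\<bar>)" by (rule integral_abs_bound)
      also have "\<dots> = expectation (\<lambda>\<omega>. \<bar>(S t \<omega> - S s \<omega>) * (S t \<omega> - S s \<omega>)\<^sup>2\<bar>)"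
        by (simp add: power3_eq_cube power2_eq_square mult.assoc)
      also have "\<dots> \<le> L2_norm (\<lambda>\<omega>. S t \<omega> - S s \<omega>) * L2_norm (\<lambda>\<omega>. (S t \<omega> - S s \<omega>)\<^sup>2)"
        by (rule Cauchy_Schwarz_expectation[OF D2[OF tt] fourth_integrableD(3)[OF D4(1)[OF tt]]])
      also have "\<dots> \<le> (c * r) * (c * r)\<^sup>2"
        using c r by (intro mult_mono D4 tt) auto
      also have "\<dots> = c ^ 3 * (\<delta> * r)" unfolding r(2) by (simp add: power2_eq_square power3_eq_cube mult_ac)
      finally show ?thesis .
    qed
    let ?J = "incr e s t" and ?X = "transverse_time s t"
    have J4: "fourth_integrable ?J" by (rule Ji(1)[OF st e1])
    have cr: "0 \<le> c * r" using c r by simp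
    have Jn: "L2_norm ?J \<le> c * r"
      using L2_norm_le_fourth(2)[OF J4 cr] Ji(2)[OF st e1] by (simp add: r_def)
    note J2 = fourth_integrableD(2)[OF J4]
    have X_le: "AE \<omega> in M. \<bar>?X \<omega>\<bar> \<le> \<delta>" using transverse_time_bound[OF st(1,2)] by (intro AE_I2) (simp add: \<delta>_def)
    have Xm: "?X \<in> borel_measurable M" by (rule transverse_time_measurable[OF st(1,2)])
    note X2 = AE_bounded_square_integrable[OF Xm X_le]
    have step: "AE \<omega> in M. S t \<omega> - S s \<omega> = A * ?X \<omega> + ?J \<omega>"
      using Y_increment AE_space
    proof eventually_elim
      case (elim \<omega>)
      then show ?case using drift_incr_e[OF st(1,2) elim(2)] st unfolding S_diff A_def by simp
    qed
    have Sm: "S t \<in> borel_measurable M" "S s \<in> borel_measurable M" using S_measurable st t0 by auto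
    { fix G assume G: "G \<in> borel_measurable (F s)" "AE \<omega> in M. \<bar>G \<omega>\<bar> \<le> B"
      have GM: "G \<in> borel_measurable M" by (rule measurable_F_M[OF G(1)])
      note Gb = AE_bounded_mult[OF GM G(2) _ B]
      have G2: "square_integrable G" by (rule AE_bounded_square_integrable(1)[OF GM G(2)])
      have trm: "transverse s \<in> borel_measurable M" by (rule transverse_measurable[OF st(1)])
      have tri: "integrable M (transverse s)"
        using transverse_bounds[OF st(1)] trm by (intro integrable_const_bound[where B=1]) (auto intro!: AE_I2)
      have GX: "\<bar>expectation (\<lambda>\<omega>. G \<omega> * ?X \<omega>) - \<delta> * expectation (\<lambda>\<omega>. G \<omega> * transverse s \<omega>)\<bar> \<le> B * L * (\<delta> * r)"
      proof -
        define f where "f u \<omega> = transverse u \<omega> - transverse s \<omega>" for u \<omega>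
        have fj: "jointly_measurable t M f"
          unfolding f_def split_beta'
          using transverse_jointly[OF t0, unfolded split_beta'] measurable_compose[OF measurable_snd trm] by (intro borel_measurable_diff)
        have fm: "f u \<in> borel_measurable M" if "u \<in> {s..t}" for u
          unfolding f_def[abs_def] using transverse_measurable[of u] trm that st by (intro borel_measurable_diff) auto
        have fint: "integrable M (f u)" if u: "u \<in> {s..t}" for u
        proof (rule integrable_const_bound[where B=1])
          have u0: "0 \<le> u" using u st by simp
          show "AE \<omega> in M. norm (f u \<omega>) \<le> 1"
            using AE_space
          proof eventually_elim
            case (elim \<omega>)
            then show ?case using transverse_bounds[OF u0 elim] transverse_bounds[OF st(1) elim]
              unfolding f_def real_norm_def by (intro abs_leI) linarith+
          qed
        qed (rule fm[OF u])
        have fE: "expectation (\<lambda>\<omega>. \<bar>f u \<omega>\<bar>) \<le> L * r" if u: "u \<in> {s..t}" for u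
        proof -
          have u0: "0 \<le> u" and uT: "u \<le> T" and us: "s \<le> u" and sT: "s \<le> T" using u st by auto
          have "AE \<omega> in M. \<bar>f u \<omega>\<bar> \<le> 2 * R * \<bar>S u \<omega> - S s \<omega>\<bar> + 2 * \<kappa> * \<delta>"
            using transverse_eq[OF u0] transverse_eq[OF st(1)] S_bound[OF u0] S_bound[OF st(1)]
          proof eventually_elim
            case (elim \<omega>)
            let ?hs = "(radius s)\<^sup>2" and ?hu = "(radius u)\<^sup>2"
            have hs: "1 \<le> ?hs" "1 \<le> ?hu" using radius(2)[OF st(1)] radius(2)[OF u0] by (auto intro: one_le_power)
            have hd: "?hu - ?hs = 2 * \<kappa> * (u - s)" using radius(1)[OF st(1)] radius(1)[OF u0] by (simp add: algebra_simps)
            have Sb: "\<bar>S u \<omega>\<bar> \<le> R" "\<bar>S s \<omega>\<bar> \<le> R" using elim radius(3)[OF u0 uT] radius(3)[OF st(1) sT] by (auto simp: R_def)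
            \<comment> \<open>The change of numerator and of denominator in
              \<open>S\<^sup>2 / radius\<^sup>2\<close> are separated; the first is Lipschitz in
              \<open>S\<close> as \<open>S\<close> is bounded by \<open>R\<close>, the second is
              linear in time.\<close>
            have "f u \<omega> = (S s \<omega> - S u \<omega>) * (S s \<omega> + S u \<omega>) / ?hs + (S u \<omega>)\<^sup>2 * (?hu - ?hs) / (?hs * ?hu)"
              unfolding f_def elim(1,2) by (rule difference_of_quotients) (use hs in linarith)+
            then have "\<bar>f u \<omega>\<bar> \<le> \<bar>(S s \<omega> - S u \<omega>) * (S s \<omega> + S u \<omega>) / ?hs\<bar> + \<bar>(S u \<omega>)\<^sup>2 * (?hu - ?hs) / (?hs * ?hu)\<bar>" by (simp only: abs_triangle_ineq)
            also have "\<bar>(S s \<omega> - S u \<omega>) * (S s \<omega> + S u \<omega>) / ?hs\<bar> \<le> 2 * R * \<bar>S u \<omega> - S s \<omega>\<bar>"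
            proof -
              have "\<bar>(S s \<omega> - S u \<omega>) * (S s \<omega> + S u \<omega>)\<bar> = \<bar>S u \<omega> - S s \<omega>\<bar> * \<bar>S s \<omega> + S u \<omega>\<bar>" by (simp add: abs_mult abs_minus_commute)
              also have "\<dots> \<le> \<bar>S u \<omega> - S s \<omega>\<bar> * (2 * R)" using Sb by (intro mult_left_mono) auto
              finally have n: "\<bar>(S s \<omega> - S u \<omega>) * (S s \<omega> + S u \<omega>)\<bar> \<le> 2 * R * \<bar>S u \<omega> - S s \<omega>\<bar>" by (simp only: mult_ac)
              have "\<bar>(S s \<omega> - S u \<omega>) * (S s \<omega> + S u \<omega>) / ?hs\<bar> \<le> \<bar>(S s \<omega> - S u \<omega>) * (S s \<omega> + S u \<omega>)\<bar> / 1"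
                unfolding abs_divide using hs by (intro divide_left_mono) auto
              then show ?thesis using n by simp
            qed
            also have "\<bar>(S u \<omega>)\<^sup>2 * (?hu - ?hs) / (?hs * ?hu)\<bar> \<le> 2 * \<kappa> * \<delta>"
            proof -
              have s2: "(S u \<omega>)\<^sup>2 \<le> ?hu" using elim(3) by (metis abs_ge_zero power2_abs power_mono)
              have d0: "0 \<le> ?hu - ?hs" "?hu - ?hs \<le> 2 * \<kappa> * \<delta>" unfolding hd using us u \<kappa>_pos by (auto simp: \<delta>_def)
              have "\<bar>(S u \<omega>)\<^sup>2 * (?hu - ?hs) / (?hs * ?hu)\<bar> = (S u \<omega>)\<^sup>2 / ?hu * ((?hu - ?hs) / ?hs)"
                using d0 hs by (simp add: abs_mult)
              also have "\<dots> \<le> 1 * ((?hu - ?hs) / 1)"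
              proof (rule mult_mono)
                have "0 < ?hu" using hs by linarith
                then show "(S u \<omega>)\<^sup>2 / ?hu \<le> 1" using s2 by (simp only: divide_le_eq_1_pos)
                show "(?hu - ?hs) / ?hs \<le> (?hu - ?hs) / 1"
                  by (rule divide_left_mono[OF hs(1) d0(1)]) (use hs(1) in linarith)
                have "0 \<le> ?hs" by simp
                then show "0 \<le> (?hu - ?hs) / ?hs" by (rule divide_nonneg_nonneg[OF d0(1)])
              qed simp
              finally show ?thesis using d0 by simp
            qed
            finally show ?case by simp
          qed
          then have "expectation (\<lambda>\<omega>. \<bar>f u \<omega>\<bar>) \<le> expectation (\<lambda>\<omega>. 2 * R * \<bar>S u \<omega> - S s \<omega>\<bar> + 2 * \<kappa> * \<delta>)"
            using fint[OF u] square_integrableD(3)[OF D2[OF u]] by (intro integral_mono_AE) auto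
          also have "\<dots> = 2 * R * expectation (\<lambda>\<omega>. \<bar>S u \<omega> - S s \<omega>\<bar>) + 2 * \<kappa> * \<delta>"
            using square_integrableD(3)[OF D2[OF u]] by (simp add: prob_space)
          also have "\<dots> \<le> 2 * R * (c * r) + 2 * \<kappa> * (r * U)"
            using Dabs[OF u] R1 \<kappa>_pos r mult_left_mono[OF r(3,1)] by (intro add_mono mult_left_mono) auto
          also have "\<dots> = L * r" by (simp add: L_def algebra_simps)
          finally show ?thesis .
        qed
        have "0 \<le> L * r" using L r by simp
        note tb = expectation_time_integral_bound[OF fj st(1,2) this fint fE]
        let ?I = "\<lambda>\<omega>. set_lebesgue_integral lborel {s..t} (\<lambda>u. f u \<omega>)"
        have I_eq: "?I \<omega> = ?X \<omega> - \<delta> * transverse s \<omega>" if w: "\<omega> \<in> space M" for \<omega>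
        proof -
          have "set_integrable lborel {s..t} (\<lambda>u. transverse s \<omega>)" by (auto simp: set_integrable_def intro: integrable_indicator_Icc)
          from set_integral_diff(2)[OF transverse_integrable[OF st(1,2) w] this]
          show ?thesis unfolding f_def transverse_time_def \<delta>_def using st by (simp add: set_lebesgue_integral_def)
        qed
        have "expectation (\<lambda>\<omega>. G \<omega> * ?X \<omega>) - \<delta> * expectation (\<lambda>\<omega>. G \<omega> * transverse s \<omega>) =
           expectation (\<lambda>\<omega>. G \<omega> * ?X \<omega> - \<delta> * (G \<omega> * transverse s \<omega>))"
          using Gb(1)[OF square_integrableD(3)[OF X2(1)]] Gb(1)[OF tri] by simp
        also have "\<dots> = expectation (\<lambda>\<omega>. G \<omega> * ?I \<omega>)"
          by (rule Bochner_Integration.integral_cong[OF refl]) (simp add: I_eq algebra_simps)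
        finally have "\<bar>expectation (\<lambda>\<omega>. G \<omega> * ?X \<omega>) - \<delta> * expectation (\<lambda>\<omega>. G \<omega> * transverse s \<omega>)\<bar> \<le> B * expectation (\<lambda>\<omega>. \<bar>?I \<omega>\<bar>)"
          using Gb(2)[OF tb(1)] by simp
        also have "\<dots> \<le> B * (L * r * (t - s))" by (rule mult_left_mono[OF tb(2) B])
        also have "\<dots> = B * L * (\<delta> * r)" unfolding \<delta>_def by (simp only: mult_ac)
        finally show ?thesis .
      qed
      have GXi: "integrable M (\<lambda>\<omega>. G \<omega> * ?X \<omega>)" by (rule Gb(1)[OF square_integrableD(3)[OF X2(1)]])
      have GJi: "integrable M (\<lambda>\<omega>. G \<omega> * ?J \<omega>)" by (rule Gb(1)[OF square_integrableD(3)[OF J2]])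
      have first: "expectation (\<lambda>\<omega>. G \<omega> * (S t \<omega> - S s \<omega>)) = A * expectation (\<lambda>\<omega>. G \<omega> * ?X \<omega>)"
      proof -
        have "expectation (\<lambda>\<omega>. G \<omega> * (S t \<omega> - S s \<omega>)) = expectation (\<lambda>\<omega>. A * (G \<omega> * ?X \<omega>) + G \<omega> * ?J \<omega>)"
        proof (rule integral_cong_AE)
          show "AE \<omega> in M. G \<omega> * (S t \<omega> - S s \<omega>) = A * (G \<omega> * ?X \<omega>) + G \<omega> * ?J \<omega>"
            using step by eventually_elim (simp add: algebra_simps)
        qed (use GM Sm Xm square_integrableD(1)[OF J2] in auto)
        then show ?thesis using GXi GJi incr_orthogonal[OF st(1,2) G(1) GJi] by simp
      qed
      have i1: "integrable M (\<lambda>\<omega>. G \<omega> * (?J \<omega> * ?J \<omega>))" and i2: "expectation (\<lambda>\<omega>. G \<omega> * (?J \<omega> * ?J \<omega>)) = expectation (\<lambda>\<omega>. G \<omega> * covariation e e s t \<omega>)"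
        by (rule incr_isometry[OF st(1,2) G(1) square_integrableD(2)[OF G2]])+
      have cov: "expectation (\<lambda>\<omega>. G \<omega> * covariation e e s t \<omega>) = \<kappa> * expectation (\<lambda>\<omega>. G \<omega> * ?X \<omega>)"
      proof -
        have "expectation (\<lambda>\<omega>. G \<omega> * covariation e e s t \<omega>) = expectation (\<lambda>\<omega>. \<kappa> * (G \<omega> * ?X \<omega>))"
          by (rule Bochner_Integration.integral_cong[OF refl]) (simp add: covariation_e[OF st(1,2)])
        then show ?thesis by simp
      qed
      have XJ: "integrable M (\<lambda>\<omega>. ?X \<omega> * ?J \<omega>)" and XX: "integrable M (\<lambda>\<omega>. ?X \<omega> * ?X \<omega>)"
        by (rule square_integrable_mult[OF X2(1) J2] square_integrable_mult[OF X2(1) X2(1)])+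
      have Xn: "L2_norm ?X \<le> \<delta>" using X2(2) r by simp
      have XJb: "\<bar>expectation (\<lambda>\<omega>. G \<omega> * (?X \<omega> * ?J \<omega>))\<bar> \<le> B * (\<delta> * (c * r))"
      proof -
        have "expectation (\<lambda>\<omega>. \<bar>?X \<omega> * ?J \<omega>\<bar>) \<le> \<delta> * (c * r)"
          by (rule order_trans[OF Cauchy_Schwarz_expectation[OF X2(1) J2] mult_mono[OF Xn Jn]]) (use r in auto)
        then show ?thesis by (rule order_trans[OF Gb(2)[OF XJ] mult_left_mono[OF _ B]])
      qed
      have XXb: "\<bar>expectation (\<lambda>\<omega>. G \<omega> * (?X \<omega> * ?X \<omega>))\<bar> \<le> B * (\<delta> * (r * U))"
      proof -
        have "expectation (\<lambda>\<omega>. \<bar>?X \<omega> * ?X \<omega>\<bar>) \<le> \<delta> * \<delta>"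
          by (rule order_trans[OF Cauchy_Schwarz_expectation[OF X2(1) X2(1)] mult_mono[OF Xn Xn]]) (use r in auto)
        also have "\<delta> * \<delta> \<le> \<delta> * (r * U)" using mult_left_mono[OF r(3,1)] r by (intro mult_left_mono) auto
        finally show ?thesis by (rule order_trans[OF Gb(2)[OF XX] mult_left_mono[OF _ B]])
      qed
      \<comment> \<open>The square of the noise increment gives the leading term through the
        isometry. The product of \<open>?X\<close> with the noise need not have mean 0, as
        \<open>?X\<close> is not known at time \<open>s\<close>; by Cauchy-Schwarz it is of order (t
        - s)^(3/2), and the square of \<open>?X\<close> is of order (t - s)^2.\<close>
      have second: "expectation (\<lambda>\<omega>. G \<omega> * (S t \<omega> - S s \<omega>)\<^sup>2) = \<kappa> * expectation (\<lambda>\<omega>. G \<omega> * ?X \<omega>)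
         + 2 * A * expectation (\<lambda>\<omega>. G \<omega> * (?X \<omega> * ?J \<omega>)) + A\<^sup>2 * expectation (\<lambda>\<omega>. G \<omega> * (?X \<omega> * ?X \<omega>))"
      proof -
        have "expectation (\<lambda>\<omega>. G \<omega> * (S t \<omega> - S s \<omega>)\<^sup>2) = expectation (\<lambda>\<omega>. G \<omega> * (?J \<omega> * ?J \<omega>)
           + 2 * A * (G \<omega> * (?X \<omega> * ?J \<omega>)) + A\<^sup>2 * (G \<omega> * (?X \<omega> * ?X \<omega>)))"
        proof (rule integral_cong_AE)
          show "AE \<omega> in M. G \<omega> * (S t \<omega> - S s \<omega>)\<^sup>2 = G \<omega> * (?J \<omega> * ?J \<omega>) + 2 * A * (G \<omega> * (?X \<omega> * ?J \<omega>)) + A\<^sup>2 * (G \<omega> * (?X \<omega> * ?X \<omega>))"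
            using step
          proof eventually_elim
            case (elim \<omega>)
            show ?case unfolding elim by (simp add: power2_eq_square algebra_simps)
          qed
        qed (use GM Sm Xm square_integrableD(1)[OF J2] in auto)
        then show ?thesis using i1 i2 cov Gb(1)[OF XJ] Gb(1)[OF XX] by simp
      qed
      let ?EX = "expectation (\<lambda>\<omega>. G \<omega> * ?X \<omega>)" and ?ET = "expectation (\<lambda>\<omega>. G \<omega> * transverse s \<omega>)"
      have "\<bar>A * ?EX - \<delta> * (A * ?ET)\<bar> \<le> A * (B * L) * (\<delta> * r)"
      proof -
        have "A * ?EX - \<delta> * (A * ?ET) = A * (?EX - \<delta> * ?ET)" by (simp add: algebra_simps)
        then have "\<bar>A * ?EX - \<delta> * (A * ?ET)\<bar> = A * \<bar>?EX - \<delta> * ?ET\<bar>" using A by (simp add: abs_mult)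
        also have "\<dots> \<le> A * (B * L * (\<delta> * r))" by (rule mult_left_mono[OF GX A])
        finally show ?thesis by (simp only: mult.assoc)
      qed
      moreover have "\<bar>(\<kappa> * ?EX + 2 * A * expectation (\<lambda>\<omega>. G \<omega> * (?X \<omega> * ?J \<omega>)) + A\<^sup>2 * expectation (\<lambda>\<omega>. G \<omega> * (?X \<omega> * ?X \<omega>))) - \<delta> * (\<kappa> * ?ET)\<bar>
         \<le> (\<kappa> * (B * L) + 2 * A * (B * c) + A\<^sup>2 * (B * U)) * (\<delta> * r)"
      proof -
        let ?p = "expectation (\<lambda>\<omega>. G \<omega> * (?X \<omega> * ?J \<omega>))" and ?q = "expectation (\<lambda>\<omega>. G \<omega> * (?X \<omega> * ?X \<omega>))"
        have "(\<kappa> * ?EX + 2 * A * ?p + A\<^sup>2 * ?q) - \<delta> * (\<kappa> * ?ET) = \<kappa> * (?EX - \<delta> * ?ET) + 2 * A * ?p + A\<^sup>2 * ?q" by (simp add: algebra_simps)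
        then have "\<bar>(\<kappa> * ?EX + 2 * A * ?p + A\<^sup>2 * ?q) - \<delta> * (\<kappa> * ?ET)\<bar> \<le> \<bar>\<kappa> * (?EX - \<delta> * ?ET)\<bar> + \<bar>2 * A * ?p\<bar> + \<bar>A\<^sup>2 * ?q\<bar>" by simp
        also have "\<dots> = \<kappa> * \<bar>?EX - \<delta> * ?ET\<bar> + 2 * A * \<bar>?p\<bar> + A\<^sup>2 * \<bar>?q\<bar>" using A \<kappa>_pos by (simp add: abs_mult)
        also have "\<dots> \<le> \<kappa> * (B * L * (\<delta> * r)) + 2 * A * (B * (\<delta> * (c * r))) + A\<^sup>2 * (B * (\<delta> * (r * U)))"
          using A \<kappa>_pos by (intro add_mono mult_left_mono GX XJb XXb) auto
        also have "\<dots> = (\<kappa> * (B * L) + 2 * A * (B * c) + A\<^sup>2 * (B * U)) * (\<delta> * r)" by (simp add: algebra_simps)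
        finally show ?thesis .
      qed
      ultimately have "\<bar>expectation (\<lambda>\<omega>. G \<omega> * (S t \<omega> - S s \<omega>)) - (t - s) * (\<alpha> * \<beta> * ?ET)\<bar> \<le> A * (B * L) * ((t - s) * sqrt (t - s)) \<and>
         \<bar>expectation (\<lambda>\<omega>. G \<omega> * (S t \<omega> - S s \<omega>)\<^sup>2) - (t - s) * (\<kappa> * ?ET)\<bar> \<le> (\<kappa> * (B * L) + 2 * A * (B * c) + A\<^sup>2 * (B * U)) * ((t - s) * sqrt (t - s))"
        unfolding first second \<delta>_def r_def by (simp add: A_def) }
    then show ?thesis
      using D2[OF tt] Dabs[OF tt] cube by (auto simp: \<delta>_def r_def)
  qed
  have mono: "x \<le> C * w" if "x \<le> c' * w" "c' \<le> C" "0 \<le> w" for x c' w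
    using that mult_right_mono[of c' C w] by simp
  have CC: "c \<le> C" "c ^ 3 \<le> C" "A * (B * L) \<le> C" "\<kappa> * (B * L) + 2 * A * (B * c) + A\<^sup>2 * (B * U) \<le> C"
    using Cn unfolding C_def by linarith+
  show ?thesis
  proof (rule that[of C])
    show "0 \<le> C" using Cn CC by linarith
    fix s t assume st: "0 \<le> s" "s \<le> t" "t \<le> T"
    have w: "0 \<le> sqrt (t - s)" "0 \<le> (t - s) * sqrt (t - s)" using st by auto
    note m = main[OF st]
    show "square_integrable (\<lambda>\<omega>. S t \<omega> - S s \<omega>)" using m by blast
    show "expectation (\<lambda>\<omega>. \<bar>S t \<omega> - S s \<omega>\<bar>) \<le> C * sqrt (t - s)" by (rule mono[OF _ CC(1) w(1)]) (use m in blast)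
    show "\<bar>expectation (\<lambda>\<omega>. (S t \<omega> - S s \<omega>) ^ 3)\<bar> \<le> C * ((t - s) * sqrt (t - s))" by (rule mono[OF _ CC(2) w(2)]) (use m in blast)
    fix G assume G: "G \<in> borel_measurable (F s)" "AE \<omega> in M. \<bar>G \<omega>\<bar> \<le> B"
    show "\<bar>expectation (\<lambda>\<omega>. G \<omega> * (S t \<omega> - S s \<omega>)) - (t - s) * (\<alpha> * \<beta> * expectation (\<lambda>\<omega>. G \<omega> * transverse s \<omega>))\<bar> \<le> C * ((t - s) * sqrt (t - s))"
      by (rule mono[OF _ CC(3) w(2)]) (use m G in blast)
    show "\<bar>expectation (\<lambda>\<omega>. G \<omega> * (S t \<omega> - S s \<omega>)\<^sup>2) - (t - s) * (\<kappa> * expectation (\<lambda>\<omega>. G \<omega> * transverse s \<omega>))\<bar> \<le> C * ((t - s) * sqrt (t - s))"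
      by (rule mono[OF _ CC(4) w(2)]) (use m G in blast)
  qed
qed

end

section \<open>The limit of the moment system\<close>

lemma gronwall_decay:
  fixes w w' :: "real \<Rightarrow> real"
  assumes c: "0 < c" and d: "\<And>x. R \<le> x \<Longrightarrow> (w has_field_derivative w' x) (at x)"
    and le: "\<And>x. R \<le> x \<Longrightarrow> w' x \<le> - c * w x + g" and x: "R \<le> x"
  shows "w x \<le> g / c + (w R - g / c) * exp (- c * (x - R))"
proof -
  let ?v = "\<lambda>x. (w x - g / c) * exp (c * x)"
  have "?v x \<le> ?v R"
  proof (rule DERIV_nonpos_imp_nonincreasing[OF x])
    fix z assume z: "R \<le> z" "z \<le> x"
    have "(?v has_field_derivative (w' z * exp (c * z) + (w z - g / c) * (exp (c * z) * c))) (at z)"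
      using d[OF z(1)] by (auto intro!: derivative_eq_intros)
    moreover have "w' z * exp (c * z) + (w z - g / c) * (exp (c * z) * c) = (w' z + c * w z - g) * exp (c * z)"
      using c by (simp add: field_simps)
    moreover have "(w' z + c * w z - g) * exp (c * z) \<le> 0"
      using le[OF z(1)] by (intro mult_nonpos_nonneg) auto
    ultimately show "\<exists>y. (?v has_field_derivative y) (at z) \<and> y \<le> 0" by metis
  qed
  then have "(w x - g / c) * exp (c * x) * exp (- c * x) \<le> (w R - g / c) * exp (c * R) * exp (- c * x)"
    by (intro mult_right_mono) auto
  then show ?thesis by (simp add: mult.assoc exp_add[symmetric] algebra_simps)
qed

text \<open>Only a differential inequality is assumed, so one application gives an upper bound; a
  lower bound results from applying it to the negative. Half of the margin \<open>\<eta>\<close>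
  absorbs the distance of \<open>g\<close> to its limit, the other half the decaying exponential of
  \<open>gronwall_decay\<close>.\<close>

lemma eventually_below_equilibrium:
  fixes w w' g :: "real \<Rightarrow> real"
  assumes c: "0 < c" and d: "\<And>x. R \<le> x \<Longrightarrow> (w has_field_derivative w' x) (at x)"
    and le: "\<And>x. R \<le> x \<Longrightarrow> w' x \<le> - c * w x + g x" and g: "(g \<longlongrightarrow> G) at_top" and \<eta>: "0 < \<eta>"
  shows "\<forall>\<^sub>F x in at_top. w x < G / c + \<eta>"
proof -
  have "\<forall>\<^sub>F x in at_top. g x < G + c * (\<eta> / 2)"
    using g c \<eta> by (intro order_tendstoD) auto
  then obtain R' where R': "\<And>x. R' \<le> x \<Longrightarrow> g x < G + c * (\<eta> / 2)" by (auto simp: eventually_at_top_linorder)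
  define Q where "Q = max R R'"
  define k where "k = (G + c * (\<eta> / 2)) / c"
  have k: "k = G / c + \<eta> / 2" using c by (simp add: k_def field_simps)
  have bd: "w x \<le> k + (w Q - k) * exp (- c * (x - Q))" if "Q \<le> x" for x
    unfolding k_def
  proof (rule gronwall_decay[OF c _ _ that])
    fix z assume z: "Q \<le> z"
    then show "(w has_field_derivative w' z) (at z)" by (intro d) (simp add: Q_def)
    have "w' z \<le> - c * w z + g z" using z by (intro le) (simp add: Q_def)
    then show "w' z \<le> - c * w z + (G + c * (\<eta> / 2))" using R'[of z] z by (simp add: Q_def)
  qed
  have "filterlim (\<lambda>x. - c * (- Q + x)) at_bot at_top"
    by (rule filterlim_tendsto_neg_mult_at_bot[OF tendsto_const _ filterlim_tendsto_add_at_top[OF tendsto_const filterlim_ident]]) (use c in simp)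
  then have "filterlim (\<lambda>x. - c * (x - Q)) at_bot at_top" by simp
  then have "((\<lambda>x. exp (- c * (x - Q))) \<longlongrightarrow> 0) at_top" by (rule filterlim_compose[OF exp_at_bot])
  then have "((\<lambda>x. (w Q - k) * exp (- c * (x - Q))) \<longlongrightarrow> (w Q - k) * 0) at_top" by (rule tendsto_mult_left)
  then have "\<forall>\<^sub>F x in at_top. (w Q - k) * exp (- c * (x - Q)) < \<eta> / 2" using \<eta> by (intro order_tendstoD) auto
  then show ?thesis
    using eventually_ge_at_top[of Q]
  proof eventually_elim
    case (elim x)
    show ?case using bd[OF elim(2)] elim(1) k by linarith
  qed
qed

text \<open>The system satisfied by the moments \<open>y\<^sub>k = E (1 - \<mu> \<bullet> e)\<^sup>k\<close> when time is measured by \<open>r = |Y|\<close>.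
  The bound on \<open>y\<^sub>3\<close> expresses that the unstable equilibrium \<open>\<mu> = - e\<close> is left fast enough.\<close>

lemma moment_system_limit:
  fixes y1 y2 y3 y4 :: "real \<Rightarrow> real"
  assumes a: "0 < a"
    and d1: "\<And>r. 1 < r \<Longrightarrow> (y1 has_field_derivative - a * (2 * y1 r - y2 r) + (1 - y1 r) / r) (at r)"
    and d2: "\<And>r. 1 < r \<Longrightarrow> (y2 has_field_derivative - 2 * a * (2 * y2 r - y3 r) + (4 * y1 r - 3 * y2 r) / r) (at r)"
    and d3: "\<And>r. 1 < r \<Longrightarrow> (y3 has_field_derivative - 3 * a * (2 * y3 r - y4 r) + 3 * (3 * y2 r - 2 * y3 r) / r) (at r)"
    and nn: "\<And>r. 1 < r \<Longrightarrow> 0 \<le> y1 r" "\<And>r. 1 < r \<Longrightarrow> 0 \<le> y2 r" "\<And>r. 1 < r \<Longrightarrow> 0 \<le> y3 r"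
    and c3: "\<And>r. 1 < r \<Longrightarrow> - 3 * a * (2 * y3 r - y4 r) + 3 * (3 * y2 r - 2 * y3 r) / r + 3 / (2 * r) * y3 r \<le> C / r ^ 3"
    and c1: "\<And>r \<eta>. 1 < r \<Longrightarrow> 0 < \<eta> \<Longrightarrow> y1 r \<le> \<eta> + y3 r / \<eta>\<^sup>2"
  shows "((\<lambda>r. r * y1 r) \<longlongrightarrow> 1 / (2 * a)) at_top"
proof -
  \<comment> \<open>By \<open>c3\<close> the derivative of r^(3/2) y_3 is at most C r^(-3/2). The
    second summand has derivative - C r^(-3/2), so \<open>V\<close> is nonincreasing.\<close>
  define V where "V r = r * sqrt r * y3 r + 2 * C / sqrt r" for r
  have V_le: "V r \<le> V 2" if r: "2 \<le> r" for r
  \<comment> \<open>The equations hold for r > 1 only, so monotonicity is started at 2 and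
    \<open>V 2\<close> enters the bound on \<open>y3\<close> as a constant.\<close>
  proof (rule DERIV_nonpos_imp_nonincreasing[OF r])
    fix z :: real assume z: "2 \<le> z" "z \<le> r"
    then have z1: "1 < z" by simp
    define s where "s = sqrt z"
    have s: "0 < s" "z = s * s" using z1 by (auto simp: s_def)
    let ?D = "- 3 * a * (2 * y3 z - y4 z) + 3 * (3 * y2 z - 2 * y3 z) / z"
    have ds: "(sqrt has_field_derivative (1 / (2 * s))) (at z)"
      by (rule DERIV_cong[OF DERIV_real_sqrt]) (use z1 in \<open>simp_all add: s_def inverse_eq_divide\<close>)
    have "(V has_field_derivative ((1 * sqrt z + 1 / (2 * s) * z) * y3 z + ?D * (z * sqrt z)
        + (0 * sqrt z - 2 * C * (1 / (2 * s))) / (sqrt z * sqrt z))) (at z)"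
      unfolding V_def[abs_def]
      by (rule DERIV_add[OF DERIV_mult[OF DERIV_mult[OF DERIV_ident ds] d3[OF z1]] DERIV_divide[OF DERIV_const ds]]) (use z1 in simp)
    moreover have "(1 * sqrt z + 1 / (2 * s) * z) * y3 z + ?D * (z * sqrt z)
        + (0 * sqrt z - 2 * C * (1 / (2 * s))) / (sqrt z * sqrt z) = z * s * ((?D + 3 / (2 * z) * y3 z) - C / z ^ 3)"
    proof -
      have "(1 * s + 1 / (2 * s) * (s * s)) * y + D * (s * s * s) + (0 * s - 2 * C * (1 / (2 * s))) / (s * s) =
        s * s * s * ((D + 3 / (2 * (s * s)) * y) - C / (s * s) ^ 3)" for y D :: real
        using s(1) by (simp add: field_simps power3_eq_cube)
      from this[of "y3 z" ?D] show ?thesis unfolding s(2)[symmetric] s_def[symmetric] .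
    qed
    moreover have "z * s * ((?D + 3 / (2 * z) * y3 z) - C / z ^ 3) \<le> 0"
      using c3[OF z1] s z1 by (intro mult_nonneg_nonpos) auto
    ultimately show "\<exists>y. (V has_field_derivative y) (at z) \<and> y \<le> 0" by metis
  qed
  define K where "K = \<bar>V 2\<bar> + 2 * \<bar>C\<bar>"
  have y3_le: "r * y3 r \<le> K / sqrt r" if r: "2 \<le> r" for r
  proof -
    have "1 \<le> sqrt r" using r by simp
    then have "- (2 * C / sqrt r) \<le> 2 * \<bar>C\<bar>"
    proof -
      have "- (2 * C / sqrt r) \<le> \<bar>2 * C / sqrt r\<bar>" by (rule abs_ge_minus_self)
      also have "\<bar>2 * C / sqrt r\<bar> = \<bar>2 * C\<bar> / sqrt r"
        unfolding abs_divide using \<open>1 \<le> sqrt r\<close> by (subst abs_of_nonneg[of "sqrt r"]) auto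
      also have "\<dots> \<le> \<bar>2 * C\<bar> / 1" using \<open>1 \<le> sqrt r\<close> by (intro divide_left_mono) auto
      finally show ?thesis by (simp add: abs_mult)
    qed
    then have "r * sqrt r * y3 r \<le> K" using V_le[OF r] unfolding V_def[of r] K_def by linarith
    then have "(r * y3 r) * sqrt r \<le> K" by (simp only: mult_ac)
    then show ?thesis using \<open>1 \<le> sqrt r\<close> by (subst pos_le_divide_eq) auto
  qed
  have sq: "((\<lambda>r. K / sqrt r) \<longlongrightarrow> 0) at_top"
    by (rule tendsto_divide_0[OF tendsto_const filterlim_at_top_imp_at_infinity[OF sqrt_at_top]])
  have lim3: "((\<lambda>r. r * y3 r) \<longlongrightarrow> 0) at_top"
  proof (rule tendsto_sandwich[of "\<lambda>_. 0" _ _ "\<lambda>r. K / sqrt r"])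
    show "\<forall>\<^sub>F r in at_top. 0 \<le> r * y3 r" using eventually_ge_at_top[of 2] by eventually_elim (simp add: nn)
    show "\<forall>\<^sub>F r in at_top. r * y3 r \<le> K / sqrt r"
      using eventually_ge_at_top[of 2] by eventually_elim (rule y3_le)
    show "((\<lambda>r. K / sqrt r) \<longlongrightarrow> 0) at_top" by (rule sq)
  qed simp
  have lim1: "(y1 \<longlongrightarrow> 0) at_top"
  proof (rule order_tendstoI)
    fix z :: real assume "z < 0"
    show "\<forall>\<^sub>F r in at_top. z < y1 r"
      using eventually_ge_at_top[of 2]
    proof eventually_elim
      case (elim r)
      then show ?case using nn(1)[of r] \<open>z < 0\<close> by simp
    qed
  next
    fix z :: real assume z: "0 < z"
    have L: "((\<lambda>r. z / 2 + K / sqrt r / (z / 2)\<^sup>2) \<longlongrightarrow> z / 2 + 0 / (z / 2)\<^sup>2) at_top"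
      by (intro tendsto_add tendsto_divide tendsto_const sq) (use z in auto)
    have "\<forall>\<^sub>F r in at_top. z / 2 + K / sqrt r / (z / 2)\<^sup>2 < z" by (intro order_tendstoD(2)[OF L]) (use z in simp)
    then show "\<forall>\<^sub>F r in at_top. y1 r < z"
      using eventually_ge_at_top[of 2]
    proof eventually_elim
      case (elim r)
      have "y1 r \<le> z / 2 + y3 r / (z / 2)\<^sup>2" using c1[of r "z / 2"] elim z by simp
      also have "z / 2 + y3 r / (z / 2)\<^sup>2 \<le> z / 2 + K / sqrt r / (z / 2)\<^sup>2"
      proof (intro add_left_mono divide_right_mono)
        have "y3 r \<le> r * y3 r" using nn(3)[of r] elim mult_right_mono[of 1 r "y3 r"] by simp
        also have "\<dots> \<le> K / sqrt r" by (rule y3_le[OF elim(2)])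
        finally show "y3 r \<le> K / sqrt r" .
      qed simp
      finally show ?case using elim by simp
    qed
  qed
  let ?z = "\<lambda>r. r * y2 r" and ?w = "\<lambda>r. r * y1 r"
  have dz: "(?z has_field_derivative (1 * y2 r + r * (- 2 * a * (2 * y2 r - y3 r) + (4 * y1 r - 3 * y2 r) / r))) (at r)" if "2 \<le> r" for r
    using DERIV_mult[OF DERIV_ident d2[of r]] that by (simp add: mult.commute add.commute)
  \<comment> \<open>Differentiating the factor r turns - 3 y_2 into - 2 y_2, whose sign is
    favourable, and it is dropped.\<close>
  have z_le: "1 * y2 r + r * (- 2 * a * (2 * y2 r - y3 r) + (4 * y1 r - 3 * y2 r) / r) \<le> - (4 * a) * ?z r + (2 * a * (r * y3 r) + 4 * y1 r)" if "2 \<le> r" for r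
  proof -
    have "1 * y2 r + r * (- 2 * a * (2 * y2 r - y3 r) + (4 * y1 r - 3 * y2 r) / r) =
        - (4 * a) * ?z r + (2 * a * (r * y3 r) + 4 * y1 r) - 2 * y2 r"
      using that by (simp add: field_simps)
    then show ?thesis using nn(2)[of r] that by simp
  qed
  have gz: "((\<lambda>r. 2 * a * (r * y3 r) + 4 * y1 r) \<longlongrightarrow> 2 * a * 0 + 4 * 0) at_top"
    by (intro tendsto_intros lim3 lim1)
  have limz: "(?z \<longlongrightarrow> 0) at_top"
  proof (rule order_tendstoI)
    fix x :: real assume "x < 0"
    show "\<forall>\<^sub>F r in at_top. x < ?z r"
      using eventually_ge_at_top[of 2]
    proof eventually_elim
      case (elim r)
      then have "0 \<le> ?z r" using nn(2)[of r] by simp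
      then show ?case using \<open>x < 0\<close> by simp
    qed
  next
    fix x :: real assume x: "0 < x"
    have "\<forall>\<^sub>F r in at_top. ?z r < (2 * a * 0 + 4 * 0) / (4 * a) + x"
      by (rule eventually_below_equilibrium[where R=2 and c="4 * a", OF _ dz z_le gz x]) (use a in simp_all)
    then show "\<forall>\<^sub>F r in at_top. ?z r < x" by simp
  qed
  \<comment> \<open>The term y_1 from the product rule cancels - y_1 from the equation exactly,
    which leaves a linear equation with damping 2 a and forcing 1 + a r y_2.\<close>
  have dw: "(?w has_field_derivative (- (2 * a) * ?w r + (1 + a * ?z r))) (at r)" if "2 \<le> r" for r
  proof -
    have "1 * y1 r + (- a * (2 * y1 r - y2 r) + (1 - y1 r) / r) * r = - (2 * a) * ?w r + (1 + a * ?z r)"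
      using that by (simp add: field_simps)
    moreover have "(?w has_field_derivative (1 * y1 r + (- a * (2 * y1 r - y2 r) + (1 - y1 r) / r) * r)) (at r)"
      by (rule DERIV_mult[OF DERIV_ident d1]) (use that in simp)
    ultimately show ?thesis by (simp only:)
  qed
  have gw: "((\<lambda>r. 1 + a * ?z r) \<longlongrightarrow> 1 + a * 0) at_top" by (intro tendsto_intros limz)
  \<comment> \<open>The equation is an equality, so the comparison applies to the negative as well
    and gives the lower bound.\<close>
  have dw': "((\<lambda>r. - ?w r) has_field_derivative (- (- (2 * a) * ?w r + (1 + a * ?z r)))) (at r)" if "2 \<le> r" for r
    by (rule DERIV_minus[OF dw[OF that]])
  have gw': "((\<lambda>r. - (1 + a * ?z r)) \<longlongrightarrow> - (1 + a * 0)) at_top" by (intro tendsto_intros limz)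
  show ?thesis
  proof (rule order_tendstoI)
    fix x assume x: "x < 1 / (2 * a)"
    have "\<forall>\<^sub>F r in at_top. - ?w r < - (1 + a * 0) / (2 * a) + (1 / (2 * a) - x)"
      by (rule eventually_below_equilibrium[where R=2 and c="2 * a", OF _ dw' _ gw']) (use a x in \<open>simp_all add: algebra_simps\<close>)
    then show "\<forall>\<^sub>F r in at_top. x < ?w r" by eventually_elim simp
  next
    fix x assume x: "1 / (2 * a) < x"
    have "\<forall>\<^sub>F r in at_top. ?w r < (1 + a * 0) / (2 * a) + (x - 1 / (2 * a))"
      by (rule eventually_below_equilibrium[where R=2 and c="2 * a", OF _ dw _ gw]) (use a x in simp_all)
    then show "\<forall>\<^sub>F r in at_top. ?w r < x" by eventually_elim simp
  qed
qed

section \<open>Pointwise inequalities behind the moment bounds\<close>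

lemma abs_power_diff_le:
  fixes x z :: real
  assumes "\<bar>x\<bar> \<le> R" "\<bar>z\<bar> \<le> R" "1 \<le> R"
  shows "\<bar>x ^ n - z ^ n\<bar> \<le> n * R ^ n * \<bar>x - z\<bar>"
proof (induction n)
  case (Suc n)
  have "x ^ Suc n - z ^ Suc n = x * (x ^ n - z ^ n) + (x - z) * z ^ n" by (simp add: algebra_simps)
  then have "\<bar>x ^ Suc n - z ^ Suc n\<bar> \<le> \<bar>x\<bar> * \<bar>x ^ n - z ^ n\<bar> + \<bar>x - z\<bar> * \<bar>z\<bar> ^ n"
    using abs_triangle_ineq[of "x * (x ^ n - z ^ n)" "(x - z) * z ^ n"] by (simp add: abs_mult power_abs)
  also have "\<dots> \<le> R * (n * R ^ n * \<bar>x - z\<bar>) + \<bar>x - z\<bar> * R ^ Suc n"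
  proof (intro add_mono mult_mono mult_left_mono Suc.IH)
    have "\<bar>z\<bar> ^ n \<le> R ^ n" using assms by (intro power_mono) auto
    also have "\<dots> \<le> R ^ Suc n" using assms by (intro power_increasing) auto
    finally show "\<bar>z\<bar> ^ n \<le> R ^ Suc n" .
  qed (use assms in auto)
  also have "\<dots> = Suc n * R ^ Suc n * \<bar>x - z\<bar>" by (simp add: algebra_simps)
  finally show ?case .
qed simp

text \<open>The coefficient 3/2 makes 9 - 6 q + (3/2) q a multiple of 2 - q, so the whole expression
  is 3 q^2 (2 - q) (3 / (2 r) - a q). It is positive only for q below 3 / (2 a r), where q^2 is of
  order r^(-2). The resulting r^(-3) is integrable even against the weight r^(3/2).\<close>

lemma quasi_cubic_bound:
  fixes q a r :: real
  assumes q: "0 \<le> q" "q \<le> 2" and a: "0 < a" and r: "0 < r"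
  shows "- 3 * a * (2 * q ^ 3 - q ^ 4) + 3 * (3 * q\<^sup>2 - 2 * q ^ 3) / r + 3 / (2 * r) * q ^ 3 \<le> 81 / (4 * a\<^sup>2) / r ^ 3"
proof -
  have eq: "- 3 * a * (2 * q ^ 3 - q ^ 4) + 3 * (3 * q\<^sup>2 - 2 * q ^ 3) / r + 3 / (2 * r) * q ^ 3 = 3 * (q\<^sup>2 * (2 - q) * (3 / (2 * r) - a * q))"
    using r by (simp add: field_simps power2_eq_square power3_eq_cube power4_eq_xxxx)
  have rhs: "0 \<le> 81 / (4 * a\<^sup>2) / r ^ 3" using a r by simp
  show ?thesis
  proof (cases "3 / (2 * r) \<le> a * q")
    case True
    then have "q\<^sup>2 * (2 - q) * (3 / (2 * r) - a * q) \<le> 0" using q by (intro mult_nonneg_nonpos) auto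
    then show ?thesis unfolding eq using rhs by linarith
  next
    case False
    then have "q \<le> 3 / (2 * r * a)" using a r by (simp add: field_simps)
    then have "q\<^sup>2 \<le> (3 / (2 * r * a))\<^sup>2" using q by (intro power_mono)
    moreover have "3 / (2 * r) - a * q \<le> 3 / (2 * r)" using a q by simp
    \<comment> \<open>The three factors are bounded separately; 3 * (3 / (2 a))^2 * 2 * (3 / 2) is
      the constant 81 / (4 a^2).\<close>
    ultimately have "q\<^sup>2 * (2 - q) * (3 / (2 * r) - a * q) \<le> (3 / (2 * r * a))\<^sup>2 * 2 * (3 / (2 * r))"
      using q False r by (intro mult_mono) auto
    also have "\<dots> = (27 / (4 * a\<^sup>2)) / r ^ 3" using a r by (simp add: field_simps power2_eq_square power3_eq_cube)
    finally show ?thesis unfolding eq using rhs by simp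
  qed
qed

text \<open>Controls the first moment by the third, the only one whose decay is obtained directly
  from its own equation.\<close>

lemma le_eta_plus_cube:
  fixes q \<eta> :: real
  assumes "0 \<le> q" "0 < \<eta>" shows "q \<le> \<eta> + q ^ 3 / \<eta>\<^sup>2"
proof (cases "q \<le> \<eta>")
  case False
  then have "\<eta>\<^sup>2 \<le> q\<^sup>2" using assms by (intro power_mono) auto
  then have "q * \<eta>\<^sup>2 \<le> q * q\<^sup>2" using assms by (intro mult_left_mono)
  then have "q \<le> q ^ 3 / \<eta>\<^sup>2" using assms by (simp add: field_simps power3_eq_cube power2_eq_square)
  then show ?thesis using assms by simp
qed (use assms in \<open>simp add: add_increasing2\<close>)

section \<open>Moment equations\<close>

lemma has_derivative_at_if_one_step:
  fixes \<phi> \<psi> :: "real \<Rightarrow> real"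
  assumes t: "0 < t" "t < T"
    and step: "\<And>s t. 0 \<le> s \<Longrightarrow> s \<le> t \<Longrightarrow> t \<le> T \<Longrightarrow> \<bar>\<phi> t - \<phi> s - (t - s) * \<psi> s\<bar> \<le> C * ((t - s) * sqrt (t - s))"
    and cont: "continuous_on {0..T} \<psi>"
  shows "(\<phi> has_field_derivative \<psi> t) (at t)"
proof -
  have "(\<phi> has_field_derivative \<psi> t) (at t within {0..T})"
    by (rule has_derivative_if_one_step[OF step cont]) (use t in auto)
  moreover have "at t within {0..T} = at t" by (rule at_within_Icc_at) (use t in auto)
  ultimately show ?thesis by simp
qed

context llg_solution begin

definition moment :: "nat \<Rightarrow> real \<Rightarrow> real"
  where "moment k t = expectation (\<lambda>\<omega>. S t \<omega> ^ k)"

lemma moment_0: "moment 0 t = 1"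
  by (simp add: moment_def prob_space)

lemma S_power_bound:
  assumes "0 \<le> t" shows "AE \<omega> in M. \<bar>S t \<omega> ^ k\<bar> \<le> radius t ^ k"
  using S_bound[OF assms]
proof eventually_elim
  case (elim \<omega>)
  then show ?case by (simp add: power_abs power_mono)
qed

lemma S_power_measurable:
  assumes "0 \<le> t" shows "(\<lambda>\<omega>. S t \<omega> ^ k) \<in> borel_measurable M" "(\<lambda>\<omega>. S t \<omega> ^ k) \<in> borel_measurable (F t)"
  using S_measurable[OF assms] S_measurable_F[OF assms] by measurable

lemma S_power_integrable:
  assumes "0 \<le> t" shows "integrable M (\<lambda>\<omega>. S t \<omega> ^ k)"
  using AE_bounded_square_integrable(1)[OF S_power_measurable(1)[OF assms] S_power_bound[OF assms]]
  by (rule square_integrableD(3))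

lemma expectation_power_transverse:
  assumes t: "0 \<le> t"
  shows "expectation (\<lambda>\<omega>. S t \<omega> ^ j * transverse t \<omega>) = moment j t - moment (j + 2) t / (1 + 2 * \<kappa> * t)"
proof -
  have "expectation (\<lambda>\<omega>. S t \<omega> ^ j * transverse t \<omega>)
      = expectation (\<lambda>\<omega>. S t \<omega> ^ j - S t \<omega> ^ (j + 2) / (1 + 2 * \<kappa> * t))"
  proof (rule integral_cong_AE)
    show "(\<lambda>\<omega>. S t \<omega> ^ j * transverse t \<omega>) \<in> borel_measurable M"
      using S_measurable[OF t] transverse_measurable[OF t] by measurable
    show "(\<lambda>\<omega>. S t \<omega> ^ j - S t \<omega> ^ (j + 2) / (1 + 2 * \<kappa> * t)) \<in> borel_measurable M"
      using S_measurable[OF t] by measurable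
    show "AE \<omega> in M. S t \<omega> ^ j * transverse t \<omega> = S t \<omega> ^ j - S t \<omega> ^ (j + 2) / (1 + 2 * \<kappa> * t)"
      using transverse_eq[OF t]
    proof eventually_elim
      case (elim \<omega>)
      show ?case unfolding elim radius(1)[OF t] power_add
        by (simp only: right_diff_distrib mult_1_right times_divide_eq_right)
    qed
  qed
  also have "\<dots> = moment j t - moment (j + 2) t / (1 + 2 * \<kappa> * t)"
    unfolding moment_def
      Bochner_Integration.integral_diff[OF S_power_integrable[OF t] Bochner_Integration.integrable_divide[OF S_power_integrable[OF t]]]
      integral_divide_zero ..
  finally show ?thesis .
qed

text \<open>The value of E (S^j transverse) at time \<open>t\<close>, according to
  \<open>expectation_power_transverse\<close>. Both drift and noise act on the moments through these
  quantities.\<close>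

definition moment_rate :: "nat \<Rightarrow> real \<Rightarrow> real"
  where "moment_rate j t = moment j t - moment (j + 2) t / (1 + 2 * \<kappa> * t)"

text \<open>Increments of \<open>S\<close> are of order sqrt (t - s) in L1, and powers are Lipschitz
  on the bounded range of \<open>S\<close>, so the moments are Hoelder continuous. This supplies the
  continuity of the rates which the one-step criterion asks for.\<close>

lemma moment_continuous:
  assumes T: "0 \<le> T" shows "continuous_on {0..T} (moment j)"
proof -
  \<comment> \<open>No weight occurs in the two estimates used here, so the bound on weights is
    instantiated with 0, by \<open>order_refl\<close>.\<close>
  obtain C where C: "0 \<le> C"
    and sq: "\<And>s t. 0 \<le> s \<Longrightarrow> s \<le> t \<Longrightarrow> t \<le> T \<Longrightarrow> square_integrable (\<lambda>\<omega>. S t \<omega> - S s \<omega>)"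
    and E1: "\<And>s t. 0 \<le> s \<Longrightarrow> s \<le> t \<Longrightarrow> t \<le> T \<Longrightarrow> expectation (\<lambda>\<omega>. \<bar>S t \<omega> - S s \<omega>\<bar>) \<le> C * sqrt (t - s)"
    by (rule S_one_step[OF T order_refl]) blast
  define R where "R = radius T"
  have R: "1 \<le> R" unfolding R_def by (rule radius(2)[OF T])
  define K where "K = real j * R ^ j"
  have K: "0 \<le> K" using R by (simp add: K_def)
  have step: "\<bar>moment j t - moment j s\<bar> \<le> (K * C) * sqrt (t - s)" if st: "0 \<le> s" "s \<le> t" "t \<le> T" for s t
  proof -
    have t0: "0 \<le> t" and sT: "s \<le> T" using st by auto
    note i = square_integrableD(4)[OF sq[OF st]]
    have b: "AE \<omega> in M. \<bar>S t \<omega> ^ j - S s \<omega> ^ j\<bar> \<le> K * \<bar>S t \<omega> - S s \<omega>\<bar>"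
      using S_bound[OF t0] S_bound[OF st(1)]
    proof eventually_elim
      case (elim \<omega>)
      have "\<bar>S t \<omega>\<bar> \<le> R" "\<bar>S s \<omega>\<bar> \<le> R"
        using elim radius(3)[OF t0 st(3)] radius(3)[OF st(1) sT] by (auto simp: R_def)
      from abs_power_diff_le[OF this R] show ?case by (simp add: K_def)
    qed
    have "\<bar>moment j t - moment j s\<bar> = \<bar>expectation (\<lambda>\<omega>. S t \<omega> ^ j - S s \<omega> ^ j)\<bar>"
      unfolding moment_def using S_power_integrable[OF t0] S_power_integrable[OF st(1)] by simp
    also have "\<dots> \<le> expectation (\<lambda>\<omega>. \<bar>S t \<omega> ^ j - S s \<omega> ^ j\<bar>)"
      by (rule integral_abs_bound)
    also have "\<dots> \<le> expectation (\<lambda>\<omega>. K * \<bar>S t \<omega> - S s \<omega>\<bar>)"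
      by (rule integral_mono_AE[OF _ _ b])
         (use S_power_integrable[OF t0] S_power_integrable[OF st(1)] i in auto)
    also have "\<dots> = K * expectation (\<lambda>\<omega>. \<bar>S t \<omega> - S s \<omega>\<bar>)" by simp
    also have "\<dots> \<le> K * (C * sqrt (t - s))" by (rule mult_left_mono[OF E1[OF st] K])
    finally show ?thesis by (simp only: mult.assoc)
  qed
  have bd: "dist (moment j t) (moment j s) \<le> (K * C) * sqrt \<bar>t - s\<bar>" if "s \<in> {0..T}" "t \<in> {0..T}" for s t
    using step[of s t] step[of t s] that by (cases "s \<le> t") (auto simp: dist_real_def abs_minus_commute)
  show ?thesis unfolding continuous_on_def
  proof
    fix s assume s: "s \<in> {0..T}"
    have "((\<lambda>t. (K * C) * sqrt \<bar>t - s\<bar>) \<longlongrightarrow> (K * C) * sqrt \<bar>s - s\<bar>) (at s within {0..T})"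
      by (intro tendsto_intros)
    then have z: "((\<lambda>t. (K * C) * sqrt \<bar>t - s\<bar>) \<longlongrightarrow> 0) (at s within {0..T})" by simp
    have "\<forall>\<^sub>F t in at s within {0..T}. dist (moment j t) (moment j s) \<le> (K * C) * sqrt \<bar>t - s\<bar>"
      using bd[OF s] by (simp add: eventually_at_filter)
    then show "(moment j \<longlongrightarrow> moment j s) (at s within {0..T})"
      unfolding tendsto_dist_iff[of "moment j"] by (rule tendsto_sandwich[OF always_eventually _ tendsto_const z, OF allI[OF zero_le_dist]])
  qed
qed

lemma moment_rate_continuous:
  assumes T: "0 \<le> T" shows "continuous_on {0..T} (moment_rate j)"
proof -
  have "1 + 2 * \<kappa> * t \<noteq> 0" if "t \<in> {0..T}" for t
    using that \<kappa>_pos by (smt (verit, best) atLeastAtMost_iff mult_nonneg_nonneg)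
  then show ?thesis unfolding moment_rate_def[abs_def]
    by (intro continuous_intros moment_continuous[OF T]) auto
qed

text \<open>Binomial expansion of S(t)^k around S(s): the terms of first and second order have
  weights S(s)^j with j at most 2, and the cube of the increment is a remainder. Moments up to the
  third suffice, because the fourth enters the final estimate only through the inequality for the
  third.\<close>

lemma moment_has_derivative:
  assumes t: "0 < t"
  shows "(moment 1 has_field_derivative \<alpha> * \<beta> * moment_rate 0 t) (at t)"
    and "(moment 2 has_field_derivative 2 * (\<alpha> * \<beta> * moment_rate 1 t) + \<kappa> * moment_rate 0 t) (at t)"
    and "(moment 3 has_field_derivative 3 * (\<alpha> * \<beta> * moment_rate 2 t) + 3 * (\<kappa> * moment_rate 1 t)) (at t)"
proof -
  \<comment> \<open>Any horizon beyond \<open>t\<close> would do; it makes \<open>t\<close> an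
    interior point and provides uniform constants. The weights S(s)^j are then bounded by
    \<open>R\<^sup>2\<close>, because \<open>R\<close> is at least 1.\<close>
  define T where "T = t + 1"
  have T: "0 \<le> T" using t by (simp add: T_def)
  define R where "R = radius T"
  have R: "1 \<le> R" unfolding R_def by (rule radius(2)[OF T])
  have R2: "0 \<le> R\<^sup>2" by simp
  obtain C where C: "0 \<le> C"
    and sq: "\<And>s t. 0 \<le> s \<Longrightarrow> s \<le> t \<Longrightarrow> t \<le> T \<Longrightarrow> square_integrable (\<lambda>\<omega>. S t \<omega> - S s \<omega>)"
    and E3: "\<And>s t. 0 \<le> s \<Longrightarrow> s \<le> t \<Longrightarrow> t \<le> T \<Longrightarrow> \<bar>expectation (\<lambda>\<omega>. (S t \<omega> - S s \<omega>) ^ 3)\<bar> \<le> C * ((t - s) * sqrt (t - s))"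
    and G1: "\<And>s t G. 0 \<le> s \<Longrightarrow> s \<le> t \<Longrightarrow> t \<le> T \<Longrightarrow> G \<in> borel_measurable (F s) \<Longrightarrow> AE \<omega> in M. \<bar>G \<omega>\<bar> \<le> R\<^sup>2 \<Longrightarrow>
      \<bar>expectation (\<lambda>\<omega>. G \<omega> * (S t \<omega> - S s \<omega>)) - (t - s) * (\<alpha> * \<beta> * expectation (\<lambda>\<omega>. G \<omega> * transverse s \<omega>))\<bar> \<le> C * ((t - s) * sqrt (t - s))"
    and G2: "\<And>s t G. 0 \<le> s \<Longrightarrow> s \<le> t \<Longrightarrow> t \<le> T \<Longrightarrow> G \<in> borel_measurable (F s) \<Longrightarrow> AE \<omega> in M. \<bar>G \<omega>\<bar> \<le> R\<^sup>2 \<Longrightarrow>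
      \<bar>expectation (\<lambda>\<omega>. G \<omega> * (S t \<omega> - S s \<omega>)\<^sup>2) - (t - s) * (\<kappa> * expectation (\<lambda>\<omega>. G \<omega> * transverse s \<omega>))\<bar> \<le> C * ((t - s) * sqrt (t - s))"
    by (rule S_one_step[OF T R2]) blast
  have bounded: "AE \<omega> in M. \<bar>S s \<omega> ^ j\<bar> \<le> R\<^sup>2" if s: "0 \<le> s" "s \<le> T" and j: "j \<le> 2" for s j
    using S_bound[OF s(1)]
  proof eventually_elim
    case (elim \<omega>)
    then have "\<bar>S s \<omega>\<bar> \<le> R" using radius(3)[OF s] by (simp add: R_def)
    then have "\<bar>S s \<omega>\<bar> ^ j \<le> R ^ j" by (rule power_mono) simp
    also have "\<dots> \<le> R\<^sup>2" by (rule power_increasing[OF j R])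
    finally show ?case by (simp add: power_abs)
  qed
  have D1: "\<bar>expectation (\<lambda>\<omega>. S s \<omega> ^ j * (S t \<omega> - S s \<omega>)) - (t - s) * (\<alpha> * \<beta> * moment_rate j s)\<bar> \<le> C * ((t - s) * sqrt (t - s))"
    if st: "0 \<le> s" "s \<le> t" "t \<le> T" and j: "j \<le> 2" for s t j
    using G1[OF st S_power_measurable(2)[OF st(1)] bounded[OF st(1) order_trans[OF st(2,3)] j]]
    unfolding expectation_power_transverse[OF st(1)] moment_rate_def .
  have D2: "\<bar>expectation (\<lambda>\<omega>. S s \<omega> ^ j * (S t \<omega> - S s \<omega>)\<^sup>2) - (t - s) * (\<kappa> * moment_rate j s)\<bar> \<le> C * ((t - s) * sqrt (t - s))"
    if st: "0 \<le> s" "s \<le> t" "t \<le> T" and j: "j \<le> 2" for s t j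
    using G2[OF st S_power_measurable(2)[OF st(1)] bounded[OF st(1) order_trans[OF st(2,3)] j]]
    unfolding expectation_power_transverse[OF st(1)] moment_rate_def .
  have I1: "integrable M (\<lambda>\<omega>. S s \<omega> ^ j * (S t \<omega> - S s \<omega>))"
    and I2: "integrable M (\<lambda>\<omega>. S s \<omega> ^ j * (S t \<omega> - S s \<omega>)\<^sup>2)"
    and I3: "integrable M (\<lambda>\<omega>. (S t \<omega> - S s \<omega>) ^ 3)"
    if st: "0 \<le> s" "s \<le> t" "t \<le> T" and j: "j \<le> 2" for s t j
  proof -
    have t0: "0 \<le> t" and sT: "s \<le> T" using st by auto
    note AEb = AE_bounded_mult(1)[OF S_power_measurable(1)[OF st(1)] bounded[OF st(1) sT j] _ R2]
    show "integrable M (\<lambda>\<omega>. S s \<omega> ^ j * (S t \<omega> - S s \<omega>))"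
      by (rule AEb[OF square_integrableD(3)[OF sq[OF st]]])
    show "integrable M (\<lambda>\<omega>. S s \<omega> ^ j * (S t \<omega> - S s \<omega>)\<^sup>2)"
      by (rule AEb[OF square_integrableD(2)[OF sq[OF st]]])
    have m: "(\<lambda>\<omega>. (S t \<omega> - S s \<omega>) ^ 3) \<in> borel_measurable M"
      using S_measurable[OF t0] S_measurable[OF st(1)] by measurable
    have "AE \<omega> in M. \<bar>(S t \<omega> - S s \<omega>) ^ 3\<bar> \<le> (2 * R) ^ 3"
      using S_bound[OF t0] S_bound[OF st(1)]
    proof eventually_elim
      case (elim \<omega>)
      have "\<bar>S t \<omega>\<bar> \<le> R" "\<bar>S s \<omega>\<bar> \<le> R"
        using elim radius(3)[OF t0 st(3)] radius(3)[OF st(1) sT] by (auto simp: R_def)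
      then have "\<bar>S t \<omega> - S s \<omega>\<bar> \<le> 2 * R" by linarith
      then have "\<bar>S t \<omega> - S s \<omega>\<bar> ^ 3 \<le> (2 * R) ^ 3" by (rule power_mono) simp
      then show ?case by (simp only: power_abs)
    qed
    from square_integrableD(3)[OF AE_bounded_square_integrable(1)[OF m this]]
    show "integrable M (\<lambda>\<omega>. (S t \<omega> - S s \<omega>) ^ 3)" .
  qed
  note rc = moment_rate_continuous[OF T]
  show "(moment 1 has_field_derivative \<alpha> * \<beta> * moment_rate 0 t) (at t)"
  proof (rule has_derivative_at_if_one_step[where T=T and \<psi>="\<lambda>t. \<alpha> * \<beta> * moment_rate 0 t" and C=C])
    show "0 < t" "t < T" using t by (auto simp: T_def)
    show "continuous_on {0..T} (\<lambda>t. \<alpha> * \<beta> * moment_rate 0 t)" by (intro continuous_intros rc)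
    fix s t assume st: "0 \<le> s" "s \<le> t" "t \<le> T"
    then have t0: "0 \<le> t" by simp
    have "moment 1 t - moment 1 s = expectation (\<lambda>\<omega>. S s \<omega> ^ 0 * (S t \<omega> - S s \<omega>))"
      unfolding moment_def using S_power_integrable[OF t0, of 1] S_power_integrable[OF st(1), of 1] by simp
    then show "\<bar>moment 1 t - moment 1 s - (t - s) * (\<alpha> * \<beta> * moment_rate 0 s)\<bar> \<le> C * ((t - s) * sqrt (t - s))"
      using D1[OF st, of 0] by simp
  qed
  show "(moment 2 has_field_derivative 2 * (\<alpha> * \<beta> * moment_rate 1 t) + \<kappa> * moment_rate 0 t) (at t)"
  \<comment> \<open>The increment is \<open>2 * u1 + u0\<close> with an error \<open>C\<close> in
    each expectation, which makes 3.\<close>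
  proof (rule has_derivative_at_if_one_step[where T=T and \<psi>="\<lambda>t. 2 * (\<alpha> * \<beta> * moment_rate 1 t) + \<kappa> * moment_rate 0 t" and C="3 * C"])
    show "0 < t" "t < T" using t by (auto simp: T_def)
    show "continuous_on {0..T} (\<lambda>t. 2 * (\<alpha> * \<beta> * moment_rate 1 t) + \<kappa> * moment_rate 0 t)"
      by (intro continuous_intros rc)
    fix s t assume st: "0 \<le> s" "s \<le> t" "t \<le> T"
    then have t0: "0 \<le> t" by simp
    have j: "(1::nat) \<le> 2" "(0::nat) \<le> 2" by auto
    define d where "d = (t - s) * sqrt (t - s)"
    define u1 where "u1 = expectation (\<lambda>\<omega>. S s \<omega> ^ 1 * (S t \<omega> - S s \<omega>))"
    define u0 where "u0 = expectation (\<lambda>\<omega>. S s \<omega> ^ 0 * (S t \<omega> - S s \<omega>)\<^sup>2)"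
    have "moment 2 t - moment 2 s = expectation (\<lambda>\<omega>. S t \<omega> ^ 2 - S s \<omega> ^ 2)"
      unfolding moment_def by (rule Bochner_Integration.integral_diff[OF S_power_integrable[OF t0] S_power_integrable[OF st(1)], symmetric])
    also have "\<dots> = expectation (\<lambda>\<omega>. 2 * (S s \<omega> ^ 1 * (S t \<omega> - S s \<omega>)) + S s \<omega> ^ 0 * (S t \<omega> - S s \<omega>)\<^sup>2)"
      by (rule Bochner_Integration.integral_cong) (simp_all add: power2_eq_square algebra_simps)
    also have "\<dots> = 2 * u1 + u0"
      unfolding u1_def u0_def using I1[OF st j(1)] I2[OF st j(2)]
      by (subst Bochner_Integration.integral_add) (auto simp del: power_0 power_one_right)
    finally have e: "moment 2 t - moment 2 s = 2 * u1 + u0" .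
    define p where "p = \<alpha> * \<beta> * moment_rate 1 s"
    define q where "q = \<kappa> * moment_rate 0 s"
    have "\<bar>u1 - (t - s) * p\<bar> \<le> C * d" "\<bar>u0 - (t - s) * q\<bar> \<le> C * d"
      using D1[OF st j(1)] D2[OF st j(2)] unfolding u1_def u0_def d_def p_def q_def by blast+
    moreover have "moment 2 t - moment 2 s - (t - s) * (2 * p + q) = 2 * (u1 - (t - s) * p) + (u0 - (t - s) * q)"
      unfolding e by (simp add: algebra_simps)
    moreover have "\<bar>2 * x + z\<bar> \<le> 3 * c" if "\<bar>x\<bar> \<le> c" "\<bar>z\<bar> \<le> c" for x z c :: real using that by linarith
    ultimately have "\<bar>moment 2 t - moment 2 s - (t - s) * (2 * p + q)\<bar> \<le> 3 * (C * d)" by metis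
    then show "\<bar>moment 2 t - moment 2 s - (t - s) * (2 * (\<alpha> * \<beta> * moment_rate 1 s) + \<kappa> * moment_rate 0 s)\<bar> \<le> 3 * C * ((t - s) * sqrt (t - s))"
      unfolding p_def q_def d_def by (simp only: mult.assoc)
  qed
  show "(moment 3 has_field_derivative 3 * (\<alpha> * \<beta> * moment_rate 2 t) + 3 * (\<kappa> * moment_rate 1 t)) (at t)"
  \<comment> \<open>The coefficients 3, 3 and 1 of the cubic expansion add up to 7.\<close>
  proof (rule has_derivative_at_if_one_step[where T=T and \<psi>="\<lambda>t. 3 * (\<alpha> * \<beta> * moment_rate 2 t) + 3 * (\<kappa> * moment_rate 1 t)" and C="7 * C"])
    show "0 < t" "t < T" using t by (auto simp: T_def)
    show "continuous_on {0..T} (\<lambda>t. 3 * (\<alpha> * \<beta> * moment_rate 2 t) + 3 * (\<kappa> * moment_rate 1 t))"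
      by (intro continuous_intros rc)
    fix s t assume st: "0 \<le> s" "s \<le> t" "t \<le> T"
    then have t0: "0 \<le> t" by simp
    have j: "(1::nat) \<le> 2" "(2::nat) \<le> 2" by auto
    define d where "d = (t - s) * sqrt (t - s)"
    define u1 where "u1 = expectation (\<lambda>\<omega>. S s \<omega> ^ 2 * (S t \<omega> - S s \<omega>))"
    define u0 where "u0 = expectation (\<lambda>\<omega>. S s \<omega> ^ 1 * (S t \<omega> - S s \<omega>)\<^sup>2)"
    define u3 where "u3 = expectation (\<lambda>\<omega>. (S t \<omega> - S s \<omega>) ^ 3)"
    have "moment 3 t - moment 3 s = expectation (\<lambda>\<omega>. S t \<omega> ^ 3 - S s \<omega> ^ 3)"
      unfolding moment_def by (rule Bochner_Integration.integral_diff[OF S_power_integrable[OF t0] S_power_integrable[OF st(1)], symmetric])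
    also have "\<dots> = expectation (\<lambda>\<omega>. 3 * (S s \<omega> ^ 2 * (S t \<omega> - S s \<omega>)) + 3 * (S s \<omega> ^ 1 * (S t \<omega> - S s \<omega>)\<^sup>2) + (S t \<omega> - S s \<omega>) ^ 3)"
      by (rule Bochner_Integration.integral_cong) (simp_all add: power2_eq_square power3_eq_cube algebra_simps)
    also have "\<dots> = 3 * u1 + 3 * u0 + u3"
      unfolding u1_def u0_def u3_def using I1[OF st j(2)] I2[OF st j(1)] I3[OF st j(1)]
      by (simp del: power_one_right)
    finally have e: "moment 3 t - moment 3 s = 3 * u1 + 3 * u0 + u3" .
    define p where "p = \<alpha> * \<beta> * moment_rate 2 s"
    define q where "q = \<kappa> * moment_rate 1 s"
    have "\<bar>u1 - (t - s) * p\<bar> \<le> C * d" "\<bar>u0 - (t - s) * q\<bar> \<le> C * d" "\<bar>u3\<bar> \<le> C * d"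
      using D1[OF st j(2)] D2[OF st j(1)] E3[OF st] unfolding u1_def u0_def u3_def d_def p_def q_def by blast+
    moreover have "moment 3 t - moment 3 s - (t - s) * (3 * p + 3 * q)
        = 3 * (u1 - (t - s) * p) + 3 * (u0 - (t - s) * q) + u3"
      unfolding e by (simp add: algebra_simps)
    moreover have "\<bar>3 * x + 3 * z + w\<bar> \<le> 7 * c" if "\<bar>x\<bar> \<le> c" "\<bar>z\<bar> \<le> c" "\<bar>w\<bar> \<le> c" for x z w c :: real
      using that by linarith
    ultimately have "\<bar>moment 3 t - moment 3 s - (t - s) * (3 * p + 3 * q)\<bar> \<le> 7 * (C * d)" by metis
    then show "\<bar>moment 3 t - moment 3 s - (t - s) * (3 * (\<alpha> * \<beta> * moment_rate 2 s) + 3 * (\<kappa> * moment_rate 1 s))\<bar> \<le> 7 * C * ((t - s) * sqrt (t - s))"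
      unfolding p_def q_def d_def by (simp only: mult.assoc)
  qed
qed

end

section \<open>Time measured by the norm of Y\<close>

context llg_solution begin

text \<open>The inverse of \<open>radius\<close>: the time at which |Y| equals
  \<open>r\<close>.\<close>

definition clock :: "real \<Rightarrow> real" where "clock r = (r\<^sup>2 - 1) / (2 * \<kappa>)"

lemma clock:
  assumes "1 < r"
  shows "0 < clock r" "1 + 2 * \<kappa> * clock r = r\<^sup>2" "radius (clock r) = r"
proof -
  have "1 < r\<^sup>2" using assms by (simp add: one_less_power)
  then show "0 < clock r" unfolding clock_def using \<kappa>_pos by (intro divide_pos_pos) auto
  show e: "1 + 2 * \<kappa> * clock r = r\<^sup>2" using \<kappa>_pos by (simp add: clock_def)
  show "radius (clock r) = r" unfolding radius_def e using assms by simp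
qed

lemma clock_has_derivative: "(clock has_field_derivative r / \<kappa>) (at r)"
  unfolding clock_def[abs_def] using \<kappa>_pos by (auto intro!: derivative_eq_intros simp: power2_eq_square)

text \<open>The drift coefficient of \<open>\<mu> \<bullet> e\<close> when time is measured by \<open>r = |Y|\<close>.\<close>

definition a :: real where "a = \<alpha> * \<beta> / \<kappa>"

lemma a_pos: "0 < a"
  unfolding a_def using \<alpha> \<beta>_pos \<kappa>_pos by simp

text \<open>The moments of \<mu> \<bullet> e at the time when |Y| = r, since S / r is that cosine
  almost surely.\<close>

definition cosine_moment :: "nat \<Rightarrow> real \<Rightarrow> real"
  where "cosine_moment k r = moment k (clock r) / r ^ k"

lemma moment_rate_clock:
  assumes "1 < r"
  shows "moment_rate j (clock r) = r ^ j * (cosine_moment j r - cosine_moment (j + 2) r)"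
proof -
  have r: "r \<noteq> 0" using assms by simp
  have "r ^ j * (cosine_moment j r - cosine_moment (j + 2) r)
      = moment j (clock r) - moment (j + 2) (clock r) * (r ^ j / r ^ (j + 2))"
    unfolding cosine_moment_def right_diff_distrib using r by simp
  also have "r ^ j / r ^ (j + 2) = 1 / r\<^sup>2" unfolding power_add using r by simp
  finally show ?thesis unfolding moment_rate_def clock(2)[OF assms] by simp
qed

lemma cosine_moment_has_derivative:
  assumes r: "1 < r" and d: "(moment (Suc k) has_field_derivative D) (at (clock r))"
  shows "(cosine_moment (Suc k) has_field_derivative D / (\<kappa> * r ^ k) - Suc k * cosine_moment (Suc k) r / r) (at r)"
proof -
  have r0: "r \<noteq> 0" "r ^ k \<noteq> 0" using r by auto
  have dp: "((\<lambda>r. r ^ Suc k) has_field_derivative real (Suc k) * r ^ k) (at r)"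
    using DERIV_pow[of "Suc k" r] by simp
  have "(cosine_moment (Suc k) has_field_derivative
      (D * (r / \<kappa>) * r ^ Suc k - moment (Suc k) (clock r) * (real (Suc k) * r ^ k)) / (r ^ Suc k * r ^ Suc k)) (at r)"
    unfolding cosine_moment_def[abs_def]
    by (rule DERIV_divide[OF DERIV_chain2[OF d clock_has_derivative] dp]) (use r0 in simp)
  moreover have "(D * (r / \<kappa>) * r ^ Suc k - moment (Suc k) (clock r) * (real (Suc k) * r ^ k)) / (r ^ Suc k * r ^ Suc k)
      = D / (\<kappa> * r ^ k) - Suc k * cosine_moment (Suc k) r / r"
  proof -
    define P where "P = r ^ k"
    define m where "m = moment (Suc k) (clock r)"
    define n where "n = real (Suc k)"
    have P: "P \<noteq> 0" using r0 by (simp add: P_def)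
    have "(D * (r / \<kappa>) * (r * P) - m * (n * P)) / (r * P * (r * P)) = D / (\<kappa> * P) - n * (m / (r * P)) / r"
      using P r0(1) \<kappa>_pos by (simp add: field_simps)
    then show ?thesis unfolding cosine_moment_def power_Suc P_def m_def n_def .
  qed
  ultimately show ?thesis by simp
qed

lemma cosine_moments_have_derivatives:
  assumes r: "1 < r"
  shows "(cosine_moment 1 has_field_derivative a * (1 - cosine_moment 2 r) - cosine_moment 1 r / r) (at r)"
    and "(cosine_moment 2 has_field_derivative 2 * a * (cosine_moment 1 r - cosine_moment 3 r)
      + (1 - cosine_moment 2 r) / r - 2 * cosine_moment 2 r / r) (at r)"
    and "(cosine_moment 3 has_field_derivative 3 * a * (cosine_moment 2 r - cosine_moment 4 r)
      + 3 * (cosine_moment 1 r - cosine_moment 3 r) / r - 3 * cosine_moment 3 r / r) (at r)"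
proof -
  have r0: "r \<noteq> 0" "\<kappa> \<noteq> 0" using r \<kappa>_pos by auto
  note t = clock(1)[OF r]
  have s: "Suc 0 = 1" "Suc 1 = 2" "Suc 2 = 3" "(0::nat) + 2 = 2" "(1::nat) + 2 = 3" "(2::nat) + 2 = 4" by auto
  have m0: "cosine_moment 0 r = 1" by (simp add: cosine_moment_def moment_0)
  have M: "moment_rate 0 (clock r) = 1 - cosine_moment 2 r"
    "moment_rate 1 (clock r) = r * (cosine_moment 1 r - cosine_moment 3 r)"
    "moment_rate 2 (clock r) = r\<^sup>2 * (cosine_moment 2 r - cosine_moment 4 r)"
    using moment_rate_clock[OF r, of 0] moment_rate_clock[OF r, of 1] moment_rate_clock[OF r, of 2]
    unfolding s m0 by simp_all
  show "(cosine_moment 1 has_field_derivative a * (1 - cosine_moment 2 r) - cosine_moment 1 r / r) (at r)"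
    by (rule DERIV_cong[OF cosine_moment_has_derivative[OF r, of 0, unfolded s, OF moment_has_derivative(1)[OF t]]])
       (simp add: M a_def)
  show "(cosine_moment 2 has_field_derivative 2 * a * (cosine_moment 1 r - cosine_moment 3 r)
      + (1 - cosine_moment 2 r) / r - 2 * cosine_moment 2 r / r) (at r)"
  proof (rule DERIV_cong[OF cosine_moment_has_derivative[OF r, of 1, unfolded s, OF moment_has_derivative(2)[OF t]]])
    define u where "u = cosine_moment 1 r - cosine_moment 3 r"
    define v where "v = 1 - cosine_moment 2 r"
    have "(2 * (\<alpha> * \<beta> * (r * u)) + \<kappa> * v) / (\<kappa> * r ^ 1) = 2 * a * u + v / r"
      unfolding a_def using r0 by (simp add: field_simps)
    then show "(2 * (\<alpha> * \<beta> * moment_rate 1 (clock r)) + \<kappa> * moment_rate 0 (clock r)) / (\<kappa> * r ^ 1)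
        - real 2 * cosine_moment 2 r / r
      = 2 * a * (cosine_moment 1 r - cosine_moment 3 r) + (1 - cosine_moment 2 r) / r - 2 * cosine_moment 2 r / r"
      unfolding M u_def v_def by simp
  qed
  show "(cosine_moment 3 has_field_derivative 3 * a * (cosine_moment 2 r - cosine_moment 4 r)
      + 3 * (cosine_moment 1 r - cosine_moment 3 r) / r - 3 * cosine_moment 3 r / r) (at r)"
  proof (rule DERIV_cong[OF cosine_moment_has_derivative[OF r, of 2, unfolded s, OF moment_has_derivative(3)[OF t]]])
    define u where "u = cosine_moment 2 r - cosine_moment 4 r"
    define v where "v = cosine_moment 1 r - cosine_moment 3 r"
    have "(3 * (\<alpha> * \<beta> * (r\<^sup>2 * u)) + 3 * (\<kappa> * (r * v))) / (\<kappa> * r ^ 2) = 3 * a * u + 3 * v / r"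
      unfolding a_def using r0 by (simp add: field_simps power2_eq_square)
    then show "(3 * (\<alpha> * \<beta> * moment_rate 2 (clock r)) + 3 * (\<kappa> * moment_rate 1 (clock r))) / (\<kappa> * r ^ 2)
        - real 3 * cosine_moment 3 r / r
      = 3 * a * (cosine_moment 2 r - cosine_moment 4 r) + 3 * (cosine_moment 1 r - cosine_moment 3 r) / r
        - 3 * cosine_moment 3 r / r"
      unfolding M u_def v_def by simp
  qed
qed

text \<open>The functions y_k of \<open>moment_system_limit\<close>: moments of q = 1 - \<mu>
  \<bullet> e. They are defined by an expectation so that pointwise inequalities in q can be
  integrated; the differential equations are obtained from the binomial expansion in
  \<open>deviation_eq\<close>.\<close>

definition deviation :: "nat \<Rightarrow> real \<Rightarrow> real"
  where "deviation k r = expectation (\<lambda>\<omega>. (1 - S (clock r) \<omega> / r) ^ k)"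

lemma relative_S_bounds:
  assumes r: "1 < r"
  shows "AE \<omega> in M. 0 \<le> 1 - S (clock r) \<omega> / r \<and> 1 - S (clock r) \<omega> / r \<le> 2"
proof -
  have "0 \<le> clock r" using clock(1)[OF r] by simp
  from S_bound[OF this] show ?thesis
  proof eventually_elim
    case (elim \<omega>)
    then have "\<bar>S (clock r) \<omega> / r\<bar> \<le> 1" unfolding clock(3)[OF r] using r by simp
    then show ?case unfolding abs_le_iff by linarith
  qed
qed

lemma cosine_power:
  assumes r: "1 < r"
  shows "integrable M (\<lambda>\<omega>. (S (clock r) \<omega> / r) ^ k)"
    and "expectation (\<lambda>\<omega>. (S (clock r) \<omega> / r) ^ k) = cosine_moment k r"
  using S_power_integrable[of "clock r" k] clock(1)[OF r]
  by (simp_all add: power_divide cosine_moment_def moment_def)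

lemma deviation_eq:
  assumes r: "1 < r"
  shows "deviation 1 r = 1 - cosine_moment 1 r"
    and "deviation 2 r = 1 - 2 * cosine_moment 1 r + cosine_moment 2 r"
    and "deviation 3 r = 1 - 3 * cosine_moment 1 r + 3 * cosine_moment 2 r - cosine_moment 3 r"
    and "deviation 4 r = 1 - 4 * cosine_moment 1 r + 6 * cosine_moment 2 r - 4 * cosine_moment 3 r + cosine_moment 4 r"
proof -
  let ?q = "\<lambda>\<omega>. S (clock r) \<omega> / r"
  note i = cosine_power(1)[OF r] and E = cosine_power(2)[OF r]
  have i1: "integrable M ?q" and E1: "expectation ?q = cosine_moment 1 r"
    using i[of 1] E[of 1] by simp_all
  have x: "(1 - z) ^ 2 = 1 - 2 * z + z ^ 2" "(1 - z) ^ 3 = 1 - 3 * z + 3 * z ^ 2 - z ^ 3"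
    "(1 - z) ^ 4 = 1 - 4 * z + 6 * z ^ 2 - 4 * z ^ 3 + z ^ 4" for z :: real
    by (simp_all add: power2_eq_square power3_eq_cube power4_eq_xxxx algebra_simps)
  show "deviation 1 r = 1 - cosine_moment 1 r"
    unfolding deviation_def power_one_right E1[symmetric]
    using Bochner_Integration.integral_diff[OF _ i1, of "\<lambda>_. 1"] by (simp add: prob_space)
  have e2: "expectation (\<lambda>\<omega>. 1 - c1 * ?q \<omega> + c2 * ?q \<omega> ^ 2 + c3 * ?q \<omega> ^ 3 + c4 * ?q \<omega> ^ 4)
      = 1 - c1 * cosine_moment 1 r + c2 * cosine_moment 2 r + c3 * cosine_moment 3 r + c4 * cosine_moment 4 r" for c1 c2 c3 c4
  proof -
    note j = integrable_mult_right[OF i]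
    have k1: "integrable M (\<lambda>\<omega>. 1 - c1 * ?q \<omega>)"
      by (rule Bochner_Integration.integrable_diff[OF _ integrable_mult_right[OF i1]]) simp
    have k2: "integrable M (\<lambda>\<omega>. 1 - c1 * ?q \<omega> + c2 * ?q \<omega> ^ 2)"
      by (rule Bochner_Integration.integrable_add[OF k1 j])
    have k3: "integrable M (\<lambda>\<omega>. 1 - c1 * ?q \<omega> + c2 * ?q \<omega> ^ 2 + c3 * ?q \<omega> ^ 3)"
      by (rule Bochner_Integration.integrable_add[OF k2 j])
    have one: "expectation (\<lambda>\<omega>. 1 - c1 * ?q \<omega>) = 1 - c1 * cosine_moment 1 r"
      unfolding Bochner_Integration.integral_diff[OF integrable_const integrable_mult_right[OF i1]]
        integral_mult_right_zero E1 by (simp add: prob_space)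
    show ?thesis
      unfolding Bochner_Integration.integral_add[OF k3 j] Bochner_Integration.integral_add[OF k2 j]
        Bochner_Integration.integral_add[OF k1 j] one integral_mult_right_zero E ..
  qed
  show "deviation 2 r = 1 - 2 * cosine_moment 1 r + cosine_moment 2 r"
    unfolding deviation_def x using e2[of 2 1 0 0] by simp
  show "deviation 3 r = 1 - 3 * cosine_moment 1 r + 3 * cosine_moment 2 r - cosine_moment 3 r"
    unfolding deviation_def x using e2[of 3 3 "-1" 0] by simp
  show "deviation 4 r = 1 - 4 * cosine_moment 1 r + 6 * cosine_moment 2 r - 4 * cosine_moment 3 r + cosine_moment 4 r"
    unfolding deviation_def x using e2[of 4 6 "-4" 1] by simp
qed

lemma deviation_integrable:
  assumes r: "1 < r" shows "integrable M (\<lambda>\<omega>. (1 - S (clock r) \<omega> / r) ^ k)"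
proof -
  have "(\<lambda>\<omega>. (1 - S (clock r) \<omega> / r) ^ k) \<in> borel_measurable M"
    using S_measurable[OF less_imp_le[OF clock(1)[OF r]]] by measurable
  moreover have "AE \<omega> in M. \<bar>(1 - S (clock r) \<omega> / r) ^ k\<bar> \<le> 2 ^ k"
    using relative_S_bounds[OF r]
  proof eventually_elim
    case (elim \<omega>)
    then have "\<bar>1 - S (clock r) \<omega> / r\<bar> \<le> 2" by linarith
    then have "\<bar>1 - S (clock r) \<omega> / r\<bar> ^ k \<le> 2 ^ k" by (rule power_mono) simp
    then show ?case by (simp only: power_abs)
  qed
  ultimately show ?thesis by (rule square_integrableD(3)[OF AE_bounded_square_integrable(1)])
qed

lemma deviation_nonneg:
  assumes r: "1 < r" shows "0 \<le> deviation k r"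
  unfolding deviation_def
  by (rule integral_nonneg_AE) (use relative_S_bounds[OF r] in eventually_elim, simp)

text \<open>The differential equations are linear combinations of those for the cosine moments. The
  two remaining conditions of \<open>moment_system_limit\<close> are pointwise inequalities for q
  between 0 and 2, integrated over the law of q.\<close>

lemma deviation_limit: "((\<lambda>r. r * deviation 1 r) \<longlongrightarrow> 1 / (2 * a)) at_top"
proof (rule moment_system_limit[OF a_pos, where C="81 / (4 * a\<^sup>2)"])
  fix r :: real assume r: "1 < r"
  \<comment> \<open>The expansions in \<open>deviation_eq\<close> hold for arguments above 1 only,
    so derivatives are transferred on a neighbourhood of \<open>r\<close>.\<close>
  have near: "\<forall>\<^sub>F z in nhds r. 1 < z"
    using r by (intro eventually_nhds_in_open[of "{1<..}", simplified]) auto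
  have r0: "r \<noteq> 0" using r by simp
  note d = cosine_moments_have_derivatives[OF r]
  show "(deviation 1 has_field_derivative - a * (2 * deviation 1 r - deviation 2 r) + (1 - deviation 1 r) / r) (at r)"
  proof (rule DERIV_cong_ev[OF refl _ refl, THEN iffD2])
    show "\<forall>\<^sub>F z in nhds r. deviation 1 z = 1 - cosine_moment 1 z"
      using near by eventually_elim (rule deviation_eq)
    show "((\<lambda>z. 1 - cosine_moment 1 z) has_field_derivative - a * (2 * deviation 1 r - deviation 2 r) + (1 - deviation 1 r) / r) (at r)"
      unfolding deviation_eq[OF r]
      by (rule DERIV_cong[OF DERIV_diff[OF DERIV_const d(1)]]) (simp add: algebra_simps)
  qed
  show "(deviation 2 has_field_derivative - 2 * a * (2 * deviation 2 r - deviation 3 r) + (4 * deviation 1 r - 3 * deviation 2 r) / r) (at r)"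
  proof (rule DERIV_cong_ev[OF refl _ refl, THEN iffD2])
    show "\<forall>\<^sub>F z in nhds r. deviation 2 z = 1 - 2 * cosine_moment 1 z + cosine_moment 2 z"
      using near by eventually_elim (rule deviation_eq)
    show "((\<lambda>z. 1 - 2 * cosine_moment 1 z + cosine_moment 2 z) has_field_derivative
        - 2 * a * (2 * deviation 2 r - deviation 3 r) + (4 * deviation 1 r - 3 * deviation 2 r) / r) (at r)"
      unfolding deviation_eq[OF r]
      by (rule DERIV_cong[OF DERIV_add[OF DERIV_diff[OF DERIV_const DERIV_cmult[OF d(1)]] d(2)]])
         (use r0 in \<open>simp add: field_simps\<close>)
  qed
  show "(deviation 3 has_field_derivative - 3 * a * (2 * deviation 3 r - deviation 4 r) + 3 * (3 * deviation 2 r - 2 * deviation 3 r) / r) (at r)"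
  proof (rule DERIV_cong_ev[OF refl _ refl, THEN iffD2])
    show "\<forall>\<^sub>F z in nhds r. deviation 3 z = 1 - 3 * cosine_moment 1 z + 3 * cosine_moment 2 z - cosine_moment 3 z"
      using near by eventually_elim (rule deviation_eq)
    show "((\<lambda>z. 1 - 3 * cosine_moment 1 z + 3 * cosine_moment 2 z - cosine_moment 3 z) has_field_derivative
        - 3 * a * (2 * deviation 3 r - deviation 4 r) + 3 * (3 * deviation 2 r - 2 * deviation 3 r) / r) (at r)"
      unfolding deviation_eq[OF r]
      by (rule DERIV_cong[OF DERIV_diff[OF DERIV_add[OF DERIV_diff[OF DERIV_const DERIV_cmult[OF d(1)]] DERIV_cmult[OF d(2)]] d(3)]])
         (use r0 in \<open>simp add: field_simps\<close>)
  qed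
  show "0 \<le> deviation 1 r" "0 \<le> deviation 2 r" "0 \<le> deviation 3 r"
    using deviation_nonneg[OF r] by blast+
  let ?q = "\<lambda>\<omega>. 1 - S (clock r) \<omega> / r"
  note i = deviation_integrable[OF r]
  show "- 3 * a * (2 * deviation 3 r - deviation 4 r) + 3 * (3 * deviation 2 r - 2 * deviation 3 r) / r
      + 3 / (2 * r) * deviation 3 r \<le> 81 / (4 * a\<^sup>2) / r ^ 3"
  proof -
    \<comment> \<open>The expression regrouped by powers of q, in order that the linear combination
      of moments is one expectation to which \<open>quasi_cubic_bound\<close> applies
      pointwise.\<close>
    let ?f = "\<lambda>\<omega>. 9 / r * ?q \<omega> ^ 2 + (3 / (2 * r) - 6 * a - 6 / r) * ?q \<omega> ^ 3 + 3 * a * ?q \<omega> ^ 4"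
    have "- 3 * a * (2 * deviation 3 r - deviation 4 r) + 3 * (3 * deviation 2 r - 2 * deviation 3 r) / r
      + 3 / (2 * r) * deviation 3 r = 9 / r * deviation 2 r + (3 / (2 * r) - 6 * a - 6 / r) * deviation 3 r + 3 * a * deviation 4 r"
      using r0 by (simp add: field_simps)
    also have "\<dots> = expectation ?f"
      unfolding deviation_def
        Bochner_Integration.integral_add[OF Bochner_Integration.integrable_add[OF integrable_mult_right[OF i] integrable_mult_right[OF i]] integrable_mult_right[OF i]]
        Bochner_Integration.integral_add[OF integrable_mult_right[OF i] integrable_mult_right[OF i]] integral_mult_right_zero ..
    also have "\<dots> \<le> expectation (\<lambda>\<omega>. 81 / (4 * a\<^sup>2) / r ^ 3)"
    proof (rule integral_mono_AE)
      show "integrable M ?f"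
        by (rule Bochner_Integration.integrable_add[OF Bochner_Integration.integrable_add[OF integrable_mult_right[OF i] integrable_mult_right[OF i]] integrable_mult_right[OF i]])
      show "AE \<omega> in M. ?f \<omega> \<le> 81 / (4 * a\<^sup>2) / r ^ 3"
        using relative_S_bounds[OF r]
      proof eventually_elim
        case (elim \<omega>)
        define q where "q = ?q \<omega>"
        have "9 / r * q ^ 2 + (3 / (2 * r) - 6 * a - 6 / r) * q ^ 3 + 3 * a * q ^ 4
            = - 3 * a * (2 * q ^ 3 - q ^ 4) + 3 * (3 * q\<^sup>2 - 2 * q ^ 3) / r + 3 / (2 * r) * q ^ 3"
          using r0 by (simp add: field_simps)
        then show ?case
          using quasi_cubic_bound[of q a r] elim a_pos r unfolding q_def by simp
      qed
    qed simp
    also have "\<dots> = 81 / (4 * a\<^sup>2) / r ^ 3" by (simp add: prob_space)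
    finally show ?thesis .
  qed
  show "deviation 1 r \<le> \<eta> + deviation 3 r / \<eta>\<^sup>2" if \<eta>: "0 < \<eta>" for \<eta>
  proof -
    have "deviation 1 r \<le> expectation (\<lambda>\<omega>. \<eta> + ?q \<omega> ^ 3 / \<eta>\<^sup>2)"
      unfolding deviation_def
    proof (rule integral_mono_AE[OF i])
      show "integrable M (\<lambda>\<omega>. \<eta> + ?q \<omega> ^ 3 / \<eta>\<^sup>2)" using i[of 3] by simp
      show "AE \<omega> in M. ?q \<omega> ^ 1 \<le> \<eta> + ?q \<omega> ^ 3 / \<eta>\<^sup>2"
        using relative_S_bounds[OF r] by eventually_elim (use le_eta_plus_cube \<eta> in auto)
    qed
    also have "\<dots> = \<eta> + deviation 3 r / \<eta>\<^sup>2"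
      using i[of 3] by (simp add: deviation_def prob_space)
    finally show ?thesis .
  qed
qed

text \<open>Almost surely |b| - \<mu> \<bullet> b equals |b| (1 - S / h), so the expectation is |b|
  times r y_1 at r = h. The limit 1 / (2 a) carries a factor 1 / |b|, and the strength of the field
  cancels.\<close>

lemma alignment_limit:
  "((\<lambda>t. expectation (\<lambda>\<omega>. radius t * \<bar>norm b - \<mu> t \<omega> \<bullet> b\<bar>)) \<longlongrightarrow> \<epsilon>\<^sup>2 * (1 + \<alpha>\<^sup>2) / (2 * \<alpha>)) at_top"
proof -
  have top: "filterlim radius at_top at_top"
    unfolding radius_def[abs_def] using \<kappa>_pos
    by (intro filterlim_compose[OF sqrt_at_top] filterlim_tendsto_add_at_top[OF tendsto_const]
        filterlim_tendsto_pos_mult_at_top[OF tendsto_const _ filterlim_ident]) simp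
  have "((\<lambda>t. \<beta> * (radius t * deviation 1 (radius t))) \<longlongrightarrow> \<beta> * (1 / (2 * a))) at_top"
    by (rule tendsto_mult[OF tendsto_const filterlim_compose[OF deviation_limit top]])
  moreover have "\<beta> * (1 / (2 * a)) = \<epsilon>\<^sup>2 * (1 + \<alpha>\<^sup>2) / (2 * \<alpha>)"
    unfolding a_def \<kappa>_def[symmetric] using \<alpha> \<beta>_pos \<kappa>_pos by (simp add: field_simps)
  moreover have "\<forall>\<^sub>F t in at_top. \<beta> * (radius t * deviation 1 (radius t)) = expectation (\<lambda>\<omega>. radius t * \<bar>norm b - \<mu> t \<omega> \<bullet> b\<bar>)"
    using eventually_gt_at_top[of 0]
  proof eventually_elim
    case (elim t)
    then have t: "0 \<le> t" by simp
    have "1 < radius t" unfolding radius_def using elim \<kappa>_pos by simp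
    have ct: "clock (radius t) = t"
      unfolding clock_def radius(1)[OF t] using \<kappa>_pos by simp
    have "expectation (\<lambda>\<omega>. radius t * \<bar>norm b - \<mu> t \<omega> \<bullet> b\<bar>)
        = expectation (\<lambda>\<omega>. \<beta> * radius t * (1 - S t \<omega> / radius t))"
    proof (rule integral_cong_AE)
      show "(\<lambda>\<omega>. radius t * \<bar>norm b - \<mu> t \<omega> \<bullet> b\<bar>) \<in> borel_measurable M"
        using \<mu>_measurable[OF t] by measurable
      show "(\<lambda>\<omega>. \<beta> * radius t * (1 - S t \<omega> / radius t)) \<in> borel_measurable M"
        using S_measurable[OF t] by measurable
      show "AE \<omega> in M. radius t * \<bar>norm b - \<mu> t \<omega> \<bullet> b\<bar> = \<beta> * radius t * (1 - S t \<omega> / radius t)"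
        using norm_Y[OF t] S_bound[OF t] AE_space
      proof eventually_elim
        case (elim \<omega>)
        have r: "0 < radius t" using \<open>1 < radius t\<close> by simp
        have "e \<bullet> \<mu> t \<omega> = S t \<omega> / radius t"
          using elim \<mu>[OF t elim(3)] by (simp add: S_def field_simps)
        then have m: "\<mu> t \<omega> \<bullet> b = \<beta> * (S t \<omega> / radius t)"
          by (subst b_eq) (simp add: inner_commute)
        have "\<bar>S t \<omega> / radius t\<bar> \<le> 1" using elim(2) r by simp
        \<comment> \<open>|S| is at most the radius, so the deviation is nonnegative and the
          absolute value in the statement can be removed.\<close>
        then have "0 \<le> \<beta> * (1 - S t \<omega> / radius t)" unfolding abs_le_iff using \<beta>_pos by (intro mult_nonneg_nonneg) linarith+
        then show ?case unfolding m \<beta>_def[symmetric] by (simp add: right_diff_distrib)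
      qed
    qed
    also have "\<dots> = \<beta> * (radius t * deviation 1 (radius t))"
      unfolding deviation_def ct by (simp only: power_one_right mult.assoc integral_mult_right_zero)
    finally show ?case by (rule sym)
  qed
  ultimately show ?thesis using Lim_transform_eventually by fastforce
qed

end

theorem theorem7:
  fixes M :: "'a measure"
    and W Y \<mu> :: "real \<Rightarrow> 'a \<Rightarrow> real^3"
    and b y :: "real^3"
    and \<alpha> \<epsilon> :: real
    and h :: "real \<Rightarrow> real"
  assumes "prob_space M"
    and "standard_brownian_motion M W"
    and "b \<noteq> 0"
    and "\<alpha> > 0"
    and "\<epsilon> > 0"
    and "y \<in> sphere 0 1"
    and "strong_solution M W b \<alpha> \<epsilon> y Y \<mu>"
    and "\<And>t. t \<ge> 0 \<Longrightarrow> h t = sqrt (2 * \<epsilon>\<^sup>2 * (\<alpha>\<^sup>2 + 1) * t + 1)"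
  shows "((\<lambda>t. \<integral>\<omega>. h t * \<bar>norm b - \<mu> t \<omega> \<bullet> b\<bar> \<partial>M)
           \<longlongrightarrow> \<epsilon>\<^sup>2 * (1 + \<alpha>\<^sup>2) / (2 * \<alpha>)) at_top"
proof -
  \<comment> \<open>Folding brings drift and integrand into the form used by the locale, so that its
    assumptions can be read off.\<close>
  note sol = \<open>strong_solution M W b \<alpha> \<epsilon> y Y \<mu>\<close>[unfolded strong_solution_def has_ito_differential_def adapted_def,
    folded llg_drift_def llg_diffusion_def]
  obtain I where I: "has_ito_integral M (augmented_filtration M W) W (\<lambda>t \<omega>. llg_diffusion \<alpha> \<epsilon> (\<mu> t \<omega>)) I"
    and eq: "AE \<omega> in M. \<forall>t\<ge>0. set_integrable lborel {0..t} (\<lambda>s. llg_drift \<alpha> b (\<mu> s \<omega>)) \<and>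
       Y t \<omega> = y + set_lebesgue_integral lborel {0..t} (\<lambda>s. llg_drift \<alpha> b (\<mu> s \<omega>)) + I t \<omega>"
    using sol by blast
  interpret prob_space M by fact
  interpret llg_solution M W b y \<alpha> \<epsilon> Y \<mu> I
  proof unfold_locales
    show "standard_brownian_motion M W" by fact
    show "norm y = 1" using \<open>y \<in> sphere 0 1\<close> by simp
  qed (use assms sol I eq in blast)+
  have "\<forall>\<^sub>F t in at_top. expectation (\<lambda>\<omega>. radius t * \<bar>norm b - \<mu> t \<omega> \<bullet> b\<bar>) = expectation (\<lambda>\<omega>. h t * \<bar>norm b - \<mu> t \<omega> \<bullet> b\<bar>)"
    using eventually_ge_at_top[of 0]
  proof eventually_elim
    case (elim t)
    have "radius t = h t"
      unfolding radius_def \<kappa>_def assms(8)[OF elim] by (rule arg_cong[where f=sqrt]) (simp add: algebra_simps)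
    then show ?case by simp
  qed
  with alignment_limit show ?thesis by (rule Lim_transform_eventually)
qed

end
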